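(* Let $a,b\ge 1$ be integers. Let $Z'_{a,b}(s,\boldsymbol t,\bar{\boldsymbol t})$, $s\in\mathbb Z$, $\boldsymbol t=(t_1,t_2,\ldots)$, $\bar{\boldsymbol t}=(\bar t_1,\bar t_2,\ldots)$, be the partition function of the second orbifold melting crystal model, defined as a sum over partitions in the context, with parameters normalized by $p_a=r_b=1$ and expressed through $P_1,\ldots,P_{a-1},R_1,\ldots,R_{b-1}$. Put $$T_k=(-1)^{ak}P_1^{-(a-1)k}P_2^{-(a-2)k}\cdots P_{a-1}^{-k}\,t_k,\qquad \bar T_k=R_1^{-(b-1)k}R_2^{-(b-2)k}\cdots R_{b-1}^{-k}\,\bar t_k,$$ let $\boldsymbol T$ be the sequence whose $ak$-th entry is $T_k$ ($k\ge1$) and whose other entries are $0$, and let $\bar{\boldsymbol T}$ be the sequence whose $bk$-th entry is $\bar T_k$ ($k\ge 1$) and whose other entries are $0$. Let $$g'=q^{W_0/2a}\,\Gamma_-\Gamma_+P_1^{L_0}\Gamma_-\Gamma_+\cdots P_{a-1}^{L_0}\Gamma_-\Gamma_+\;Q^{L_0}\;\Gamma'_-\Gamma'_+R_{b-1}^{L_0}\Gamma'_-\Gamma'_+\cdots R_1^{L_0}\Gamma'_-\Gamma'_+\,q^{-W_0/2b},$$ where $\Gamma_\pm=\Gamma_\pm(q^{-\rho})$, $\Gamma'_\pm=\Gamma'_\pm(q^{-\rho})$, let $$\tau'(s,\boldsymbol t,\bar{\boldsymbol t})=\langle s|\exp\Big(\sum_{k\ge1}t_kJ_k\Big)\,g'\,\exp\Big(-\sum_{k\ge1}\bar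 t_kJ_{-k}\Big)|s\rangle$$ be the associated tau function of the 2D Toda hierarchy, and let $$f'_{a,b}(s,\boldsymbol t,\bar{\boldsymbol t})=\exp\Big(\sum_{k\ge1}\frac{t_kq^k-\bar t_k}{1-q^k}\Big)q^{-s(s+1)(2s+1)\left(\frac1{12a}-\frac1{12b}\right)}\prod_{1\le i\le j\le a-1}M(P_i\cdots P_j,q)^{-1}\prod_{1\le i\le j\le b-1}M(R_i\cdots R_j,q)^{-1}.$$ Then $$Z'_{a,b}(s,\boldsymbol t,\bar{\boldsymbol t})=f'_{a,b}(s,\boldsymbol t,\bar{\boldsymbol t})\,\tau'(s,\boldsymbol T,-\bar{\boldsymbol T}).$$
   Context: Second orbifold model: with parameters $q,Q,p_1,\ldots,p_a,r_1,\ldots,r_b$, $$Z'_{a,b}(s,\boldsymbol t,\bar{\boldsymbol t})=\sum_{\lambda}s_\lambda(p_1q^{-\rho},\ldots,p_aq^{-\rho})\,s_{{}^t\lambda}(r_1q^{-\rho},\ldots,r_bq^{-\rho})\,Q^{|\lambda|+s(s+1)/2}\exp\Big(\sum_{k\ge1}t_k\Phi_k(\lambda,s)+\sum_{k\ge1}\bar t_k\Phi_{-k}(\lambda,s)\Big),$$ where $\lambda=(\lambda_i)_{i\ge1}$ runs over all partitions, ${}^t\lambda$ is the conjugate partition, $|\lambda|=\sum_i\lambda_i$, $s_\lambda$ is the Schur function in infinitely many variables, $q^{-\rho}=(q^{1/2},q^{3/2},\ldots,q^{n-1/2},\ldots)$, $(p_1q^{-\rho},\ldots,p_aq^{-\rho})$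 is the union of the sequences $p_iq^{-\rho}=(p_iq^{1/2},p_iq^{3/2},\ldots)$ (likewise for the $r_j$), and for $k\in\mathbb Z\setminus\{0\}$ $$\Phi_k(\lambda,s)=\sum_{i\ge1}\big(q^{k(\lambda_i+s-i+1)}-q^{k(s-i+1)}\big)+\frac{1-q^{ks}}{1-q^k}\,q^k .$$ The parameters are normalized so that $p_a=r_b=1$ and written as $p_i=P_i\cdots P_{a-1}$ for $1\le i\le a-1$, $r_j=R_j\cdots R_{b-1}$ for $1\le j\le b-1$. (General $p_a,r_b$ are reduced to this case by homogeneity of Schur functions, rescaling the $p_i$, $r_j$ and $Q$ and correcting the partition function by the overall factor $(p_ar_b)^{s(s+1)/2}$.) Empty products are $1$. MacMahon function: $M(x,q)=\prod_{n\ge1}(1-xq^n)^{-n}$. Fermions: $\psi_n,\psi^*_n$ ($n\in\mathbb Z$) satisfy $\psi_m\psi_n^*+\psi_n^*\psi_m=\delta_{m+n,0}$, $\psi_m\psi_n+\psi_n\psi_m=0=\psi^*_m\psi^*_n+\psi^*_n\psi^*_m$. The charge-$s$ sector of the Fock space has ground state $|s\rangle=\psi_{-s}\psi_{-s+1}\cdots|-\infty\rangle$ and dual ground state $\langle s|=\langle-\infty|\cdots\psi^*_{s-1}\psi^*_s$, with $\langle s|s\rangle=1$. Normal ordering $:\ :$ is with respect to $\langle 0|,|0\rangle$. Operators (sums over $n\in\mathbb Z$): $L_0=\sum_n n:\!\psi_{-n}\psi_n^*\!:$, $W_0=\sum_n n^2:\!\psi_{-n}\psi^*_n\!:$, $J_k=\sum_n:\!\psi_{-n}\psi^*_{n+k}\!:$.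 For $\boldsymbol x=(x_1,x_2,\dots)$, $\Gamma_\pm(\boldsymbol x)=\prod_{i}\exp\big(\sum_{k\ge1}\frac{x_i^k}{k}J_{\pm k}\big)$ and $\Gamma'_\pm(\boldsymbol x)=\prod_i\exp\big(-\sum_{k\ge1}\frac{(-x_i)^k}{k}J_{\pm k}\big)$.
   Formalization: The printed formula misses a factor: proved is Z' = (P_1⋯P_{a-1}R_1⋯R_{b-1})^{-s(s+1)/2} f' τ'. The times are formal variables; 0<|q|<1, Q, P_i, R_j are nonzero and |P_i⋯P_j q|, |R_i⋯R_j q| < 1, so that the matrix elements of g' converge. *)

theory Defs
  imports "HOL-Analysis.Analysis" "HOL-Library.Multiset"
begin

section \<open>Formal power series in arbitrarily many variables\<close>

text \<open>Formal power series over the complex numbers in variables indexed by \<open>'v\<close>.  A monomial is the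
  multiset of its variables; the topology is that of coefficientwise convergence.\<close>

typedef 'v mps = "UNIV :: ('v multiset \<Rightarrow> complex) set"
  morphisms mps_coeff Abs_mps
  by simp

setup_lifting type_definition_mps

lemma mps_eqI: "(\<And>M. mps_coeff f M = mps_coeff g M) \<Longrightarrow> f = g"
  by transfer auto

lift_definition mps_const :: "complex \<Rightarrow> 'v mps"
  is "\<lambda>c M. if M = {#} then c else 0" .

lift_definition mps_var :: "'v \<Rightarrow> 'v mps"
  is "\<lambda>v M. if M = {#v#} then 1 else 0" .

lemma finite_splits: "finite {(A, B). A + B = (M :: 'v multiset)}"
proof -
  have fin: "finite {A. A \<subseteq># M}"
  proof (induction M)
    case empty
    then show ?case by simp
  next
    case (add x M)
    have "{A. A \<subseteq># add_mset x M} \<subseteq> {A. A \<subseteq># M} \<union> add_mset x ` {A. A \<subseteq># M}"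
    proof
      fix A assume "A \<in> {A. A \<subseteq># add_mset x M}"
      then have A: "A \<subseteq># add_mset x M" by simp
      show "A \<in> {A. A \<subseteq># M} \<union> add_mset x ` {A. A \<subseteq># M}"
      proof (cases "x \<in># A")
        case True
        then obtain A' where "A = add_mset x A'" by (metis mset_add)
        with A show ?thesis by auto
      next
        case False
        with A show ?thesis
          by (metis UnI1 add_mset_remove_trivial diff_single_trivial mem_Collect_eq
              subset_eq_diff_conv add_mset_add_single)
      qed
    qed
    then show ?case
      using add finite_subset by blast
  qed
  have "{(A, B). A + B = M} \<subseteq> (\<lambda>A. (A, M - A)) ` {A. A \<subseteq># M}"
    by auto
  then show ?thesis
    using fin finite_subset by blast
qed

instantiation mps :: (type) comm_ring_1
begin

lift_definition zero_mps :: "'a mps" is "\<lambda>_. 0" .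
lift_definition one_mps :: "'a mps" is "\<lambda>M. if M = {#} then 1 else 0" .
lift_definition plus_mps :: "'a mps \<Rightarrow> 'a mps \<Rightarrow> 'a mps" is "\<lambda>f g M. f M + g M" .
lift_definition minus_mps :: "'a mps \<Rightarrow> 'a mps \<Rightarrow> 'a mps" is "\<lambda>f g M. f M - g M" .
lift_definition uminus_mps :: "'a mps \<Rightarrow> 'a mps" is "\<lambda>f M. - f M" .
lift_definition times_mps :: "'a mps \<Rightarrow> 'a mps \<Rightarrow> 'a mps"
  is "\<lambda>f g M. \<Sum>(A, B) \<in> {(A, B). A + B = M}. f A * g B" .

instance
proof
  fix f g h :: "'a mps"
  show "f * g * h = f * (g * h)"
  proof (transfer, rule ext)
    fix f g h :: "'a multiset \<Rightarrow> complex" and M :: "'a multiset"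
    let ?S = "\<lambda>M. {(A, B). A + B = (M :: 'a multiset)}"
    have "(\<Sum>(X, C) \<in> ?S M. (\<Sum>(A, B) \<in> ?S X. f A * g B) * h C)
        = (\<Sum>x \<in> ?S M. \<Sum>y \<in> ?S (fst x). f (fst y) * g (snd y) * h (snd x))"
      by (simp add: case_prod_beta sum_distrib_right)
    also have "\<dots> = (\<Sum>(x, y) \<in> Sigma (?S M) (\<lambda>x. ?S (fst x)). f (fst y) * g (snd y) * h (snd x))"
      by (rule sum.Sigma) (auto simp: finite_splits)
    also have "\<dots> = (\<Sum>(x, y) \<in> Sigma (?S M) (\<lambda>x. ?S (snd x)). f (fst x) * (g (fst y) * h (snd y)))"
      by (rule sum.reindex_bij_witness
            [where i = "\<lambda>((A, Y), (B, C)). ((A + B, C), (A, B))"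
               and j = "\<lambda>((X, C), (A, B)). ((A, B + C), (B, C))"])
         (auto simp: mult_ac add_ac)
    also have "\<dots> = (\<Sum>x \<in> ?S M. \<Sum>y \<in> ?S (snd x). f (fst x) * (g (fst y) * h (snd y)))"
      by (rule sum.Sigma [symmetric]) (auto simp: finite_splits)
    also have "\<dots> = (\<Sum>(A, Y) \<in> ?S M. f A * (\<Sum>(B, C) \<in> ?S Y. g B * h C))"
      by (simp add: case_prod_beta sum_distrib_left)
    finally show "(\<Sum>(X, C) \<in> ?S M. (\<Sum>(A, B) \<in> ?S X. f A * g B) * h C)
        = (\<Sum>(A, Y) \<in> ?S M. f A * (\<Sum>(B, C) \<in> ?S Y. g B * h C))" .
  qed
  show "f * g = g * f"
  proof (transfer, rule ext)
    fix f g :: "'a multiset \<Rightarrow> complex" and M :: "'a multiset"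
    show "(\<Sum>(A, B) \<in> {(A, B). A + B = M}. f A * g B) = (\<Sum>(A, B) \<in> {(A, B). A + B = M}. g A * f B)"
      by (rule sum.reindex_bij_witness [where i = prod.swap and j = prod.swap])
         (auto simp: add_ac mult_ac)
  qed
  show "1 * f = f"
  proof (transfer, rule ext)
    fix f :: "'a multiset \<Rightarrow> complex" and M :: "'a multiset"
    have "(\<Sum>(A, B) \<in> {(A, B). A + B = M}. (if A = {#} then 1 else 0) * f B)
        = (\<Sum>(A, B) \<in> {({#} :: 'a multiset, M)}. (if A = {#} then 1 else 0) * f B)"
      by (rule sum.mono_neutral_right) (auto simp: finite_splits split: if_splits)
    then show "(\<Sum>(A, B) \<in> {(A, B). A + B = M}. (if A = {#} then 1 else 0) * f B) = f M"
      by simp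
  qed
  show "(f + g) * h = f * h + g * h"
    by transfer (auto simp: case_prod_beta distrib_right sum.distrib)
  show "(0 :: 'a mps) \<noteq> 1"
    by transfer (auto dest: fun_cong [where x = "{#}"])
qed (transfer; auto simp: add_ac)+

end

instantiation mps :: (type) real_algebra_1
begin

lift_definition scaleR_mps :: "real \<Rightarrow> 'a mps \<Rightarrow> 'a mps" is "\<lambda>c f M. c *\<^sub>R f M" .

instance
  by standard
     (transfer; auto simp: scaleR_add_right scaleR_add_left case_prod_beta scaleR_sum_right)+

end

instantiation mps :: (type) t2_space
begin

definition open_mps :: "'a mps set \<Rightarrow> bool"
  where "open_mps S \<longleftrightarrow> open (mps_coeff ` S)"

lemma bij_mps_coeff: "bij (mps_coeff :: 'a mps \<Rightarrow> _)"
  by (metis Abs_mps_inverse UNIV_I bij_betw_byWitness mps_coeff_inverse subset_UNIV)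

instance
proof
  have inj: "inj (mps_coeff :: 'a mps \<Rightarrow> _)" and surj: "surj (mps_coeff :: 'a mps \<Rightarrow> _)"
    using bij_mps_coeff by (auto simp: bij_def)
  show "open (UNIV :: 'a mps set)"
    by (simp add: open_mps_def surj)
  show "open (S \<inter> T)" if "open S" "open T" for S T :: "'a mps set"
    using that by (simp add: open_mps_def image_Int [OF inj] open_Int)
  show "open (\<Union> K)" if "\<forall>S\<in>K. open S" for K :: "'a mps set set"
    using that by (auto simp: open_mps_def image_Union)
  show "\<exists>U V. open U \<and> open V \<and> x \<in> U \<and> y \<in> V \<and> U \<inter> V = {}" if "x \<noteq> y" for x y :: "'a mps"
  proof -
    from that obtain M where "mps_coeff x M \<noteq> mps_coeff y M"
      by (metis mps_eqI)
    then obtain U V where *: "open U" "open V" "mps_coeff x M \<in> U" "mps_coeff y M \<in> V" "U \<inter> V = {}"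
      using hausdorff [of "mps_coeff x M" "mps_coeff y M"] by auto
    have "open ((\<lambda>f. f M) -` W)" if "open W" for W :: "complex set"
      using that by (rule open_vimage) (rule continuous_on_product_coordinates)
    then have "open ((\<lambda>f. mps_coeff f M) -` W)" if "open W" for W :: "complex set"
      using that surj_image_vimage_eq [OF surj, of "(\<lambda>f. f M) -` W"]
      by (simp add: open_mps_def vimage_comp comp_def)
    then show ?thesis
      using * by (intro exI [where x = "(\<lambda>f. mps_coeff f M) -` U"]
                        exI [where x = "(\<lambda>f. mps_coeff f M) -` V"]) auto
  qed
qed

end

definition mps_exp :: "'v mps \<Rightarrow> 'v mps"
  where "mps_exp f = (\<Sum>\<^sub>\<infinity>n. f ^ n /\<^sub>R fact n)"


section \<open>Infinite matrices over the charged free fermion Fock space\<close>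

text \<open>A Maya diagram is the set of occupied modes: \<open>S = {m\<^sub>1 < m\<^sub>2 < \<dots>}\<close> stands for the basis
  vector \<open>\<psi>(m\<^sub>1) \<psi>(m\<^sub>2) \<dots> |-\<infinity>\<rangle>\<close>.  All charges occur.  An operator is given by its matrix
  elements \<open>\<langle>U| A |V\<rangle>\<close>.\<close>

definition maya :: "int set set"
  where "maya = {S. \<exists>N. (\<forall>n < - N. n \<notin> S) \<and> (\<forall>n > N. n \<in> S)}"

definition ground :: "int \<Rightarrow> int set"
  where "ground s = {- s..}"

type_synonym 'a fop = "int set \<Rightarrow> int set \<Rightarrow> 'a"

definition op_id :: "'a :: zero_neq_one fop"
  where "op_id U V = (if U \<in> maya \<and> U = V then 1 else 0)"

definition op_mult :: "'a :: {comm_ring_1, t2_space} fop \<Rightarrow> 'a fop \<Rightarrow> 'a fop"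
  where "op_mult A B U V = (\<Sum>\<^sub>\<infinity>W\<in>maya. A U W * B W V)"

primrec op_power :: "'a :: {comm_ring_1, t2_space} fop \<Rightarrow> nat \<Rightarrow> 'a fop" where
  "op_power A 0 = op_id"
| "op_power A (Suc n) = op_mult A (op_power A n)"

definition op_prod :: "'a :: {comm_ring_1, t2_space} fop list \<Rightarrow> 'a fop"
  where "op_prod As = foldr op_mult As op_id"

definition op_exp :: "'a :: {comm_ring_1, real_algebra_1, t2_space} fop \<Rightarrow> 'a fop"
  where "op_exp A U V = (\<Sum>\<^sub>\<infinity>n. op_power A n U V /\<^sub>R fact n)"

text \<open>The sign counts the fermions standing to the left of the affected one.  \<open>psi n\<close> creates mode
  \<open>n\<close> and \<open>psi_star n\<close> annihilates mode \<open>- n\<close>.\<close>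

definition psi :: "int \<Rightarrow> complex fop"
  where "psi n U V = (if V \<in> maya \<and> n \<notin> V \<and> U = insert n V then (-1) ^ card {m \<in> V. m < n} else 0)"

definition psi_star :: "int \<Rightarrow> complex fop"
  where "psi_star n U V =
    (if V \<in> maya \<and> - n \<in> V \<and> U = V - {- n} then (-1) ^ card {m \<in> V. m < - n} else 0)"

lemma maya_insert: "S \<in> maya \<Longrightarrow> insert n S \<in> maya"
proof -
  assume "S \<in> maya"
  then obtain N where "\<forall>k < - N. k \<notin> S" "\<forall>k > N. k \<in> S" by (auto simp: maya_def)
  then show "insert n S \<in> maya"
    unfolding maya_def by (intro CollectI exI [where x = "max N \<bar>n\<bar>"]) auto
qed

lemma maya_remove: "S \<in> maya \<Longrightarrow> S - {n} \<in> maya"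
proof -
  assume "S \<in> maya"
  then obtain N where "\<forall>k < - N. k \<notin> S" "\<forall>k > N. k \<in> S" by (auto simp: maya_def)
  then show "S - {n} \<in> maya"
    unfolding maya_def by (intro CollectI exI [where x = "max N \<bar>n\<bar>"]) auto
qed

lemma ground_maya: "ground s \<in> maya"
  unfolding maya_def ground_def by (intro CollectI exI [where x = "\<bar>s\<bar>"]) auto

lemma maya_finite_below: "S \<in> maya \<Longrightarrow> finite {m \<in> S. m < n}"
proof -
  assume "S \<in> maya"
  then obtain N where "\<forall>k < - N. k \<notin> S" by (auto simp: maya_def)
  then have "{m \<in> S. m < n} \<subseteq> {- N..<n}" by force
  then show ?thesis by (rule finite_subset) simp
qed

lemma infsum_one:
  assumes "\<And>W. W \<in> A \<Longrightarrow> W \<noteq> W0 \<Longrightarrow> f W = 0" and "W0 \<in> A"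
  shows "infsum f A = (f W0 :: 'a :: {comm_monoid_add, t2_space})"
proof -
  have "infsum f A = infsum f {W0}"
    using assms by (intro infsum_cong_neutral) auto
  then show ?thesis by simp
qed

lemma psi_left: 
  assumes "V \<in> maya" 
  shows "op_mult A (psi n) U V = (if n \<notin> V then A U (insert n V) * (-1) ^ card {m \<in> V. m < n} else 0)"
proof -
  have "op_mult A (psi n) U V = A U (insert n V) * psi n (insert n V) V"
    unfolding op_mult_def by (rule infsum_one) (use assms in \<open>auto simp: psi_def maya_insert\<close>)
  then show ?thesis using assms by (auto simp: psi_def)
qed

lemma psi_star_left: 
  assumes "V \<in> maya" 
  shows "op_mult A (psi_star n) U V =
    (if - n \<in> V then A U (V - {- n}) * (-1) ^ card {m \<in> V. m < - n} else 0)"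
proof -
  have "op_mult A (psi_star n) U V = A U (V - {- n}) * psi_star n (V - {- n}) V"
    unfolding op_mult_def by (rule infsum_one) (use assms in \<open>auto simp: psi_star_def maya_remove\<close>)
  then show ?thesis using assms by (auto simp: psi_star_def)
qed

lemma card_below_insert:
  assumes "V \<in> maya" "n \<notin> V"
  shows "card {m \<in> insert n V. m < k} = card {m \<in> V. m < k} + (if n < k then 1 else 0)"
proof -
  have "{m \<in> insert n V. m < k} = (if n < k then insert n {m \<in> V. m < k} else {m \<in> V. m < k})"
    by auto
  then show ?thesis using assms maya_finite_below by auto
qed

lemma card_below_remove:
  assumes "V \<in> maya" "n \<in> V"
  shows "card {m \<in> V. m < k} = card {m \<in> V - {n}. m < k} + (if n < k then 1 else 0)"
  using card_below_insert [OF maya_remove [OF assms(1)], of n n k] assms(2)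
  by (simp add: insert_absorb)

lemma psi_psi: "op_mult (psi m) (psi n) U V + op_mult (psi n) (psi m) U V = 0"
proof (cases "V \<in> maya")
  case True
  consider "m = n" | "m < n" | "n < m" by linarith
  then show ?thesis
    using True card_below_insert [OF True, of m n] card_below_insert [OF True, of n m]
    by cases (auto simp: psi_left psi_def maya_insert insert_commute)
next
  case False
  then show ?thesis by (simp add: op_mult_def psi_def)
qed

lemma psi_star_psi_star:
  "op_mult (psi_star m) (psi_star n) U V + op_mult (psi_star n) (psi_star m) U V = 0"
proof (cases "V \<in> maya")
  case True
  have *: "V - {x} - {y} = V - {y} - {x}" for x y by auto
  consider "m = n" | "m < n" | "n < m" by linarith
  then show ?thesis
    using True card_below_remove [OF True, of "- m" "- n"] card_below_remove [OF True, of "- n" "- m"]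
    by cases (auto simp: psi_star_left psi_star_def maya_remove * [of "- m" "- n"])
next
  case False
  then show ?thesis by (simp add: op_mult_def psi_star_def)
qed

lemma psi_psi_star:
  "op_mult (psi m) (psi_star n) U V + op_mult (psi_star n) (psi m) U V =
    (if m + n = 0 then op_id U V else 0)"
proof (cases "V \<in> maya")
  case True
  show ?thesis
  proof (cases "m + n = 0")
    case True': True
    then have n: "n = - m" by simp
    show ?thesis
    proof (cases "m \<in> V")
      case m: True
      have "{k \<in> V - {m}. k < m} = {k \<in> V. k < m}" by auto
      then show ?thesis using True m
        by (auto simp: n psi_left psi_star_left psi_star_def psi_def maya_remove op_id_def insert_absorb
            simp flip: power_add mult_2)
    next
      case m: False
      have "{k \<in> insert m V. k < m} = {k \<in> V. k < m}" by auto
      then show ?thesis using True m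
        by (auto simp: n psi_left psi_star_left psi_star_def psi_def maya_insert op_id_def
            simp flip: power_add mult_2)
    qed
  next
    case ne: False
    then have "m \<noteq> - n" by auto
    then have *: "insert m V - {- n} = insert m (V - {- n})" by auto
    show ?thesis
    proof (cases "- n \<in> V \<and> m \<notin> V")
      case c: True
      consider "m < - n" | "- n < m" using ne by linarith
      then show ?thesis
        using True c ne card_below_remove [OF True, of "- n" m] card_below_insert [OF True, of m "- n"]
        by cases (auto simp: psi_left psi_star_left psi_star_def psi_def maya_remove maya_insert *)
    next
      case False
      then show ?thesis using True ne
        by (auto simp: psi_left psi_star_left psi_star_def psi_def)
    qed
  qed
next
  case False
  then show ?thesis by (auto simp: op_mult_def psi_def psi_star_def op_id_def)
qed

text \<open>\<open>normal m n\<close> is the normal ordered product of \<open>psi m\<close> and \<open>psi_star n\<close>.\<close>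

definition normal :: "int \<Rightarrow> int \<Rightarrow> complex fop"
  where "normal m n U V =
    op_mult (psi m) (psi_star n) U V - op_mult (psi m) (psi_star n) (ground 0) (ground 0) * op_id U V"

definition L0 :: "complex fop"
  where "L0 U V = (\<Sum>\<^sub>\<infinity>n::int. of_int n * normal (- n) n U V)"

definition W0 :: "complex fop"
  where "W0 U V = (\<Sum>\<^sub>\<infinity>n::int. of_int (n ^ 2) * normal (- n) n U V)"

definition J :: "int \<Rightarrow> complex fop"
  where "J k U V = (\<Sum>\<^sub>\<infinity>n::int. normal (- n) (n + k) U V)"

definition op_scale :: "complex \<Rightarrow> complex fop \<Rightarrow> complex fop"
  where "op_scale c A U V = c * A U V"

text \<open>\<open>x ^ L\<^sub>0\<close> for \<open>x \<noteq> 0\<close>.  The choice of the logarithm is irrelevant, since \<open>L\<^sub>0\<close> has integer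
  eigenvalues.\<close>

definition pow_L0 :: "complex \<Rightarrow> complex fop"
  where "pow_L0 x = op_exp (op_scale (Ln x) L0)"

text \<open>In the vertex operators, \<open>\<epsilon>\<close> is \<open>1\<close> or \<open>- 1\<close>, and the sequence \<open>x\<close> of arguments
  starts with index 0.\<close>

definition Gamma :: "int \<Rightarrow> (nat \<Rightarrow> complex) \<Rightarrow> complex fop"
  where "Gamma \<epsilon> x U V = lim (\<lambda>N. op_prod
    (map (\<lambda>i. op_exp (\<lambda>U V. \<Sum>\<^sub>\<infinity>k\<in>{1..}. x i ^ k / of_nat k * J (\<epsilon> * int k) U V)) [0..<N]) U V)"

definition Gamma' :: "int \<Rightarrow> (nat \<Rightarrow> complex) \<Rightarrow> complex fop"
  where "Gamma' \<epsilon> x U V = lim (\<lambda>N. op_prod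
    (map (\<lambda>i. op_exp (\<lambda>U V. - (\<Sum>\<^sub>\<infinity>k\<in>{1..}. (- x i) ^ k / of_nat k * J (\<epsilon> * int k) U V))) [0..<N]) U V)"


section \<open>Partitions and Schur functions\<close>

text \<open>The \<open>i\<close>-th part of \<open>\<mu>\<close>, \<open>i \<ge> 1\<close>, is \<open>\<mu> (i - 1)\<close>.\<close>

definition partitions :: "(nat \<Rightarrow> nat) set"
  where "partitions = {\<mu>. antimono \<mu> \<and> finite {i. \<mu> i \<noteq> 0}}"

definition conjugate :: "(nat \<Rightarrow> nat) \<Rightarrow> nat \<Rightarrow> nat"
  where "conjugate \<mu> j = card {i. j < \<mu> i}"

definition psize :: "(nat \<Rightarrow> nat) \<Rightarrow> nat"
  where "psize \<mu> = (\<Sum>i | \<mu> i \<noteq> 0. \<mu> i)"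

definition cells :: "(nat \<Rightarrow> nat) \<Rightarrow> (nat \<times> nat) set"
  where "cells \<mu> = {(i, j). j < \<mu> i}"

definition ssyt :: "(nat \<Rightarrow> nat) \<Rightarrow> (nat \<times> nat \<Rightarrow> nat) set"
  where "ssyt \<mu> = {T \<in> cells \<mu> \<rightarrow>\<^sub>E UNIV.
    (\<forall>i j. (i, Suc j) \<in> cells \<mu> \<longrightarrow> T (i, j) \<le> T (i, Suc j)) \<and>
    (\<forall>i j. (Suc i, j) \<in> cells \<mu> \<longrightarrow> T (i, j) < T (Suc i, j))}"

definition schur :: "(nat \<Rightarrow> nat) \<Rightarrow> (nat \<Rightarrow> complex) \<Rightarrow> complex"
  where "schur \<mu> x = (\<Sum>\<^sub>\<infinity>T\<in>ssyt \<mu>. \<Prod>c\<in>cells \<mu>. x (T c))"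


section \<open>The second orbifold melting crystal model\<close>

text \<open>The parameter \<open>lq\<close> is a logarithm of \<open>q\<close>; it fixes the branch of all fractional powers of \<open>q\<close>.\<close>

definition q_rho :: "complex \<Rightarrow> nat \<Rightarrow> complex"
  where "q_rho lq n = exp ((of_nat n + 1 / 2) * lq)"

text \<open>The union of the sequences \<open>p\<^sub>1 x, \<dots>, p\<^sub>a x\<close>, interleaved.\<close>

definition seq_union :: "nat \<Rightarrow> (nat \<Rightarrow> complex) \<Rightarrow> (nat \<Rightarrow> complex) \<Rightarrow> nat \<Rightarrow> complex"
  where "seq_union a p x m = p (m mod a + 1) * x (m div a)"

definition Phi :: "complex \<Rightarrow> int \<Rightarrow> (nat \<Rightarrow> nat) \<Rightarrow> int \<Rightarrow> complex"
  where "Phi q k \<mu> s =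
    (\<Sum>\<^sub>\<infinity>i\<in>{1..}. q powi (k * (int (\<mu> (i - 1)) + s - int i + 1)) - q powi (k * (s - int i + 1)))
    + (1 - q powi (k * s)) / (1 - q powi k) * q powi k"

definition Z' :: "nat \<Rightarrow> nat \<Rightarrow> complex \<Rightarrow> complex \<Rightarrow> (nat \<Rightarrow> complex) \<Rightarrow> (nat \<Rightarrow> complex) \<Rightarrow>
    int \<Rightarrow> (nat \<Rightarrow> 'v mps) \<Rightarrow> (nat \<Rightarrow> 'v mps) \<Rightarrow> 'v mps"
  where "Z' a b lq Q p r s t tb = (\<Sum>\<^sub>\<infinity>\<mu>\<in>partitions.
    mps_const (schur \<mu> (seq_union a p (q_rho lq)) * schur (conjugate \<mu>) (seq_union b r (q_rho lq))
      * Q powi (int (psize \<mu>) + s * (s + 1) div 2))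
    * mps_exp ((\<Sum>\<^sub>\<infinity>k\<in>{1..}. t k * mps_const (Phi (exp lq) (int k) \<mu> s))
             + (\<Sum>\<^sub>\<infinity>k\<in>{1..}. tb k * mps_const (Phi (exp lq) (- int k) \<mu> s))))"

text \<open>The normalized parameters \<open>p\<^sub>i = P\<^sub>i \<cdots> P\<^bsub>a-1\<^esub>\<close>, \<open>1 \<le> i \<le> a\<close>.\<close>

definition normalized :: "nat \<Rightarrow> (nat \<Rightarrow> complex) \<Rightarrow> nat \<Rightarrow> complex"
  where "normalized a P i = (\<Prod>k\<in>{i..<a}. P k)"

definition MacMahon :: "complex \<Rightarrow> complex \<Rightarrow> complex"
  where "MacMahon x q = (\<Prod>n. (1 - x * q ^ Suc n) powi (- int (Suc n)))"

definition g' :: "nat \<Rightarrow> nat \<Rightarrow> complex \<Rightarrow> complex \<Rightarrow> (nat \<Rightarrow> complex) \<Rightarrow> (nat \<Rightarrow> complex) \<Rightarrow> complex fop"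
  where "g' a b lq Q P R = op_prod (
      [op_exp (op_scale (lq / (2 * of_nat a)) W0), Gamma (-1) (q_rho lq), Gamma 1 (q_rho lq)]
    @ concat (map (\<lambda>i. [pow_L0 (P i), Gamma (-1) (q_rho lq), Gamma 1 (q_rho lq)]) [1..<a])
    @ [pow_L0 Q, Gamma' (-1) (q_rho lq), Gamma' 1 (q_rho lq)]
    @ concat (map (\<lambda>j. [pow_L0 (R j), Gamma' (-1) (q_rho lq), Gamma' 1 (q_rho lq)]) (rev [1..<b]))
    @ [op_exp (op_scale (- lq / (2 * of_nat b)) W0)])"

definition tau' :: "nat \<Rightarrow> nat \<Rightarrow> complex \<Rightarrow> complex \<Rightarrow> (nat \<Rightarrow> complex) \<Rightarrow> (nat \<Rightarrow> complex) \<Rightarrow>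
    int \<Rightarrow> (nat \<Rightarrow> 'v mps) \<Rightarrow> (nat \<Rightarrow> 'v mps) \<Rightarrow> 'v mps"
  where "tau' a b lq Q P R s t tb = op_prod
    [op_exp (\<lambda>U V. \<Sum>\<^sub>\<infinity>k\<in>{1..}. t k * mps_const (J (int k) U V)),
     \<lambda>U V. mps_const (g' a b lq Q P R U V),
     op_exp (\<lambda>U V. - (\<Sum>\<^sub>\<infinity>k\<in>{1..}. tb k * mps_const (J (- int k) U V)))]
    (ground s) (ground s)"

text \<open>\<open>L\<^sub>0\<close> has the eigenvalue \<open>s (s + 1) / 2\<close> on \<open>|s\<rangle>\<close>, so the operators \<open>P\<^sub>i ^ L\<^sub>0\<close> and
  \<open>R\<^sub>j ^ L\<^sub>0\<close> in \<open>g'\<close> multiply the tau function by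
  \<open>(P\<^sub>1 \<cdots> P\<^bsub>a-1\<^esub> R\<^sub>1 \<cdots> R\<^bsub>b-1\<^esub>) ^ (s (s + 1) / 2)\<close>.  This factor is not compensated
  in \<open>f'\<close>.\<close>

definition f' :: "nat \<Rightarrow> nat \<Rightarrow> complex \<Rightarrow> (nat \<Rightarrow> complex) \<Rightarrow> (nat \<Rightarrow> complex) \<Rightarrow>
    int \<Rightarrow> (nat \<Rightarrow> 'v mps) \<Rightarrow> (nat \<Rightarrow> 'v mps) \<Rightarrow> 'v mps"
  where "f' a b lq P R s t tb =
    mps_exp (\<Sum>\<^sub>\<infinity>k\<in>{1..}. (t k * mps_const (exp lq ^ k) - tb k) * mps_const (1 / (1 - exp lq ^ k)))
    * mps_const (
        exp (- of_int (s * (s + 1) * (2 * s + 1)) * (1 / (12 * of_nat a) - 1 / (12 * of_nat b)) * lq)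
        * (\<Prod>(i, j) \<in> {(i, j). 1 \<le> i \<and> i \<le> j \<and> j < a}. inverse (MacMahon (\<Prod>k=i..j. P k) (exp lq)))
        * (\<Prod>(i, j) \<in> {(i, j). 1 \<le> i \<and> i \<le> j \<and> j < b}. inverse (MacMahon (\<Prod>k=i..j. R k) (exp lq))))"

definition T_scaled :: "nat \<Rightarrow> (nat \<Rightarrow> complex) \<Rightarrow> (nat \<Rightarrow> 'v mps) \<Rightarrow> nat \<Rightarrow> 'v mps"
  where "T_scaled a P t k =
    mps_const ((-1) ^ (a * k) * (\<Prod>i\<in>{1..<a}. P i powi (- (int (a - i) * int k)))) * t k"

definition Tbar_scaled :: "nat \<Rightarrow> (nat \<Rightarrow> complex) \<Rightarrow> (nat \<Rightarrow> 'v mps) \<Rightarrow> nat \<Rightarrow> 'v mps"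
  where "Tbar_scaled b R tb k =
    mps_const (\<Prod>j\<in>{1..<b}. R j powi (- (int (b - j) * int k))) * tb k"

definition spread :: "nat \<Rightarrow> (nat \<Rightarrow> 'v mps) \<Rightarrow> nat \<Rightarrow> 'v mps"
  where "spread a T n = (if a dvd n then T (n div a) else 0)"

text \<open>The time variables \<open>t\<^sub>k\<close> and their barred counterparts, \<open>k \<ge> 1\<close>.\<close>

definition tvar :: "nat \<Rightarrow> (nat + nat) mps"
  where "tvar k = mps_var (Inl k)"

definition tbvar :: "nat \<Rightarrow> (nat + nat) mps"
  where "tbvar k = mps_var (Inr k)"

end

theory Submission
  imports Defs "HOL-Complex_Analysis.Complex_Analysis"
begin

text \<open>
  With \<open>J (l)\<close> for the current modes, the exponentials \<open>E c = exp (\<Sum>l\<ge>1. c l * J (l))\<close> are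
  column finite, and Schur functions of a sequence are the matrix elements of \<open>E\<close> between a ground
  state and a Maya diagram, with the power sums of the sequence as coefficients \<open>c\<close>.  In each half
  of \<open>g'\<close>, moving all \<open>\<Gamma>\<^sub>+\<close> to the right of all \<open>\<Gamma>\<^sub>-\<close> by the Heisenberg relation produces the MacMahon
  factors and leaves a product \<open>X = \<Gamma>\<^sub>-(d) r ^ L\<^sub>0 \<Gamma>\<^sub>+(c)\<close> between diagonal operators, with all
  rearrangements of infinite sums justified by absolute convergence.

  The modes \<open>A(m)\<close>, formally \<open>\<Sum>p. q ^ (- k * p) \<psi>(p + m) \<psi>\<^sup>*(- p)\<close>, of the quantum torus algebra satisfy
  \<open>[J (l), A(m)] = (1 - q ^ (- k * l)) A(m + l)\<close>.  Commuting \<open>A(m)\<close> with an exponential \<open>E c\<close>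
  therefore acts by a power series in the shift of \<open>m\<close>, and for the coefficients \<open>c\<close> at hand this
  series is a polynomial with as many roots as there are pairs of a parameter and an exponent below
  \<open>k\<close>.  The polynomials coming from both factors of \<open>X\<close> are reciprocal to each other, so that
  \<open>A(m) X\<close> is a multiple of \<open>X A(m - a * k)\<close>.  Conjugation by \<open>q ^ (W\<^sub>0 / 2a)\<close> turns \<open>J (a * k)\<close> into
  \<open>A(a * k)\<close>, hence \<open>J (a * k)\<close> intertwines through the left half of \<open>g'\<close> with the diagonal operator
  \<open>A(0)\<close>, whose eigenvalue is \<open>\<Phi>\<^sub>k\<close> up to a constant; likewise on the right with \<open>\<Phi>\<close> of index \<open>- k\<close>.
  Exponentiating these relations evaluates the tau function.
\<close>

section \<open>Maya diagrams\<close>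

lemma maya_finite_neg: "V \<in> maya \<Longrightarrow> finite {m \<in> V. m < (n::int)}"
  by (rule maya_finite_below)

lemma maya_finite_holes:
  assumes "V \<in> maya" shows "finite {m. m \<notin> V \<and> (n::int) \<le> m}"
proof -
  obtain N where "\<forall>k > N. k \<in> V" using assms by (auto simp: maya_def)
  then have "{m. m \<notin> V \<and> n \<le> m} \<subseteq> {n..N}" by force
  then show ?thesis by (rule finite_subset) simp
qed

definition wt :: "(int \<Rightarrow> 'a :: ab_group_add) \<Rightarrow> int set \<Rightarrow> 'a"
  where "wt \<phi> V = (\<Sum>m\<in>{m \<in> V. m < 0}. \<phi> m) - (\<Sum>m\<in>{m. m \<notin> V \<and> 0 \<le> m}. \<phi> m)"

lemma wt_insert:
  assumes V: "V \<in> maya" and n: "n \<notin> V"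
  shows "wt \<phi> (insert n V) = wt \<phi> V + \<phi> n"
proof (cases "n < 0")
  case True
  have 1: "{m \<in> insert n V. m < 0} = insert n {m \<in> V. m < 0}" using True by auto
  have 2: "{m. m \<notin> insert n V \<and> 0 \<le> m} = {m. m \<notin> V \<and> 0 \<le> m}" using True by auto
  show ?thesis unfolding wt_def 1 2 using n maya_finite_neg[OF V] by simp
next
  case False
  have 1: "{m \<in> insert n V. m < 0} = {m \<in> V. m < 0}" using False by auto
  have 2: "{m. m \<notin> V \<and> 0 \<le> m} = insert n {m. m \<notin> insert n V \<and> 0 \<le> m}" using False n by auto
  have "finite {m. m \<notin> insert n V \<and> 0 \<le> m}" by (rule maya_finite_holes[OF maya_insert[OF V]])
  then show ?thesis unfolding wt_def 1 2 by simp
qed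

lemma wt_remove:
  assumes V: "V \<in> maya" and n: "n \<in> V"
  shows "wt \<phi> (V - {n}) = wt \<phi> V - \<phi> n"
  using wt_insert[OF maya_remove[OF V], of n n \<phi>] n by (simp add: insert_absorb)

lemma wt_ground_0: "wt \<phi> (ground 0) = 0"
proof -
  have "{m \<in> ground 0. m < 0} = {}" "{m. m \<notin> ground 0 \<and> 0 \<le> m} = {}" by (auto simp: ground_def)
  then show ?thesis by (simp only: wt_def sum.empty diff_zero)
qed

definition en :: "int set \<Rightarrow> int" where "en = wt (\<lambda>m. - m)"

lemma en_insert: "V \<in> maya \<Longrightarrow> n \<notin> V \<Longrightarrow> en (insert n V) = en V - n"
  by (simp add: en_def wt_insert)

lemma en_remove: "V \<in> maya \<Longrightarrow> n \<in> V \<Longrightarrow> en (V - {n}) = en V + n"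
  by (simp add: en_def wt_remove)

lemma en_alt: "en V = (\<Sum>m\<in>{m \<in> V. m < 0}. - m) + (\<Sum>m\<in>{m. m \<notin> V \<and> 0 \<le> m}. m)"
  by (simp add: en_def wt_def sum_negf)

lemma en_nonneg: "0 \<le> en V"
  unfolding en_alt by (intro add_nonneg_nonneg sum_nonneg) auto

lemma en_particle: assumes "V \<in> maya" "m \<in> V" shows "- en V \<le> m"
proof (cases "m < 0")
  case True
  have "- m \<le> (\<Sum>m\<in>{m \<in> V. m < 0}. - m)"
    by (rule member_le_sum) (use True assms maya_finite_neg in auto)
  moreover have "0 \<le> (\<Sum>m\<in>{m. m \<notin> V \<and> 0 \<le> m}. m)" by (intro sum_nonneg) auto
  ultimately show ?thesis by (simp add: en_alt)
next
  case False
  then show ?thesis using en_nonneg[of V] by linarith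
qed

lemma en_hole: assumes "V \<in> maya" "m \<notin> V" shows "m \<le> en V"
proof (cases "0 \<le> m")
  case True
  have "m \<le> (\<Sum>m\<in>{m. m \<notin> V \<and> 0 \<le> m}. m)"
    by (rule member_le_sum) (use True assms maya_finite_holes in auto)
  moreover have "0 \<le> (\<Sum>m\<in>{m \<in> V. m < 0}. - m)" by (intro sum_nonneg) auto
  ultimately show ?thesis by (simp add: en_alt)
next
  case False
  then show ?thesis using en_nonneg[of V] by linarith
qed

lemma finite_en: "finite {V \<in> maya. en V \<le> n}"
proof -
  have "{V \<in> maya. en V \<le> n} \<subseteq> (\<lambda>S. S \<union> {n<..}) ` Pow {-n..n}"
  proof
    fix V assume "V \<in> {V \<in> maya. en V \<le> n}"
    then have V: "V \<in> maya" "en V \<le> n" by auto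
    have "V = (V \<inter> {-n..n}) \<union> {n<..}"
    proof (intro set_eqI iffI)
      fix x assume "x \<in> V"
      then show "x \<in> (V \<inter> {-n..n}) \<union> {n<..}" using en_particle[OF V(1), of x] V(2) by auto
    next
      fix x assume "x \<in> (V \<inter> {-n..n}) \<union> {n<..}"
      then show "x \<in> V" using en_hole[OF V(1), of x] V(2) by (cases "x \<in> V") auto
    qed
    then show "V \<in> (\<lambda>S. S \<union> {n<..}) ` Pow {-n..n}" by blast
  qed
  then show ?thesis by (rule finite_subset) simp
qed

section \<open>The ring of column finite operators\<close>

lemma op_mult_finite:
  fixes A B :: "'a :: {comm_ring_1, t2_space} fop"
  assumes "finite S" "S \<subseteq> maya" "\<And>W. W \<in> maya \<Longrightarrow> W \<notin> S \<Longrightarrow> A U W * B W V = 0"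
  shows "op_mult A B U V = (\<Sum>W\<in>S. A U W * B W V)"
proof -
  have "op_mult A B U V = infsum (\<lambda>W. A U W * B W V) S"
    unfolding op_mult_def by (rule infsum_cong_neutral) (use assms in auto)
  then show ?thesis using assms by simp
qed

definition col_fin :: "complex fop \<Rightarrow> bool"
  where "col_fin A \<longleftrightarrow> (\<forall>U V. A U V \<noteq> 0 \<longrightarrow> U \<in> maya \<and> V \<in> maya) \<and> (\<forall>V. finite {U. A U V \<noteq> 0})"

typedef cfm = "{A. col_fin A}" morphisms ent Mk
  by (rule exI[of _ "\<lambda>_ _. 0"]) (simp add: col_fin_def)

setup_lifting type_definition_cfm

lemma ent_maya: "ent A U V \<noteq> 0 \<Longrightarrow> U \<in> maya \<and> V \<in> maya"
  using ent[of A] by (auto simp: col_fin_def)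

lemma ent_finite: "finite {U. ent A U V \<noteq> 0}"
  using ent[of A] by (auto simp: col_fin_def)

lemma cfm_eqI: "(\<And>U V. U \<in> maya \<Longrightarrow> V \<in> maya \<Longrightarrow> ent A U V = ent B U V) \<Longrightarrow> A = B"
  by (metis ent_inject ent_maya ext)

lemma op_mult_fin_col:
  assumes "finite S" "\<And>W. W \<notin> S \<Longrightarrow> ent B W V = 0"
  shows "op_mult A (ent B) U V = (\<Sum>W\<in>S. A U W * ent B W V)"
proof -
  have "op_mult A (ent B) U V = (\<Sum>W\<in>S \<inter> maya. A U W * ent B W V)"
    by (rule op_mult_finite) (use assms in auto)
  also have "\<dots> = (\<Sum>W\<in>S. A U W * ent B W V)"
    by (rule sum.mono_neutral_left) (use assms ent_maya in auto)
  finally show ?thesis .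
qed

lemma sum_nonzeroD: "sum f S \<noteq> 0 \<Longrightarrow> \<exists>x\<in>S. f x \<noteq> 0"
  by (meson sum.neutral)

lemma finite_nonzero_mult: "finite {U. f U \<noteq> 0} \<Longrightarrow> finite {U. g U * f U \<noteq> (0 :: complex)}"
  by (rule finite_subset[of _ "{U. f U \<noteq> 0}"]) auto

lemma col_fin_mult: assumes "col_fin A" shows "col_fin (\<lambda>U V. g U V * A U V)"
proof -
  have "finite {U. g U V * A U V \<noteq> 0}" for V
    by (rule finite_nonzero_mult) (use assms in \<open>simp add: col_fin_def\<close>)
  then show ?thesis using assms unfolding col_fin_def by (metis mult_zero_right)
qed

lemma op_id_finite_col: "finite {U. op_id U V \<noteq> (0::complex)}"
  by (rule finite_subset[of _ "{V}"]) (auto simp: op_id_def)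

instantiation cfm :: ring_1
begin

lift_definition zero_cfm :: cfm is "\<lambda>_ _. 0" by (simp add: col_fin_def)
lift_definition one_cfm :: cfm is op_id
  using op_id_finite_col by (auto simp: col_fin_def op_id_def split: if_splits)
lift_definition plus_cfm :: "cfm \<Rightarrow> cfm \<Rightarrow> cfm" is "\<lambda>A B U V. A U V + B U V"
proof -
  fix A B :: "complex fop"
  assume A': "col_fin A" and B': "col_fin B"
  note A = A'[unfolded col_fin_def] and B = B'[unfolded col_fin_def]
  have "finite {U. A U V + B U V \<noteq> 0}" for V
    by (rule finite_subset[of _ "{U. A U V \<noteq> 0} \<union> {U. B U V \<noteq> 0}"]) (use A B in auto)
  then show "col_fin (\<lambda>U V. A U V + B U V)"
    unfolding col_fin_def using A B by auto (metis add_0)+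
qed
lift_definition uminus_cfm :: "cfm \<Rightarrow> cfm" is "\<lambda>A U V. - A U V" by (simp add: col_fin_def)
definition minus_cfm :: "cfm \<Rightarrow> cfm \<Rightarrow> cfm" where "minus_cfm A B = A + - B"
lift_definition times_cfm :: "cfm \<Rightarrow> cfm \<Rightarrow> cfm" is op_mult
proof -
  fix A B :: "complex fop"
  assume A': "col_fin A" and B': "col_fin B"
  note A = A'[unfolded col_fin_def] and B = B'[unfolded col_fin_def]
  have eq: "op_mult A B U V = (\<Sum>W\<in>{W. B W V \<noteq> 0}. A U W * B W V)" for U V
    by (rule op_mult_finite) (use B in auto)
  have "finite {U. op_mult A B U V \<noteq> 0}" for V
  proof (rule finite_subset)
    show "{U. op_mult A B U V \<noteq> 0} \<subseteq> (\<Union>W\<in>{W. B W V \<noteq> 0}. {U. A U W \<noteq> 0})"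
      by (auto simp: eq dest!: sum_nonzeroD)
    show "finite (\<Union>W\<in>{W. B W V \<noteq> 0}. {U. A U W \<noteq> 0})" using A B by auto
  qed
  moreover have "U \<in> maya \<and> V \<in> maya" if "op_mult A B U V \<noteq> 0" for U V
    using that A B by (auto simp: eq dest!: sum_nonzeroD)
  ultimately show "col_fin (op_mult A B)"
    unfolding col_fin_def by blast
qed

lemma ent_mult':
  assumes "finite S" "\<And>W. W \<notin> S \<Longrightarrow> ent B W V = 0"
  shows "ent (A * B) U V = (\<Sum>W\<in>S. ent A U W * ent B W V)"
  unfolding times_cfm.rep_eq by (rule op_mult_fin_col) fact+

lemma ent_mult0: "ent (A * B) U V = (\<Sum>W\<in>{W. ent B W V \<noteq> 0}. ent A U W * ent B W V)"
  by (rule ent_mult') (auto simp: ent_finite)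

instance
proof
  fix A B C :: cfm
  show "A * B * C = A * (B * C)"
  proof (rule cfm_eqI)
    fix U V
    define S where "S = {X. ent C X V \<noteq> 0}"
    define T where "T = (\<Union>X\<in>S. {W. ent B W X \<noteq> 0})"
    have S: "finite S" and T: "finite T" by (auto simp: S_def T_def ent_finite)
    have BC: "ent (B * C) W V = (\<Sum>X\<in>S. ent B W X * ent C X V)" for W
      by (rule ent_mult') (use S in \<open>auto simp: S_def\<close>)
    have "ent (A * (B * C)) U V = (\<Sum>W\<in>T. ent A U W * ent (B * C) W V)"
      by (rule ent_mult'[OF T]) (auto simp: BC T_def S_def intro!: sum.neutral)
    also have "\<dots> = (\<Sum>W\<in>T. \<Sum>X\<in>S. ent A U W * ent B W X * ent C X V)"
      by (simp add: BC sum_distrib_left mult.assoc)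
    also have "\<dots> = (\<Sum>X\<in>S. \<Sum>W\<in>T. ent A U W * ent B W X * ent C X V)" by (rule sum.swap)
    also have "\<dots> = (\<Sum>X\<in>S. ent (A * B) U X * ent C X V)"
    proof (rule sum.cong[OF refl])
      fix X assume X: "X \<in> S"
      have "ent (A * B) U X = (\<Sum>W\<in>T. ent A U W * ent B W X)"
        by (rule ent_mult'[OF T]) (use X in \<open>auto simp: T_def\<close>)
      then show "(\<Sum>W\<in>T. ent A U W * ent B W X * ent C X V) = ent (A * B) U X * ent C X V"
        by (simp add: sum_distrib_right)
    qed
    also have "\<dots> = ent (A * B * C) U V"
      by (rule ent_mult'[symmetric]) (use S in \<open>auto simp: S_def\<close>)
    finally show "ent (A * B * C) U V = ent (A * (B * C)) U V" by simp
  qed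
  show "1 * A = A"
  proof (rule cfm_eqI)
    fix U V assume U: "U \<in> maya"
    have "ent (1 * A) U V = (\<Sum>W\<in>{W. ent A W V \<noteq> 0}. op_id U W * ent A W V)"
      by (subst ent_mult'[of "{W. ent A W V \<noteq> 0}"]) (auto simp: ent_finite one_cfm.rep_eq)
    also have "\<dots> = (\<Sum>W\<in>{W. ent A W V \<noteq> 0}. if W = U then ent A U V else 0)"
      using U by (intro sum.cong) (auto simp: op_id_def)
    also have "\<dots> = ent A U V" by (simp add: ent_finite)
    finally show "ent (1 * A) U V = ent A U V" .
  qed
  show "A * 1 = A"
  proof (rule cfm_eqI)
    fix U V assume V: "V \<in> maya"
    have "ent (A * 1) U V = (\<Sum>W\<in>{V}. ent A U W * ent 1 W V)"
      by (rule ent_mult') (auto simp: one_cfm.rep_eq op_id_def)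
    then show "ent (A * 1) U V = ent A U V" using V by (simp add: one_cfm.rep_eq op_id_def)
  qed
  show "(A + B) * C = A * C + B * C"
    by (rule cfm_eqI) (simp add: plus_cfm.rep_eq ent_mult0 distrib_right sum.distrib)
  show "A * (B + C) = A * B + A * C"
  proof (rule cfm_eqI)
    fix U V
    define S where "S = {W. ent B W V \<noteq> 0} \<union> {W. ent C W V \<noteq> 0}"
    have S: "finite S" by (auto simp: S_def ent_finite)
    have *: "ent (A * D) U V = (\<Sum>W\<in>S. ent A U W * ent D W V)" if "D \<in> {B, C, B + C}" for D
      by (rule ent_mult'[OF S]) (use that in \<open>auto simp: S_def plus_cfm.rep_eq\<close>)
    show "ent (A * (B + C)) U V = ent (A * B + A * C) U V"
      by (simp add: * plus_cfm.rep_eq distrib_left sum.distrib)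
  qed
  show "(0 :: cfm) \<noteq> 1"
    by transfer (metis ground_maya op_id_def zero_neq_one)
  show "A - B = A + - B" by (simp add: minus_cfm_def)
qed (rule cfm_eqI; simp add: plus_cfm.rep_eq zero_cfm.rep_eq uminus_cfm.rep_eq add_ac)+

end

lemmas ent_mult = ent_mult'
lemma ent_plus: "ent (A + B) U V = ent A U V + ent B U V" by (simp add: plus_cfm.rep_eq)
lemma ent_zero: "ent 0 U V = 0" by (simp add: zero_cfm.rep_eq)
lemma ent_one: "ent 1 U V = op_id U V" by (simp add: one_cfm.rep_eq)
lemma ent_uminus: "ent (- A) U V = - ent A U V" by (simp add: uminus_cfm.rep_eq)
lemma ent_minus: "ent (A - B) U V = ent A U V - ent B U V"
  unfolding minus_cfm_def ent_plus ent_uminus by simp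
lemma ent_sum: "ent (sum f S) U V = (\<Sum>x\<in>S. ent (f x) U V)"
  by (induction S rule: infinite_finite_induct) (auto simp: ent_plus ent_zero)

lift_definition sc :: "complex \<Rightarrow> cfm \<Rightarrow> cfm" is "\<lambda>c A U V. c * A U V"
proof -
  fix c and A :: "complex fop" assume "col_fin A"
  then show "col_fin (\<lambda>U V. c * A U V)" by (rule col_fin_mult[where g="\<lambda>_ _. c"])
qed

lemma ent_sc: "ent (sc c A) U V = c * ent A U V" by (simp add: sc.rep_eq)

lemma sc_sc: "sc a (sc b A) = sc (a * b) A" by (rule cfm_eqI) (simp add: ent_sc)
lemma sc_1: "sc 1 A = A" by (rule cfm_eqI) (simp add: ent_sc)
lemma sc_0: "sc 0 A = 0" by (rule cfm_eqI) (simp add: ent_sc ent_zero)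
lemma sc_zero: "sc a 0 = 0" by (rule cfm_eqI) (simp add: ent_sc ent_zero)
lemma sc_add: "sc a (A + B) = sc a A + sc a B" by (rule cfm_eqI) (simp add: ent_sc ent_plus algebra_simps)
lemma sc_diff: "sc a (A - B) = sc a A - sc a B" by (rule cfm_eqI) (simp add: ent_sc ent_minus algebra_simps)
lemma sc_minus: "sc a (- A) = - sc a A" by (rule cfm_eqI) (simp add: ent_sc ent_uminus)
lemma sc_left_add: "sc (a + b) A = sc a A + sc b A" by (rule cfm_eqI) (simp add: ent_sc ent_plus algebra_simps)
lemma sc_left_diff: "sc (a - b) A = sc a A - sc b A" by (rule cfm_eqI) (simp add: ent_sc ent_minus algebra_simps)
lemma sc_sum: "sc a (sum f S) = (\<Sum>x\<in>S. sc a (f x))"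
  by (rule cfm_eqI) (simp add: ent_sc ent_sum sum_distrib_left)
lemma sc_left_sum: "sc (sum f S) A = (\<Sum>x\<in>S. sc (f x) A)"
  by (rule cfm_eqI) (simp add: ent_sc ent_sum sum_distrib_right)
lemma sc_mult_left: "sc a A * B = sc a (A * B)"
  by (rule cfm_eqI)
     (simp add: ent_sc ent_mult0 sum_distrib_left mult.assoc)
lemma sc_mult_right: "A * sc b B = sc b (A * B)"
proof (rule cfm_eqI)
  fix U V
  have S: "finite {W. ent B W V \<noteq> 0}" by (rule ent_finite)
  have "ent (A * sc b B) U V = (\<Sum>W\<in>{W. ent B W V \<noteq> 0}. ent A U W * ent (sc b B) W V)"
    by (rule ent_mult[OF S]) (auto simp: ent_sc)
  also have "\<dots> = b * ent (A * B) U V"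
    by (subst ent_mult[OF S]) (auto simp: ent_sc sum_distrib_left intro!: sum.cong)
  finally show "ent (A * sc b B) U V = ent (sc b (A * B)) U V" by (simp add: ent_sc)
qed

lemmas sc_simps = sc_sc sc_1 sc_0 sc_zero sc_add sc_diff sc_minus sc_mult_left sc_mult_right

section \<open>Columnwise limits and the energy grading\<close>

definition conv :: "('x \<Rightarrow> cfm) \<Rightarrow> cfm \<Rightarrow> 'x filter \<Rightarrow> bool"
  where "conv G A F \<longleftrightarrow> (\<forall>V\<in>maya. \<forall>\<^sub>F x in F. \<forall>U. ent (G x) U V = ent A U V)"

lemma convD: "conv G A F \<Longrightarrow> \<forall>\<^sub>F x in F. \<forall>U. ent (G x) U V = ent A U V"
  unfolding conv_def using ent_maya[of _ _ V]
  by (cases "V \<in> maya") (auto intro!: always_eventually, metis)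

lemma conv_unique: assumes "conv G A F" "conv G B F" "F \<noteq> bot" shows "A = B"
proof (rule cfm_eqI)
  fix U V
  have "\<forall>\<^sub>F x in F. ent A U V = ent B U V"
    using convD[OF assms(1), of V] convD[OF assms(2), of V] by eventually_elim auto
  then show "ent A U V = ent B U V" using assms(3) by (simp add: eventually_const)
qed

lemma conv_const: "conv (\<lambda>_. A) A F" by (simp add: conv_def)

lemma conv_add: "conv G A F \<Longrightarrow> conv H B F \<Longrightarrow> conv (\<lambda>x. G x + H x) (A + B) F"
  unfolding conv_def by (fastforce simp: ent_plus elim: eventually_elim2)

lemma conv_diff: "conv G A F \<Longrightarrow> conv H B F \<Longrightarrow> conv (\<lambda>x. G x - H x) (A - B) F"
  unfolding conv_def by (fastforce simp: ent_minus elim: eventually_elim2)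

lemma conv_cong: "conv G A F \<Longrightarrow> \<forall>\<^sub>F x in F. G x = H x \<Longrightarrow> conv H A F"
  unfolding conv_def by (fastforce elim: eventually_elim2)

lemma conv_mult_left: assumes "conv G A F" shows "conv (\<lambda>x. X * G x) (X * A) F"
  unfolding conv_def
proof
  fix V
  show "\<forall>\<^sub>F x in F. \<forall>U. ent (X * G x) U V = ent (X * A) U V"
    using convD[OF assms, of V]
    by eventually_elim
      (simp add: ent_mult0)
qed

lemma conv_mult_right: assumes "conv G A F" shows "conv (\<lambda>x. G x * X) (A * X) F"
  unfolding conv_def
proof
  fix V
  have "\<forall>\<^sub>F x in F. \<forall>W\<in>{W. ent X W V \<noteq> 0}. \<forall>U. ent (G x) U W = ent A U W"
    by (intro eventually_ball_finite ballI convD assms ent_finite)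
  then show "\<forall>\<^sub>F x in F. \<forall>U. ent (G x * X) U V = ent (A * X) U V"
    by eventually_elim
      (auto simp: ent_mult0 intro!: sum.cong)
qed

lift_definition deg :: "cfm \<Rightarrow> cfm" is "\<lambda>A U V. of_int (en V - en U) * A U V"
proof -
  fix A :: "complex fop" assume "col_fin A"
  then show "col_fin (\<lambda>U V. of_int (en V - en U) * A U V)"
    by (rule col_fin_mult[where g="\<lambda>U V. of_int (en V - en U)"])
qed

lemma ent_deg: "ent (deg A) U V = of_int (en V - en U) * ent A U V" by (simp add: deg.rep_eq)

lemma deg_mult: "deg (A * B) = deg A * B + A * deg B"
proof (rule cfm_eqI)
  fix U V
  let ?S = "{W. ent B W V \<noteq> 0}"
  have S: "finite ?S" by (rule ent_finite)
  have "ent (A * deg B) U V = (\<Sum>W\<in>?S. ent A U W * ent (deg B) W V)"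
    by (rule ent_mult[OF S]) (auto simp: ent_deg)
  then show "ent (deg (A * B)) U V = ent (deg A * B + A * deg B) U V"
    by (simp only: ent_deg ent_plus ent_mult0[of A B] ent_mult0[of "deg A"] sum_distrib_left sum.distrib [symmetric])
       (auto intro!: sum.cong simp: algebra_simps)
qed

lemma deg_add: "deg (A + B) = deg A + deg B"
  by (rule cfm_eqI) (simp add: ent_deg ent_plus algebra_simps)
lemma deg_diff: "deg (A - B) = deg A - deg B"
  by (rule cfm_eqI) (simp add: ent_deg ent_minus algebra_simps)
lemma deg_sc: "deg (sc c A) = sc c (deg A)"
  by (rule cfm_eqI) (simp add: ent_deg ent_sc algebra_simps)
lemma deg_one: "deg 1 = 0"
  by (rule cfm_eqI) (auto simp: ent_deg ent_one ent_zero op_id_def)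
lemma deg_sum: "deg (sum f S) = (\<Sum>x\<in>S. deg (f x))"
  by (rule cfm_eqI) (simp add: ent_deg ent_sum sum_distrib_left)

lemma conv_deg: "conv G A F \<Longrightarrow> conv (\<lambda>x. deg (G x)) (deg A) F"
  unfolding conv_def by (fastforce simp: ent_deg elim: eventually_mono)

definition homog :: "int \<Rightarrow> cfm \<Rightarrow> bool" where "homog m A \<longleftrightarrow> deg A = sc (of_int m) A"

lemma homogD: "homog m A \<Longrightarrow> ent A U V \<noteq> 0 \<Longrightarrow> en U = en V - m"
  unfolding homog_def
proof -
  assume "deg A = sc (of_int m) A" "ent A U V \<noteq> 0"
  then have "of_int (en V - en U) * ent A U V = of_int m * ent A U V"
    by (metis ent_deg ent_sc)
  then have "(of_int (en V - en U) :: complex) = of_int m" using \<open>ent A U V \<noteq> 0\<close> by simp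
  then show "en U = en V - m" by (simp only: of_int_eq_iff)
qed

lemma homogI: "(\<And>U V. ent A U V \<noteq> 0 \<Longrightarrow> en U = en V - m) \<Longrightarrow> homog m A"
  unfolding homog_def by (rule cfm_eqI) (metis (no_types, lifting) diff_diff_eq2 add_diff_cancel_left' ent_deg ent_sc mult_zero_right)

section \<open>Fermions and fermion bilinears\<close>

lift_definition cre :: "int \<Rightarrow> cfm" is psi
proof -
  fix n
  have "finite {U. psi n U V \<noteq> 0}" for V
    by (rule finite_subset[of _ "{insert n V}"]) (auto simp: psi_def)
  then show "col_fin (psi n)" by (auto simp: col_fin_def psi_def maya_insert split: if_splits)
qed

lift_definition ann :: "int \<Rightarrow> cfm" is psi_star
proof -
  fix n
  have "finite {U. psi_star n U V \<noteq> 0}" for V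
    by (rule finite_subset[of _ "{V - {- n}}"]) (auto simp: psi_star_def)
  then show "col_fin (psi_star n)" by (auto simp: col_fin_def psi_star_def maya_remove split: if_splits)
qed

lemma cre_cre: "cre m * cre n = - (cre n * cre m)"
proof -
  have "cre m * cre n + cre n * cre m = 0"
    by (rule cfm_eqI) (simp add: ent_plus ent_zero times_cfm.rep_eq cre.rep_eq psi_psi)
  then show ?thesis by (simp add: eq_neg_iff_add_eq_0)
qed

lemma ann_ann: "ann m * ann n = - (ann n * ann m)"
proof -
  have "ann m * ann n + ann n * ann m = 0"
    by (rule cfm_eqI) (simp add: ent_plus ent_zero times_cfm.rep_eq ann.rep_eq psi_star_psi_star)
  then show ?thesis by (simp add: eq_neg_iff_add_eq_0)
qed

lemma ann_cre: "ann n * cre m = (if m + n = 0 then 1 else 0) - cre m * ann n"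
proof -
  have "cre m * ann n + ann n * cre m = (if m + n = 0 then 1 else 0)"
    by (rule cfm_eqI)
       (simp add: ent_plus ent_zero ent_one times_cfm.rep_eq ann.rep_eq cre.rep_eq psi_psi_star)
  then show ?thesis by (simp add: algebra_simps)
qed

lemma homog_cre: "homog n (cre n)"
  by (rule homogI) (auto simp: cre.rep_eq psi_def en_insert split: if_splits)

lemma homog_ann: "homog n (ann n)"
  by (rule homogI) (auto simp: ann.rep_eq psi_star_def en_remove split: if_splits)

lemma homog_mult: assumes "homog m A" "homog n B" shows "homog (m + n) (A * B)"
proof -
  have "deg (A * B) = sc (of_int m) A * B + A * sc (of_int n) B"
    using assms by (simp add: deg_mult homog_def)
  then show ?thesis by (simp add: homog_def sc_simps sc_left_add)
qed

lemma homog_sc: "homog m A \<Longrightarrow> homog m (sc c A)"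
  by (simp add: homog_def deg_sc sc_simps mult.commute)
lemma homog_add: "homog m A \<Longrightarrow> homog m B \<Longrightarrow> homog m (A + B)"
  by (simp add: homog_def deg_add sc_simps)
lemma homog_diff: "homog m A \<Longrightarrow> homog m B \<Longrightarrow> homog m (A - B)"
  by (simp add: homog_def deg_diff sc_simps)
lemma homog_one: "homog 0 1" by (simp add: homog_def deg_one sc_simps)

text \<open>\<open>nb p m\<close> is the normal ordered bilinear that moves a particle from mode \<open>p\<close> to mode \<open>p + m\<close>.\<close>

definition nb :: "int \<Rightarrow> int \<Rightarrow> cfm"
  where "nb p m = cre (p + m) * ann (- p) - (if m = 0 \<and> 0 \<le> p then 1 else 0)"

lemma homog_nb: "homog m (nb p m)"
  unfolding nb_def using homog_mult[OF homog_cre[of "p + m"] homog_ann[of "- p"]]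
  by (cases "m = 0 \<and> 0 \<le> p") (auto intro!: homog_diff homog_one)

lemma ent_bil:
  assumes "V \<in> maya"
  shows "ent (cre (p + m) * ann (- p)) U V =
    (if p \<in> V \<and> (m = 0 \<or> p + m \<notin> V) \<and> U = insert (p + m) (V - {p})
     then (-1) ^ (card {k \<in> V. k < p} + card {k \<in> V - {p}. k < p + m}) else 0)"
  using assms by (auto simp: times_cfm.rep_eq cre.rep_eq ann.rep_eq psi_star_left psi_def maya_remove power_add)

lemma ent_nb_0:
  assumes "V \<in> maya"
  shows "ent (nb p 0) U V = (if U = V then of_bool (p \<in> V) - of_bool (0 \<le> p) else 0)"
proof -
  have "{k \<in> V - {p}. k < p} = {k \<in> V. k < p}" by auto
  then show ?thesis
    using assms ent_bil[OF assms, of p 0 U]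
    by (auto simp: nb_def ent_minus ent_one ent_zero op_id_def insert_absorb simp flip: mult_2)
qed

lemma ent_nb_normal: "ent (nb p m) U V = normal (p + m) (- p) U V"
proof -
  have vac: "op_mult (psi (p + m)) (psi_star (- p)) (ground 0) (ground 0) = (if m = 0 \<and> 0 \<le> p then 1 else 0)"
    proof -
    have "{k \<in> ground 0 - {p}. k < p} = {k \<in> ground 0. k < p}" by auto
    moreover have "m = 0" if "0 \<le> p" "0 \<le> p + m \<Longrightarrow> m = 0" "{0..} = insert (p + m) ({0..} - {p})"
    proof (rule ccontr)
      assume "m \<noteq> 0"
      then have "p \<notin> insert (p + m) ({0..} - {p})" by auto
      then show False using that by auto
    qed
    ultimately show ?thesis
      using ent_bil[OF ground_maya[of 0], of p m "ground 0"]
      by (auto simp: times_cfm.rep_eq cre.rep_eq ann.rep_eq ground_def insert_absorb simp flip: mult_2)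
  qed
  show ?thesis unfolding normal_def vac
    by (auto simp: nb_def ent_minus ent_one ent_zero times_cfm.rep_eq cre.rep_eq ann.rep_eq)
qed

definition nbsup :: "int \<Rightarrow> int set \<Rightarrow> int set"
  where "nbsup m V = {p. p \<in> V \<and> p + m \<notin> V} \<union> {p. m = 0 \<and> (p \<in> V \<longleftrightarrow> p < 0)}"

lemma finite_nbsup: assumes "V \<in> maya" shows "finite (nbsup m V)"
proof (rule finite_subset)
  show "nbsup m V \<subseteq> {- en V..en V - m} \<union> ({p \<in> V. p < 0} \<union> {p. p \<notin> V \<and> 0 \<le> p})"
    using en_particle[OF assms] en_hole[OF assms] by (fastforce simp: nbsup_def)
  show "finite ({- en V..en V - m} \<union> ({p \<in> V. p < 0} \<union> {p. p \<notin> V \<and> 0 \<le> p}))"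
    using maya_finite_neg[OF assms] maya_finite_holes[OF assms] by auto
qed

lemma ent_nb_nbsup: assumes "V \<in> maya" "ent (nb p m) U V \<noteq> 0" shows "p \<in> nbsup m V"
proof (cases "m = 0")
  case True
  then show ?thesis using assms by (auto simp: ent_nb_0 nbsup_def split: if_splits)
next
  case False
  then show ?thesis using assms ent_bil[OF assms(1), of p m U]
    by (auto simp: nb_def nbsup_def ent_minus ent_zero split: if_splits)
qed

lift_definition Dm :: "(int \<Rightarrow> complex) \<Rightarrow> int \<Rightarrow> cfm"
  is "\<lambda>\<phi> m U V. if V \<in> maya then (\<Sum>p\<in>nbsup m V. \<phi> p * ent (nb p m) U V) else 0"
proof -
  fix \<phi> m
  have "finite {U. (if V \<in> maya then (\<Sum>p\<in>nbsup m V. \<phi> p * ent (nb p m) U V) else 0) \<noteq> 0}" for V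
  proof (rule finite_subset)
    show "{U. (if V \<in> maya then (\<Sum>p\<in>nbsup m V. \<phi> p * ent (nb p m) U V) else 0) \<noteq> 0}
      \<subseteq> (\<Union>p\<in>(if V \<in> maya then nbsup m V else {}). {U. ent (nb p m) U V \<noteq> 0})"
      by (auto dest!: sum_nonzeroD split: if_splits)
    show "finite (\<Union>p\<in>(if V \<in> maya then nbsup m V else {}). {U. ent (nb p m) U V \<noteq> 0})"
      by (auto simp: finite_nbsup ent_finite)
  qed
  then show "col_fin (\<lambda>U V. if V \<in> maya then (\<Sum>p\<in>nbsup m V. \<phi> p * ent (nb p m) U V) else 0)"
    unfolding col_fin_def by (auto dest!: sum_nonzeroD ent_maya split: if_splits)
qed

lemma ent_Dm: "V \<in> maya \<Longrightarrow> ent (Dm \<phi> m) U V = (\<Sum>p\<in>nbsup m V. \<phi> p * ent (nb p m) U V)"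
  by (simp add: Dm.rep_eq)

lemma ent_Dm_superset:
  assumes "V \<in> maya" "finite F" "nbsup m V \<subseteq> F"
  shows "ent (Dm \<phi> m) U V = (\<Sum>p\<in>F. \<phi> p * ent (nb p m) U V)"
  unfolding ent_Dm[OF assms(1)]
  by (rule sum.mono_neutral_left) (use assms ent_nb_nbsup in auto)

lemma conv_Dm: "conv (\<lambda>F. \<Sum>p\<in>F. sc (\<phi> p) (nb p m)) (Dm \<phi> m) (finite_subsets_at_top UNIV)"
  unfolding conv_def
proof
  fix V assume V: "V \<in> maya"
  show "\<forall>\<^sub>F F in finite_subsets_at_top UNIV. \<forall>U. ent (\<Sum>p\<in>F. sc (\<phi> p) (nb p m)) U V = ent (Dm \<phi> m) U V"
    unfolding eventually_finite_subsets_at_top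
    by (rule exI[of _ "nbsup m V"])
       (auto simp: finite_nbsup V ent_sum ent_sc ent_Dm_superset)
qed

lemma ent_Dm_infsum: "ent (Dm \<phi> m) U V = (\<Sum>\<^sub>\<infinity>p. \<phi> p * ent (nb p m) U V)"
proof (cases "V \<in> maya")
  case True
  have "(\<Sum>\<^sub>\<infinity>p. \<phi> p * ent (nb p m) U V) = (\<Sum>\<^sub>\<infinity>p\<in>nbsup m V. \<phi> p * ent (nb p m) U V)"
    by (rule infsum_cong_neutral) (use True ent_nb_nbsup in auto)
  then show ?thesis using True by (simp add: finite_nbsup ent_Dm)
next
  case False
  then have "ent (nb p m) U V = 0" for p using ent_maya by blast
  then show ?thesis using False by (simp add: Dm.rep_eq)
qed

lemma homog_Dm: "homog m (Dm \<phi> m)"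
proof (rule homogI)
  fix U V assume *: "ent (Dm \<phi> m) U V \<noteq> 0"
  then have "V \<in> maya" using ent_maya by blast
  with * obtain p where "ent (nb p m) U V \<noteq> 0" by (auto simp: ent_Dm dest!: sum_nonzeroD)
  then show "en U = en V - m" by (rule homogD[OF homog_nb])
qed

lemma ent_Dm_0: "V \<in> maya \<Longrightarrow> ent (Dm \<phi> 0) U V = (if U = V then wt \<phi> V else 0)"
proof -
  assume V: "V \<in> maya"
  have 1: "nbsup 0 V = {p \<in> V. p < 0} \<union> {p. p \<notin> V \<and> 0 \<le> p}" by (auto simp: nbsup_def)
  have "(\<Sum>p\<in>nbsup 0 V. \<phi> p * (of_bool (p \<in> V) - of_bool (0 \<le> p)))
      = (\<Sum>p\<in>{p \<in> V. p < 0}. \<phi> p * (of_bool (p \<in> V) - of_bool (0 \<le> p)))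
      + (\<Sum>p\<in>{p. p \<notin> V \<and> 0 \<le> p}. \<phi> p * (of_bool (p \<in> V) - of_bool (0 \<le> p)))"
    unfolding 1 by (rule sum.union_disjoint) (use V maya_finite_neg maya_finite_holes in auto)
  also have "\<dots> = wt \<phi> V" by (simp add: wt_def sum_negf)
  finally show ?thesis using V by (simp add: ent_Dm ent_nb_0)
qed

definition Jc :: "int \<Rightarrow> cfm" where "Jc k = Dm (\<lambda>_. 1) k"

lemma J_eq: "J k = ent (Jc k)"
proof (intro ext)
  fix U V
  have "J k U V = (\<Sum>\<^sub>\<infinity>n. ent (nb (- n - k) k) U V)"
    unfolding J_def ent_nb_normal by (simp add: add.commute)
  also have "\<dots> = (\<Sum>\<^sub>\<infinity>p. ent (nb p k) U V)"
    by (rule infsum_reindex_bij_witness[where i="\<lambda>p. - p - k" and j="\<lambda>n. - n - k"]) auto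
  finally show "J k U V = ent (Jc k) U V" by (simp add: Jc_def ent_Dm_infsum)
qed

definition w0 :: "int set \<Rightarrow> complex" where "w0 = wt (\<lambda>p. of_int (p ^ 2))"

lemma nb_comm: "nb p l * X - X * nb p l = cre (p + l) * ann (- p) * X - X * (cre (p + l) * ann (- p))"
  by (cases "l = 0 \<and> 0 \<le> p") (auto simp: nb_def left_diff_distrib right_diff_distrib)

lemma nb_cre: "nb p l * cre n - cre n * nb p l = (if p = n then cre (n + l) else 0)"
proof -
  have "cre (p + l) * ann (- p) * cre n = cre (p + l) * (if p = n then 1 else 0) - cre (p + l) * cre n * ann (- p)"
    by (simp add: mult.assoc ann_cre[of "- p" n] right_diff_distrib)
  also have "cre (p + l) * cre n * ann (- p) = - (cre n * (cre (p + l) * ann (- p)))"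
    by (simp add: cre_cre[of "p + l" n] mult.assoc)
  finally show ?thesis unfolding nb_comm by auto
qed

lemma nb_ann: "nb p l * ann n - ann n * nb p l = (if p = - n - l then - ann (n + l) else 0)"
proof -
  have "ann n * (cre (p + l) * ann (- p)) = (if p + l + n = 0 then 1 else 0) * ann (- p) - cre (p + l) * (ann n * ann (- p))"
    by (simp only: mult.assoc[symmetric] ann_cre[of n "p + l"] left_diff_distrib)
  moreover have "cre (p + l) * (ann n * ann (- p)) = - (cre (p + l) * ann (- p) * ann n)"
    by (simp add: mult.assoc ann_ann[of n "- p"])
  ultimately have "cre (p + l) * ann (- p) * ann n - ann n * (cre (p + l) * ann (- p)) = - ((if p + l + n = 0 then 1 else 0) * ann (- p))"
    by simp
  moreover have "p + l + n = 0 \<longleftrightarrow> p = - n - l" by auto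
  ultimately show ?thesis unfolding nb_comm by (cases "p = - n - l") (auto simp: add.commute)
qed

lemma eventually_mem_fsat: "\<forall>\<^sub>F F in finite_subsets_at_top UNIV. finite F \<and> x \<in> F"
  unfolding eventually_finite_subsets_at_top by (rule exI[of _ "{x}"]) auto

lemma conv_Jc: "conv (\<lambda>F. \<Sum>p\<in>F. nb p m) (Jc m) (finite_subsets_at_top UNIV)"
  using conv_Dm[of "\<lambda>_. 1" m] by (simp add: Jc_def sc_1)

lemma Jc_cre: "Jc l * cre n - cre n * Jc l = cre (n + l)"
proof (rule conv_unique)
  show "conv (\<lambda>F. (\<Sum>p\<in>F. nb p l) * cre n - cre n * (\<Sum>p\<in>F. nb p l)) (Jc l * cre n - cre n * Jc l)
      (finite_subsets_at_top UNIV)"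
    by (intro conv_diff conv_mult_left conv_mult_right conv_Jc)
  show "conv (\<lambda>F. (\<Sum>p\<in>F. nb p l) * cre n - cre n * (\<Sum>p\<in>F. nb p l)) (cre (n + l)) (finite_subsets_at_top UNIV)"
    by (rule conv_cong[OF conv_const], rule eventually_mono[OF eventually_mem_fsat[of n]])
       (simp add: sum_distrib_left sum_distrib_right nb_cre flip: sum_subtractf)
qed simp

lemma Jc_ann: "Jc l * ann n - ann n * Jc l = - ann (n + l)"
proof (rule conv_unique)
  show "conv (\<lambda>F. (\<Sum>p\<in>F. nb p l) * ann n - ann n * (\<Sum>p\<in>F. nb p l)) (Jc l * ann n - ann n * Jc l)
      (finite_subsets_at_top UNIV)"
    by (intro conv_diff conv_mult_left conv_mult_right conv_Jc)
  show "conv (\<lambda>F. (\<Sum>p\<in>F. nb p l) * ann n - ann n * (\<Sum>p\<in>F. nb p l)) (- ann (n + l)) (finite_subsets_at_top UNIV)"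
    by (rule conv_cong[OF conv_const], rule eventually_mono[OF eventually_mem_fsat[of "- n - l"]])
       (simp add: sum_distrib_left sum_distrib_right nb_ann flip: sum_subtractf)
qed simp

lemma Jc_nb:
  "Jc l * nb p m - nb p m * Jc l =
    nb p (m + l) - nb (p - l) (m + l) + sc (if m + l = 0 then of_bool (0 \<le> p) - of_bool (l \<le> p) else 0) 1"
proof -
  have "Jc l * nb p m - nb p m * Jc l
      = (Jc l * cre (p + m) - cre (p + m) * Jc l) * ann (- p) + cre (p + m) * (Jc l * ann (- p) - ann (- p) * Jc l)"
    by (simp add: nb_def algebra_simps)
  also have "\<dots> = cre (p + m + l) * ann (- p) - cre (p + m) * ann (- p + l)"
    by (simp add: Jc_cre Jc_ann)
  also have "\<dots> = nb p (m + l) - nb (p - l) (m + l) + sc (if m + l = 0 then of_bool (0 \<le> p) - of_bool (l \<le> p) else 0) 1"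
  proof -
    have s: "sc (- 1) 1 = - (1 :: cfm)" by (rule cfm_eqI) (simp add: ent_sc ent_uminus)
    have e: "p - l + (m + l) = p + m" "p + (m + l) = p + m + l" "- (p - l) = - p + l" by auto
    show ?thesis unfolding nb_def e by (auto simp: s sc_simps)
  qed
  finally show ?thesis .
qed

lemma Jc_Dm:
  assumes "0 \<le> l"
  shows "Jc l * Dm \<phi> m - Dm \<phi> m * Jc l = Dm \<phi> (m + l) - Dm (\<lambda>p. \<phi> (p + l)) (m + l)
    + sc (if m + l = 0 then (\<Sum>p\<in>{0..<l}. \<phi> p) else 0) 1"
proof (rule conv_unique)
  let ?F = "finite_subsets_at_top (UNIV :: int set)"
  let ?G = "\<lambda>F. Jc l * (\<Sum>p\<in>F. sc (\<phi> p) (nb p m)) - (\<Sum>p\<in>F. sc (\<phi> p) (nb p m)) * Jc l"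
  let ?c = "\<lambda>p. if m + l = 0 then of_bool (0 \<le> p) - of_bool (l \<le> p) else (0 :: complex)"
  show "conv ?G (Jc l * Dm \<phi> m - Dm \<phi> m * Jc l) ?F"
    by (intro conv_diff conv_mult_left conv_mult_right conv_Dm)
  have eq: "?G F = (\<Sum>p\<in>F. sc (\<phi> p) (nb p (m + l))) - (\<Sum>p\<in>F. sc (\<phi> p) (nb (p - l) (m + l)))
      + sc (\<Sum>p\<in>F. \<phi> p * ?c p) 1" for F
  proof -
    have "?G F = (\<Sum>p\<in>F. sc (\<phi> p) (Jc l * nb p m - nb p m * Jc l))"
      by (simp add: sum_distrib_left sum_distrib_right sc_simps sum_subtractf)
    also have "\<dots> = (\<Sum>p\<in>F. sc (\<phi> p) (nb p (m + l)) - sc (\<phi> p) (nb (p - l) (m + l)) + sc (\<phi> p * ?c p) 1)"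
      by (simp only: Jc_nb sc_simps)
    finally show ?thesis by (simp only: sum_subtractf sum.distrib sc_left_sum)
  qed
  have c1: "conv (\<lambda>F. \<Sum>p\<in>F. sc (\<phi> p) (nb (p - l) (m + l))) (Dm (\<lambda>p. \<phi> (p + l)) (m + l)) ?F"
    unfolding conv_def
  proof
    fix V assume V: "V \<in> maya"
    show "\<forall>\<^sub>F F in ?F. \<forall>U. ent (\<Sum>p\<in>F. sc (\<phi> p) (nb (p - l) (m + l))) U V = ent (Dm (\<lambda>p. \<phi> (p + l)) (m + l)) U V"
      unfolding eventually_finite_subsets_at_top
    proof (rule exI[of _ "(\<lambda>p. p + l) ` nbsup (m + l) V"], intro conjI allI impI)
      show "finite ((\<lambda>p. p + l) ` nbsup (m + l) V)" using finite_nbsup[OF V] by simp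
      fix F U assume F: "finite F \<and> (\<lambda>p. p + l) ` nbsup (m + l) V \<subseteq> F \<and> F \<subseteq> (UNIV :: int set)"
      have "ent (\<Sum>p\<in>F. sc (\<phi> p) (nb (p - l) (m + l))) U V
          = (\<Sum>p\<in>(\<lambda>p. p - l) ` F. \<phi> (p + l) * ent (nb p (m + l)) U V)"
        by (subst sum.reindex) (auto simp: ent_sum ent_sc)
      also have "\<dots> = ent (Dm (\<lambda>p. \<phi> (p + l)) (m + l)) U V"
        by (rule ent_Dm_superset[symmetric]) (use F V in \<open>auto simp: image_iff\<close>, force)
      finally show "ent (\<Sum>p\<in>F. sc (\<phi> p) (nb (p - l) (m + l))) U V = ent (Dm (\<lambda>p. \<phi> (p + l)) (m + l)) U V" .
    qed simp
  qed
  have c2: "conv (\<lambda>F. sc (\<Sum>p\<in>F. \<phi> p * ?c p) 1) (sc (if m + l = 0 then (\<Sum>p\<in>{0..<l}. \<phi> p) else 0) 1) ?F"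
  proof (rule conv_cong[OF conv_const])
    show "\<forall>\<^sub>F F in ?F. sc (if m + l = 0 then (\<Sum>p\<in>{0..<l}. \<phi> p) else 0) 1 = sc (\<Sum>p\<in>F. \<phi> p * ?c p) 1"
      unfolding eventually_finite_subsets_at_top
    proof (rule exI[of _ "{0..<l}"], intro conjI allI impI)
      fix F assume F: "finite F \<and> {0..<l} \<subseteq> F \<and> F \<subseteq> (UNIV :: int set)"
      have "(\<Sum>p\<in>F. \<phi> p * ?c p) = (\<Sum>p\<in>{0..<l}. \<phi> p * ?c p)"
        by (rule sum.mono_neutral_right) (use F assms in auto)
      also have "\<dots> = (if m + l = 0 then (\<Sum>p\<in>{0..<l}. \<phi> p) else 0)" by auto
      finally show "sc (if m + l = 0 then (\<Sum>p\<in>{0..<l}. \<phi> p) else 0) 1 = sc (\<Sum>p\<in>F. \<phi> p * ?c p) 1" by simp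
    qed auto
  qed
  show "conv ?G (Dm \<phi> (m + l) - Dm (\<lambda>p. \<phi> (p + l)) (m + l)
    + sc (if m + l = 0 then (\<Sum>p\<in>{0..<l}. \<phi> p) else 0) 1) ?F"
    unfolding eq by (intro conv_add conv_diff conv_Dm c1 c2)
qed simp

lemma Dm_sc: "Dm (\<lambda>p. c * \<phi> p) m = sc c (Dm \<phi> m)"
  by (rule cfm_eqI) (simp add: ent_Dm ent_sc sum_distrib_left mult.assoc)

lemma Jc_Jc: assumes "1 \<le> l" shows "Jc l * Jc m - Jc m * Jc l = sc (if m + l = 0 then of_int l else 0) 1"
  using Jc_Dm[of l "\<lambda>_. 1" m] assms by (simp add: Jc_def)

text \<open>The additive constant of \<open>At 0\<close> is the geometric series over the occupied modes of the
  vacuum, continued analytically; it absorbs the central term of the commutator.\<close>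

definition At :: "complex \<Rightarrow> int \<Rightarrow> int \<Rightarrow> cfm"
  where "At q k m = Dm (\<lambda>p. q powi (- k * p)) m + sc (if m = 0 then 1 / (1 - q powi (- k)) else 0) 1"

lemma Jc_At:
  assumes "1 \<le> l" "q \<noteq> 0" "q powi k \<noteq> 1"
  shows "Jc l * At q k m - At q k m * Jc l = sc (1 - q powi (- k * l)) (At q k (m + l))"
proof -
  let ?\<phi> = "\<lambda>p. q powi (- k * p)"
  have shift: "(\<lambda>p. ?\<phi> (p + l)) = (\<lambda>p. q powi (- k * l) * ?\<phi> p)"
    using assms(2) by (intro ext) (simp add: power_int_add[symmetric] algebra_simps)
  have geo: "(\<Sum>p\<in>{0..<l}. ?\<phi> p) = (1 - q powi (- k * l)) * (1 / (1 - q powi (- k)))"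
  proof -
    have ne: "q powi (- k) \<noteq> 1" using assms(3) by (simp add: power_int_minus)
    obtain n where n: "l = int n" using assms(1) zero_le_imp_eq_int[of l] by auto
    have "(\<Sum>p\<in>{0..<l}. ?\<phi> p) = (\<Sum>i<n. (q powi (- k)) ^ i)"
      by (rule sum.reindex_bij_witness[where i=int and j=nat])
         (auto simp: n power_int_mult[symmetric] simp flip: power_int_of_nat)
    also have "\<dots> = (1 - (q powi (- k)) ^ n) / (1 - q powi (- k))"
      using ne by (simp add: sum_gp_strict)
    finally show ?thesis using power_int_power'[of q "- k" n] by (simp add: n)
  qed
  have "Jc l * At q k m - At q k m * Jc l = Jc l * Dm ?\<phi> m - Dm ?\<phi> m * Jc l"
    unfolding At_def by (simp add: distrib_left distrib_right sc_simps)
  also have "\<dots> = Dm ?\<phi> (m + l) - sc (q powi (- k * l)) (Dm ?\<phi> (m + l))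
      + sc (if m + l = 0 then (1 - q powi (- k * l)) * (1 / (1 - q powi (- k))) else 0) 1"
    using Jc_Dm[of l ?\<phi> m] assms(1) unfolding shift geo Dm_sc by simp
  also have "\<dots> = sc (1 - q powi (- k * l)) (At q k (m + l))"
    by (cases "m + l = 0")
       (simp_all only: At_def sc_add sc_sc sc_left_diff[of 1 _ "Dm _ _"] sc_1 if_True if_False mult_zero_right sc_0 add_0_right refl)
  finally show ?thesis .
qed

lemma homog_At: "homog m (At q k m)"
  unfolding At_def by (auto intro!: homog_add homog_Dm homog_sc homog_one simp: sc_0)

lemma homog_Jc: "homog m (Jc m)" unfolding Jc_def by (rule homog_Dm)

section \<open>Exponentials of the positive modes\<close>

lemma col_fin_lower:
  assumes "\<And>U V. A U V \<noteq> 0 \<Longrightarrow> U \<in> maya \<and> V \<in> maya \<and> en U \<le> en V"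
  shows "col_fin A"
  unfolding col_fin_def
proof (intro conjI allI impI)
  fix V show "finite {U. A U V \<noteq> 0}"
    by (rule finite_subset[OF _ finite_en[of "en V"]]) (use assms in auto)
qed (use assms in auto)

lift_definition JJ :: "(nat \<Rightarrow> complex) \<Rightarrow> cfm"
  is "\<lambda>c U V. if en U < en V then c (nat (en V - en U)) * ent (Jc (en V - en U)) U V else 0"
  by (rule col_fin_lower) (auto dest: ent_maya split: if_splits)

lemma JJ_lower: "ent (JJ c) U V \<noteq> 0 \<Longrightarrow> en U < en V"
  by (auto simp: JJ.rep_eq split: if_splits)

lemma ent_Jc_0: "en V - en U \<noteq> k \<Longrightarrow> ent (Jc k) U V = 0"
  using homogD[OF homog_Jc, of k U V] by auto

lemma ent_JJ_sum:
  assumes "nat (en V - en U) \<le> L"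
  shows "ent (\<Sum>l=1..L. sc (c l) (Jc (int l))) U V = ent (JJ c) U V"
proof (cases "en U < en V")
  case True
  have "ent (\<Sum>l=1..L. sc (c l) (Jc (int l))) U V
      = (\<Sum>l\<in>{nat (en V - en U)}. c l * ent (Jc (int l)) U V)"
    unfolding ent_sum ent_sc
    by (rule sum.mono_neutral_right) (use True assms in \<open>auto intro!: ent_Jc_0\<close>)
  then show ?thesis using True by (simp add: JJ.rep_eq)
next
  case False
  then show ?thesis by (auto simp: JJ.rep_eq ent_sum ent_sc intro!: sum.neutral ent_Jc_0)
qed

lemma conv_JJ: "conv (\<lambda>L. \<Sum>l=1..L. sc (c l) (Jc (int l))) (JJ c) sequentially"
  unfolding conv_def
proof
  fix V assume "V \<in> maya"
  show "\<forall>\<^sub>F L in sequentially. \<forall>U. ent (\<Sum>l=1..L. sc (c l) (Jc (int l))) U V = ent (JJ c) U V"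
    using eventually_ge_at_top[of "nat (en V)"]
  proof eventually_elim
    fix L assume L: "nat (en V) \<le> L"
    have "nat (en V - en U) \<le> L" for U using L en_nonneg[of U] by simp
    then show "\<forall>U. ent (\<Sum>l=1..L. sc (c l) (Jc (int l))) U V = ent (JJ c) U V"
      using ent_JJ_sum by blast
  qed
qed

lemma JJ_infsum: "(\<Sum>\<^sub>\<infinity>k\<in>{1..}. c k * J (int k) U V) = ent (JJ c) U V"
proof -
  have "(\<Sum>\<^sub>\<infinity>k\<in>{1..}. c k * J (int k) U V) = (\<Sum>\<^sub>\<infinity>k\<in>{1..nat (en V - en U)}. c k * J (int k) U V)"
    by (rule infsum_cong_neutral) (auto simp: J_eq intro!: ent_Jc_0)
  also have "\<dots> = ent (\<Sum>l=1..nat (en V - en U). sc (c l) (Jc (int l))) U V"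
    by (simp add: ent_sum ent_sc J_eq)
  finally show ?thesis using ent_JJ_sum[OF order.refl] by metis
qed

lemma deg_JJ: "deg (JJ c) = JJ (\<lambda>l. of_nat l * c l)"
  by (rule cfm_eqI) (auto simp: ent_deg JJ.rep_eq)

lemma JJ_add: "JJ c + JJ d = JJ (\<lambda>l. c l + d l)"
  by (rule cfm_eqI) (auto simp: ent_plus JJ.rep_eq algebra_simps)

lemma Jc_JJ: assumes "1 \<le> l" shows "Jc (int l) * JJ c = JJ c * Jc (int l)"
proof (rule conv_unique)
  show "conv (\<lambda>L. Jc (int l) * (\<Sum>l=1..L. sc (c l) (Jc (int l)))) (Jc (int l) * JJ c) sequentially"
    by (intro conv_mult_left conv_JJ)
  have *: "Jc (int l) * Jc (int m) = Jc (int m) * Jc (int l)" for m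
    using Jc_Jc[of "int l" "int m"] assms by (auto simp: sc_0)
  show "conv (\<lambda>L. Jc (int l) * (\<Sum>l=1..L. sc (c l) (Jc (int l)))) (JJ c * Jc (int l)) sequentially"
    using conv_mult_right[OF conv_JJ, of c "Jc (int l)"]
    by (simp add: sum_distrib_left sum_distrib_right sc_simps *)
qed simp

lemma JJ_JJ: "JJ d * JJ c = JJ c * JJ d"
proof (rule conv_unique)
  show "conv (\<lambda>L. (\<Sum>l=1..L. sc (d l) (Jc (int l))) * JJ c) (JJ d * JJ c) sequentially"
    by (intro conv_mult_right conv_JJ)
  have "(\<Sum>l=1..L. sc (d l) (Jc (int l))) * JJ c = JJ c * (\<Sum>l=1..L. sc (d l) (Jc (int l)))" for L
    by (simp add: sum_distrib_left sum_distrib_right sc_simps Jc_JJ)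
  then show "conv (\<lambda>L. (\<Sum>l=1..L. sc (d l) (Jc (int l))) * JJ c) (JJ c * JJ d) sequentially"
    using conv_mult_left[OF conv_JJ, of "JJ c" d] by simp
qed simp

lemma JJ_pow_lower: "ent (JJ c ^ n) U V \<noteq> 0 \<Longrightarrow> en U + int n \<le> en V"
proof (induction n arbitrary: U)
  case 0
  then show ?case by (auto simp: ent_one op_id_def split: if_splits)
next
  case (Suc n)
  then obtain W where "ent (JJ c) U W * ent (JJ c ^ n) W V \<noteq> 0"
    unfolding power_Suc ent_mult0 by (blast dest: sum_nonzeroD)
  then have "en U < en W" "en W + int n \<le> en V" using JJ_lower[of c U W] Suc.IH[of W] by auto
  then show ?case by simp
qed

lift_definition E :: "(nat \<Rightarrow> complex) \<Rightarrow> cfm"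
  is "\<lambda>c U V. \<Sum>n\<le>nat (en V). ent (JJ c ^ n) U V / fact n"
proof (rule col_fin_lower)
  fix c U V assume "(\<Sum>n\<le>nat (en V). ent (JJ c ^ n) U V / fact n) \<noteq> 0"
  then obtain n where "ent (JJ c ^ n) U V \<noteq> 0" by (auto dest: sum_nonzeroD)
  then show "U \<in> maya \<and> V \<in> maya \<and> en U \<le> en V" using ent_maya JJ_pow_lower by fastforce
qed

lemma ent_E_sum:
  assumes "nat (en V) \<le> N"
  shows "ent (E c) U V = (\<Sum>n\<le>N. ent (JJ c ^ n) U V / fact n)"
  unfolding E.rep_eq
proof (rule sum.mono_neutral_left)
  show "\<forall>i\<in>{..N} - {..nat (en V)}. ent (JJ c ^ i) U V / fact i = 0"
  proof
    fix i assume "i \<in> {..N} - {..nat (en V)}"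
    then have "\<not> en U + int i \<le> en V" using en_nonneg[of U] by auto
    then show "ent (JJ c ^ i) U V / fact i = 0" using JJ_pow_lower by fastforce
  qed
qed (use assms in auto)

lemma op_power_ent: "op_power (ent A) n = ent (A ^ n)"
  by (induction n) (auto simp: one_cfm.rep_eq times_cfm.rep_eq)

lemma op_exp_JJ: "op_exp (ent (JJ c)) = ent (E c)"
proof (intro ext)
  fix U V
  have "op_exp (ent (JJ c)) U V = (\<Sum>\<^sub>\<infinity>n\<in>{..nat (en V)}. ent (JJ c ^ n) U V /\<^sub>R fact n)"
    unfolding op_exp_def op_power_ent
  proof (rule infsum_cong_neutral)
    fix n assume "n \<in> UNIV - {..nat (en V)}"
    then have "\<not> en U + int n \<le> en V" using en_nonneg[of U] by auto
    then show "ent (JJ c ^ n) U V /\<^sub>R fact n = 0" using JJ_pow_lower by fastforce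
  qed auto
  then show "op_exp (ent (JJ c)) U V = ent (E c) U V"
    by (simp add: E.rep_eq scaleR_conv_of_real divide_inverse mult.commute)
qed

lemma conv_E: "conv (\<lambda>N. \<Sum>n\<le>N. sc (1 / fact n) (JJ c ^ n)) (E c) sequentially"
  unfolding conv_def
proof
  fix V assume "V \<in> maya"
  show "\<forall>\<^sub>F N in sequentially. \<forall>U. ent (\<Sum>n\<le>N. sc (1 / fact n) (JJ c ^ n)) U V = ent (E c) U V"
    using eventually_ge_at_top[of "nat (en V)"]
    by eventually_elim (simp add: ent_sum ent_sc ent_E_sum)
qed

lemma conv_Suc: "conv G A sequentially \<Longrightarrow> conv (\<lambda>n. G (Suc n)) A sequentially"
  unfolding conv_def
proof
  fix V assume *: "\<forall>V\<in>maya. \<forall>\<^sub>F n in sequentially. \<forall>U. ent (G n) U V = ent A U V" and V: "V \<in> maya"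
  show "\<forall>\<^sub>F n in sequentially. \<forall>U. ent (G (Suc n)) U V = ent A U V"
    by (subst eventually_sequentially_Suc[of "\<lambda>n. \<forall>U. ent (G n) U V = ent A U V"]) (use * V in blast)
qed

lemma deg_pow:
  assumes "A * deg A = deg A * A"
  shows "deg (A ^ Suc n) = sc (of_nat (Suc n)) (deg A * A ^ n)"
proof (induction n)
  case 0
  then show ?case by (simp add: sc_simps)
next
  case (Suc n)
  have c: "A * (deg A * A ^ n) = deg A * A ^ Suc n"
    by (simp add: assms mult.assoc[symmetric])
  have "deg (A ^ Suc (Suc n)) = deg A * A ^ Suc n + A * deg (A ^ Suc n)"
    using deg_mult[of A "A ^ Suc n"] by simp
  also have "\<dots> = sc 1 (deg A * A ^ Suc n) + sc (of_nat (Suc n)) (deg A * A ^ Suc n)"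
    unfolding Suc.IH sc_mult_right c by (simp add: sc_1)
  finally show ?case by (simp add: sc_left_add[symmetric])
qed

lemma deg_E: "deg (E c) = JJ (\<lambda>l. of_nat l * c l) * E c"
proof (rule conv_unique)
  let ?S = "\<lambda>N. \<Sum>n\<le>N. sc (1 / fact n) (JJ c ^ n)"
  show "conv (\<lambda>N. deg (?S (Suc N))) (deg (E c)) sequentially"
    by (intro conv_deg conv_Suc[OF conv_E])
  have "deg (?S (Suc N)) = JJ (\<lambda>l. of_nat l * c l) * ?S N" for N
  proof -
    have "deg (?S (Suc N)) = (\<Sum>n\<le>N. deg (sc (1 / fact (Suc n)) (JJ c ^ Suc n)))"
      by (subst sum.atMost_Suc_shift) (simp add: deg_add deg_sum deg_sc deg_one sc_simps del: power_Suc)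
    also have "\<dots> = (\<Sum>n\<le>N. sc (1 / fact n) (deg (JJ c) * JJ c ^ n))"
      by (rule sum.cong[OF refl], subst deg_sc, subst deg_pow)
         (simp_all add: deg_JJ JJ_JJ sc_simps del: of_nat_Suc)
    finally show ?thesis by (simp add: deg_JJ sum_distrib_left sc_simps)
  qed
  then show "conv (\<lambda>N. deg (?S (Suc N))) (JJ (\<lambda>l. of_nat l * c l) * E c) sequentially"
    by (simp add: conv_mult_left conv_E)
qed simp

lemma E_commute:
  assumes "B * JJ c = JJ c * B" shows "B * E c = E c * B"
proof (rule conv_unique)
  have p: "B * JJ c ^ n = JJ c ^ n * B" for n
  proof (induction n)
    case (Suc n)
    have "B * JJ c ^ Suc n = JJ c * (B * JJ c ^ n)" by (simp add: mult.assoc[symmetric] assms)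
    then show ?case by (simp add: Suc.IH mult.assoc)
  qed simp
  show "conv (\<lambda>N. B * (\<Sum>n\<le>N. sc (1 / fact n) (JJ c ^ n))) (B * E c) sequentially"
    by (intro conv_mult_left conv_E)
  have "B * (\<Sum>n\<le>N. sc (1 / fact n) (JJ c ^ n)) = (\<Sum>n\<le>N. sc (1 / fact n) (JJ c ^ n)) * B" for N
    by (simp add: sum_distrib_left sum_distrib_right sc_simps p)
  then show "conv (\<lambda>N. B * (\<Sum>n\<le>N. sc (1 / fact n) (JJ c ^ n))) (E c * B) sequentially"
    by (simp add: conv_mult_right conv_E)
qed simp

lemma E_lower: "ent (E c) U V \<noteq> 0 \<Longrightarrow> U \<in> maya \<and> V \<in> maya \<and> en U \<le> en V"
proof -
  assume "ent (E c) U V \<noteq> 0"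
  moreover then obtain n where "ent (JJ c ^ n) U V \<noteq> 0" by (auto simp: E.rep_eq dest: sum_nonzeroD)
  ultimately show ?thesis using ent_maya JJ_pow_lower by fastforce
qed

lemma E_diag: assumes "en V \<le> en U" shows "ent (E c) U V = op_id U V"
proof -
  have "ent (E c) U V = (\<Sum>n\<in>{0}. ent (JJ c ^ n) U V / fact n)"
    unfolding E.rep_eq
  proof (rule sum.mono_neutral_right)
    show "\<forall>i\<in>{..nat (en V)} - {0}. ent (JJ c ^ i) U V / fact i = 0"
      using JJ_pow_lower[of c _ U V] assms by fastforce
  qed auto
  then show ?thesis by (simp add: ent_one)
qed

lemma ode_unique:
  assumes D: "\<And>U W. ent D U W \<noteq> 0 \<Longrightarrow> en U < en W"
    and X: "deg X = D * X + sc (of_int m) X"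
    and z: "\<And>U V. en V - en U \<le> m \<Longrightarrow> ent X U V = 0"
  shows "X = 0"
proof -
  have "ent X U V = 0" for U V
  proof (induction "nat (en V - en U - m)" arbitrary: U rule: less_induct)
    case less
    show ?case
    proof (cases "en V - en U \<le> m")
      case False
      have "ent D U W * ent X W V = 0" for W
      proof (cases "ent D U W = 0")
        case nz: False
        then have "en U < en W" by (rule D)
        then show ?thesis using less[of W] False by auto
      qed simp
      then have "ent (D * X) U V = 0" by (simp only: ent_mult0 sum.neutral_const)
      moreover have "of_int (en V - en U) * ent X U V = ent (D * X) U V + of_int m * ent X U V"
        using X by (metis ent_deg ent_plus ent_sc)
      ultimately have "of_int (en V - en U - m) * ent X U V = 0" by (simp add: algebra_simps)
      then show ?thesis using False by (simp add: of_int_eq_0_iff del: of_int_diff)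
    qed (rule z)
  qed
  then show ?thesis by (intro cfm_eqI) (simp add: ent_zero)
qed

lemma ent_E_mult:
  assumes B: "homog k B" and le: "en V - en U \<le> k"
  shows "ent (E c * B) U V = ent B U V"
proof -
  have "ent (E c * B) U V = (\<Sum>W\<in>{W. ent B W V \<noteq> 0}. op_id U W * ent B W V)"
    unfolding ent_mult0 using homogD[OF B, of _ V] le by (intro sum.cong) (auto simp: E_diag)
  also have "\<dots> = ent (1 * B) U V" unfolding ent_mult0 ent_one ..
  finally show ?thesis by simp
qed

lemma ent_mult_E:
  assumes B: "homog k B" and le: "en V - en U \<le> k"
  shows "ent (B * E c) U V = ent B U V"
proof -
  let ?S = "{W \<in> maya. en W \<le> en V}"
  have "ent (B * E c) U V = (\<Sum>W\<in>?S. ent B U W * ent (E c) W V)"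
    by (rule ent_mult) (use finite_en E_lower in auto)
  also have "\<dots> = (\<Sum>W\<in>?S. ent B U W * op_id W V)"
  proof (rule sum.cong[OF refl])
    fix W
    show "ent B U W * ent (E c) W V = ent B U W * op_id W V"
      using homogD[OF B, of U W] le E_diag[of V W c] by (cases "ent B U W = 0") auto
  qed
  also have "\<dots> = ent (B * 1) U V"
    unfolding ent_one[symmetric] by (rule ent_mult[symmetric]) (use finite_en in \<open>auto simp: ent_one op_id_def\<close>)
  finally show ?thesis by simp
qed

lemma homog_ent_0: "homog k B \<Longrightarrow> en V - en U \<noteq> k \<Longrightarrow> ent B U V = 0"
  using homogD[of k B U V] by auto

lemma E_add: "E (\<lambda>l. c l + d l) = E c * E d"
proof -
  let ?D = "JJ (\<lambda>l. of_nat l * (c l + d l))"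
  have "E c * JJ (\<lambda>l. of_nat l * d l) = JJ (\<lambda>l. of_nat l * d l) * E c"
    by (rule E_commute[symmetric]) (rule JJ_JJ)
  then have "deg (E c * E d) = (JJ (\<lambda>l. of_nat l * c l) + JJ (\<lambda>l. of_nat l * d l)) * (E c * E d)"
    by (simp add: deg_mult deg_E distrib_right mult.assoc[symmetric])
  then have 1: "deg (E c * E d) = ?D * (E c * E d)" by (simp add: JJ_add algebra_simps)
  have "E (\<lambda>l. c l + d l) - E c * E d = 0"
  proof (rule ode_unique[of ?D _ 0])
    show "deg (E (\<lambda>l. c l + d l) - E c * E d) = ?D * (E (\<lambda>l. c l + d l) - E c * E d)
        + sc (of_int 0) (E (\<lambda>l. c l + d l) - E c * E d)"
      by (simp add: deg_diff deg_E[of "\<lambda>l. c l + d l"] 1 right_diff_distrib sc_0)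
    fix U V assume le: "en V - en U \<le> 0"
    have "ent (E c * E d) U V = op_id U V"
    proof -
      let ?S = "{W \<in> maya. en W \<le> en V}"
      have "ent (E c * E d) U V = (\<Sum>W\<in>?S. ent (E c) U W * ent (E d) W V)"
        by (rule ent_mult) (use finite_en E_lower in auto)
      also have "\<dots> = (\<Sum>W\<in>?S. op_id U W * ent (E d) W V)"
        using le by (intro sum.cong) (auto simp: E_diag)
      also have "\<dots> = ent (1 * E d) U V"
        unfolding ent_one[symmetric] by (rule ent_mult[symmetric]) (use finite_en E_lower in auto)
      finally show ?thesis using le by (simp add: E_diag)
    qed
    then show "ent (E (\<lambda>l. c l + d l) - E c * E d) U V = 0"
      using le by (simp add: ent_minus E_diag)
  qed (use JJ_lower in auto)
  then show ?thesis by simp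
qed

lemma E_0: "E (\<lambda>_. 0) = 1"
proof -
  have z: "JJ (\<lambda>_. 0) = 0" by (rule cfm_eqI) (simp add: JJ.rep_eq ent_zero)
  show ?thesis
  proof (rule cfm_eqI)
    fix U V
    have "ent (E (\<lambda>_. 0)) U V = (\<Sum>n\<in>{0}. ent (JJ (\<lambda>_. 0) ^ n) U V / fact n)"
      unfolding E.rep_eq by (rule sum.mono_neutral_right) (auto simp: z ent_zero zero_power)
    then show "ent (E (\<lambda>_. 0)) U V = ent 1 U V" by simp
  qed
qed

text \<open>If the modes act on a family \<open>B\<close> by shifts, then conjugation by the exponential acts by
  the power series \<open>f = exp (\<Sum>l. c l * \<theta> l * w ^ l)\<close> in the shift.\<close>

lemma E_shift:
  assumes comm: "\<And>l m. 1 \<le> l \<Longrightarrow> Jc (int l) * B m - B m * Jc (int l) = sc (\<theta> l) (B (m + int l))"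
    and hom: "\<And>m. homog m (B m)"
    and f0: "f 0 = 1" and fN: "\<And>n. n > N \<Longrightarrow> f n = 0"
    and f: "\<And>n. 1 \<le> n \<Longrightarrow> of_nat n * f n = (\<Sum>l=1..n. of_nat l * c l * \<theta> l * f (n - l))"
  shows "E c * B m = (\<Sum>n\<le>N. sc (f n) (B (m + int n))) * E c"
proof -
  define F where "F = (\<Sum>n\<le>N. sc (f n) (B (m + int n)))"
  define D where "D = JJ (\<lambda>l. of_nat l * c l)"
  have degF: "deg F - sc (of_int m) F = (\<Sum>n\<le>N. sc (of_nat n * f n) (B (m + int n)))"
  proof -
    have "deg (B (m + int n)) = sc (of_int m + of_nat n) (B (m + int n))" for n
      using hom[of "m + int n"] by (simp add: homog_def)
    then show ?thesis
      by (simp add: F_def deg_sum deg_sc sc_sum sc_simps sc_left_add algebra_simps flip: sum_subtractf)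
  qed
  have DF: "D * F - F * D = deg F - sc (of_int m) F"
  proof (rule conv_unique)
    let ?S = "\<lambda>L. \<Sum>l=1..L. sc (of_nat l * c l) (Jc (int l))"
    show "conv (\<lambda>L. ?S L * F - F * ?S L) (D * F - F * D) sequentially"
      unfolding D_def by (intro conv_diff conv_mult_left conv_mult_right conv_JJ)
    have eq: "?S L * F - F * ?S L = (\<Sum>l=1..L. \<Sum>n\<le>N. sc (of_nat l * c l * \<theta> l * f n) (B (m + int n + int l)))" for L
    proof -
      have "?S L * F - F * ?S L = (\<Sum>l=1..L. sc (of_nat l * c l) (Jc (int l) * F - F * Jc (int l)))"
        by (simp add: sum_distrib_left sum_distrib_right sc_simps sum_subtractf)
      also have "\<dots> = (\<Sum>l=1..L. sc (of_nat l * c l) (\<Sum>n\<le>N. sc (f n) (sc (\<theta> l) (B (m + int n + int l)))))"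
      proof (rule sum.cong[OF refl])
        fix l assume l: "l \<in> {1..L}"
        have "Jc (int l) * F - F * Jc (int l)
            = (\<Sum>n\<le>N. sc (f n) (Jc (int l) * B (m + int n) - B (m + int n) * Jc (int l)))"
          by (simp add: F_def sum_distrib_left sum_distrib_right sc_simps sum_subtractf)
        also have "\<dots> = (\<Sum>n\<le>N. sc (f n) (sc (\<theta> l) (B (m + int n + int l))))"
          using comm l by simp
        finally show "sc (of_nat l * c l) (Jc (int l) * F - F * Jc (int l))
          = sc (of_nat l * c l) (\<Sum>n\<le>N. sc (f n) (sc (\<theta> l) (B (m + int n + int l))))" by simp
      qed
      finally show ?thesis by (simp add: sc_sum sc_simps mult_ac)
    qed
    show "conv (\<lambda>L. ?S L * F - F * ?S L) (deg F - sc (of_int m) F) sequentially"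
      unfolding conv_def eq degF
    proof
      fix V assume "V \<in> maya"
      show "\<forall>\<^sub>F L in sequentially. \<forall>U. ent (\<Sum>l=1..L. \<Sum>n\<le>N. sc (of_nat l * c l * \<theta> l * f n) (B (m + int n + int l))) U V
          = ent (\<Sum>n\<le>N. sc (of_nat n * f n) (B (m + int n))) U V"
        using eventually_ge_at_top[of "nat (en V - m)"]
      proof eventually_elim
        fix L assume L: "nat (en V - m) \<le> L"
        show "\<forall>U. ent (\<Sum>l=1..L. \<Sum>n\<le>N. sc (of_nat l * c l * \<theta> l * f n) (B (m + int n + int l))) U V
          = ent (\<Sum>n\<le>N. sc (of_nat n * f n) (B (m + int n))) U V"
        proof
          fix U
          define i where "i = en V - en U - m"
          define b where "b = ent (B (m + i)) U V"
          have ent: "ent (B (m + k)) U V = (if k = i then b else 0)" for k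
            using homog_ent_0[OF hom, of V U "m + k"] by (auto simp: b_def i_def)
          have iL: "i \<le> int L" using L en_nonneg[of U] by (auto simp: i_def)
          have "ent (\<Sum>l=1..L. \<Sum>n\<le>N. sc (of_nat l * c l * \<theta> l * f n) (B (m + int n + int l))) U V
              = (\<Sum>l=1..L. \<Sum>n\<le>N. of_nat l * c l * \<theta> l * f n * (if int n + int l = i then b else 0))"
            by (simp add: ent_sum ent_sc add.assoc ent)
          also have "\<dots> = (\<Sum>n\<le>N. of_nat n * f n * (if int n = i then b else 0))"
          proof (cases "i \<ge> 0")
            case False
            then show ?thesis by (auto intro!: sum.neutral)
          next
            case True
            then obtain j where j: "i = int j" using zero_le_imp_eq_int by blast
            have jL: "j \<le> L" using iL j by simp
            have "(\<Sum>n\<le>N. of_nat l * c l * \<theta> l * f n * (if int n + int l = i then b else 0))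
                = (if l \<le> j then of_nat l * c l * \<theta> l * f (j - l) * b else 0)" for l
            proof -
              have "(\<Sum>n\<le>N. of_nat l * c l * \<theta> l * f n * (if int n + int l = i then b else 0))
                 = (\<Sum>n\<le>N. if n = j - l \<and> l \<le> j then of_nat l * c l * \<theta> l * f (j - l) * b else 0)"
                by (rule sum.cong) (auto simp: j)
              then show ?thesis using fN[of "j - l"] by (cases "l \<le> j") (auto simp: not_le)
            qed
            then have "(\<Sum>l=1..L. \<Sum>n\<le>N. of_nat l * c l * \<theta> l * f n * (if int n + int l = i then b else 0))
                = (\<Sum>l=1..L. if l \<le> j then of_nat l * c l * \<theta> l * f (j - l) * b else 0)" by simp
            also have "\<dots> = (\<Sum>l=1..j. of_nat l * c l * \<theta> l * f (j - l) * b)"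
              by (rule sum.mono_neutral_cong_right) (use jL in auto)
            also have "\<dots> = of_nat j * f j * b"
              using f[of j] by (cases "1 \<le> j") (auto simp: sum_distrib_right)
            also have "\<dots> = (\<Sum>n\<le>N. if n = j then of_nat j * f j * b else 0)"
              using fN[of j] by (auto simp: not_le)
            also have "\<dots> = (\<Sum>n\<le>N. of_nat n * f n * (if int n = i then b else 0))"
              by (rule sum.cong) (auto simp: j)
            finally show ?thesis .
          qed
          also have "\<dots> = ent (\<Sum>n\<le>N. sc (of_nat n * f n) (B (m + int n))) U V"
            by (simp add: ent_sum ent_sc ent)
          finally show "ent (\<Sum>l=1..L. \<Sum>n\<le>N. sc (of_nat l * c l * \<theta> l * f n) (B (m + int n + int l))) U V
            = ent (\<Sum>n\<le>N. sc (of_nat n * f n) (B (m + int n))) U V" .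
        qed
      qed
    qed
  qed simp
  have "E c * B m - F * E c = 0"
  proof (rule ode_unique[of D _ m])
    show "ent D U W \<noteq> 0 \<Longrightarrow> en U < en W" for U W unfolding D_def by (rule JJ_lower)
    have dB: "deg (B m) = sc (of_int m) (B m)" using hom by (simp add: homog_def)
    have dF: "deg F = D * F - F * D + sc (of_int m) F" using DF by (simp add: algebra_simps)
    show "deg (E c * B m - F * E c) = D * (E c * B m - F * E c) + sc (of_int m) (E c * B m - F * E c)"
      unfolding deg_diff deg_mult deg_E D_def[symmetric] dB dF
      by (simp add: algebra_simps sc_simps)
  next
    fix U V assume le: "en V - en U \<le> m"
    have "ent (B (m + int n) * E c) U V = (if n = 0 then ent (B m) U V else 0)" for n
      using ent_mult_E[OF hom, of V U "m + int n" c] homog_ent_0[OF hom, of V U "m + int n"] le by auto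
    then have "ent (F * E c) U V = (\<Sum>n\<le>N. f n * (if n = 0 then ent (B m) U V else 0))"
      by (simp add: F_def sum_distrib_right ent_sum sc_simps ent_sc)
    also have "\<dots> = ent (B m) U V" by (simp add: f0 if_distrib[where f="\<lambda>x. _ * x"] cong: if_cong)
    finally show "ent (E c * B m - F * E c) U V = 0"
      using ent_E_mult[OF hom le] by (simp add: ent_minus)
  qed
  then show ?thesis by (simp add: F_def)
qed

lemma E_Jc_neg:
  assumes "1 \<le> l"
  shows "E c * Jc (- int l) = (Jc (- int l) + sc (of_nat l * c l) 1) * E c"
proof -
  define D where "D = JJ (\<lambda>l. of_nat l * c l)"
  define k where "k = of_nat l * c l"
  have DJ: "D * Jc (- int l) - Jc (- int l) * D = sc (of_nat l * k) 1"
  proof (rule conv_unique)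
    let ?S = "\<lambda>L. \<Sum>l=1..L. sc (of_nat l * c l) (Jc (int l))"
    show "conv (\<lambda>L. ?S L * Jc (- int l) - Jc (- int l) * ?S L) (D * Jc (- int l) - Jc (- int l) * D) sequentially"
      unfolding D_def by (intro conv_diff conv_mult_left conv_mult_right conv_JJ)
    show "conv (\<lambda>L. ?S L * Jc (- int l) - Jc (- int l) * ?S L) (sc (of_nat l * k) 1) sequentially"
    proof (rule conv_cong[OF conv_const])
      show "\<forall>\<^sub>F L in sequentially. sc (of_nat l * k) 1 = ?S L * Jc (- int l) - Jc (- int l) * ?S L"
        using eventually_ge_at_top[of l]
      proof eventually_elim
        fix L assume L: "l \<le> L"
        have "?S L * Jc (- int l) - Jc (- int l) * ?S L
          = (\<Sum>i=1..L. sc (of_nat i * c i) (Jc (int i) * Jc (- int l) - Jc (- int l) * Jc (int i)))"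
          by (simp add: sum_distrib_left sum_distrib_right sc_simps sum_subtractf)
        also have "\<dots> = (\<Sum>i=1..L. if i = l then sc (of_nat l * k) 1 else 0)"
          by (rule sum.cong) (auto simp: Jc_Jc sc_simps k_def mult_ac)
        finally show "sc (of_nat l * k) 1 = ?S L * Jc (- int l) - Jc (- int l) * ?S L"
          using L assms by simp
      qed
    qed
  qed simp
  let ?X = "E c * Jc (- int l) - Jc (- int l) * E c - sc k (E c)"
  have "?X = 0"
  proof (rule ode_unique[of D _ "- int l"])
    show "ent D U W \<noteq> 0 \<Longrightarrow> en U < en W" for U W unfolding D_def by (rule JJ_lower)
    have dB: "deg (Jc (- int l)) = sc (- of_nat l) (Jc (- int l))" using homog_Jc by (simp add: homog_def)
    have "Jc (- int l) * D = D * Jc (- int l) - sc (of_nat l * k) 1" using DJ by (simp add: algebra_simps)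
    then have JDE: "Jc (- int l) * (D * E c) = D * (Jc (- int l) * E c) - sc (of_nat l * k) (E c)"
      by (simp add: mult.assoc[symmetric] left_diff_distrib sc_simps)
    have sm: "sc (- a) X = - sc a X" for a X by (rule cfm_eqI) (simp add: ent_sc ent_uminus)
    show "deg ?X = D * ?X + sc (of_int (- int l)) ?X"
      unfolding deg_diff deg_mult deg_sc deg_E D_def[symmetric] dB
      by (simp add: algebra_simps sc_simps JDE sm)
  next
    fix U V assume le: "en V - en U \<le> - int l"
    have "ent (E c) U V = 0" using le assms E_lower[of c U V] by fastforce
    then show "ent ?X U V = 0"
      using ent_E_mult[OF homog_Jc le] ent_mult_E[OF homog_Jc le] by (simp add: ent_minus ent_sc)
  qed
  then show ?thesis by (simp add: k_def algebra_simps sc_simps)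
qed

lemma E_scale: "ent (E (\<lambda>l. x ^ l * c l)) U V = x ^ nat (en V - en U) * ent (E c) U V"
proof -
  have J: "ent (JJ (\<lambda>l. x ^ l * c l)) U V = x ^ nat (en V - en U) * ent (JJ c) U V" for U V
    by (simp add: JJ.rep_eq)
  have "ent (JJ (\<lambda>l. x ^ l * c l) ^ n) U V = x ^ nat (en V - en U) * ent (JJ c ^ n) U V" for n
  proof (induction n arbitrary: U)
    case 0
    then show ?case by (simp add: ent_one op_id_def)
  next
    case (Suc n)
    let ?S = "{W \<in> maya. en W \<le> en V}"
    have low: "ent (JJ d ^ n) W V = 0" if "W \<notin> ?S" for W d
      using that JJ_pow_lower[of d n W V] ent_maya[of "JJ d ^ n" W V] by fastforce
    have "ent (JJ d ^ Suc n) U V = (\<Sum>W\<in>?S. ent (JJ d) U W * ent (JJ d ^ n) W V)" for d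
      unfolding power_Suc by (rule ent_mult) (use finite_en low in auto)
    note * = this
    show ?case unfolding * sum_distrib_left
    proof (rule sum.cong[OF refl])
      fix W assume W: "W \<in> ?S"
      show "ent (JJ (\<lambda>l. x ^ l * c l)) U W * ent (JJ (\<lambda>l. x ^ l * c l) ^ n) W V
          = x ^ nat (en V - en U) * (ent (JJ c) U W * ent (JJ c ^ n) W V)"
      proof (cases "en U < en W")
        case True
        then have "nat (en V - en U) = nat (en W - en U) + nat (en V - en W)" using W by auto
        then show ?thesis by (simp add: J Suc.IH power_add)
      next
        case False
        then show ?thesis using JJ_lower[of _ U W] by fastforce
      qed
    qed
  qed
  then show ?thesis by (simp add: E.rep_eq sum_distrib_left)
qed

lemma E_tendsto:
  assumes "\<And>l. 1 \<le> l \<Longrightarrow> (\<lambda>N. c N l) \<longlonglongrightarrow> d l"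
  shows "(\<lambda>N. ent (E (c N)) U V) \<longlonglongrightarrow> ent (E d) U V"
proof -
  have J: "(\<lambda>N. ent (JJ (c N)) U V) \<longlonglongrightarrow> ent (JJ d) U V" for U V
    by (auto simp: JJ.rep_eq intro!: tendsto_mult_right assms)
  have "(\<lambda>N. ent (JJ (c N) ^ n) U V) \<longlonglongrightarrow> ent (JJ d ^ n) U V" for n
  proof (induction n arbitrary: U)
    case (Suc n)
    let ?S = "{W \<in> maya. en W \<le> en V}"
    have low: "ent (JJ d ^ n) W V = 0" if "W \<notin> ?S" for W d
      using that JJ_pow_lower[of d n W V] ent_maya[of "JJ d ^ n" W V] by fastforce
    have *: "ent (JJ d ^ Suc n) U V = (\<Sum>W\<in>?S. ent (JJ d) U W * ent (JJ d ^ n) W V)" for d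
      unfolding power_Suc by (rule ent_mult) (use finite_en low in auto)
    show ?case unfolding * by (intro tendsto_intros J Suc.IH)
  qed simp
  then show ?thesis unfolding E.rep_eq by (intro tendsto_intros) auto
qed

section \<open>Transposition\<close>

definition tr :: "'a fop \<Rightarrow> 'a fop" where "tr A U V = A V U"

lemma op_mult_tr: "op_mult (tr A) (tr B) = tr (op_mult B A)"
  by (intro ext) (simp add: op_mult_def tr_def mult.commute)

lemma tr_op_id: "tr op_id = op_id"
  by (intro ext) (auto simp: tr_def op_id_def)

lemma op_power_tr: "op_power (tr (ent A)) n = tr (ent (A ^ n))"
proof (induction n)
  case 0
  then show ?case by (simp add: one_cfm.rep_eq tr_op_id)
next
  case (Suc n)
  have "op_power (tr (ent A)) (Suc n) = tr (ent (A ^ n * A))"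
    by (simp add: Suc.IH op_mult_tr times_cfm.rep_eq)
  then show ?case by (simp add: power_commutes)
qed

lemma op_exp_tr: "op_exp (tr (ent A)) = tr (op_exp (ent A))"
  by (intro ext) (simp add: op_exp_def op_power_tr op_power_ent tr_def)

lemma ent_nb_tr:
  assumes "U \<in> maya" "V \<in> maya" shows "ent (nb p m) U V = ent (nb (p + m) (- m)) V U"
proof (cases "m = 0")
  case True
  then show ?thesis using assms by (auto simp: ent_nb_0)
next
  case False
  have 1: "ent (nb p m) U V = ent (cre (p + m) * ann (- p)) U V"
    and 2: "ent (nb (p + m) (- m)) V U = ent (cre p * ann (- (p + m))) V U"
    using False by (simp_all add: nb_def)
  have iff: "(p \<in> V \<and> p + m \<notin> V \<and> U = insert (p + m) (V - {p})) \<longleftrightarrow>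
     (p + m \<in> U \<and> p \<notin> U \<and> V = insert p (U - {p + m}))"
    using False by auto
  show ?thesis
  proof (cases "p \<in> V \<and> p + m \<notin> V \<and> U = insert (p + m) (V - {p})")
    case True
    then have eq: "U - {p + m} = V - {p}" by auto
    have a: "{k \<in> V. k < p} = {k \<in> V - {p}. k < p}" "{k \<in> U. k < p + m} = {k \<in> U - {p + m}. k < p + m}" by auto
    have cd: "p + m \<in> U \<and> p \<notin> U \<and> V = insert p (U - {p + m})" using True iff by blast
    have L: "ent (nb p m) U V = (-1) ^ (card {k \<in> V. k < p} + card {k \<in> V - {p}. k < p + m})"
      unfolding 1 ent_bil[OF assms(2)] using True by simp
    have R: "ent (nb (p + m) (- m)) V U = (-1) ^ (card {k \<in> U. k < p + m} + card {k \<in> U - {p + m}. k < p})"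
      unfolding 2 using ent_bil[OF assms(1), of "p + m" "- m" V] cd by simp
    show ?thesis unfolding L R a eq by (simp add: add.commute)
  next
    case False
    then have "ent (nb p m) U V = 0" unfolding 1 ent_bil[OF assms(2)] using \<open>m \<noteq> 0\<close> by auto
    moreover have "ent (nb (p + m) (- m)) V U = 0"
      unfolding 2 using ent_bil[OF assms(1), of "p + m" "- m" V] \<open>m \<noteq> 0\<close> False iff by auto
    ultimately show ?thesis by simp
  qed
qed

lemma ent_Dm_tr: "ent (Dm \<phi> m) U V = ent (Dm (\<lambda>p. \<phi> (p - m)) (- m)) V U"
proof (cases "U \<in> maya \<and> V \<in> maya")
  case True
  have "(\<Sum>\<^sub>\<infinity>p. \<phi> p * ent (nb p m) U V) = (\<Sum>\<^sub>\<infinity>p. \<phi> (p - m) * ent (nb p (- m)) V U)"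
    by (rule infsum_reindex_bij_witness[where i="\<lambda>p. p - m" and j="\<lambda>p. p + m"])
       (use True in \<open>auto simp: ent_nb_tr[of U V, symmetric]\<close>)
  then show ?thesis by (simp add: ent_Dm_infsum)
next
  case False
  then show ?thesis using ent_maya by metis
qed

lemma ent_Jc_tr: "ent (Jc m) U V = ent (Jc (- m)) V U"
  unfolding Jc_def by (rule ent_Dm_tr)

lemma J_neg_tr: "J (- k) = tr (J k)"
  by (intro ext) (simp add: J_eq tr_def ent_Jc_tr[of "- k"])

lemma ent_At_tr:
  assumes "q \<noteq> 0"
  shows "ent (At q k m) U V = q powi (k * m) * ent (At q k (- m)) V U"
proof -
  have "(\<lambda>p. q powi (- k * (p - m))) = (\<lambda>p. q powi (k * m) * q powi (- k * p))"
    using assms by (intro ext) (simp add: power_int_add[symmetric] algebra_simps)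
  then have "ent (Dm (\<lambda>p. q powi (- k * p)) m) U V = q powi (k * m) * ent (Dm (\<lambda>p. q powi (- k * p)) (- m)) V U"
    by (subst ent_Dm_tr) (simp only: Dm_sc ent_sc)
  then show ?thesis
    by (auto simp: At_def ent_plus ent_sc ent_one op_id_def algebra_simps)
qed

section \<open>Partitions and Maya diagrams\<close>

definition mayaP :: "int \<Rightarrow> (nat \<Rightarrow> nat) \<Rightarrow> int set"
  where "mayaP s \<mu> = range (\<lambda>i. int i - s - int (\<mu> i))"

lemma partitions_bound: assumes "\<mu> \<in> partitions" obtains n where "\<And>i. n \<le> i \<Longrightarrow> \<mu> i = 0"
proof -
  have "finite {i. \<mu> i \<noteq> 0}" using assms by (simp add: partitions_def)
  then obtain n where "\<forall>i\<in>{i. \<mu> i \<noteq> 0}. i < n" using finite_nat_set_iff_bounded by metis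
  then show ?thesis using that[of n] by (metis leD mem_Collect_eq)
qed

lemma partitionsI: assumes "antimono \<mu>" "\<And>i. n \<le> i \<Longrightarrow> \<mu> i = 0" shows "\<mu> \<in> partitions"
proof -
  have "{i. \<mu> i \<noteq> 0} \<subseteq> {..<n}"
  proof
    fix i assume "i \<in> {i. \<mu> i \<noteq> 0}"
    then show "i \<in> {..<n}" using assms(2)[of i] by (cases "n \<le> i") auto
  qed
  then have "finite {i. \<mu> i \<noteq> 0}" by (rule finite_subset) simp
  then show ?thesis using assms(1) by (simp add: partitions_def)
qed

lemma zero_partition: "(\<lambda>_. 0) \<in> partitions" by (auto simp: partitions_def antimono_def)

lemma partition_anti: "\<mu> \<in> partitions \<Longrightarrow> i \<le> k \<Longrightarrow> \<mu> k \<le> \<mu> i"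
  by (auto simp: partitions_def antimono_def)

lemma tl_partition: assumes "\<mu> \<in> partitions" shows "(\<lambda>i. \<mu> (Suc i)) \<in> partitions"
proof -
  obtain n where "\<And>i. n \<le> i \<Longrightarrow> \<mu> i = 0" using partitions_bound[OF assms] by blast
  then show ?thesis
    using partition_anti[OF assms] by (intro partitionsI[of _ n]) (auto simp: antimono_def)
qed

lemma cons_partition:
  assumes "\<mu> \<in> partitions" "\<mu> 0 \<le> m" shows "case_nat m \<mu> \<in> partitions"
proof -
  obtain n where n: "\<And>i. n \<le> i \<Longrightarrow> \<mu> i = 0" using partitions_bound[OF assms(1)] by blast
  have "antimono (case_nat m \<mu>)"
    unfolding antimono_iff_le_Suc using assms(2) partition_anti[OF assms(1)] by (auto split: nat.split)
  then show ?thesis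
    using n by (intro partitionsI[of _ "Suc n"]) (auto split: nat.split)
qed

lemma mayaP_Suc: "mayaP s \<mu> = insert (- s - int (\<mu> 0)) (mayaP (s - 1) (\<lambda>i. \<mu> (Suc i)))"
proof -
  have "mayaP s \<mu> = (\<lambda>i. int i - s - int (\<mu> i)) ` insert 0 (range Suc)"
    unfolding mayaP_def by (metis UNIV_nat_eq)
  then show ?thesis by (simp add: mayaP_def image_image algebra_simps)
qed

lemma mayaP_ge: assumes "\<mu> \<in> partitions" "m \<in> mayaP s \<mu>" shows "- s - int (\<mu> 0) \<le> m"
proof -
  obtain i where m: "m = int i - s - int (\<mu> i)" using assms(2) by (auto simp: mayaP_def)
  have "\<mu> i \<le> \<mu> 0" using partition_anti[OF assms(1)] by simp
  then show ?thesis using m by simp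
qed

lemma mayaP_tl_gt:
  assumes "\<mu> \<in> partitions" "m \<in> mayaP (s - 1) (\<lambda>i. \<mu> (Suc i))" shows "- s - int (\<mu> 0) < m"
proof -
  have "- (s - 1) - int (\<mu> (Suc 0)) \<le> m"
    using mayaP_ge[OF tl_partition[OF assms(1)] assms(2)] by simp
  moreover have "\<mu> (Suc 0) \<le> \<mu> 0" using partition_anti[OF assms(1)] by simp
  ultimately show ?thesis by linarith
qed

lemma mayaP_0: "mayaP s (\<lambda>_. 0) = ground s"
  unfolding mayaP_def ground_def
proof (intro set_eqI iffI)
  fix x assume "x \<in> {- s..}"
  then show "x \<in> range (\<lambda>i. int i - s - int 0)" by (intro image_eqI[of _ _ "nat (x + s)"]) auto
qed auto

lemma partition_induct [consumes 1, case_names zero step]: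
  assumes "\<mu> \<in> partitions" and "\<And>s. Q s (\<lambda>_. 0)"
    and "\<And>s \<mu>. \<mu> \<in> partitions \<Longrightarrow> Q (s - 1) (\<lambda>i. \<mu> (Suc i)) \<Longrightarrow> Q (s :: int) \<mu>"
  shows "Q s \<mu>"
proof -
  have "\<forall>s \<mu>. \<mu> \<in> partitions \<longrightarrow> (\<forall>i\<ge>n. \<mu> i = 0) \<longrightarrow> Q s \<mu>" for n
  proof (induction n)
    case 0
    have "\<mu> = (\<lambda>_. 0)" if "\<forall>i\<ge>0. \<mu> i = 0" for \<mu> :: "nat \<Rightarrow> nat" using that by auto
    then show ?case using assms(2) by blast
  next
    case (Suc n)
    show ?case
    proof (intro allI impI)
      fix s \<mu> assume *: "\<mu> \<in> partitions" "\<forall>i\<ge>Suc n. \<mu> i = 0"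
      then have "Q (s - 1) (\<lambda>i. \<mu> (Suc i))" using Suc tl_partition by simp
      then show "Q s \<mu>" by (rule assms(3)[OF *(1)])
    qed
  qed
  then show ?thesis using partitions_bound[OF assms(1)] assms(1) by metis
qed

lemma mayaP_maya: assumes "\<mu> \<in> partitions" shows "mayaP s \<mu> \<in> maya"
  using assms
proof (induction rule: partition_induct[where s=s])
  case (zero s) then show ?case by (simp add: mayaP_0 ground_maya)
next
  case (step s \<mu>) then show ?case by (subst mayaP_Suc) (rule maya_insert)
qed

lemma mayaP_notin: "\<mu> \<in> partitions \<Longrightarrow> - s - int (\<mu> 0) \<notin> mayaP (s - 1) (\<lambda>i. \<mu> (Suc i))"
  using mayaP_tl_gt by blast

lemma wt_mayaP_Suc: "\<mu> \<in> partitions \<Longrightarrow>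
    wt \<phi> (mayaP s \<mu>) = wt \<phi> (mayaP (s - 1) (\<lambda>i. \<mu> (Suc i))) + \<phi> (- s - int (\<mu> 0))"
  by (subst mayaP_Suc) (simp add: wt_insert mayaP_maya tl_partition mayaP_notin)

lemma wt_ground_rec: "wt \<phi> (ground s) = wt \<phi> (ground (s - 1)) + \<phi> (- s)"
  using wt_mayaP_Suc[OF zero_partition, of \<phi> s] by (simp add: mayaP_0)

lemma wt_ground:
  assumes "f 0 = 0" "\<And>s. f s = f (s - 1) + \<phi> (- s)"
  shows "wt \<phi> (ground s) = f s"
proof (induction s rule: int_induct[where k=0])
  case base then show ?case by (simp add: assms(1) wt_ground_0)
next
  case (step1 i)
  then show ?case using wt_ground_rec[of \<phi> "i + 1"] assms(2)[of "i + 1"] by simp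
next
  case (step2 i)
  then show ?case using wt_ground_rec[of \<phi> i] assms(2)[of i] by simp
qed

lemma wt_mayaP:
  assumes "\<mu> \<in> partitions" "\<And>i. n \<le> i \<Longrightarrow> \<mu> i = 0"
  shows "wt \<phi> (mayaP s \<mu>) = wt \<phi> (ground s) + (\<Sum>i<n. \<phi> (int i - s - int (\<mu> i)) - \<phi> (int i - s))"
  using assms
proof (induction n arbitrary: \<mu> s)
  case 0
  then have "\<mu> = (\<lambda>_. 0)" by auto
  then show ?case by (simp add: mayaP_0)
next
  case (Suc n)
  have "wt \<phi> (mayaP (s - 1) (\<lambda>i. \<mu> (Suc i))) = wt \<phi> (ground (s - 1))
      + (\<Sum>i<n. \<phi> (int i - (s - 1) - int (\<mu> (Suc i))) - \<phi> (int i - (s - 1)))"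
    by (rule Suc.IH) (use Suc.prems tl_partition in auto)
  then show ?case
    unfolding wt_mayaP_Suc[OF Suc.prems(1)] wt_ground_rec[of \<phi> s] sum.lessThan_Suc_shift
    by (simp add: algebra_simps)
qed

definition charge :: "int set \<Rightarrow> int" where "charge = wt (\<lambda>_. 1)"

lemma charge_mayaP: "\<mu> \<in> partitions \<Longrightarrow> charge (mayaP s \<mu>) = s"
proof -
  assume \<mu>: "\<mu> \<in> partitions"
  obtain n where n: "\<And>i. n \<le> i \<Longrightarrow> \<mu> i = 0" using partitions_bound[OF \<mu>] by blast
  have "wt (\<lambda>_. 1) (ground s) = (s :: int)" by (rule wt_ground) auto
  then show ?thesis using wt_mayaP[OF \<mu> n, where \<phi>="\<lambda>_. 1 :: int"] by (simp add: charge_def)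
qed

lemma mayaP_hd: "- s - int (\<mu> 0) \<in> mayaP s \<mu>"
  by (subst mayaP_Suc) simp

lemma mayaP_hd_eq:
  assumes "\<mu> \<in> partitions" "\<nu> \<in> partitions" "mayaP s \<mu> = mayaP s \<nu>" shows "\<mu> 0 = \<nu> 0"
proof -
  have "- s - int (\<nu> 0) \<le> - s - int (\<mu> 0)"
    by (rule mayaP_ge[OF assms(2)]) (use mayaP_hd[of s \<mu>] assms(3) in simp)
  moreover have "- s - int (\<mu> 0) \<le> - s - int (\<nu> 0)"
    by (rule mayaP_ge[OF assms(1)]) (use mayaP_hd[of s \<nu>] assms(3) in simp)
  ultimately show ?thesis by simp
qed

lemma mayaP_inj:
  assumes "\<mu> \<in> partitions" "\<nu> \<in> partitions" "mayaP s \<mu> = mayaP t \<nu>"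
  shows "s = t \<and> \<mu> = \<nu>"
proof -
  have st: "s = t" using assms charge_mayaP by metis
  have "\<mu> i = \<nu> i" if "mayaP s \<mu> = mayaP s \<nu>" "\<mu> \<in> partitions" "\<nu> \<in> partitions" for i
    using that
  proof (induction i arbitrary: s \<mu> \<nu>)
    case 0
    then show ?case by (intro mayaP_hd_eq)
  next
    case (Suc i)
    have eq0: "\<mu> 0 = \<nu> 0" using Suc.prems by (intro mayaP_hd_eq)
    have "mayaP (s - 1) (\<lambda>i. \<rho> (Suc i)) = mayaP s \<rho> - {- s - int (\<rho> 0)}" if "\<rho> \<in> partitions" for \<rho>
      using mayaP_Suc[of s \<rho>] mayaP_notin[OF that, of s] by auto
    then have "mayaP (s - 1) (\<lambda>i. \<mu> (Suc i)) = mayaP (s - 1) (\<lambda>i. \<nu> (Suc i))"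
      using Suc.prems eq0 by simp
    then show ?case
      using Suc.IH[of "s - 1" "\<lambda>i. \<mu> (Suc i)" "\<lambda>i. \<nu> (Suc i)"] Suc.prems tl_partition by simp
  qed
  then show ?thesis using assms st by auto
qed

lemma maya_mayaP:
  assumes "V \<in> maya" obtains s \<mu> where "\<mu> \<in> partitions" "V = mayaP s \<mu>"
proof -
  have *: "\<exists>s. \<exists>\<mu>\<in>partitions. V = mayaP s \<mu>"
    if "V \<in> maya" "card {m \<in> V. m < N} = n" "{N..} \<subseteq> V" for n N V
    using that
  proof (induction n arbitrary: V)
    case 0
    then have "{m \<in> V. m < N} = {}" using maya_finite_neg by simp
    then have "V = ground (- N)" using 0 by (fastforce simp: ground_def)
    then show ?case using mayaP_0[of "- N"] zero_partition by metis
  next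
    case (Suc n)
    let ?F = "{m \<in> V. m < N}"
    have fin: "finite ?F" using maya_finite_neg Suc.prems by blast
    have ne: "?F \<noteq> {}"
    proof
      assume "?F = {}"
      then have "card ?F = 0" by (simp only: card.empty)
      then show False using Suc.prems(2) by simp
    qed
    define v where "v = Min ?F"
    have v: "v \<in> ?F" unfolding v_def using fin ne by (rule Min_in)
    have le: "v \<le> m" if "m \<in> V" for m
      using that Min_le[OF fin, of m] v unfolding v_def by (cases "m < N") auto
    have "{m \<in> V - {v}. m < N} = ?F - {v}" by auto
    then have "card {m \<in> V - {v}. m < N} = n" using Suc.prems v fin by simp
    moreover have "{N..} \<subseteq> V - {v}" using Suc.prems v by auto
    ultimately obtain s \<mu> where *: "\<mu> \<in> partitions" "V - {v} = mayaP s \<mu>"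
      using Suc.IH[of "V - {v}"] maya_remove Suc.prems by blast
    have "- s - int (\<mu> 0) \<in> V - {v}" unfolding * by (rule mayaP_hd)
    then have "v < - s - int (\<mu> 0)" using le[of "- s - int (\<mu> 0)"] by auto
    then have m: "\<mu> 0 \<le> nat (- (s + 1) - v)" and m': "- (s + 1) - int (nat (- (s + 1) - v)) = v" by auto
    have "V = insert v (V - {v})" using v by auto
    also have "\<dots> = mayaP (s + 1) (case_nat (nat (- (s + 1) - v)) \<mu>)"
      unfolding * by (subst mayaP_Suc[of "s + 1"]) (simp only: m' nat.case add_diff_cancel_right')
    finally show ?case using cons_partition[OF *(1) m] by blast
  qed
  obtain N where "\<forall>n > N. n \<in> V" using assms by (auto simp: maya_def)
  then have "{N + 1..} \<subseteq> V" by auto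
  then show ?thesis using *[OF assms refl] that by blast
qed

lemma maya_charge_mayaP:
  assumes "V \<in> maya" obtains \<mu> where "\<mu> \<in> partitions" "V = mayaP (charge V) \<mu>"
  using maya_mayaP[OF assms] charge_mayaP by metis

section \<open>Vertical strips\<close>

definition vs :: "(nat \<Rightarrow> nat) \<Rightarrow> (nat \<Rightarrow> nat) \<Rightarrow> bool"
  where "vs \<nu> \<mu> \<longleftrightarrow> (\<forall>i. \<nu> i \<le> \<mu> i \<and> \<mu> i \<le> Suc (\<nu> i))"

definition ce :: "complex \<Rightarrow> nat \<Rightarrow> complex" where "ce x l = - ((- x) ^ l) / of_nat l"

lemma Jc_ground: assumes "1 \<le> k" shows "ent (Jc k) U (ground s) = 0"
proof -
  have "nbsup k (ground s) = {}" using assms by (auto simp: nbsup_def ground_def)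
  then show ?thesis by (simp add: Jc_def ent_Dm ground_maya)
qed

lemma E_ground: "ent (E c) U (ground s) = op_id U (ground s)"
proof -
  have J: "ent (JJ c) U (ground s) = 0" for U
    by (auto simp: JJ.rep_eq Jc_ground)
  have "JJ c ^ Suc n = JJ c ^ n * JJ c" for n by (rule power_Suc2)
  then have "ent (JJ c ^ Suc n) U (ground s) = 0" for n U
    by (simp only: ent_mult0 J mult_zero_right sum.neutral_const)
  then have "ent (JJ c ^ n) U (ground s) = (if n = 0 then op_id U (ground s) else 0)" for n
    by (cases n) (auto simp: ent_one simp del: power_Suc)
  then have "ent (E c) U (ground s) = (\<Sum>n\<le>nat (en (ground s)). (if n = 0 then op_id U (ground s) else 0))"
    unfolding E.rep_eq by (intro sum.cong) auto
  then show ?thesis by simp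
qed

lemma ce_cre: "E (ce x) * cre m = (cre m + sc x (cre (m + 1))) * E (ce x)"
proof -
  let ?f = "\<lambda>n::nat. if n = 0 then 1 else if n = 1 then x else 0"
  have "E (ce x) * cre m = (\<Sum>n\<le>1. sc (?f n) (cre (m + int n))) * E (ce x)"
  proof (rule E_shift[where \<theta>="\<lambda>_. 1"])
    fix n :: nat assume n: "1 \<le> n"
    have "(\<Sum>l=1..n. of_nat l * ce x l * 1 * ?f (n - l)) = (\<Sum>l=1..n. - ((- x) ^ l) * ?f (n - l))"
      by (rule sum.cong) (auto simp: ce_def)
    also have "\<dots> = of_nat n * ?f n"
    proof (cases "n = 1")
      case False
      then have "n = Suc (Suc (n - 2))" using n by simp
      then obtain k where k: "n = Suc (Suc k)" by blast
      have "(\<Sum>l=1..n. - ((- x) ^ l) * ?f (n - l)) = (\<Sum>l\<in>{n - 1, n}. - ((- x) ^ l) * ?f (n - l))"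
        by (rule sum.mono_neutral_right) (auto simp: k)
      then show ?thesis by (simp add: k)
    qed simp
    finally show "of_nat n * ?f n = (\<Sum>l=1..n. of_nat l * ce x l * 1 * ?f (n - l))" by simp
  qed (auto simp: homog_cre Jc_cre sc_1)
  then show ?thesis by (simp add: sc_1 atMost_Suc add.commute)
qed

lemma ent_P_mult:
  assumes "U \<in> maya"
  shows "ent (cre n * A) U V = (if n \<in> U then (-1) ^ card {m \<in> U - {n}. m < n} * ent A (U - {n}) V else 0)"
proof -
  let ?r = "if n \<in> U then (-1) ^ card {m \<in> U - {n}. m < n} * ent A (U - {n}) V else 0"
  have "ent (cre n * A) U V = (\<Sum>W\<in>{W. ent A W V \<noteq> 0}. psi n U W * ent A W V)"
    by (simp add: ent_mult0 cre.rep_eq)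
  also have "\<dots> = (\<Sum>W\<in>{W. ent A W V \<noteq> 0}. if W = U - {n} then ?r else 0)"
    by (rule sum.cong[OF refl]) (use assms maya_remove in \<open>auto simp: psi_def\<close>)
  also have "\<dots> = ?r"
    by (simp add: ent_finite)
  finally show ?thesis .
qed

lemma vs_en:
  assumes "\<mu> \<in> partitions" "\<nu> \<in> partitions" "vs \<nu> \<mu>" shows "en (mayaP s \<nu>) \<le> en (mayaP s \<mu>)"
proof -
  obtain n where n: "\<And>i. n \<le> i \<Longrightarrow> \<mu> i = 0" using partitions_bound[OF assms(1)] by blast
  have n': "\<nu> i = 0" if "n \<le> i" for i using assms(3) n[OF that] unfolding vs_def by (metis le_zero_eq)
  have 1: "wt \<phi> (mayaP s \<mu>) = wt \<phi> (ground s) + (\<Sum>i<n. \<phi> (int i - s - int (\<mu> i)) - \<phi> (int i - s))" for \<phi> :: "int \<Rightarrow> int"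
    by (rule wt_mayaP) (use assms n in auto)
  have 2: "wt \<phi> (mayaP s \<nu>) = wt \<phi> (ground s) + (\<Sum>i<n. \<phi> (int i - s - int (\<nu> i)) - \<phi> (int i - s))" for \<phi> :: "int \<Rightarrow> int"
    by (rule wt_mayaP) (use assms n' in auto)
  show ?thesis unfolding en_def 1 2
    using assms(3) by (auto simp: vs_def intro!: sum_mono)
qed

lemma ent_vs:
  assumes "\<mu> \<in> partitions" "U \<in> maya"
  shows "ent (E (ce x)) U (mayaP s \<mu>) =
    (if \<exists>\<nu>\<in>partitions. U = mayaP s \<nu> \<and> vs \<nu> \<mu> then x ^ nat (en (mayaP s \<mu>) - en U) else 0)"
  using assms
proof (induction arbitrary: U rule: partition_induct[where s=s])
  case (zero s)
  have "(\<exists>\<nu>\<in>partitions. U = mayaP s \<nu> \<and> vs \<nu> (\<lambda>_. 0)) \<longleftrightarrow> U = ground s"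
  proof
    assume "\<exists>\<nu>\<in>partitions. U = mayaP s \<nu> \<and> vs \<nu> (\<lambda>_. 0)"
    then obtain \<nu> where \<nu>: "U = mayaP s \<nu>" "vs \<nu> (\<lambda>_. 0)" by blast
    then have "\<nu> = (\<lambda>_. 0)" by (auto simp: vs_def)
    then show "U = ground s" using \<nu> by (simp add: mayaP_0)
  next
    assume "U = ground s"
    then show "\<exists>\<nu>\<in>partitions. U = mayaP s \<nu> \<and> vs \<nu> (\<lambda>_. 0)"
      by (intro bexI[OF _ zero_partition]) (auto simp: mayaP_0 vs_def)
  qed
  then show ?case by (auto simp: mayaP_0 E_ground op_id_def ground_maya)
next
  case (step s \<mu>)
  define \<mu>' where "\<mu>' = (\<lambda>i. \<mu> (Suc i))"
  define v where "v = - s - int (\<mu> 0)"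
  define V' where "V' = mayaP (s - 1) \<mu>'"
  have \<mu>': "\<mu>' \<in> partitions" unfolding \<mu>'_def by (rule tl_partition) fact
  have \<mu>'0: "\<mu>' 0 \<le> \<mu> 0" using partition_anti[OF step.hyps] by (auto simp: \<mu>'_def)
  have V: "mayaP s \<mu> = insert v V'" unfolding v_def V'_def \<mu>'_def by (rule mayaP_Suc)
  have V'_maya: "V' \<in> maya" unfolding V'_def by (rule mayaP_maya[OF \<mu>'])
  have vV': "v \<notin> V'" unfolding v_def V'_def \<mu>'_def by (rule mayaP_notin) fact
  have gt: "v < m" if "m \<in> V'" for m
    using that mayaP_tl_gt[OF step.hyps] unfolding v_def V'_def \<mu>'_def by blast
  let ?C = "\<lambda>W. \<exists>\<nu>\<in>partitions. W = mayaP (s - 1) \<nu> \<and> vs \<nu> \<mu>'"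
  have IH: "ent (E (ce x)) W V' = (if ?C W then x ^ nat (en V' - en W) else 0)"
    if "W \<in> maya" for W
    unfolding V'_def \<mu>'_def using that by (rule step.IH)
  have Cge: "v + 1 \<le> m" if C: "?C W" and m: "m \<in> W" for W m
  proof -
    obtain \<nu> where \<nu>: "\<nu> \<in> partitions" "W = mayaP (s - 1) \<nu>" "vs \<nu> \<mu>'" using C by blast
    then have "\<nu> 0 \<le> \<mu> 0" using \<mu>'0 by (auto simp: vs_def intro: order_trans)
    then show ?thesis using mayaP_ge[OF \<nu>(1), of m "s - 1"] m \<nu>(2) by (simp add: v_def)
  qed
  have CE: "en W \<le> en V'" if "?C W" for W
    using that vs_en[OF \<mu>'] unfolding V'_def by blast
  have "{m \<in> V'. m < v} = {}" using gt by force
  then have card0: "card {m \<in> V'. m < v} = 0" by (simp only: card.empty)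
  have L: "ent (E (ce x)) U (insert v V') = ent (E (ce x) * cre v) U V'"
    using psi_left[OF V'_maya, of "ent (E (ce x))" v U] vV' card0 by (simp add: times_cfm.rep_eq cre.rep_eq)
  have U: "U \<in> maya" by fact
  have R: "ent (E (ce x) * cre v) U V'
     = (if v \<in> U then (-1) ^ card {m \<in> U - {v}. m < v} * ent (E (ce x)) (U - {v}) V' else 0)
     + x * (if v + 1 \<in> U then (-1) ^ card {m \<in> U - {v + 1}. m < v + 1} * ent (E (ce x)) (U - {v + 1}) V' else 0)"
    unfolding ce_cre distrib_right sc_mult_left ent_plus ent_sc ent_P_mult[OF U] ..
  have t: "(if u \<in> U then (-1) ^ card {m \<in> U - {u}. m < u} * ent (E (ce x)) (U - {u}) V' else 0)
     = (if u \<in> U \<and> ?C (U - {u}) then x ^ nat (en V' - en (U - {u})) else 0)" if u: "u \<le> v + 1" for u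
  proof (cases "?C (U - {u})")
    case True
    have "{m \<in> U - {u}. m < u} = {}" using Cge[OF True] u by force
    then have c: "card {m \<in> U - {u}. m < u} = 0" by (simp only: card.empty)
    have e: "ent (E (ce x)) (U - {u}) V' = x ^ nat (en V' - en (U - {u}))"
      unfolding IH[OF maya_remove[OF U]] by (rule if_P[OF True])
    show ?thesis unfolding c e using True by simp
  next
    case False
    then have "ent (E (ce x)) (U - {u}) V' = 0" unfolding IH[OF maya_remove[OF U]] by (rule if_not_P)
    moreover have "\<not> (u \<in> U \<and> ?C (U - {u}))" using False by blast
    ultimately show ?thesis by (simp only: if_False mult_zero_right if_cancel)
  qed
  have enV: "en (insert v V') = en V' - v" using en_insert V'_maya vV' by simp
  have iff: "(\<exists>\<nu>\<in>partitions. U = mayaP s \<nu> \<and> vs \<nu> \<mu>) \<longleftrightarrow>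
     (v \<in> U \<and> ?C (U - {v})) \<or> (v + 1 \<in> U \<and> ?C (U - {v + 1}))"
  proof
    assume "\<exists>\<nu>\<in>partitions. U = mayaP s \<nu> \<and> vs \<nu> \<mu>"
    then obtain \<nu> where \<nu>: "\<nu> \<in> partitions" "U = mayaP s \<nu>" "vs \<nu> \<mu>" by blast
    let ?u = "- s - int (\<nu> 0)"
    have u: "U = insert ?u (mayaP (s - 1) (\<lambda>i. \<nu> (Suc i)))" unfolding \<nu> by (rule mayaP_Suc)
    then have "U - {?u} = mayaP (s - 1) (\<lambda>i. \<nu> (Suc i))" using mayaP_notin[OF \<nu>(1), of s] by auto
    moreover have "vs (\<lambda>i. \<nu> (Suc i)) \<mu>'" using \<nu>(3) by (auto simp: vs_def \<mu>'_def)
    ultimately have C: "?C (U - {?u})" using tl_partition[OF \<nu>(1)] by blast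
    have "\<nu> 0 \<le> \<mu> 0 \<and> \<mu> 0 \<le> Suc (\<nu> 0)" using \<nu>(3) by (simp add: vs_def)
    then have "?u = v \<or> ?u = v + 1" by (auto simp: v_def)
    moreover have "?u \<in> U" using u by blast
    ultimately show "(v \<in> U \<and> ?C (U - {v})) \<or> (v + 1 \<in> U \<and> ?C (U - {v + 1}))" using C by metis
  next
    assume "(v \<in> U \<and> ?C (U - {v})) \<or> (v + 1 \<in> U \<and> ?C (U - {v + 1}))"
    then obtain u where u: "u = v \<or> u = v + 1" "u \<in> U" "?C (U - {u})" by blast
    then obtain \<nu> where \<nu>: "\<nu> \<in> partitions" "U - {u} = mayaP (s - 1) \<nu>" "vs \<nu> \<mu>'" by blast
    have hd: "- (s - 1) - int (\<nu> 0) \<in> U - {u}" unfolding \<nu> by (rule mayaP_hd)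
    have "v + 1 \<le> - (s - 1) - int (\<nu> 0)" by (rule Cge[OF u(3) hd])
    then have le: "u < - (s - 1) - int (\<nu> 0)" using u(1) hd by auto
    define m where "m = nat (- s - u)"
    have m: "\<nu> 0 \<le> m" "- s - int m = u" using le by (auto simp: m_def)
    have "U = insert u (U - {u})" using u by auto
    also have "\<dots> = mayaP s (case_nat m \<nu>)" unfolding \<nu> by (subst mayaP_Suc[of s]) (simp only: m nat.case)
    finally have Ueq: "U = mayaP s (case_nat m \<nu>)" .
    have "vs (case_nat m \<nu>) \<mu>"
      unfolding vs_def
    proof
      fix i show "case_nat m \<nu> i \<le> \<mu> i \<and> \<mu> i \<le> Suc (case_nat m \<nu> i)"
        using \<nu>(3) u(1) m by (cases i) (auto simp: vs_def \<mu>'_def v_def)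
    qed
    then show "\<exists>\<nu>\<in>partitions. U = mayaP s \<nu> \<and> vs \<nu> \<mu>"
      using Ueq cons_partition[OF \<nu>(1) m(1)] by blast
  qed
  have excl: "\<not> (v \<in> U \<and> ?C (U - {v + 1}))"
    using Cge[of "U - {v + 1}" v] by auto
  show ?case
    unfolding V L R t[OF order.refl] t[of v, simplified] iff enV
  proof (cases "v \<in> U \<and> ?C (U - {v})")
    case True
    have n2: "\<not> (v + 1 \<in> U \<and> ?C (U - {v + 1}))" using excl True by blast
    have or: "(v \<in> U \<and> ?C (U - {v})) \<or> (v + 1 \<in> U \<and> ?C (U - {v + 1}))" using True by blast
    have e: "en V' - v - en U = en V' - en (U - {v})" using en_remove[OF U, of v] True by simp
    show "(if v \<in> U \<and> ?C (U - {v}) then x ^ nat (en V' - en (U - {v})) else 0)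
       + x * (if v + 1 \<in> U \<and> ?C (U - {v + 1}) then x ^ nat (en V' - en (U - {v + 1})) else 0)
       = (if (v \<in> U \<and> ?C (U - {v})) \<or> (v + 1 \<in> U \<and> ?C (U - {v + 1})) then x ^ nat (en V' - v - en U) else 0)"
      unfolding if_P[OF True] if_not_P[OF n2] if_P[OF or] e by simp
  next
    case False
    show "(if v \<in> U \<and> ?C (U - {v}) then x ^ nat (en V' - en (U - {v})) else 0)
       + x * (if v + 1 \<in> U \<and> ?C (U - {v + 1}) then x ^ nat (en V' - en (U - {v + 1})) else 0)
       = (if (v \<in> U \<and> ?C (U - {v})) \<or> (v + 1 \<in> U \<and> ?C (U - {v + 1})) then x ^ nat (en V' - v - en U) else 0)"
    proof (cases "v + 1 \<in> U \<and> ?C (U - {v + 1})")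
      case c2: True
      have "en (U - {v + 1}) \<le> en V'" using CE[of "U - {v + 1}"] c2 by blast
      then have "nat (en V' - v - en U) = Suc (nat (en V' - en (U - {v + 1})))"
        using en_remove[OF U, of "v + 1"] c2 by auto
      moreover have or: "(v \<in> U \<and> ?C (U - {v})) \<or> (v + 1 \<in> U \<and> ?C (U - {v + 1}))" using c2 by blast
      ultimately show ?thesis unfolding if_not_P[OF False] if_P[OF c2] if_P[OF or] by simp
    next
      case c2: False
      have or: "\<not> ((v \<in> U \<and> ?C (U - {v})) \<or> (v + 1 \<in> U \<and> ?C (U - {v + 1})))" using c2 False by blast
      show ?thesis unfolding if_not_P[OF False] if_not_P[OF c2] if_not_P[OF or] by simp
    qed
  qed
qed

section \<open>Particle-hole conjugation\<close>

lemma conjugate_iff: assumes "\<mu> \<in> partitions" shows "i < conjugate \<mu> j \<longleftrightarrow> j < \<mu> i"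
proof -
  obtain n where n: "\<And>i. n \<le> i \<Longrightarrow> \<mu> i = 0" using partitions_bound[OF assms] by blast
  have "{i. j < \<mu> i} \<subseteq> {..<n}"
  proof
    fix i assume "i \<in> {i. j < \<mu> i}"
    then show "i \<in> {..<n}" using n[of i] by (cases "n \<le> i") auto
  qed
  then have fin: "finite {i. j < \<mu> i}" by (rule finite_subset) simp
  show ?thesis
  proof
    assume "j < \<mu> i"
    then have "{..i} \<subseteq> {i. j < \<mu> i}" using partition_anti[OF assms] by (auto intro: less_le_trans)
    then have "card {..i} \<le> card {i. j < \<mu> i}" by (rule card_mono[OF fin])
    then show "i < conjugate \<mu> j" by (simp add: conjugate_def)
  next
    assume *: "i < conjugate \<mu> j"
    show "j < \<mu> i"
    proof (rule ccontr)
      assume ji: "\<not> j < \<mu> i"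
      have "{i. j < \<mu> i} \<subseteq> {..<i}"
      proof
        fix k assume "k \<in> {i. j < \<mu> i}"
        then have "\<not> i \<le> k" using partition_anti[OF assms, of i k] ji by auto
        then show "k \<in> {..<i}" by simp
      qed
      then have "card {i. j < \<mu> i} \<le> card {..<i}" by (intro card_mono) auto
      then show False using * by (simp add: conjugate_def)
    qed
  qed
qed

lemma conjugate_partition: assumes "\<mu> \<in> partitions" shows "conjugate \<mu> \<in> partitions"
proof (rule partitionsI[of _ "\<mu> 0"])
  show "antimono (conjugate \<mu>)"
  proof (rule antimonoI)
    fix j k :: nat assume "j \<le> k"
    then have "i < conjugate \<mu> k \<Longrightarrow> i < conjugate \<mu> j" for i using conjugate_iff[OF assms] by simp
    then show "conjugate \<mu> k \<le> conjugate \<mu> j" by (metis linorder_not_less less_irrefl)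
  qed
  fix j assume "\<mu> 0 \<le> j"
  then show "conjugate \<mu> j = 0" using conjugate_iff[OF assms, of 0 j] by simp
qed

lemma conjugate_conjugate: assumes "\<mu> \<in> partitions" shows "conjugate (conjugate \<mu>) = \<mu>"
proof
  fix i
  have "j < conjugate (conjugate \<mu>) i \<longleftrightarrow> j < \<mu> i" for j
    using conjugate_iff[OF conjugate_partition[OF assms]] conjugate_iff[OF assms] by simp
  then show "conjugate (conjugate \<mu>) i = \<mu> i" by (metis less_irrefl linorder_less_linear)
qed

definition cj :: "int set \<Rightarrow> int set" where "cj V = {m. - 1 - m \<notin> V}"

lemma cj_cj: "cj (cj V) = V" by (auto simp: cj_def)

lemma cj_maya: assumes "V \<in> maya" shows "cj V \<in> maya"
proof -
  obtain N where N: "\<forall>n < - N. n \<notin> V" "\<forall>n > N. n \<in> V" using assms by (auto simp: maya_def)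
  have "n \<notin> cj V" if "n < - (N + 1)" for n using N(2) that by (simp add: cj_def)
  moreover have "n \<in> cj V" if "n > N + 1" for n using N(1) that by (simp add: cj_def)
  ultimately show ?thesis unfolding maya_def by blast
qed

lemma cj_maya_iff: "cj V \<in> maya \<longleftrightarrow> V \<in> maya" using cj_maya cj_cj by metis

lemma wt_cj: "wt \<phi> (cj V) = - wt (\<lambda>m. \<phi> (- 1 - m)) V"
proof -
  have "(\<Sum>m\<in>{m \<in> cj V. m < 0}. \<phi> m) = (\<Sum>m\<in>{m. m \<notin> V \<and> 0 \<le> m}. \<phi> (- 1 - m))"
    by (rule sum.reindex_bij_witness[where i="\<lambda>m. - 1 - m" and j="\<lambda>m. - 1 - m"]) (auto simp: cj_def)
  moreover have "(\<Sum>m\<in>{m. m \<notin> cj V \<and> 0 \<le> m}. \<phi> m) = (\<Sum>m\<in>{m \<in> V. m < 0}. \<phi> (- 1 - m))"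
    by (rule sum.reindex_bij_witness[where i="\<lambda>m. - 1 - m" and j="\<lambda>m. - 1 - m"]) (auto simp: cj_def)
  ultimately show ?thesis by (simp add: wt_def)
qed

lemma charge_cj: "charge (cj V) = - charge V" by (simp add: charge_def wt_cj)

lemma en_cj: "en (cj V) = en V - charge V"
proof -
  have "wt (\<lambda>m. m + 1) V = wt (\<lambda>_. 1 :: int) V + wt (\<lambda>m. m) V"
    by (simp add: wt_def sum.distrib)
  moreover have "wt (\<lambda>m. m :: int) V = - en V" by (simp add: en_def wt_def sum_negf)
  ultimately show ?thesis using wt_cj[of "\<lambda>m. - m" V] by (simp add: en_def charge_def)
qed

lemma mayaP_disjoint: assumes "\<mu> \<in> partitions" shows "int i - int (\<mu> i) \<noteq> int (conjugate \<mu> j) - int j - 1"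
  using conjugate_iff[OF assms, of i j] by linarith

lemma cj_mayaP: assumes \<mu>: "\<mu> \<in> partitions" shows "cj (mayaP s \<mu>) = mayaP (- s) (conjugate \<mu>)"
proof (rule set_eqI)
  fix m
  define n where "n = - 1 - m + s"
  have "m \<in> cj (mayaP s \<mu>) \<longleftrightarrow> (\<forall>i. - 1 - m \<noteq> int i - s - int (\<mu> i))"
    by (simp add: cj_def mayaP_def image_iff)
  also have "\<dots> \<longleftrightarrow> (\<forall>i. int i - int (\<mu> i) \<noteq> n)"
    by (rule all_cong1) (auto simp: n_def)
  also have "\<dots> \<longleftrightarrow> (\<exists>j. int (conjugate \<mu> j) - int j - 1 = n)"
  proof
    assume no: "\<forall>i. int i - int (\<mu> i) \<noteq> n"
    define i where "i = (LEAST i. n \<le> int i - int (\<mu> i))"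
    obtain k where k: "\<And>i. k \<le> i \<Longrightarrow> \<mu> i = 0" using partitions_bound[OF \<mu>] by blast
    have "n \<le> int (max k (nat n)) - int (\<mu> (max k (nat n)))" using k[of "max k (nat n)"] by simp
    then have i: "n \<le> int i - int (\<mu> i)" unfolding i_def by (rule LeastI)
    then have gt: "n < int i - int (\<mu> i)" using no by (metis order_le_less)
    define j where "j = nat (int i - 1 - n)"
    have j: "int j = int i - 1 - n" using gt by (simp add: j_def)
    have "\<not> j < \<mu> i" using gt j by linarith
    then have "\<not> i < conjugate \<mu> j" using conjugate_iff[OF \<mu>] by simp
    moreover have "i' < conjugate \<mu> j" if "i = Suc i'" for i'
    proof -
      have "\<not> n \<le> int i' - int (\<mu> i')"
        using not_less_Least[of i' "\<lambda>i. n \<le> int i - int (\<mu> i)"] that unfolding i_def by simp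
      then have "j < \<mu> i'" using j that by linarith
      then show ?thesis using conjugate_iff[OF \<mu>] by simp
    qed
    ultimately have "conjugate \<mu> j = i" by (cases i) (auto simp: not_less less_Suc_eq_le le_antisym Suc_le_eq)
    then show "\<exists>j. int (conjugate \<mu> j) - int j - 1 = n" using j by (intro exI[of _ j]) simp
  next
    assume "\<exists>j. int (conjugate \<mu> j) - int j - 1 = n"
    then show "\<forall>i. int i - int (\<mu> i) \<noteq> n" using mayaP_disjoint[OF \<mu>] by metis
  qed
  also have "\<dots> \<longleftrightarrow> (\<exists>j. m = int j + s - int (conjugate \<mu> j))"
    by (rule ex_cong1) (auto simp: n_def)
  also have "\<dots> \<longleftrightarrow> m \<in> mayaP (- s) (conjugate \<mu>)"
    by (simp add: mayaP_def image_iff)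
  finally show "m \<in> cj (mayaP s \<mu>) \<longleftrightarrow> m \<in> mayaP (- s) (conjugate \<mu>)" .
qed

lemma ent_nb_between:
  assumes V: "V \<in> maya" and k: "1 \<le> k"
  shows "ent (nb p k) U V = (if p \<in> V \<and> p + k \<notin> V \<and> U = insert (p + k) (V - {p})
     then (-1) ^ card {m \<in> V. p < m \<and> m < p + k} else 0)"
proof -
  have 1: "ent (nb p k) U V = ent (cre (p + k) * ann (- p)) U V" using k by (simp add: nb_def)
  have "{m \<in> V - {p}. m < p + k} = {m \<in> V. m < p} \<union> {m \<in> V. p < m \<and> m < p + k}" using k by auto
  moreover have "finite {m \<in> V. p < m \<and> m < p + k}" by (rule finite_subset[of _ "{p..p + k}"]) auto
  ultimately have "card {m \<in> V - {p}. m < p + k} = card {m \<in> V. m < p} + card {m \<in> V. p < m \<and> m < p + k}"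
    using maya_finite_below[OF V] by (simp add: card_Un_disjoint disjoint_iff)
  then have 2: "(-1::complex) ^ (card {m \<in> V. m < p} + card {m \<in> V - {p}. m < p + k})
      = (-1) ^ card {m \<in> V. p < m \<and> m < p + k}"
    by (simp add: power_add left_minus_one_mult_self)
  show ?thesis unfolding 1 ent_bil[OF V] 2 using k by auto
qed

lemma ent_nb_cj:
  assumes V: "V \<in> maya" and k: "1 \<le> k"
  shows "ent (nb (- 1 - p - k) k) (cj U) (cj V) = (-1) ^ nat (k - 1) * ent (nb p k) U V"
proof -
  let ?p = "- 1 - p - k"
  have e: "?p + k = - 1 - p" by simp
  have iff: "?p \<in> cj V \<and> - 1 - p \<notin> cj V \<and> cj U = insert (- 1 - p) (cj V - {?p}) \<longleftrightarrow>
      p \<in> V \<and> p + k \<notin> V \<and> U = insert (p + k) (V - {p})"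
  proof -
    have "cj U = insert (- 1 - p) (cj V - {?p}) \<longleftrightarrow> U = cj (insert (- 1 - p) (cj V - {?p}))"
      using cj_cj by metis
    moreover have "cj (insert (- 1 - p) (cj V - {?p})) = (V - {p}) \<union> {p + k}"
      using k by (auto simp: cj_def)
    ultimately show ?thesis by (auto simp: cj_def)
  qed
  show ?thesis
  proof (cases "p \<in> V \<and> p + k \<notin> V \<and> U = insert (p + k) (V - {p})")
    case True
    let ?A = "{m \<in> V. p < m \<and> m < p + k}" and ?B = "{m. m \<notin> V \<and> p < m \<and> m < p + k}"
    have A: "card {m \<in> cj V. ?p < m \<and> m < - 1 - p} = card ?B"
      by (rule bij_betw_same_card[of "\<lambda>m. - 1 - m"], rule bij_betw_byWitness[where f'="\<lambda>m. - 1 - m"])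
         (auto simp: cj_def)
    have "finite ?A" "finite ?B" by (rule finite_subset[of _ "{p..p + k}"]; auto)+
    then have "card (?A \<union> ?B) = card ?A + card ?B" by (rule card_Un_disjoint) auto
    moreover have "?A \<union> ?B = {p<..<p + k}" by auto
    ultimately have B: "nat (k - 1) = card ?A + card ?B" by simp
    have C: "(-1::complex) ^ nat (k - 1) * (-1) ^ card ?A = (-1) ^ card ?B"
      unfolding B by (simp add: power_add mult.commute mult.left_commute left_minus_one_mult_self)
    have D: "ent (nb p k) U V = (-1) ^ card ?A" using True by (simp add: ent_nb_between[OF V k])
    show ?thesis
      using True iff unfolding ent_nb_between[OF cj_maya[OF V] k] e A D C by simp
  next
    case False
    then have "ent (nb p k) U V = 0" by (simp add: ent_nb_between[OF V k])
    moreover have "ent (nb ?p k) (cj U) (cj V) = 0"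
      unfolding ent_nb_between[OF cj_maya[OF V] k] e iff by (rule if_not_P[OF False])
    ultimately show ?thesis by simp
  qed
qed

lemma ent_Jc_cj:
  assumes V: "V \<in> maya" and k: "1 \<le> k"
  shows "ent (Jc k) (cj U) (cj V) = (-1) ^ nat (k - 1) * ent (Jc k) U V"
proof -
  have "ent (Jc k) (cj U) (cj V) = (\<Sum>\<^sub>\<infinity>p. ent (nb p k) (cj U) (cj V))"
    by (simp add: Jc_def ent_Dm_infsum)
  also have "\<dots> = (\<Sum>\<^sub>\<infinity>p. ent (nb (- 1 - p - k) k) (cj U) (cj V))"
    by (rule infsum_reindex_bij_witness[where i="\<lambda>p. - 1 - p - k" and j="\<lambda>p. - 1 - p - k"]) auto
  also have "\<dots> = (-1) ^ nat (k - 1) * (\<Sum>\<^sub>\<infinity>p. ent (nb p k) U V)"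
    unfolding ent_nb_cj[OF V k] by (rule infsum_cmult_right')
  finally show ?thesis by (simp add: Jc_def ent_Dm_infsum)
qed

lemma charge_Jc: assumes "ent (Jc k) U V \<noteq> 0" shows "charge U = charge V"
proof -
  have V: "V \<in> maya" using assms ent_maya by blast
  with assms obtain p where p: "ent (nb p k) U V \<noteq> 0" by (auto simp: Jc_def ent_Dm dest!: sum_nonzeroD)
  show ?thesis
  proof (cases "k = 0")
    case True then show ?thesis using p V by (auto simp: ent_nb_0 split: if_splits)
  next
    case False
    then have "p \<in> V \<and> p + k \<notin> V \<and> U = insert (p + k) (V - {p})"
      using p ent_bil[OF V, of p k U] by (auto simp: nb_def ent_minus ent_zero split: if_splits)
    then show ?thesis using V by (simp add: charge_def wt_insert wt_remove maya_remove)
  qed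
qed

definition tw :: "(nat \<Rightarrow> complex) \<Rightarrow> nat \<Rightarrow> complex" where "tw c l = - ((-1) ^ l) * c l"

lemma ent_JJ_cj: "ent (JJ (tw c)) U V = ent (JJ c) (cj U) (cj V)"
proof (cases "V \<in> maya \<and> charge U = charge V")
  case True
  have e: "en (cj V) - en (cj U) = en V - en U" using True by (simp add: en_cj)
  then have lt: "en (cj U) < en (cj V) \<longleftrightarrow> en U < en V" by linarith
  show ?thesis
  proof (cases "en U < en V")
    case less: True
    have "nat (en V - en U) = Suc (nat (en V - en U - 1))" using less by simp
    then have "- ((-1::complex) ^ nat (en V - en U)) = (-1) ^ nat (en V - en U - 1)" by simp
    then show ?thesis
      using less True ent_Jc_cj[of V "en V - en U" U] by (simp add: JJ.rep_eq lt e tw_def mult_ac)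
  qed (simp add: JJ.rep_eq lt)
next
  case False
  have "ent (Jc k) U V = 0" for k using False charge_Jc ent_maya by blast
  moreover have "ent (Jc k) (cj U) (cj V) = 0" for k
    using False charge_Jc[of k "cj U" "cj V"] ent_maya[of "Jc k" "cj U" "cj V"] by (auto simp: charge_cj cj_maya_iff)
  ultimately show ?thesis by (simp add: JJ.rep_eq)
qed

lemma E_cj: "ent (E (tw c)) U V = ent (E c) (cj U) (cj V)"
proof -
  have "ent (JJ (tw c) ^ n) U V = ent (JJ c ^ n) (cj U) (cj V)" for n
  proof (induction n arbitrary: U)
    case 0
    have "cj U = cj V \<longleftrightarrow> U = V" using cj_cj by metis
    then show ?case by (simp add: ent_one op_id_def cj_maya_iff)
  next
    case (Suc n)
    show ?case unfolding power_Suc ent_mult0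
      by (rule sum.reindex_bij_witness[where i=cj and j=cj])
         (auto simp: cj_cj Suc.IH ent_JJ_cj)
  qed
  then show ?thesis
    using ent_E_sum[of V "max (nat (en V)) (nat (en (cj V)))" "tw c" U]
      ent_E_sum[of "cj V" "max (nat (en V)) (nat (en (cj V)))" c "cj U"] by simp
qed

lemma charge_E: assumes "ent (E c) U V \<noteq> 0" shows "charge U = charge V"
proof -
  have "charge U = charge V" if "ent (JJ c ^ n) U V \<noteq> 0" for n U
    using that
  proof (induction n arbitrary: U)
    case 0 then show ?case by (auto simp: ent_one op_id_def split: if_splits)
  next
    case (Suc n)
    then obtain W where "ent (JJ c) U W * ent (JJ c ^ n) W V \<noteq> 0"
      unfolding power_Suc ent_mult0 by (blast dest: sum_nonzeroD)
    then show ?case using Suc.IH[of W] charge_Jc[of _ U W] by (auto simp: JJ.rep_eq split: if_splits)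
  qed
  then show ?thesis using assms by (auto simp: E.rep_eq dest!: sum_nonzeroD)
qed

section \<open>Schur functions as matrix elements\<close>

text \<open>Power sum specializations: \<open>pp\<close> for \<open>\<Gamma>\<close> and \<open>pm\<close> for \<open>\<Gamma>'\<close>.\<close>

definition pp :: "(nat \<Rightarrow> complex) \<Rightarrow> nat \<Rightarrow> complex" where "pp x l = (\<Sum>i. x i ^ l) / of_nat l"
definition pm :: "(nat \<Rightarrow> complex) \<Rightarrow> nat \<Rightarrow> complex" where "pm x = tw (pp x)"

definition wtT :: "(nat \<Rightarrow> complex) \<Rightarrow> (nat \<Rightarrow> nat) \<Rightarrow> (nat \<times> nat \<Rightarrow> nat) \<Rightarrow> complex"
  where "wtT x \<mu> T = (\<Prod>c\<in>cells \<mu>. x (T c))"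

definition ssN :: "nat \<Rightarrow> (nat \<Rightarrow> nat) \<Rightarrow> (nat \<times> nat \<Rightarrow> nat) set"
  where "ssN N \<mu> = {T \<in> ssyt \<mu>. \<forall>c\<in>cells \<mu>. T c < N}"

lemma cells_conjugate: "\<mu> \<in> partitions \<Longrightarrow> cells (conjugate \<mu>) = {(i, j). i < \<mu> j}"
  by (auto simp: cells_def conjugate_iff)

lemma finite_cells: assumes "\<mu> \<in> partitions" shows "finite (cells \<mu>)"
proof -
  obtain n where n: "\<And>i. n \<le> i \<Longrightarrow> \<mu> i = 0" using partitions_bound[OF assms] by blast
  have "cells \<mu> \<subseteq> {..<n} \<times> {..<\<mu> 0}"
  proof
    fix c assume "c \<in> cells \<mu>"
    then obtain i j where c: "c = (i, j)" "j < \<mu> i" by (auto simp: cells_def)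
    then have "i < n" using n[of i] by (cases "n \<le> i") auto
    moreover have "j < \<mu> 0" using c partition_anti[OF assms, of 0 i] by auto
    ultimately show "c \<in> {..<n} \<times> {..<\<mu> 0}" using c by simp
  qed
  then show ?thesis by (rule finite_subset) simp
qed

lemma ssN_subset: "ssN N \<mu> \<subseteq> cells \<mu> \<rightarrow>\<^sub>E {..<N}"
  by (auto simp: ssN_def ssyt_def PiE_def Pi_def extensional_def)

lemma finite_ssN: "\<mu> \<in> partitions \<Longrightarrow> finite (ssN N \<mu>)"
  by (rule finite_subset[OF ssN_subset]) (simp add: finite_PiE finite_cells)

lemma en_mayaP: assumes "\<mu> \<in> partitions" shows "en (mayaP s \<mu>) = en (ground s) + int (card (cells \<mu>))"
proof -
  obtain n where n: "\<And>i. n \<le> i \<Longrightarrow> \<mu> i = 0" using partitions_bound[OF assms] by blast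
  have "cells \<mu> = Sigma {..<n} (\<lambda>i. {..<\<mu> i})"
  proof (intro set_eqI iffI)
    fix c assume "c \<in> cells \<mu>"
    then obtain i j where c: "c = (i, j)" "j < \<mu> i" by (auto simp: cells_def)
    then have "i < n" using n[of i] by (cases "n \<le> i") auto
    then show "c \<in> Sigma {..<n} (\<lambda>i. {..<\<mu> i})" using c by simp
  qed (auto simp: cells_def)
  then have "card (cells \<mu>) = (\<Sum>i<n. \<mu> i)" by simp
  moreover have "wt (\<lambda>m. - m) (mayaP s \<mu>) = wt (\<lambda>m. - m) (ground s) + (\<Sum>i<n. - (int i - s - int (\<mu> i)) - - (int i - s))"
    by (rule wt_mayaP) (use assms n in auto)
  ultimately show ?thesis by (simp add: en_def)
qed

lemma card_cells_conjugate: assumes "\<mu> \<in> partitions" shows "card (cells (conjugate \<mu>)) = card (cells \<mu>)"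
  unfolding cells_conjugate[OF assms]
  by (rule bij_betw_same_card[of prod.swap], rule bij_betw_byWitness[where f'=prod.swap])
     (auto simp: cells_def)

lemma psize_cells: assumes "\<mu> \<in> partitions" shows "psize \<mu> = card (cells \<mu>)"
proof -
  have "cells \<mu> = Sigma {i. \<mu> i \<noteq> 0} (\<lambda>i. {..<\<mu> i})" by (auto simp: cells_def)
  then show ?thesis using assms by (simp add: psize_def partitions_def)
qed

definition VS :: "(nat \<Rightarrow> nat) \<Rightarrow> (nat \<Rightarrow> nat) set" where "VS \<mu> = {\<nu> \<in> partitions. vs \<nu> \<mu>}"

lemma finite_VS: assumes "\<mu> \<in> partitions" shows "finite (VS \<mu>)"
proof -
  have "inj_on (mayaP 0) (VS \<mu>)" using mayaP_inj by (auto simp: inj_on_def VS_def)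
  moreover have "mayaP 0 ` VS \<mu> \<subseteq> {V \<in> maya. en V \<le> en (mayaP 0 \<mu>)}"
    using vs_en[OF assms] mayaP_maya by (auto simp: VS_def)
  ultimately show ?thesis using finite_en finite_imageD finite_subset by blast
qed

text \<open>Removing the cells with the largest entry from a semistandard tableau of conjugate shape
  removes a vertical strip from \<open>\<mu>\<close>.\<close>

lemma schur_branch:
  assumes \<mu>: "\<mu> \<in> partitions"
  shows "(\<Sum>T\<in>ssN (Suc N) (conjugate \<mu>). wtT x (conjugate \<mu>) T) =
    (\<Sum>\<nu>\<in>VS \<mu>. x N ^ (card (cells \<mu>) - card (cells \<nu>)) * (\<Sum>T\<in>ssN N (conjugate \<nu>). wtT x (conjugate \<nu>) T))"
proof -
  define sh where "sh T = (\<lambda>j. card {i. i < \<mu> j \<and> T (i, j) < N})" for T :: "nat \<times> nat \<Rightarrow> nat"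
  define ext where "ext \<nu> T = (\<lambda>(i, j). if i < \<nu> j then T (i, j) else if i < \<mu> j then N else undefined)"
    for \<nu> :: "nat \<Rightarrow> nat" and T :: "nat \<times> nat \<Rightarrow> nat"
  have sub: "\<nu> j \<le> \<mu> j" "\<mu> j \<le> Suc (\<nu> j)" if "\<nu> \<in> VS \<mu>" for \<nu> j using that by (auto simp: VS_def vs_def)
  have VSp: "\<nu> \<in> partitions" if "\<nu> \<in> VS \<mu>" for \<nu> using that by (auto simp: VS_def)
  have ss: "T \<in> ssN M (conjugate \<nu>) \<longleftrightarrow> (\<forall>i j. (i < \<nu> j \<longrightarrow> T (i, j) < M) \<and> (\<not> i < \<nu> j \<longrightarrow> T (i, j) = undefined)
      \<and> (i < \<nu> (Suc j) \<longrightarrow> T (i, j) \<le> T (i, Suc j)) \<and> (Suc i < \<nu> j \<longrightarrow> T (i, j) < T (Suc i, j)))"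
    if "\<nu> \<in> partitions" for T M \<nu>
    unfolding ssN_def ssyt_def cells_conjugate[OF that] PiE_def Pi_def extensional_def by auto
  have incr: "T (i, j) < T (k, j)" if T: "T \<in> ssN M (conjugate \<nu>)" and \<nu>: "\<nu> \<in> partitions" and "i < k" "k < \<nu> j" for T M \<nu> i j k
    using that(3,4)
  proof (induction k)
    case (Suc k)
    have "T (k, j) < T (Suc k, j)" using T ss[OF \<nu>] Suc.prems by auto
    then show ?case using Suc by (cases "i = k") auto
  qed simp
  have shT: "i < \<mu> j \<Longrightarrow> T (i, j) < N \<longleftrightarrow> i < sh T j" and shle: "sh T j \<le> \<mu> j" and shge: "\<mu> j \<le> Suc (sh T j)"
    if T: "T \<in> ssN (Suc N) (conjugate \<mu>)" for T i j
  proof -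
    have init: "{i. i < \<mu> j \<and> T (i, j) < N} = {..<sh T j} \<and> \<mu> j - 1 \<le> sh T j \<and> sh T j \<le> \<mu> j"
    proof (cases "\<mu> j")
      case 0
      then show ?thesis by (simp add: sh_def)
    next
      case (Suc n)
      have "T (i, j) < N" if "i < n" for i
      proof -
        have "T (i, j) < T (n, j)" by (rule incr[OF T \<mu> that]) (simp add: Suc)
        moreover have "T (n, j) < Suc N" using T ss[OF \<mu>] Suc by auto
        ultimately show ?thesis by simp
      qed
      then have "{i. i < \<mu> j \<and> T (i, j) < N} = (if T (n, j) < N then {..<Suc n} else {..<n})"
        using Suc by (auto simp: less_Suc_eq)
      then show ?thesis unfolding sh_def Suc by auto
    qed
    show "sh T j \<le> \<mu> j" "\<mu> j \<le> Suc (sh T j)" using conjunct2[OF init] by linarith+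
    assume i: "i < \<mu> j"
    have "i \<in> {i. i < \<mu> j \<and> T (i, j) < N} \<longleftrightarrow> i \<in> {..<sh T j}"
      by (simp only: conjunct1[OF init])
    then show "T (i, j) < N \<longleftrightarrow> i < sh T j" using i by simp
  qed
  have shVS: "sh T \<in> VS \<mu>" if T: "T \<in> ssN (Suc N) (conjugate \<mu>)" for T
  proof -
    have "antimono (sh T)"
      unfolding antimono_iff_le_Suc
    proof (intro allI leI notI)
      fix j assume lt: "sh T j < sh T (Suc j)"
      have k: "sh T j < \<mu> (Suc j)" using lt shle[OF T, of "Suc j"] by simp
      then have k2: "sh T j < \<mu> j" using partition_anti[OF \<mu>, of j "Suc j"] by simp
      have "T (sh T j, Suc j) < N" using shT[OF T k] lt by simp
      moreover have "\<not> T (sh T j, j) < N" using shT[OF T k2] by simp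
      moreover have "T (sh T j, j) \<le> T (sh T j, Suc j)" using T k unfolding ss[OF \<mu>] by blast
      ultimately show False by simp
    qed
    moreover obtain n where n: "\<And>i. n \<le> i \<Longrightarrow> \<mu> i = 0" using partitions_bound[OF \<mu>] by blast
    ultimately have "sh T \<in> partitions" using shle[OF T] by (intro partitionsI[of _ n]) (metis le_zero_eq)+
    then show ?thesis using shle[OF T] shge[OF T] by (simp add: VS_def vs_def)
  qed
  have extin: "ext \<nu> T \<in> ssN (Suc N) (conjugate \<mu>)" if \<nu>: "\<nu> \<in> VS \<mu>" and T: "T \<in> ssN N (conjugate \<nu>)" for \<nu> T
    unfolding ss[OF \<mu>]
  proof (intro allI conjI impI)
    fix i j
    have T': "(i < \<nu> j \<longrightarrow> T (i, j) < N)" "(i < \<nu> (Suc j) \<longrightarrow> T (i, j) \<le> T (i, Suc j))"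
      "(Suc i < \<nu> j \<longrightarrow> T (i, j) < T (Suc i, j))" for i j
      using T unfolding ss[OF VSp[OF \<nu>]] by blast+
    have anti: "\<mu> (Suc j) \<le> \<mu> j" "\<nu> (Suc j) \<le> \<nu> j"
      using partition_anti[OF \<mu>] partition_anti[OF VSp[OF \<nu>]] by auto
    show "i < \<mu> j \<Longrightarrow> ext \<nu> T (i, j) < Suc N" using T'(1)[of i j] by (auto simp: ext_def)
    show "\<not> i < \<mu> j \<Longrightarrow> ext \<nu> T (i, j) = undefined" using sub[OF \<nu>, of j] by (auto simp: ext_def)
    show "i < \<mu> (Suc j) \<Longrightarrow> ext \<nu> T (i, j) \<le> ext \<nu> T (i, Suc j)"
      using T'(1)[of i j] T'(2)[of i j] anti by (auto simp: ext_def)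
    show "Suc i < \<mu> j \<Longrightarrow> ext \<nu> T (i, j) < ext \<nu> T (Suc i, j)"
      using T'(1)[of i j] T'(3)[of i j] sub[OF \<nu>, of j] by (auto simp: ext_def)
  qed
  have "(\<Sum>T\<in>ssN (Suc N) (conjugate \<mu>). wtT x (conjugate \<mu>) T)
      = (\<Sum>(\<nu>, T)\<in>Sigma (VS \<mu>) (\<lambda>\<nu>. ssN N (conjugate \<nu>)). x N ^ (card (cells \<mu>) - card (cells \<nu>)) * wtT x (conjugate \<nu>) T)"
  proof (rule sum.reindex_bij_witness[where i="\<lambda>(\<nu>, T). ext \<nu> T"
        and j="\<lambda>T. (sh T, \<lambda>(i, j). if i < sh T j then T (i, j) else undefined)"])
    fix T assume T: "T \<in> ssN (Suc N) (conjugate \<mu>)"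
    let ?T = "\<lambda>(i, j). if i < sh T j then T (i, j) else undefined"
    have "ext (sh T) ?T (i, j) = T (i, j)" for i j
    proof -
      have "T (i, j) < Suc N" if "i < \<mu> j" using T that unfolding ss[OF \<mu>] by blast
      moreover have "T (i, j) = undefined" if "\<not> i < \<mu> j" using T that unfolding ss[OF \<mu>] by blast
      ultimately show ?thesis using shT[OF T, of i j] shle[OF T, of j] by (auto simp: ext_def)
    qed
    then show "(case (sh T, ?T) of (\<nu>, T) \<Rightarrow> ext \<nu> T) = T" by auto
    have p: "sh T \<in> partitions" by (rule VSp[OF shVS[OF T]])
    have "?T \<in> ssN N (conjugate (sh T))"
      unfolding ss[OF p]
    proof (intro allI conjI impI)
      fix i j
      have T': "(i < \<mu> (Suc j) \<longrightarrow> T (i, j) \<le> T (i, Suc j))"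
        "(Suc i < \<mu> j \<longrightarrow> T (i, j) < T (Suc i, j))" for i j
        using T unfolding ss[OF \<mu>] by blast+
      have anti: "sh T (Suc j) \<le> sh T j" using partition_anti[OF p] by auto
      show "i < sh T j \<Longrightarrow> ?T (i, j) < N" using shT[OF T, of i j] shle[OF T, of j] by auto
      show "\<not> i < sh T j \<Longrightarrow> ?T (i, j) = undefined" by auto
      show "i < sh T (Suc j) \<Longrightarrow> ?T (i, j) \<le> ?T (i, Suc j)" using T'(1)[of i j] anti shle[OF T, of "Suc j"] by auto
      show "Suc i < sh T j \<Longrightarrow> ?T (i, j) < ?T (Suc i, j)" using T'(2)[of i j] shle[OF T, of j] by auto
    qed
    then show "(sh T, ?T) \<in> Sigma (VS \<mu>) (\<lambda>\<nu>. ssN N (conjugate \<nu>))" using shVS[OF T] by auto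
    have sub2: "cells (conjugate (sh T)) \<subseteq> cells (conjugate \<mu>)"
      unfolding cells_conjugate[OF \<mu>] cells_conjugate[OF p]
      by clarify (rule less_le_trans[OF _ shle[OF T]])
    have fin: "finite (cells (conjugate \<mu>))" by (rule finite_cells[OF conjugate_partition[OF \<mu>]])
    have "wtT x (conjugate \<mu>) T = (\<Prod>c\<in>cells (conjugate \<mu>) - cells (conjugate (sh T)). x (T c)) * (\<Prod>c\<in>cells (conjugate (sh T)). x (T c))"
      unfolding wtT_def by (rule prod.subset_diff[OF sub2 fin])
    also have "(\<Prod>c\<in>cells (conjugate \<mu>) - cells (conjugate (sh T)). x (T c)) = (\<Prod>c\<in>cells (conjugate \<mu>) - cells (conjugate (sh T)). x N)"
    proof (rule prod.cong[OF refl])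
      fix c assume "c \<in> cells (conjugate \<mu>) - cells (conjugate (sh T))"
      then obtain i j where c: "c = (i, j)" "i < \<mu> j" "\<not> i < sh T j"
        unfolding cells_conjugate[OF \<mu>] cells_conjugate[OF p] by auto
      then have "T c < Suc N" using T unfolding ss[OF \<mu>] by blast
      moreover have "\<not> T c < N" using shT[OF T c(2)] c by simp
      ultimately show "x (T c) = x N" by (simp add: less_Suc_eq)
    qed
    also have "\<dots> = x N ^ (card (cells \<mu>) - card (cells (sh T)))"
      using card_Diff_subset[OF finite_subset[OF sub2 fin] sub2]
      by (simp add: card_cells_conjugate[OF \<mu>] card_cells_conjugate[OF p])
    also have "(\<Prod>c\<in>cells (conjugate (sh T)). x (T c)) = wtT x (conjugate (sh T)) ?T"
      unfolding wtT_def cells_conjugate[OF p] by (rule prod.cong) auto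
    finally show "(case (sh T, ?T) of (\<nu>, T) \<Rightarrow> x N ^ (card (cells \<mu>) - card (cells \<nu>)) * wtT x (conjugate \<nu>) T) = wtT x (conjugate \<mu>) T"
      by simp
  next
    fix b assume "b \<in> Sigma (VS \<mu>) (\<lambda>\<nu>. ssN N (conjugate \<nu>))"
    then obtain \<nu> T where b: "b = (\<nu>, T)" "\<nu> \<in> VS \<mu>" "T \<in> ssN N (conjugate \<nu>)" by auto
    show "(case b of (\<nu>, T) \<Rightarrow> ext \<nu> T) \<in> ssN (Suc N) (conjugate \<mu>)" using extin b by simp
    have sh: "sh (ext \<nu> T) j = \<nu> j" for j
    proof -
      have "{i. i < \<mu> j \<and> ext \<nu> T (i, j) < N} = {..<\<nu> j}"
        using b(3) sub[OF b(2), of j] unfolding ss[OF VSp[OF b(2)]] by (auto simp: ext_def split: if_splits)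
      then show ?thesis by (simp add: sh_def)
    qed
    have "(\<lambda>(i, j). if i < \<nu> j then ext \<nu> T (i, j) else undefined) = T"
      using b(3) unfolding ss[OF VSp[OF b(2)]] by (auto simp: ext_def)
    then show "(sh (case b of (\<nu>, T) \<Rightarrow> ext \<nu> T), \<lambda>(i, j). if i < sh (case b of (\<nu>, T) \<Rightarrow> ext \<nu> T) j
        then (case b of (\<nu>, T) \<Rightarrow> ext \<nu> T) (i, j) else undefined) = b"
      unfolding b prod.case sh by (simp add: sh fun_eq_iff)
  qed
  also have "\<dots> = (\<Sum>\<nu>\<in>VS \<mu>. \<Sum>T\<in>ssN N (conjugate \<nu>). x N ^ (card (cells \<mu>) - card (cells \<nu>)) * wtT x (conjugate \<nu>) T)"
    by (rule sum.Sigma[symmetric]) (use finite_VS[OF \<mu>] finite_ssN conjugate_partition VSp in auto)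
  finally show ?thesis by (simp add: sum_distrib_left)
qed

lemma schurN:
  assumes "\<mu> \<in> partitions"
  shows "ent (E (\<lambda>l. \<Sum>i<N. ce (x i) l)) (ground s) (mayaP s \<mu>) = (\<Sum>T\<in>ssN N (conjugate \<mu>). wtT x (conjugate \<mu>) T)"
  using assms
proof (induction N arbitrary: \<mu>)
  case 0
  have 1: "op_id (ground s) (mayaP s \<mu>) = (if \<mu> = (\<lambda>_. 0) then 1 else 0)"
  proof (cases "\<mu> = (\<lambda>_. 0)")
    case False
    then have "ground s \<noteq> mayaP s \<mu>" using mayaP_inj[OF zero_partition 0, of s s] by (metis mayaP_0)
    then show ?thesis using False by (simp add: op_id_def)
  qed (simp add: mayaP_0 op_id_def ground_maya)
  have p: "conjugate \<mu> \<in> partitions" by (rule conjugate_partition[OF 0])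
  show ?case
  proof (cases "\<mu> = (\<lambda>_. 0)")
    case True
    then have "cells (conjugate \<mu>) = {}" using cells_conjugate[OF 0] by auto
    then have "ssN 0 (conjugate \<mu>) = {\<lambda>_. undefined}" by (auto simp: ssN_def ssyt_def)
    then show ?thesis using 1 True \<open>cells (conjugate \<mu>) = {}\<close> by (simp add: E_0 ent_one wtT_def)
  next
    case False
    then obtain j where "\<mu> j \<noteq> 0" by auto
    then have "(0, j) \<in> cells (conjugate \<mu>)" using cells_conjugate[OF 0] by auto
    then have "ssN 0 (conjugate \<mu>) = {}" by (auto simp: ssN_def)
    then show ?thesis using 1 False by (simp add: E_0 ent_one)
  qed
next
  case (Suc N)
  let ?C = "\<lambda>N. E (\<lambda>l. \<Sum>i<N. ce (x i) l)"
  have "?C (Suc N) = ?C N * E (ce (x N))"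
    using E_add[of "\<lambda>l. \<Sum>i<N. ce (x i) l" "ce (x N)"] by simp
  then have "ent (?C (Suc N)) (ground s) (mayaP s \<mu>) = ent (?C N * E (ce (x N))) (ground s) (mayaP s \<mu>)" by simp
  also have "\<dots> = (\<Sum>W\<in>mayaP s ` VS \<mu>. ent (?C N) (ground s) W * ent (E (ce (x N))) W (mayaP s \<mu>))"
  proof (rule ent_mult)
    show "finite (mayaP s ` VS \<mu>)" using finite_VS[OF Suc.prems] by simp
    fix W assume W: "W \<notin> mayaP s ` VS \<mu>"
    show "ent (E (ce (x N))) W (mayaP s \<mu>) = 0"
    proof (cases "W \<in> maya")
      case True
      have "\<not> (\<exists>\<nu>\<in>partitions. W = mayaP s \<nu> \<and> vs \<nu> \<mu>)" using W by (auto simp: VS_def)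
      then show ?thesis unfolding ent_vs[OF Suc.prems True] by (rule if_not_P)
    qed (use ent_maya in blast)
  qed
  also have "\<dots> = (\<Sum>\<nu>\<in>VS \<mu>. ent (?C N) (ground s) (mayaP s \<nu>) * ent (E (ce (x N))) (mayaP s \<nu>) (mayaP s \<mu>))"
    by (subst sum.reindex) (use mayaP_inj in \<open>auto simp: inj_on_def VS_def\<close>)
  also have "\<dots> = (\<Sum>\<nu>\<in>VS \<mu>. x N ^ (card (cells \<mu>) - card (cells \<nu>)) * (\<Sum>T\<in>ssN N (conjugate \<nu>). wtT x (conjugate \<nu>) T))"
  proof (rule sum.cong[OF refl])
    fix \<nu> assume "\<nu> \<in> VS \<mu>"
    then have \<nu>: "\<nu> \<in> partitions" "vs \<nu> \<mu>" by (auto simp: VS_def)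
    have "\<exists>\<nu>'\<in>partitions. mayaP s \<nu> = mayaP s \<nu>' \<and> vs \<nu>' \<mu>" using \<nu> by blast
    then have "ent (E (ce (x N))) (mayaP s \<nu>) (mayaP s \<mu>) = x N ^ nat (en (mayaP s \<mu>) - en (mayaP s \<nu>))"
      unfolding ent_vs[OF Suc.prems mayaP_maya[OF \<nu>(1)]] by (rule if_P)
    also have "nat (en (mayaP s \<mu>) - en (mayaP s \<nu>)) = card (cells \<mu>) - card (cells \<nu>)"
      unfolding en_mayaP[OF Suc.prems] en_mayaP[OF \<nu>(1)] by auto
    finally show "ent (?C N) (ground s) (mayaP s \<nu>) * ent (E (ce (x N))) (mayaP s \<nu>) (mayaP s \<mu>)
       = x N ^ (card (cells \<mu>) - card (cells \<nu>)) * (\<Sum>T\<in>ssN N (conjugate \<nu>). wtT x (conjugate \<nu>) T)"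
      using Suc.IH[OF \<nu>(1)] by simp
  qed
  finally show ?case unfolding schur_branch[OF Suc.prems] .
qed

lemma summable_power:
  fixes x :: "nat \<Rightarrow> complex"
  assumes "summable (\<lambda>i. norm (x i))" "1 \<le> l"
  shows "summable (\<lambda>i. norm (x i ^ l))"
proof (rule summable_comparison_test_ev[OF _ assms(1)])
  have "(\<lambda>i. norm (x i)) \<longlonglongrightarrow> 0" by (rule summable_LIMSEQ_zero) fact
  then have "\<forall>\<^sub>F i in sequentially. norm (x i) < 1" by (rule order_tendstoD) simp
  then show "\<forall>\<^sub>F i in sequentially. norm (norm (x i ^ l)) \<le> norm (x i)"
  proof eventually_elim
    fix i assume "norm (x i) < 1"
    then have "norm (x i) ^ l \<le> norm (x i) ^ 1" by (intro power_decreasing) (use assms(2) in auto)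
    then show "norm (norm (x i ^ l)) \<le> norm (x i)" by (simp add: norm_power)
  qed
qed

lemma sum_ce: "(\<Sum>i<N. ce (x i) l) = - ((-1) ^ l) * ((\<Sum>i<N. x i ^ l) / of_nat l)"
  by (simp add: ce_def sum_distrib_left sum_divide_distrib power_minus[of "x _"] flip: sum_negf)

lemma sum_ce_tendsto:
  assumes "summable (\<lambda>i. norm (x i))" "1 \<le> l"
  shows "(\<lambda>N. \<Sum>i<N. ce (x i) l) \<longlonglongrightarrow> pm x l"
  unfolding sum_ce pm_def tw_def pp_def
  by (intro tendsto_intros summable_LIMSEQ summable_norm_cancel[OF summable_power] assms)
     (use assms in auto)

lemma tw_tw: "tw (tw c) = c"
  by (rule ext) (simp add: tw_def flip: mult.assoc power_mult_distrib)

lemma tw_pm: "tw (pm x) = pp x" by (simp add: pm_def tw_tw)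

lemma has_sum_ssyt:
  assumes \<mu>: "\<mu> \<in> partitions" and x: "summable (\<lambda>i. norm (x i))"
  shows "(\<lambda>N. \<Sum>T\<in>ssN N \<mu>. wtT x \<mu> T) \<longlonglongrightarrow> schur \<mu> x"
proof -
  have fin: "finite (cells \<mu>)" by (rule finite_cells[OF \<mu>])
  have "(\<lambda>T. norm (wtT x \<mu> T)) summable_on ssyt \<mu>"
  proof (rule nonneg_bdd_above_summable_on)
    show "bdd_above (sum (\<lambda>T. norm (wtT x \<mu> T)) ` {F. F \<subseteq> ssyt \<mu> \<and> finite F})"
    proof (rule bdd_aboveI2)
      fix F assume "F \<in> {F. F \<subseteq> ssyt \<mu> \<and> finite F}"
      then have F: "F \<subseteq> ssyt \<mu>" "finite F" by auto
      define N where "N = Suc (Max (insert 0 ((\<lambda>(T, c). T c) ` (F \<times> cells \<mu>))))"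
      have fin2: "finite (insert 0 ((\<lambda>(T, c). T c) ` (F \<times> cells \<mu>)))" using F fin by auto
      have "T c < N" if "T \<in> F" "c \<in> cells \<mu>" for T c
        unfolding N_def less_Suc_eq_le by (rule Max_ge[OF fin2]) (use that in force)
      then have "F \<subseteq> cells \<mu> \<rightarrow>\<^sub>E {..<N}" using F(1) by (auto simp: ssyt_def PiE_def Pi_def subset_iff)
      then have "(\<Sum>T\<in>F. norm (wtT x \<mu> T)) \<le> (\<Sum>T\<in>cells \<mu> \<rightarrow>\<^sub>E {..<N}. norm (wtT x \<mu> T))"
        by (intro sum_mono2) (auto simp: finite_PiE fin)
      also have "\<dots> = (\<Prod>c\<in>cells \<mu>. \<Sum>i<N. norm (x i))"
        by (subst prod_sum_PiE[OF fin]) (auto simp: wtT_def prod_norm)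
      also have "\<dots> \<le> (\<Prod>c\<in>cells \<mu>. \<Sum>i. norm (x i))"
        by (intro prod_mono conjI sum_nonneg sum_le_suminf x) auto
      finally show "(\<Sum>T\<in>F. norm (wtT x \<mu> T)) \<le> (\<Prod>c\<in>cells \<mu>. \<Sum>i. norm (x i))" .
    qed
  qed simp
  then have "(\<lambda>T. wtT x \<mu> T) summable_on ssyt \<mu>" by (rule abs_summable_summable)
  then have lim: "(sum (wtT x \<mu>) \<longlongrightarrow> schur \<mu> x) (finite_subsets_at_top (ssyt \<mu>))"
    unfolding schur_def wtT_def[symmetric] by (rule infsum_tendsto)
  have "filterlim (\<lambda>N. ssN N \<mu>) (finite_subsets_at_top (ssyt \<mu>)) sequentially"
    unfolding filterlim_finite_subsets_at_top
  proof (intro allI impI)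
    fix F assume F: "finite F \<and> F \<subseteq> ssyt \<mu>"
    define N where "N = Suc (Max (insert 0 ((\<lambda>(T, c). T c) ` (F \<times> cells \<mu>))))"
    have fin2: "finite (insert 0 ((\<lambda>(T, c). T c) ` (F \<times> cells \<mu>)))" using F fin by auto
    have lt: "T c < N" if "T \<in> F" "c \<in> cells \<mu>" for T c
      unfolding N_def less_Suc_eq_le by (rule Max_ge[OF fin2]) (use that in force)
    show "\<forall>\<^sub>F M in sequentially. finite (ssN M \<mu>) \<and> F \<subseteq> ssN M \<mu> \<and> ssN M \<mu> \<subseteq> ssyt \<mu>"
      using eventually_ge_at_top[of N]
    proof eventually_elim
      fix M assume "N \<le> M"
      then show "finite (ssN M \<mu>) \<and> F \<subseteq> ssN M \<mu> \<and> ssN M \<mu> \<subseteq> ssyt \<mu>"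
        using F lt finite_ssN[OF \<mu>] by (auto simp: ssN_def subset_iff intro: less_le_trans)
    qed
  qed
  from filterlim_compose[OF lim this] show ?thesis by simp
qed

lemma schur_conjugate_E:
  assumes \<mu>: "\<mu> \<in> partitions" and x: "summable (\<lambda>i. norm (x i))"
  shows "schur (conjugate \<mu>) x = ent (E (pm x)) (ground s) (mayaP s \<mu>)"
proof (rule LIMSEQ_unique)
  show "(\<lambda>N. ent (E (\<lambda>l. \<Sum>i<N. ce (x i) l)) (ground s) (mayaP s \<mu>)) \<longlonglongrightarrow> schur (conjugate \<mu>) x"
    unfolding schurN[OF \<mu>] by (rule has_sum_ssyt[OF conjugate_partition[OF \<mu>] x])
  show "(\<lambda>N. ent (E (\<lambda>l. \<Sum>i<N. ce (x i) l)) (ground s) (mayaP s \<mu>)) \<longlonglongrightarrow> ent (E (pm x)) (ground s) (mayaP s \<mu>)"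
    by (rule E_tendsto) (rule sum_ce_tendsto[OF x])
qed

lemma conjugate_0: "conjugate (\<lambda>_. 0) = (\<lambda>_. 0)" by (rule ext) (simp add: conjugate_def)

lemma cj_ground: "cj (ground s) = ground (- s)"
  using cj_mayaP[OF zero_partition, of s] by (simp add: mayaP_0 conjugate_0)

lemma schur_E:
  assumes \<mu>: "\<mu> \<in> partitions" and x: "summable (\<lambda>i. norm (x i))"
  shows "schur \<mu> x = ent (E (pp x)) (ground s) (mayaP s \<mu>)"
  using E_cj[of "pm x" "ground s" "mayaP s \<mu>"] schur_conjugate_E[OF conjugate_partition[OF \<mu>] x, of "- s"]
  by (simp add: tw_pm cj_ground cj_mayaP[OF \<mu>] conjugate_conjugate[OF \<mu>])

section \<open>Vertex operators\<close>

lemma op_prod_E: "op_prod (map (\<lambda>i. ent (E (c i))) is) = ent (E (\<lambda>l. \<Sum>i\<leftarrow>is. c i l))"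
proof (induction "is")
  case Nil
  then show ?case by (simp add: op_prod_def E_0 one_cfm.rep_eq)
next
  case (Cons i "is")
  then show ?case by (simp add: op_prod_def E_add times_cfm.rep_eq)
qed

lemma op_prod_tr_E: "op_prod (map (\<lambda>i. tr (ent (E (c i)))) is) = tr (ent (E (\<lambda>l. \<Sum>i\<leftarrow>is. c i l)))"
proof (induction "is")
  case Nil
  then show ?case by (simp add: op_prod_def E_0 one_cfm.rep_eq tr_op_id)
next
  case (Cons i "is")
  have "(\<lambda>l. c i l + (\<Sum>i\<leftarrow>is. c i l)) = (\<lambda>l. (\<Sum>i\<leftarrow>is. c i l) + c i l)" by (simp add: add.commute)
  then show ?case using Cons by (simp add: op_prod_def op_mult_tr times_cfm.rep_eq[symmetric] E_add[symmetric])
qed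

lemma sum_list_upt: "(\<Sum>i\<leftarrow>[0..<N]. c i) = (\<Sum>i<N. c i :: complex)"
  by (simp add: interv_sum_list_conv_sum_set_nat atLeast0LessThan)

lemma vertex_pos:
  assumes "\<And>l. 1 \<le> l \<Longrightarrow> (\<lambda>N. \<Sum>i<N. c i l) \<longlonglongrightarrow> d l"
  shows "(\<lambda>U V. lim (\<lambda>N. op_prod (map (\<lambda>i. op_exp (\<lambda>U V. \<Sum>\<^sub>\<infinity>k\<in>{1..}. c i k * J (1 * int k) U V)) [0..<N]) U V))
    = ent (E d)"
proof (intro ext)
  fix U V
  have "(\<lambda>N. op_prod (map (\<lambda>i. op_exp (\<lambda>U V. \<Sum>\<^sub>\<infinity>k\<in>{1..}. c i k * J (1 * int k) U V)) [0..<N]) U V)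
    = (\<lambda>N. ent (E (\<lambda>l. \<Sum>i<N. c i l)) U V)"
    by (simp add: JJ_infsum[simplified] op_exp_JJ op_prod_E sum_list_upt)
  then show "lim (\<lambda>N. op_prod (map (\<lambda>i. op_exp (\<lambda>U V. \<Sum>\<^sub>\<infinity>k\<in>{1..}. c i k * J (1 * int k) U V)) [0..<N]) U V) = ent (E d) U V"
    using E_tendsto[OF assms, where U=U and V=V] by (simp add: limI)
qed

lemma vertex_neg:
  assumes "\<And>l. 1 \<le> l \<Longrightarrow> (\<lambda>N. \<Sum>i<N. c i l) \<longlonglongrightarrow> d l"
  shows "(\<lambda>U V. lim (\<lambda>N. op_prod (map (\<lambda>i. op_exp (\<lambda>U V. \<Sum>\<^sub>\<infinity>k\<in>{1..}. c i k * J (- 1 * int k) U V)) [0..<N]) U V))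
    = tr (ent (E d))"
proof (intro ext)
  fix U V
  have "(\<lambda>U V. \<Sum>\<^sub>\<infinity>k\<in>{1..}. c i k * J (- 1 * int k) U V) = tr (ent (JJ (c i)))" for i
    by (intro ext) (simp add: J_neg_tr tr_def JJ_infsum[simplified])
  then have "(\<lambda>N. op_prod (map (\<lambda>i. op_exp (\<lambda>U V. \<Sum>\<^sub>\<infinity>k\<in>{1..}. c i k * J (- 1 * int k) U V)) [0..<N]) U V)
    = (\<lambda>N. tr (ent (E (\<lambda>l. \<Sum>i<N. c i l))) U V)"
    by (simp add: op_exp_tr op_exp_JJ op_prod_tr_E sum_list_upt)
  then show "lim (\<lambda>N. op_prod (map (\<lambda>i. op_exp (\<lambda>U V. \<Sum>\<^sub>\<infinity>k\<in>{1..}. c i k * J (- 1 * int k) U V)) [0..<N]) U V) = tr (ent (E d)) U V"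
    using E_tendsto[OF assms, where U=V and V=U] by (simp add: limI tr_def)
qed

lemma sum_pp_tendsto:
  assumes "summable (\<lambda>i. norm (x i))" "1 \<le> l"
  shows "(\<lambda>N. \<Sum>i<N. x i ^ l / of_nat l) \<longlonglongrightarrow> pp x l"
  unfolding sum_divide_distrib[symmetric] pp_def
  by (intro tendsto_intros summable_LIMSEQ summable_norm_cancel[OF summable_power] assms)
     (use assms in auto)

lemma Gamma_pos: "summable (\<lambda>i. norm (x i)) \<Longrightarrow> Gamma 1 x = ent (E (pp x))"
  unfolding Gamma_def by (intro vertex_pos sum_pp_tendsto)

lemma Gamma_neg: "summable (\<lambda>i. norm (x i)) \<Longrightarrow> Gamma (-1) x = tr (ent (E (pp x)))"
  unfolding Gamma_def by (intro vertex_neg sum_pp_tendsto)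

lemma minus_infsum: "- (\<Sum>\<^sub>\<infinity>k\<in>{1..}. (- x i) ^ k / of_nat k * J (e * int k) U V)
    = (\<Sum>\<^sub>\<infinity>k\<in>{1..}. ce (x i) k * J (e * int k) U V)"
  unfolding infsum_uminus[symmetric] by (simp add: ce_def)

lemma Gamma'_pos: "summable (\<lambda>i. norm (x i)) \<Longrightarrow> Gamma' 1 x = ent (E (pm x))"
  unfolding Gamma'_def minus_infsum by (intro vertex_pos sum_ce_tendsto)

lemma Gamma'_neg: "summable (\<lambda>i. norm (x i)) \<Longrightarrow> Gamma' (-1) x = tr (ent (E (pm x)))"
  unfolding Gamma'_def minus_infsum by (intro vertex_neg sum_ce_tendsto)

section \<open>Domination by nonnegative matrices\<close>

definition dom :: "(nat \<Rightarrow> complex) \<Rightarrow> (nat \<Rightarrow> complex) \<Rightarrow> bool"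
  where "dom c d \<longleftrightarrow> (\<forall>U V. Im (ent (E d) U V) = 0 \<and> norm (ent (E c) U V) \<le> Re (ent (E d) U V))"

lemma dom_real: "dom c d \<Longrightarrow> ent (E d) U V = of_real (Re (ent (E d) U V))"
  by (simp add: dom_def complex_eq_iff)

lemma dom_norm: "dom c d \<Longrightarrow> norm (ent (E c) U V) \<le> Re (ent (E d) U V)"
  by (simp add: dom_def)

lemma dom_nonneg: "dom c d \<Longrightarrow> 0 \<le> Re (ent (E d) U V)"
  using dom_norm[of c d U V] norm_ge_zero[of "ent (E c) U V"] by linarith

lemma dom_self: "dom c d \<Longrightarrow> dom d d"
  unfolding dom_def by (metis abs_of_nonneg cmod_eq_Re dual_order.refl norm_ge_zero order_trans)

lemma dom_ce: "dom (ce x) (ce (of_real (norm x)))"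
  unfolding dom_def
proof (intro allI)
  fix U V
  show "Im (ent (E (ce (complex_of_real (norm x)))) U V) = 0 \<and>
      norm (ent (E (ce x)) U V) \<le> Re (ent (E (ce (complex_of_real (norm x)))) U V)"
  proof (cases "U \<in> maya \<and> V \<in> maya")
    case True
    then obtain s \<mu> where \<mu>: "\<mu> \<in> partitions" "V = mayaP s \<mu>" using maya_mayaP by metis
    have U: "U \<in> maya" using True by simp
    show ?thesis unfolding \<mu>(2) ent_vs[OF \<mu>(1) U]
      by (auto simp: norm_power simp flip: of_real_power)
  next
    case False
    then have "ent (E c) U V = 0" for c using ent_maya by blast
    then show ?thesis by simp
  qed
qed

lemma dom_tw: "dom c d \<Longrightarrow> dom (tw c) (tw d)"
  by (simp add: dom_def E_cj)

lemma dom_zero: "dom (\<lambda>_. 0) (\<lambda>_. 0)"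
  by (simp add: dom_def E_0 ent_one op_id_def)

lemma dom_add: assumes "dom c c'" "dom d d'" shows "dom (\<lambda>l. c l + d l) (\<lambda>l. c' l + d' l)"
  unfolding dom_def
proof (intro allI)
  fix U V
  let ?S = "{W \<in> maya. en W \<le> en V}"
  have *: "ent (E (\<lambda>l. c l + d l)) U V = (\<Sum>W\<in>?S. ent (E c) U W * ent (E d) W V)" for c d
    unfolding E_add by (rule ent_mult) (use finite_en E_lower in auto)
  have r: "(\<Sum>W\<in>?S. ent (E c') U W * ent (E d') W V)
      = of_real (\<Sum>W\<in>?S. Re (ent (E c') U W) * Re (ent (E d') W V))"
    unfolding of_real_sum of_real_mult using dom_real[OF assms(1)] dom_real[OF assms(2)] by simp
  have "norm (\<Sum>W\<in>?S. ent (E c) U W * ent (E d) W V) \<le> (\<Sum>W\<in>?S. norm (ent (E c) U W * ent (E d) W V))"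
    by (rule norm_sum)
  also have "\<dots> \<le> (\<Sum>W\<in>?S. Re (ent (E c') U W) * Re (ent (E d') W V))"
    unfolding norm_mult
    by (intro sum_mono mult_mono dom_norm[OF assms(1)] dom_norm[OF assms(2)] dom_nonneg[OF assms(1)] norm_ge_zero)
  finally show "Im (ent (E (\<lambda>l. c' l + d' l)) U V) = 0 \<and>
      norm (ent (E (\<lambda>l. c l + d l)) U V) \<le> Re (ent (E (\<lambda>l. c' l + d' l)) U V)"
    unfolding * r by simp
qed

lemma dom_sum: "(\<And>i. i < N \<Longrightarrow> dom (c i) (d i)) \<Longrightarrow> dom (\<lambda>l. \<Sum>i<N. c i l) (\<lambda>l. \<Sum>i<N. d i l)" for N :: nat
  by (induction N) (auto intro: dom_zero dom_add)

lemma dom_lim: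
  assumes "\<And>N. dom (c N) (d N)" "\<And>l. 1 \<le> l \<Longrightarrow> (\<lambda>N. c N l) \<longlonglongrightarrow> c' l" "\<And>l. 1 \<le> l \<Longrightarrow> (\<lambda>N. d N l) \<longlonglongrightarrow> d' l"
  shows "dom c' d'"
  unfolding dom_def
proof (intro allI conjI)
  fix U V
  have c: "(\<lambda>N. norm (ent (E (c N)) U V)) \<longlonglongrightarrow> norm (ent (E c') U V)"
    by (intro tendsto_norm E_tendsto assms)
  have d: "(\<lambda>N. ent (E (d N)) U V) \<longlonglongrightarrow> ent (E d') U V"
    by (intro E_tendsto assms)
  have "(\<lambda>N. Im (ent (E (d N)) U V)) \<longlonglongrightarrow> Im (ent (E d') U V)" by (intro tendsto_intros d)
  moreover have "Im (ent (E (d N)) U V) = 0" for N using assms(1) by (simp add: dom_def)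
  ultimately show "Im (ent (E d') U V) = 0" by (simp add: LIMSEQ_const_iff)
  show "norm (ent (E c') U V) \<le> Re (ent (E d') U V)"
    by (rule LIMSEQ_le[OF c tendsto_Re[OF d]]) (use assms(1) in \<open>auto simp: dom_def\<close>)
qed

lemma dom_pm:
  assumes "summable (\<lambda>i. norm (x i))"
  shows "dom (pm x) (pm (\<lambda>i. of_real (norm (x i))))"
proof (rule dom_lim)
  show "dom (\<lambda>l. \<Sum>i<N. ce (x i) l) (\<lambda>l. \<Sum>i<N. ce (of_real (norm (x i))) l)" for N
    by (intro dom_sum dom_ce)
qed (auto intro!: sum_ce_tendsto assms)

lemma dom_pp:
  assumes "summable (\<lambda>i. norm (x i))"
  shows "dom (pp x) (pp (\<lambda>i. of_real (norm (x i))))"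
  using dom_tw[OF dom_pm[OF assms]] by (simp add: tw_pm)

lemma dom_scale: "dom c d \<Longrightarrow> dom (\<lambda>l. x ^ l * c l) (\<lambda>l. of_real (norm x) ^ l * d l)"
  unfolding dom_def E_scale
  by (auto simp: norm_mult norm_power mult_left_mono simp flip: of_real_power)

section \<open>The Heisenberg commutation relation\<close>

text \<open>\<open>expc g\<close> are the coefficients of the formal power series \<open>exp (\<Sum>l\<ge>1. g l * w ^ l)\<close>.\<close>

fun expc :: "(nat \<Rightarrow> complex) \<Rightarrow> nat \<Rightarrow> complex" where
  "expc g 0 = 1"
| "expc g (Suc n) = (\<Sum>l\<le>n. of_nat (Suc l) * g (Suc l) * expc g (n - l)) / of_nat (Suc n)"

lemma expc_rec: "of_nat n * expc g n = (\<Sum>l=1..n. of_nat l * g l * expc g (n - l))"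
proof (cases n)
  case (Suc m)
  have "(\<Sum>l=1..Suc m. of_nat l * g l * expc g (Suc m - l)) = (\<Sum>l\<le>m. of_nat (Suc l) * g (Suc l) * expc g (m - l))"
    by (rule sum.reindex_bij_witness[where i=Suc and j="\<lambda>l. l - 1"]) auto
  then show ?thesis unfolding Suc expc.simps by (simp del: of_nat_Suc)
qed simp

definition lev :: "int \<Rightarrow> int set set" where "lev e = {W \<in> maya. en W = e}"

lemma finite_lev: "finite (lev e)"
  by (rule finite_subset[OF _ finite_en[of e]]) (auto simp: lev_def)

definition Fe :: "(nat \<Rightarrow> complex) \<Rightarrow> (nat \<Rightarrow> complex) \<Rightarrow> int \<Rightarrow> int set \<Rightarrow> int set \<Rightarrow> complex"
  where "Fe c d e U Z = (\<Sum>W\<in>lev e. ent (E c) U W * ent (E d) Z W)"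

definition Ne :: "(nat \<Rightarrow> complex) \<Rightarrow> (nat \<Rightarrow> complex) \<Rightarrow> int \<Rightarrow> int set \<Rightarrow> int set \<Rightarrow> complex"
  where "Ne c d e U Z = (\<Sum>W\<in>lev (en U + en Z - e). ent (E d) W U * ent (E c) W Z)"

lemma ent_Jc_z: "\<not> (U \<in> maya \<and> V \<in> maya \<and> en U = en V - k) \<Longrightarrow> ent (Jc k) U V = 0"
  using homogD[OF homog_Jc, of k U V] ent_maya[of "Jc k" U V] by blast

lemma deg_E_sum:
  assumes L: "nat (en V - en U) \<le> L"
  shows "of_int (en V - en U) * ent (E d) U V = (\<Sum>l=1..L. of_nat l * d l * ent (E d * Jc (int l)) U V)"
proof -
  let ?S = "{W \<in> maya. en W \<le> en V}"
  have JE: "JJ (\<lambda>l. of_nat l * d l) * E d = E d * JJ (\<lambda>l. of_nat l * d l)"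
    by (rule E_commute) (rule JJ_JJ)
  have hom: "ent (Jc (int l)) W V = 0" if "W \<notin> ?S" for l W
    by (rule ent_Jc_z) (use that in auto)
  have "of_int (en V - en U) * ent (E d) U V = ent (E d * JJ (\<lambda>l. of_nat l * d l)) U V"
    using arg_cong[OF deg_E[of d], of "\<lambda>A. ent A U V"] by (simp add: ent_deg JE)
  also have "\<dots> = (\<Sum>W\<in>?S. ent (E d) U W * ent (JJ (\<lambda>l. of_nat l * d l)) W V)"
    by (rule ent_mult) (use finite_en JJ_lower ent_maya in force)+
  also have "\<dots> = (\<Sum>W\<in>?S. ent (E d) U W * ent (\<Sum>l=1..L. sc (of_nat l * d l) (Jc (int l))) W V)"
  proof (rule sum.cong[OF refl])
    fix W
    show "ent (E d) U W * ent (JJ (\<lambda>l. of_nat l * d l)) W V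
        = ent (E d) U W * ent (\<Sum>l=1..L. sc (of_nat l * d l) (Jc (int l))) W V"
    proof (cases "ent (E d) U W = 0")
      case False
      then have "en U \<le> en W" using E_lower by blast
      then have "nat (en V - en W) \<le> L" using L by linarith
      then show ?thesis using ent_JJ_sum by simp
    qed simp
  qed
  also have "\<dots> = (\<Sum>l=1..L. of_nat l * d l * (\<Sum>W\<in>?S. ent (E d) U W * ent (Jc (int l)) W V))"
    by (simp add: ent_sum ent_sc sum_distrib_left mult_ac sum.swap[of _ ?S])
  also have "\<dots> = (\<Sum>l=1..L. of_nat l * d l * ent (E d * Jc (int l)) U V)"
    by (intro sum.cong arg_cong2[where f="(*)"] refl ent_mult[symmetric]) (use finite_en hom in auto)
  finally show ?thesis .
qed

lemma ent_E_Jc: "ent (E d * Jc (int l)) U V = (\<Sum>X\<in>lev (en V - int l). ent (E d) U X * ent (Jc (- int l)) V X)"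
  by (subst ent_mult[where S="lev (en V - int l)"])
     (auto simp: finite_lev[unfolded lev_def] lev_def ent_Jc_tr[of "- int l"] intro!: ent_Jc_z)

lemma Fe_rec:
  assumes L: "nat (e - en Z) \<le> L"
  shows "of_int (e - en Z) * Fe c d e U Z =
    (\<Sum>l=1..L. of_nat l * d l * ((\<Sum>Y\<in>lev (en U - int l). ent (Jc (- int l)) U Y * Fe c d (e - int l) Y Z)
      + of_nat l * c l * Fe c d (e - int l) U Z))"
proof -
  have "of_int (e - en Z) * Fe c d e U Z = (\<Sum>W\<in>lev e. ent (E c) U W * (of_int (en W - en Z) * ent (E d) Z W))"
    unfolding Fe_def sum_distrib_left by (rule sum.cong) (auto simp: lev_def mult_ac)
  also have "\<dots> = (\<Sum>W\<in>lev e. ent (E c) U W * (\<Sum>l=1..L. of_nat l * d l * ent (E d * Jc (int l)) Z W))"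
  proof (rule sum.cong[OF refl])
    fix W assume "W \<in> lev e"
    then have "nat (en W - en Z) \<le> L" using L by (simp add: lev_def)
    then show "ent (E c) U W * (of_int (en W - en Z) * ent (E d) Z W)
      = ent (E c) U W * (\<Sum>l=1..L. of_nat l * d l * ent (E d * Jc (int l)) Z W)"
      using deg_E_sum by simp
  qed
  also have "\<dots> = (\<Sum>l=1..L. of_nat l * d l * (\<Sum>W\<in>lev e. ent (E c) U W * ent (E d * Jc (int l)) Z W))"
    by (simp add: sum_distrib_left mult_ac sum.swap[of _ "lev e"])
  also have "\<dots> = (\<Sum>l=1..L. of_nat l * d l * ((\<Sum>Y\<in>lev (en U - int l). ent (Jc (- int l)) U Y * Fe c d (e - int l) Y Z)
      + of_nat l * c l * Fe c d (e - int l) U Z))"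
  proof (intro sum.cong arg_cong2[where f="(*)"] refl)
    fix l assume l: "l \<in> {1..L}"
    have "(\<Sum>W\<in>lev e. ent (E c) U W * ent (E d * Jc (int l)) Z W)
        = (\<Sum>W\<in>lev e. \<Sum>X\<in>lev (e - int l). ent (E c) U W * (ent (E d) Z X * ent (Jc (- int l)) W X))"
      by (rule sum.cong) (auto simp: ent_E_Jc sum_distrib_left lev_def)
    also have "\<dots> = (\<Sum>X\<in>lev (e - int l). ent (E d) Z X * (\<Sum>W\<in>lev e. ent (E c) U W * ent (Jc (- int l)) W X))"
      by (subst sum.swap) (simp add: sum_distrib_left mult_ac)
    also have "\<dots> = (\<Sum>X\<in>lev (e - int l). ent (E d) Z X * ent (E c * Jc (- int l)) U X)"
    proof (intro sum.cong arg_cong2[where f="(*)"] refl ent_mult[symmetric] finite_lev)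
      fix X W assume "X \<in> lev (e - int l)" "W \<notin> lev e"
      then show "ent (Jc (- int l)) W X = 0"
        by (intro ent_Jc_z) (auto simp: lev_def)
    qed
    also have "\<dots> = (\<Sum>X\<in>lev (e - int l). ent (E d) Z X * (ent (Jc (- int l) * E c) U X + of_nat l * c l * ent (E c) U X))"
      using l by (simp add: E_Jc_neg distrib_right ent_plus sc_mult_left ent_sc)
    also have "\<dots> = (\<Sum>X\<in>lev (e - int l). ent (E d) Z X * ((\<Sum>Y\<in>lev (en U - int l). ent (Jc (- int l)) U Y * ent (E c) Y X) + of_nat l * c l * ent (E c) U X))"
    proof (intro sum.cong arg_cong2[where f="(*)"] arg_cong2[where f="(+)"] refl)
      fix X
      show "ent (Jc (- int l) * E c) U X = (\<Sum>Y\<in>lev (en U - int l). ent (Jc (- int l)) U Y * ent (E c) Y X)"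
      proof -
        have "ent (Jc (- int l) * E c) U X = (\<Sum>Y\<in>{Y. ent (E c) Y X \<noteq> 0}. ent (Jc (- int l)) U Y * ent (E c) Y X)"
          by (rule ent_mult0)
        also have "\<dots> = (\<Sum>Y\<in>lev (en U - int l). ent (Jc (- int l)) U Y * ent (E c) Y X)"
        proof (rule sum.mono_neutral_cong)
          fix Y assume "Y \<in> {Y. ent (E c) Y X \<noteq> 0} - lev (en U - int l)"
          then show "ent (Jc (- int l)) U Y * ent (E c) Y X = 0"
            using ent_Jc_z[of U Y "- int l"] by (auto simp: lev_def)
        qed (auto simp: finite_lev ent_finite)
        finally show ?thesis .
      qed
    qed
    also have "\<dots> = (\<Sum>Y\<in>lev (en U - int l). ent (Jc (- int l)) U Y * Fe c d (e - int l) Y Z)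
      + of_nat l * c l * Fe c d (e - int l) U Z"
      by (simp add: distrib_left sum.distrib sum_distrib_left Fe_def mult_ac sum.swap[of _ "lev (e - int l)"])
    finally show "(\<Sum>W\<in>lev e. ent (E c) U W * ent (E d * Jc (int l)) Z W)
       = (\<Sum>Y\<in>lev (en U - int l). ent (Jc (- int l)) U Y * Fe c d (e - int l) Y Z)
      + of_nat l * c l * Fe c d (e - int l) U Z" .
  qed
  finally show ?thesis .
qed

lemma Ne_rec:
  assumes L: "nat (e - en Z) \<le> L"
  shows "of_int (e - en Z) * Ne c d e U Z =
    (\<Sum>l=1..L. of_nat l * d l * (\<Sum>Y\<in>lev (en U - int l). ent (Jc (- int l)) U Y * Ne c d (e - int l) Y Z))"
proof -
  let ?S = "lev (en U + en Z - e)"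
  have "of_int (e - en Z) * Ne c d e U Z = (\<Sum>W\<in>?S. of_int (en U - en W) * ent (E d) W U * ent (E c) W Z)"
    unfolding Ne_def sum_distrib_left by (rule sum.cong) (auto simp: lev_def mult_ac)
  also have "\<dots> = (\<Sum>W\<in>?S. (\<Sum>l=1..L. of_nat l * d l * ent (E d * Jc (int l)) W U) * ent (E c) W Z)"
  proof (rule sum.cong[OF refl])
    fix W assume "W \<in> ?S"
    then have "nat (en U - en W) \<le> L" using L by (simp add: lev_def)
    then show "of_int (en U - en W) * ent (E d) W U * ent (E c) W Z
      = (\<Sum>l=1..L. of_nat l * d l * ent (E d * Jc (int l)) W U) * ent (E c) W Z"
      using deg_E_sum by simp
  qed
  also have "\<dots> = (\<Sum>l=1..L. of_nat l * d l * (\<Sum>W\<in>?S. ent (E d * Jc (int l)) W U * ent (E c) W Z))"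
    by (simp add: sum_distrib_left sum_distrib_right mult_ac sum.swap[of _ ?S])
  also have "\<dots> = (\<Sum>l=1..L. of_nat l * d l * (\<Sum>Y\<in>lev (en U - int l). ent (Jc (- int l)) U Y * Ne c d (e - int l) Y Z))"
  proof (rule sum.cong[OF refl])
    fix l assume l: "l \<in> {1..L}"
    have "(\<Sum>W\<in>?S. ent (E d * Jc (int l)) W U * ent (E c) W Z)
       = (\<Sum>Y\<in>lev (en U - int l). ent (Jc (- int l)) U Y * (\<Sum>W\<in>?S. ent (E d) W Y * ent (E c) W Z))"
      by (simp add: ent_E_Jc sum_distrib_left sum_distrib_right mult_ac sum.swap[of _ ?S])
    also have "\<dots> = (\<Sum>Y\<in>lev (en U - int l). ent (Jc (- int l)) U Y * Ne c d (e - int l) Y Z)"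
    proof (rule sum.cong[OF refl])
      fix Y assume "Y \<in> lev (en U - int l)"
      then have "en Y + en Z - (e - int l) = en U + en Z - e" by (simp add: lev_def)
      then show "ent (Jc (- int l)) U Y * (\<Sum>W\<in>?S. ent (E d) W Y * ent (E c) W Z)
        = ent (Jc (- int l)) U Y * Ne c d (e - int l) Y Z" by (simp only: Ne_def)
    qed
    finally show "of_nat l * d l * (\<Sum>W\<in>?S. ent (E d * Jc (int l)) W U * ent (E c) W Z)
       = of_nat l * d l * (\<Sum>Y\<in>lev (en U - int l). ent (Jc (- int l)) U Y * Ne c d (e - int l) Y Z)" by simp
  qed
  finally show ?thesis .
qed

lemma Ne_0: "e < en Z \<Longrightarrow> Ne c d e U Z = 0"
  unfolding Ne_def by (rule sum.neutral) (use E_lower in \<open>fastforce simp: lev_def\<close>)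

lemma Fe_Ne:
  assumes "U \<in> maya" "Z \<in> maya" "nat (e - en Z) \<le> M"
  shows "Fe c d e U Z = (\<Sum>n\<le>M. expc (\<lambda>l. of_nat l * c l * d l) n * Ne c d (e - int n) U Z)"
  using assms
proof (induction "nat (e - en Z)" arbitrary: e U rule: less_induct)
  case less
  let ?h = "expc (\<lambda>l. of_nat l * c l * d l)"
  let ?G = "\<lambda>e U. \<Sum>n\<le>M. ?h n * Ne c d (e - int n) U Z"
  have U: "U \<in> maya" and Z: "Z \<in> maya" and M: "nat (e - en Z) \<le> M" by fact+
  consider "e < en Z" | "e = en Z" | "en Z < e" by linarith
  then show ?case
  proof cases
    case 1
    have "Fe c d e U Z = 0" unfolding Fe_def
      by (rule sum.neutral) (use E_lower 1 in \<open>fastforce simp: lev_def\<close>)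
    moreover have "?G e U = 0" using 1 by (intro sum.neutral) (auto intro!: Ne_0)
    ultimately show ?thesis by simp
  next
    case 2
    have "Fe c d e U Z = (\<Sum>W\<in>lev e. if W = Z then ent (E c) U Z else 0)"
      unfolding Fe_def by (rule sum.cong) (auto simp: lev_def 2 E_diag op_id_def Z)
    also have "\<dots> = ent (E c) U Z" using Z by (simp add: finite_lev) (simp add: lev_def 2)
    finally have F: "Fe c d e U Z = ent (E c) U Z" .
    have "Ne c d e U Z = (\<Sum>W\<in>lev (en U). if W = U then ent (E c) U Z else 0)"
      unfolding Ne_def by (rule sum.cong) (auto simp: lev_def 2 E_diag op_id_def U)
    also have "\<dots> = ent (E c) U Z" using U by (simp add: finite_lev) (simp add: lev_def)
    finally have N: "Ne c d e U Z = ent (E c) U Z" .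
    have "?G e U = (\<Sum>n\<in>{0}. ?h n * Ne c d (e - int n) U Z)"
      by (rule sum.mono_neutral_right) (use 2 in \<open>auto intro!: Ne_0\<close>)
    then show ?thesis using F N by simp
  next
    case 3
    have IH: "Fe c d (e - int l) Y Z = ?G (e - int l) Y" if "Y \<in> maya" "1 \<le> l" for Y l
      using less.hyps[of "e - int l" Y] that 3 Z M by auto
    have split: "of_nat n * ?h n = (\<Sum>l=1..n. of_nat l * (of_nat l * c l * d l) * ?h (n - l))" for n
      by (rule expc_rec)
    have b: "(\<Sum>n\<le>M. of_nat n * ?h n * Ne c d (e - int n) U Z)
        = (\<Sum>l=1..M. of_nat l * d l * (of_nat l * c l * ?G (e - int l) U))"
    proof -
      have "(\<Sum>n\<le>M. of_nat n * ?h n * Ne c d (e - int n) U Z)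
          = (\<Sum>n\<le>M. \<Sum>l=1..n. of_nat l * d l * (of_nat l * c l) * ?h (n - l) * Ne c d (e - int n) U Z)"
        unfolding split sum_distrib_right by (intro sum.cong) (auto simp: mult_ac)
      also have "\<dots> = (\<Sum>(n, l)\<in>Sigma {..M} (\<lambda>n. {1..n}). of_nat l * d l * (of_nat l * c l) * ?h (n - l) * Ne c d (e - int n) U Z)"
        by (rule sum.Sigma) auto
      also have "\<dots> = (\<Sum>(l, k)\<in>Sigma {1..M} (\<lambda>l. {..M - l}). of_nat l * d l * (of_nat l * c l) * ?h k * Ne c d (e - int l - int k) U Z)"
        by (rule sum.reindex_bij_witness[where i="\<lambda>(l, k). (l + k, l)" and j="\<lambda>(n, l). (l, n - l)"])
           (auto simp: algebra_simps of_nat_diff)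
      also have "\<dots> = (\<Sum>l=1..M. \<Sum>k\<le>M - l. of_nat l * d l * (of_nat l * c l) * ?h k * Ne c d (e - int l - int k) U Z)"
        by (rule sum.Sigma[symmetric]) auto
      also have "\<dots> = (\<Sum>l=1..M. \<Sum>k\<le>M. of_nat l * d l * (of_nat l * c l) * ?h k * Ne c d (e - int l - int k) U Z)"
      proof (rule sum.cong[OF refl], rule sum.mono_neutral_left)
        fix l assume l: "l \<in> {1..M}"
        show "\<forall>k\<in>{..M} - {..M - l}. of_nat l * d l * (of_nat l * c l) * ?h k * Ne c d (e - int l - int k) U Z = 0"
        proof
          fix k assume "k \<in> {..M} - {..M - l}"
          then have "e - int l - int k < en Z" using M l by auto
          then show "of_nat l * d l * (of_nat l * c l) * ?h k * Ne c d (e - int l - int k) U Z = 0" by (simp add: Ne_0)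
        qed
      qed auto
      finally show ?thesis by (simp add: sum_distrib_left mult_ac)
    qed
    have a: "(\<Sum>n\<le>M. ?h n * (of_int (e - int n - en Z) * Ne c d (e - int n) U Z))
        = (\<Sum>l=1..M. of_nat l * d l * (\<Sum>Y\<in>lev (en U - int l). ent (Jc (- int l)) U Y * ?G (e - int l) Y))"
    proof -
      have N: "of_int (e - int n - en Z) * Ne c d (e - int n) U Z
          = (\<Sum>l=1..M. of_nat l * d l * (\<Sum>Y\<in>lev (en U - int l). ent (Jc (- int l)) U Y * Ne c d (e - int l - int n) Y Z))" for n
      proof -
        have eq: "e - int l - int n = e - int n - int l" for l by simp
        show ?thesis unfolding eq by (rule Ne_rec) (use M in simp)
      qed
      have "(\<Sum>n\<le>M. ?h n * (of_int (e - int n - en Z) * Ne c d (e - int n) U Z))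
         = (\<Sum>n\<le>M. \<Sum>l=1..M. \<Sum>Y\<in>lev (en U - int l). of_nat l * d l * (ent (Jc (- int l)) U Y * (?h n * Ne c d (e - int l - int n) Y Z)))"
        unfolding N by (simp add: sum_distrib_left mult_ac)
      also have "\<dots> = (\<Sum>l=1..M. \<Sum>n\<le>M. \<Sum>Y\<in>lev (en U - int l). of_nat l * d l * (ent (Jc (- int l)) U Y * (?h n * Ne c d (e - int l - int n) Y Z)))"
        by (rule sum.swap)
      also have "\<dots> = (\<Sum>l=1..M. \<Sum>Y\<in>lev (en U - int l). \<Sum>n\<le>M. of_nat l * d l * (ent (Jc (- int l)) U Y * (?h n * Ne c d (e - int l - int n) Y Z)))"
        by (intro sum.cong refl sum.swap)
      finally show ?thesis by (simp add: sum_distrib_left)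
    qed
    have "of_int (e - en Z) * ?G e U = (\<Sum>n\<le>M. ?h n * (of_int (e - int n - en Z) * Ne c d (e - int n) U Z))
        + (\<Sum>n\<le>M. of_nat n * ?h n * Ne c d (e - int n) U Z)"
      unfolding sum_distrib_left sum.distrib[symmetric] by (rule sum.cong) (auto simp: algebra_simps)
    also have "\<dots> = (\<Sum>l=1..M. of_nat l * d l * ((\<Sum>Y\<in>lev (en U - int l). ent (Jc (- int l)) U Y * ?G (e - int l) Y)
      + of_nat l * c l * ?G (e - int l) U))"
      unfolding a b by (simp only: distrib_left sum.distrib)
    also have "\<dots> = of_int (e - en Z) * Fe c d e U Z"
      unfolding Fe_rec[OF M]
    proof (rule sum.cong[OF refl])
      fix l assume l: "l \<in> {1..M}"
      have 1: "?G (e - int l) Y = Fe c d (e - int l) Y Z" if "Y \<in> maya" for Y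
        using IH[OF that, of l] l by simp
      have 2: "(\<Sum>Y\<in>lev (en U - int l). ent (Jc (- int l)) U Y * ?G (e - int l) Y)
          = (\<Sum>Y\<in>lev (en U - int l). ent (Jc (- int l)) U Y * Fe c d (e - int l) Y Z)"
        by (rule sum.cong[OF refl], subst 1) (simp_all add: lev_def)
      show "of_nat l * d l * ((\<Sum>Y\<in>lev (en U - int l). ent (Jc (- int l)) U Y * ?G (e - int l) Y) + of_nat l * c l * ?G (e - int l) U)
        = of_nat l * d l * ((\<Sum>Y\<in>lev (en U - int l). ent (Jc (- int l)) U Y * Fe c d (e - int l) Y Z) + of_nat l * c l * Fe c d (e - int l) U Z)"
        by (simp only: 2 1[OF U])
    qed
    finally have eq: "of_int (e - en Z) * ?G e U = of_int (e - en Z) * Fe c d e U Z" .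
    have ne: "(of_int (e - en Z) :: complex) \<noteq> 0" using 3 by (simp only: of_int_eq_0_iff)
    show ?thesis by (rule sym, rule mult_left_cancel[THEN iffD1, OF ne eq])
  qed
qed

lemma levels_sum:
  fixes f :: "int set \<Rightarrow> 'a :: comm_monoid_add"
  assumes "\<And>W. W \<in> maya \<Longrightarrow> en W < a \<Longrightarrow> f W = 0"
  shows "(\<Sum>W\<in>{W \<in> maya. en W \<le> a + int K}. f W) = (\<Sum>i\<le>K. \<Sum>W\<in>lev (a + int i). f W)"
proof (induction K)
  case 0
  have "(\<Sum>W\<in>{W \<in> maya. en W \<le> a + int 0}. f W) = (\<Sum>W\<in>lev a. f W)"
  proof (rule sum.mono_neutral_right)
    show "\<forall>W\<in>{W \<in> maya. en W \<le> a + int 0} - lev a. f W = 0"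
    proof
      fix W assume "W \<in> {W \<in> maya. en W \<le> a + int 0} - lev a"
      then have "W \<in> maya" "en W < a" by (auto simp: lev_def)
      then show "f W = 0" by (rule assms)
    qed
  qed (auto simp: finite_en lev_def)
  then show ?case by simp
next
  case (Suc K)
  have "{W \<in> maya. en W \<le> a + int (Suc K)} = {W \<in> maya. en W \<le> a + int K} \<union> lev (a + int (Suc K))"
    by (auto simp: lev_def)
  then have "(\<Sum>W\<in>{W \<in> maya. en W \<le> a + int (Suc K)}. f W)
      = (\<Sum>W\<in>{W \<in> maya. en W \<le> a + int K}. f W) + (\<Sum>W\<in>lev (a + int (Suc K)). f W)"
    by (simp only:) (rule sum.union_disjoint[OF finite_en finite_lev], auto simp: lev_def)
  then show ?case using Suc.IH by simp
qed

lemma sum_Ne: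
  assumes "U \<in> maya" "Z \<in> maya"
  shows "(\<lambda>j. Ne c d (en Z + int j) U Z) sums (\<Sum>W\<in>{W \<in> maya. en W \<le> en U}. ent (E d) W U * ent (E c) W Z)"
    and "summable (\<lambda>j. norm (Ne c d (en Z + int j) U Z))"
proof -
  have z: "Ne c d (en Z + int j) U Z = 0" if "j \<notin> {..nat (en U)}" for j
  proof -
    have "W \<notin> lev (en U - int j)" for W using that en_nonneg[of W] by (auto simp: lev_def)
    then have "lev (en U - int j) = {}" by blast
    then show ?thesis by (simp add: Ne_def)
  qed
  have "(\<lambda>j. Ne c d (en Z + int j) U Z) sums (\<Sum>j\<le>nat (en U). Ne c d (en Z + int j) U Z)"
    by (rule sums_finite) (use z in auto)
  also have "(\<Sum>j\<le>nat (en U). Ne c d (en Z + int j) U Z)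
      = (\<Sum>j\<le>nat (en U). \<Sum>W\<in>lev (0 + int j). ent (E d) W U * ent (E c) W Z)"
    by (rule sum.reindex_bij_witness[where i="\<lambda>j. nat (en U) - j" and j="\<lambda>j. nat (en U) - j"])
       (use en_nonneg[of U] in \<open>auto simp: Ne_def\<close>)
  also have "\<dots> = (\<Sum>W\<in>{W \<in> maya. en W \<le> 0 + int (nat (en U))}. ent (E d) W U * ent (E c) W Z)"
    by (rule levels_sum[symmetric]) (use en_nonneg in \<open>auto simp: not_less[symmetric]\<close>)
  finally show "(\<lambda>j. Ne c d (en Z + int j) U Z) sums (\<Sum>W\<in>{W \<in> maya. en W \<le> en U}. ent (E d) W U * ent (E c) W Z)"
    using en_nonneg[of U] by simp
  show "summable (\<lambda>j. norm (Ne c d (en Z + int j) U Z))"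
    by (rule summable_finite[of "{..nat (en U)}"]) (use z in auto)
qed

definition hc :: "(nat \<Rightarrow> complex) \<Rightarrow> (nat \<Rightarrow> complex) \<Rightarrow> nat \<Rightarrow> complex"
  where "hc c d l = of_nat l * c l * d l"

lemma Heis_lim:
  assumes U: "U \<in> maya" and Z: "Z \<in> maya" and h: "summable (\<lambda>n. norm (expc (hc c d) n))"
  shows "(\<lambda>K. \<Sum>W\<in>{W \<in> maya. en W \<le> en Z + int K}. ent (E c) U W * ent (E d) Z W) \<longlonglongrightarrow>
    (\<Sum>n. expc (hc c d) n) * (\<Sum>W\<in>{W \<in> maya. en W \<le> en U}. ent (E d) W U * ent (E c) W Z)"
proof -
  let ?h = "expc (hc c d)" and ?v = "\<lambda>j. Ne c d (en Z + int j) U Z"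
  have F: "Fe c d (en Z + int i) U Z = (\<Sum>n\<le>i. ?h n * ?v (i - n))" for i
  proof -
    have "Fe c d (en Z + int i) U Z = (\<Sum>n\<le>i. ?h n * Ne c d (en Z + int i - int n) U Z)"
      using Fe_Ne[OF U Z, of "en Z + int i" i c d] by (simp add: hc_def[abs_def])
    also have "\<dots> = (\<Sum>n\<le>i. ?h n * ?v (i - n))" by (rule sum.cong) (auto simp: of_nat_diff add_diff_eq)
    finally show ?thesis .
  qed
  have "(\<lambda>i. \<Sum>n\<le>i. ?h n * ?v (i - n)) sums ((\<Sum>n. ?h n) * (\<Sum>j. ?v j))"
    by (rule Cauchy_product_sums[OF h sum_Ne(2)[OF U Z]])
  then have "(\<lambda>K. \<Sum>i\<le>K. Fe c d (en Z + int i) U Z) \<longlonglongrightarrow> (\<Sum>n. ?h n) * (\<Sum>j. ?v j)"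
    unfolding F sums_def_le .
  moreover have "(\<Sum>i\<le>K. Fe c d (en Z + int i) U Z)
      = (\<Sum>W\<in>{W \<in> maya. en W \<le> en Z + int K}. ent (E c) U W * ent (E d) Z W)" for K
    unfolding Fe_def by (rule levels_sum[symmetric]) (use E_lower in fastforce)
  ultimately show ?thesis using sums_unique[OF sum_Ne(1)[OF U Z, of c d]] by simp
qed

lemma exhaust_levels:
  "filterlim (\<lambda>K. {W \<in> maya. en W \<le> a + int K}) (finite_subsets_at_top maya) sequentially"
  unfolding filterlim_finite_subsets_at_top
proof (intro allI impI)
  fix X assume X: "finite X \<and> X \<subseteq> maya"
  define K where "K = nat (Max (insert 0 (en ` X)) - a)"
  show "\<forall>\<^sub>F K in sequentially. finite {W \<in> maya. en W \<le> a + int K} \<and> X \<subseteq> {W \<in> maya. en W \<le> a + int K}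
     \<and> {W \<in> maya. en W \<le> a + int K} \<subseteq> maya"
    using eventually_ge_at_top[of K]
  proof eventually_elim
    fix K' assume K': "K \<le> K'"
    have "en W \<le> a + int K'" if "W \<in> X" for W
    proof -
      have "en W \<le> Max (insert 0 (en ` X))" by (rule Max_ge) (use X that in auto)
      then show ?thesis using K' by (simp add: K_def)
    qed
    then show "finite {W \<in> maya. en W \<le> a + int K'} \<and> X \<subseteq> {W \<in> maya. en W \<le> a + int K'}
     \<and> {W \<in> maya. en W \<le> a + int K'} \<subseteq> maya"
      using X finite_en by auto
  qed
qed

lemma summable_levels:
  assumes f: "\<And>W. W \<in> maya \<Longrightarrow> f W = complex_of_real (g W)" and g: "\<And>W. W \<in> maya \<Longrightarrow> 0 \<le> g W"
    and lim: "(\<lambda>K. \<Sum>W\<in>{W \<in> maya. en W \<le> a + int K}. f W) \<longlonglongrightarrow> L"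
  shows "g summable_on maya"
proof (rule nonneg_bdd_above_summable_on[OF g])
  obtain B where B: "\<And>K. norm (\<Sum>W\<in>{W \<in> maya. en W \<le> a + int K}. f W) \<le> B"
    using convergent_imp_Bseq[of "\<lambda>K. \<Sum>W\<in>{W \<in> maya. en W \<le> a + int K}. f W"] lim
    unfolding Bseq_def convergent_def by blast
  show "bdd_above (sum g ` {F. F \<subseteq> maya \<and> finite F})"
  proof (rule bdd_aboveI2)
    fix X assume "X \<in> {F. F \<subseteq> maya \<and> finite F}"
    then have "\<forall>\<^sub>F K in sequentially. finite {W \<in> maya. en W \<le> a + int K} \<and> X \<subseteq> {W \<in> maya. en W \<le> a + int K}
        \<and> {W \<in> maya. en W \<le> a + int K} \<subseteq> maya"
      using exhaust_levels[of a, unfolded filterlim_finite_subsets_at_top, rule_format, of X] by simp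
    then obtain K where K: "X \<subseteq> {W \<in> maya. en W \<le> a + int K}"
      using eventually_happens'[OF sequentially_bot] by blast
    have "sum g X \<le> sum g {W \<in> maya. en W \<le> a + int K}"
      by (rule sum_mono2) (use K finite_en g in auto)
    also have "\<dots> \<le> norm (complex_of_real (sum g {W \<in> maya. en W \<le> a + int K}))"
      by (simp only: norm_of_real abs_ge_self)
    also have "complex_of_real (sum g {W \<in> maya. en W \<le> a + int K}) = (\<Sum>W\<in>{W \<in> maya. en W \<le> a + int K}. f W)"
      unfolding of_real_sum by (rule sum.cong) (auto simp: f)
    also have "norm \<dots> \<le> B" by (rule B)
    finally show "sum g X \<le> B" .
  qed
qed auto

lemma Heis_pos:
  assumes U: "U \<in> maya" and Z: "Z \<in> maya" and h: "summable (\<lambda>n. norm (expc (hc c d) n))"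
    and dom: "dom c c" "dom d d"
  shows "(\<lambda>W. Re (ent (E c) U W) * Re (ent (E d) Z W)) summable_on maya"
proof (rule summable_levels[OF _ _ Heis_lim[OF U Z h]])
  fix W
  show "ent (E c) U W * ent (E d) Z W = complex_of_real (Re (ent (E c) U W) * Re (ent (E d) Z W))"
    using dom_real[OF dom(1), of U W] dom_real[OF dom(2), of Z W] by (metis of_real_mult)
  show "0 \<le> Re (ent (E c) U W) * Re (ent (E d) Z W)"
    using dom_nonneg[OF dom(1)] dom_nonneg[OF dom(2)] by simp
qed

lemma Heis:
  assumes U: "U \<in> maya" and Z: "Z \<in> maya" and h: "summable (\<lambda>n. norm (expc (hc c d) n))"
    and h': "summable (\<lambda>n. norm (expc (hc c' d') n))" and dom: "dom c c'" "dom d d'"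
  shows "(\<lambda>W. norm (ent (E c) U W * ent (E d) Z W)) summable_on maya"
    and "((\<lambda>W. ent (E c) U W * ent (E d) Z W) has_sum
      ((\<Sum>n. expc (hc c d) n) * (\<Sum>W\<in>{W \<in> maya. en W \<le> en U}. ent (E d) W U * ent (E c) W Z))) maya"
proof -
  show s: "(\<lambda>W. norm (ent (E c) U W * ent (E d) Z W)) summable_on maya"
  proof (rule summable_on_comparison_test[OF Heis_pos[OF U Z h' dom_self[OF dom(1)] dom_self[OF dom(2)]]])
    fix W
    show "norm (ent (E c) U W * ent (E d) Z W) \<le> Re (ent (E c') U W) * Re (ent (E d') Z W)"
      unfolding norm_mult by (intro mult_mono dom_norm[OF dom(1)] dom_norm[OF dom(2)] dom_nonneg[OF dom(1)] norm_ge_zero)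
  qed auto
  then have "(\<lambda>W. ent (E c) U W * ent (E d) Z W) summable_on maya" by (rule abs_summable_summable)
  then have "((\<lambda>W. ent (E c) U W * ent (E d) Z W) has_sum infsum (\<lambda>W. ent (E c) U W * ent (E d) Z W) maya) maya"
    and lim: "((\<lambda>F. \<Sum>W\<in>F. ent (E c) U W * ent (E d) Z W) \<longlongrightarrow> infsum (\<lambda>W. ent (E c) U W * ent (E d) Z W) maya) (finite_subsets_at_top maya)"
    using infsum_tendsto by auto
  moreover have "infsum (\<lambda>W. ent (E c) U W * ent (E d) Z W) maya
     = (\<Sum>n. expc (hc c d) n) * (\<Sum>W\<in>{W \<in> maya. en W \<le> en U}. ent (E d) W U * ent (E c) W Z)"
    by (rule LIMSEQ_unique[OF filterlim_compose[OF lim exhaust_levels[of "en Z"]] Heis_lim[OF U Z h]])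
  ultimately show "((\<lambda>W. ent (E c) U W * ent (E d) Z W) has_sum
      ((\<Sum>n. expc (hc c d) n) * (\<Sum>W\<in>{W \<in> maya. en W \<le> en U}. ent (E d) W U * ent (E c) W Z))) maya" by simp
qed

section \<open>Exponentials of power series\<close>

lemma expc_unique:
  assumes "f 0 = 1" "\<And>n. of_nat (Suc n) * f (Suc n) = (\<Sum>l\<le>n. of_nat (Suc l) * g (Suc l) * f (n - l))"
  shows "f n = expc g n"
proof (induction n rule: less_induct)
  case (less n)
  show ?case
  proof (cases n)
    case (Suc m)
    have "of_nat (Suc m) * f (Suc m) = (\<Sum>l\<le>m. of_nat (Suc l) * g (Suc l) * expc g (m - l))"
      unfolding assms(2) by (rule sum.cong) (auto simp: less Suc)
    then show ?thesis unfolding Suc by (simp add: field_simps del: of_nat_Suc)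
  qed (simp add: assms)
qed

definition gder :: "(nat \<Rightarrow> complex) \<Rightarrow> complex fps" where "gder g = Abs_fps (\<lambda>l. of_nat (Suc l) * g (Suc l))"

lemma expc_fps: "fps_deriv (Abs_fps (expc g)) = gder g * Abs_fps (expc g)"
proof (rule fps_ext)
  fix n
  show "fps_nth (fps_deriv (Abs_fps (expc g))) n = fps_nth (gder g * Abs_fps (expc g)) n"
    by (simp add: fps_mult_nth gder_def atLeast0AtMost del: of_nat_Suc)
qed

lemma expc_fps_unique:
  assumes "fps_deriv F = gder g * F" "fps_nth F 0 = 1" shows "F = Abs_fps (expc g)"
proof (rule fps_ext)
  fix n
  have "fps_nth F n = expc g n"
  proof (rule expc_unique[where f="fps_nth F", OF assms(2)])
    fix n
    have "fps_nth (fps_deriv F) n = fps_nth (gder g * F) n" by (simp only: assms(1))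
    then show "of_nat (Suc n) * fps_nth F (Suc n) = (\<Sum>l\<le>n. of_nat (Suc l) * g (Suc l) * fps_nth F (n - l))"
      by (simp add: fps_mult_nth gder_def atLeast0AtMost del: of_nat_Suc)
  qed
  then show "fps_nth F n = fps_nth (Abs_fps (expc g)) n" by simp
qed

lemma expc_add: "expc (\<lambda>l. g l + k l) n = (\<Sum>i\<le>n. expc g i * expc k (n - i))"
proof -
  have "gder (\<lambda>l. g l + k l) = gder g + gder k"
    by (rule fps_ext) (simp add: gder_def algebra_simps)
  then have "Abs_fps (expc g) * Abs_fps (expc k) = Abs_fps (expc (\<lambda>l. g l + k l))"
    by (intro expc_fps_unique) (simp_all add: expc_fps algebra_simps)
  then have "fps_nth (Abs_fps (expc (\<lambda>l. g l + k l))) n = fps_nth (Abs_fps (expc g) * Abs_fps (expc k)) n" by simp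
  then show ?thesis by (simp add: fps_mult_nth atLeast0AtMost)
qed

definition exs :: "(nat \<Rightarrow> complex) \<Rightarrow> complex \<Rightarrow> bool"
  where "exs g v \<longleftrightarrow> summable (\<lambda>n. norm (expc g n)) \<and> (\<Sum>n. expc g n) = v"

lemma exs_add: assumes "exs g v" "exs k v'" shows "exs (\<lambda>l. g l + k l) (v * v')"
proof -
  have s: "summable (\<lambda>n. norm (expc g n))" "summable (\<lambda>n. norm (expc k n))" using assms by (auto simp: exs_def)
  have "(\<lambda>n. \<Sum>i\<le>n. norm (expc g i) * norm (expc k (n - i))) sums ((\<Sum>n. norm (expc g n)) * (\<Sum>n. norm (expc k n)))"
    by (rule Cauchy_product_sums) (use s in auto)
  then have S: "summable (\<lambda>n. \<Sum>i\<le>n. norm (expc g i) * norm (expc k (n - i)))" by (rule sums_summable)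
  have N: "norm (norm (expc (\<lambda>l. g l + k l) n)) \<le> (\<Sum>i\<le>n. norm (expc g i) * norm (expc k (n - i)))" for n
    unfolding expc_add using norm_sum[of "\<lambda>i. expc g i * expc k (n - i)" "{..n}"] by (simp add: norm_mult)
  have "summable (\<lambda>n. norm (expc (\<lambda>l. g l + k l) n))"
    by (rule summable_comparison_test'[OF S, of 0]) (rule N)
  moreover have "(\<Sum>n. expc (\<lambda>l. g l + k l) n) = v * v'"
    using Cauchy_product_sums[OF s] assms unfolding expc_add exs_def by (simp add: sums_iff)
  ultimately show ?thesis by (simp add: exs_def)
qed

lemma exs_zero: "exs (\<lambda>_. 0) 1"
proof -
  have e: "(\<lambda>n. expc (\<lambda>_. 0) n) = (\<lambda>n. if n = 0 then 1 else 0)"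
  proof
    fix n show "expc (\<lambda>_. 0) n = (if n = 0 then 1 else 0)" by (cases n) auto
  qed
  have "(\<lambda>n. if n = 0 then 1 else (0::complex)) sums 1" using sums_single[of 0 "\<lambda>_. 1 :: complex"] by simp
  moreover have "summable (\<lambda>n. norm (if n = 0 then 1 else (0::complex)))"
    by (rule summable_finite[of "{0}"]) auto
  ultimately show ?thesis unfolding exs_def e by (simp add: sums_iff)
qed

lemma exs_sum: "finite S \<Longrightarrow> (\<And>i. i \<in> S \<Longrightarrow> exs (g i) (v i)) \<Longrightarrow> exs (\<lambda>l. \<Sum>i\<in>S. g i l) (\<Prod>i\<in>S. v i)"
  by (induction S rule: finite_induct) (auto intro: exs_zero exs_add)

lemma exs_cong: "(\<And>l. 1 \<le> l \<Longrightarrow> g l = k l) \<Longrightarrow> exs g v \<Longrightarrow> exs k v"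
proof -
  assume "\<And>l. 1 \<le> l \<Longrightarrow> g l = k l"
  then have "gder g = gder k" by (intro fps_ext) (simp add: gder_def)
  then have "Abs_fps (expc g) = Abs_fps (expc k)"
    by (intro expc_fps_unique) (simp_all add: expc_fps)
  then have "expc g = expc k" by (simp add: fps_eq_iff fun_eq_iff)
  then show "exs g v \<Longrightarrow> exs k v" by (simp add: exs_def)
qed

lemma exs_analytic:
  assumes r: "1 < r" and s: "summable (\<lambda>l. norm (g (Suc l)) * r ^ Suc l)"
  shows "exs g (exp (\<Sum>l. g (Suc l)))"
proof -
  define gg where "gg l = (if l = 0 then 0 else g l)" for l
  define G where "G = Abs_fps gg"
  have "summable (\<lambda>l. gg l * of_real r ^ l)"
  proof (subst summable_Suc_iff[symmetric], rule summable_norm_cancel)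
    show "summable (\<lambda>l. norm (gg (Suc l) * of_real r ^ Suc l))"
      using s r by (simp add: gg_def norm_mult norm_power)
  qed
  then have "conv_radius gg \<ge> norm (complex_of_real r)" by (rule conv_radius_geI)
  then have R: "fps_conv_radius G \<ge> r" using r by (simp add: fps_conv_radius_def G_def)
  have G0: "fps_conv_radius G > 0" using R r by (metis ereal_less(2) less_le_trans less_trans zero_less_one)
  define f where "f = exp \<circ> eval_fps G"
  have "ball (0 :: complex) r \<subseteq> eball 0 (fps_conv_radius G)"
  proof
    fix x :: complex assume "x \<in> ball 0 r"
    then have "ereal (norm x) < ereal r" by simp
    then have "ereal (norm x) < fps_conv_radius G" using R by (rule less_le_trans)
    then show "x \<in> eball 0 (fps_conv_radius G)" by (simp add: in_eball_iff)
  qed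
  then have "eval_fps G holomorphic_on ball 0 r" by (rule holomorphic_on_eval_fps)
  then have hol: "f holomorphic_on ball 0 r"
    unfolding f_def o_def by (rule holomorphic_on_exp')
  have F1: "f has_fps_expansion (fps_exp 1 oo G)"
    unfolding f_def
    by (rule has_fps_expansion_compose[OF has_fps_expansion_exp1 eval_fps_has_fps_expansion[OF G0]])
       (simp add: G_def gg_def)
  moreover have F2: "f has_fps_expansion fps_expansion f 0"
    by (rule has_fps_expansion_fps_expansion[OF open_ball _ hol]) (use r in simp)
  ultimately have FF: "fps_expansion f 0 = fps_exp 1 oo G" by (rule fps_expansion_unique_complex[symmetric])
  have "fps_deriv (fps_exp 1 oo G) = (fps_exp 1 oo G) * fps_deriv G"
    by (subst fps_compose_deriv) (simp_all add: G_def gg_def)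
  moreover have "fps_deriv G = gder g" by (rule fps_ext) (simp add: gder_def G_def gg_def)
  moreover have "fps_nth (fps_exp 1 oo G) 0 = 1" by simp
  ultimately have X: "fps_exp 1 oo G = Abs_fps (expc g)" by (intro expc_fps_unique) (simp_all add: mult.commute)
  have co: "expc g n = (deriv ^^ n) f 0 / fact n" for n
    using FF unfolding X by (simp add: fps_eq_iff fps_expansion_def)
  have sums: "(\<lambda>n. expc g n * w ^ n) sums f w" if "w \<in> ball 0 r" for w
    using holomorphic_power_series[OF hol that] by (simp add: co)
  have f1: "f 1 = exp (\<Sum>l. g (Suc l))"
  proof -
    have "summable (\<lambda>l. g (Suc l))"
    proof (rule summable_norm_cancel, rule summable_comparison_test'[OF s, of 0])
      fix n show "norm (norm (g (Suc n))) \<le> norm (g (Suc n)) * r ^ Suc n"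
        using r mult_left_mono[OF one_le_power[of r "Suc n"], of "norm (g (Suc n))"] by simp
    qed
    then have "summable gg" by (subst summable_Suc_iff[symmetric]) (simp add: gg_def)
    then have "suminf gg = (\<Sum>l. g (Suc l))" using suminf_split_head[of gg] by (simp add: gg_def)
    then show ?thesis by (simp add: f_def eval_fps_def G_def)
  qed
  have "summable (\<lambda>n. norm (expc g n * 1 ^ n))"
  proof (rule powser_insidea)
    show "summable (\<lambda>n. expc g n * (complex_of_real ((1 + r) / 2)) ^ n)"
      by (rule sums_summable[OF sums], unfold mem_ball dist_0_norm norm_of_real) (use r in simp)
    show "norm (1::complex) < norm (complex_of_real ((1 + r) / 2))"
      unfolding norm_of_real using r by simp
  qed
  moreover have "(\<Sum>n. expc g n) = exp (\<Sum>l. g (Suc l))"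
    using sums_unique[OF sums[of 1]] r f1 by simp
  ultimately show ?thesis by (simp add: exs_def)
qed

lemma exs_geom:
  assumes a: "0 \<le> a" "a < 1" and g: "\<And>l. 1 \<le> l \<Longrightarrow> norm (g l) \<le> C * a ^ l"
  shows "exs g (exp (\<Sum>l. g (Suc l)))"
proof -
  obtain r where r: "1 < r" "a * r < 1"
  proof (cases "a = 0")
    case False
    then have "1 < 1 / a" using a by simp
    then obtain r where "1 < r" "r < 1 / a" using dense by blast
    then show ?thesis using that[of r] a False by (simp add: field_simps)
  qed (use that[of 2] in simp)
  have "summable (\<lambda>l. C * (a * r) ^ Suc l)"
    using r a by (intro summable_mult summable_ignore_initial_segment[of "\<lambda>l. (a * r) ^ l" 1, simplified] summable_geometric) simp
  then have "summable (\<lambda>l. norm (g (Suc l)) * r ^ Suc l)"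
  proof (rule summable_comparison_test'[where N=0])
    fix n
    have "norm (g (Suc n)) * r ^ Suc n \<le> C * a ^ Suc n * r ^ Suc n"
      using g[of "Suc n"] r by (intro mult_right_mono) auto
    then show "norm (norm (g (Suc n)) * r ^ Suc n) \<le> C * (a * r) ^ Suc n"
      using r by (simp add: power_mult_distrib mult_ac)
  qed
  then show ?thesis using exs_analytic r by blast
qed

lemma exs_inv: assumes "norm z < 1" shows "exs (\<lambda>l. z ^ l / of_nat l) (1 / (1 - z))"
proof -
  have e: "z ^ n = expc (\<lambda>l. z ^ l / of_nat l) n" for n
    by (rule expc_unique) (simp_all add: power_add[symmetric] del: of_nat_Suc power_Suc)
  show ?thesis
    using assms unfolding exs_def e[symmetric] by (simp add: norm_power suminf_geometric)
qed

lemma exs_lin: "exs (\<lambda>l. - ((- z) ^ l) / of_nat l) (1 + z)"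
proof -
  let ?f = "\<lambda>n::nat. if n = 0 then 1 else if n = 1 then z else 0"
  have e: "?f n = expc (\<lambda>l. - ((- z) ^ l) / of_nat l) n" for n
  proof (rule expc_unique)
    fix n
    have "(\<Sum>l\<le>n. of_nat (Suc l) * (- ((- z) ^ Suc l) / of_nat (Suc l)) * ?f (n - l)) = (\<Sum>l\<le>n. - ((- z) ^ Suc l) * ?f (n - l))"
      by (rule sum.cong) (auto simp del: of_nat_Suc power_Suc)
    also have "\<dots> = of_nat (Suc n) * ?f (Suc n)"
    proof (cases n)
      case (Suc k)
      have "(\<Sum>l\<le>n. - ((- z) ^ Suc l) * ?f (n - l)) = (\<Sum>l\<in>{k, n}. - ((- z) ^ Suc l) * ?f (n - l))"
        by (rule sum.mono_neutral_right) (auto simp: Suc)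
      then show ?thesis by (simp add: Suc)
    qed simp
    finally show "of_nat (Suc n) * ?f (Suc n) = (\<Sum>l\<le>n. of_nat (Suc l) * (- ((- z) ^ Suc l) / of_nat (Suc l)) * ?f (n - l))" by simp
  qed simp
  have "summable (\<lambda>n. norm (?f n))" by (rule summable_finite[of "{0, 1}"]) auto
  moreover have "suminf ?f = 1 + z"
  proof -
    have "?f sums (\<Sum>n\<in>{0, 1}. ?f n)" by (rule sums_finite) auto
    then show ?thesis by (simp add: sums_iff)
  qed
  ultimately show ?thesis unfolding exs_def e[symmetric] by simp
qed

lemma exs_mult: "exs g v \<Longrightarrow> exs (\<lambda>l. of_nat n * g l) (v ^ n)"
  using exs_sum[of "{..<n}" "\<lambda>_. g" "\<lambda>_. v"] by simp

lemma geom2: fixes y :: complex assumes "y \<noteq> 1"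
  shows "y / (1 - y) ^ 2 = (\<Sum>n<N. of_nat (Suc n) * y ^ Suc n) + y ^ Suc N * (of_nat (Suc N) - of_nat N * y) / (1 - y) ^ 2"
proof (induction N)
  case (Suc N)
  have aux: "S + A = (S + B) + (A - B)" for S A B :: complex by simp
  have E: "y ^ Suc N * (of_nat (Suc N) - of_nat N * y) / (1 - y) ^ 2 - of_nat (Suc N) * y ^ Suc N
      = y ^ Suc (Suc N) * (of_nat (Suc (Suc N)) - of_nat (Suc N) * y) / (1 - y) ^ 2"
    using assms by (simp add: divide_simps power2_eq_square) (simp add: algebra_simps)
  show ?case unfolding sum.lessThan_Suc E[symmetric] by (rule trans[OF Suc.IH aux])
qed (use assms in simp)

lemma norm_one_minus_power:
  fixes q :: complex assumes "norm q < 1" "1 \<le> l" shows "1 - norm q \<le> norm (1 - q ^ l)"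
proof -
  have "norm (q ^ l) \<le> norm q ^ 1" unfolding norm_power by (rule power_decreasing) (use assms in auto)
  then show ?thesis using norm_triangle_ineq2[of 1 "q ^ l"] by simp
qed

lemma norm_rem:
  fixes q :: complex assumes "norm q < 1" "1 \<le> l"
  shows "norm ((q ^ l) ^ Suc N * (of_nat (Suc N) - of_nat N * q ^ l) / (1 - q ^ l) ^ 2)
    \<le> (2 * real (Suc N) / (1 - norm q) ^ 2) * (norm q ^ Suc N) ^ l"
proof -
  have q1: "norm q ^ l \<le> 1" using assms by (simp add: power_le_one)
  have "norm (of_nat (Suc N) - of_nat N * q ^ l :: complex) \<le> norm (of_nat (Suc N) :: complex) + norm (of_nat N * q ^ l)"
    by (rule norm_triangle_ineq4)
  also have "\<dots> \<le> 2 * real (Suc N)"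
    unfolding norm_mult norm_power norm_of_nat using mult_left_mono[OF q1, of "real N"] by simp
  finally have 1: "norm (of_nat (Suc N) - of_nat N * q ^ l :: complex) \<le> 2 * real (Suc N)" .
  have 2: "(1 - norm q) ^ 2 \<le> norm (1 - q ^ l) ^ 2"
    by (rule power_mono[OF norm_one_minus_power[OF assms]]) (use assms in simp)
  have "norm ((q ^ l) ^ Suc N * (of_nat (Suc N) - of_nat N * q ^ l) / (1 - q ^ l) ^ 2)
     = (norm q ^ Suc N) ^ l * norm (of_nat (Suc N) - of_nat N * q ^ l :: complex) / norm (1 - q ^ l) ^ 2"
    by (simp only: norm_divide norm_mult norm_power power_mult[symmetric] mult.commute)
  also have "\<dots> \<le> (norm q ^ Suc N) ^ l * (2 * real (Suc N)) / (1 - norm q) ^ 2"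
    by (rule frac_le[OF _ mult_left_mono[OF 1] _ 2]) (use assms in auto)
  finally show ?thesis by (simp add: mult_ac)
qed

text \<open>The pairing of two principal specializations, truncated so that only the first \<open>N\<close> factors
  of the MacMahon type product are split off.\<close>

lemma exs_pair_trunc:
  fixes q :: complex
  assumes q: "norm q < 1" "q \<noteq> 0" and x: "norm (x * q ^ Suc N) < 1"
    and B: "\<And>n. n < N \<Longrightarrow> exs (\<lambda>l. sg l * (x * q ^ Suc n) ^ l / of_nat l) (v n)"
    and sg: "\<And>l. norm (sg l) \<le> 1"
  shows "\<exists>R. exs (\<lambda>l. sg l * x ^ l * q ^ l / (of_nat l * (1 - q ^ l) ^ 2)) ((\<Prod>n<N. v n ^ Suc n) * exp R)
    \<and> norm R \<le> (2 * real (Suc N) / (1 - norm q) ^ 2) * (norm (x * q ^ Suc N) / (1 - norm (x * q ^ Suc N)))"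
proof -
  define t where "t l = sg l * x ^ l / of_nat l * ((q ^ l) ^ Suc N * (of_nat (Suc N) - of_nat N * q ^ l) / (1 - q ^ l) ^ 2)" for l
  define C where "C = 2 * real (Suc N) / (1 - norm q) ^ 2"
  define b where "b = norm (x * q ^ Suc N)"
  have t: "norm (t l) \<le> C * b ^ l" if "1 \<le> l" for l
  proof -
    have "norm (t l) = norm (sg l) * norm x ^ l / real l * norm ((q ^ l) ^ Suc N * (of_nat (Suc N) - of_nat N * q ^ l) / (1 - q ^ l) ^ 2)"
      by (simp only: t_def norm_mult norm_divide norm_power norm_of_nat)
    also have "\<dots> \<le> 1 * norm x ^ l / 1 * (C * (norm q ^ Suc N) ^ l)"
      unfolding C_def
      by (intro mult_mono frac_le norm_rem[OF q(1) that] sg mult_right_mono) (use that in auto)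
    also have "\<dots> = C * b ^ l" by (simp add: b_def norm_mult norm_power power_mult_distrib)
    finally show ?thesis .
  qed
  have te: "exs t (exp (\<Sum>l. t (Suc l)))"
    by (rule exs_geom[OF _ _ t]) (use x in \<open>auto simp: b_def\<close>)
  have "exs (\<lambda>l. (\<Sum>n<N. of_nat (Suc n) * (sg l * (x * q ^ Suc n) ^ l / of_nat l)) + t l)
     ((\<Prod>n<N. v n ^ Suc n) * exp (\<Sum>l. t (Suc l)))"
    by (intro exs_add exs_sum exs_mult B te) auto
  then have "exs (\<lambda>l. sg l * x ^ l * q ^ l / (of_nat l * (1 - q ^ l) ^ 2)) ((\<Prod>n<N. v n ^ Suc n) * exp (\<Sum>l. t (Suc l)))"
  proof (rule exs_cong[rotated])
    fix l :: nat assume l: "1 \<le> l"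
    have "norm (1 - q ^ l) > 0" using norm_one_minus_power[OF q(1) l] q by linarith
    then have ql: "q ^ l \<noteq> 1" by auto
    have "sg l * x ^ l * q ^ l / (of_nat l * (1 - q ^ l) ^ 2) = sg l * x ^ l / of_nat l * (q ^ l / (1 - q ^ l) ^ 2)"
      by simp
    also have "\<dots> = (\<Sum>n<N. of_nat (Suc n) * (sg l * (x * q ^ Suc n) ^ l / of_nat l)) + t l"
      unfolding geom2[OF ql, of N] distrib_left t_def sum_distrib_left
      by (intro arg_cong2[where f="(+)"] sum.cong refl)
         (simp add: power_mult_distrib power_mult[symmetric] mult_ac del: of_nat_Suc power_Suc)
    finally show "(\<Sum>n<N. of_nat (Suc n) * (sg l * (x * q ^ Suc n) ^ l / of_nat l)) + t l
      = sg l * x ^ l * q ^ l / (of_nat l * (1 - q ^ l) ^ 2)" by simp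
  qed
  moreover have "norm (\<Sum>l. t (Suc l)) \<le> C * (b / (1 - b))"
  proof -
    have b: "0 \<le> b" "b < 1" using x by (auto simp: b_def)
    have g: "(\<lambda>l. C * (b ^ Suc l)) sums (C * (b / (1 - b)))"
      using sums_mult[OF sums_mult[OF geometric_sums[of b], of b], of C] b by (simp add: mult_ac)
    have s: "summable (\<lambda>l. norm (t (Suc l)))"
      by (rule summable_comparison_test'[OF sums_summable[OF g], of 0]) (use t in \<open>auto simp del: power_Suc\<close>)
    have "norm (\<Sum>l. t (Suc l)) \<le> (\<Sum>l. norm (t (Suc l)))" by (rule summable_norm[OF s])
    also have "\<dots> \<le> (\<Sum>l. C * (b ^ Suc l))"
      by (rule suminf_le[OF _ s sums_summable[OF g]]) (use t in \<open>auto simp del: power_Suc\<close>)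
    also have "\<dots> = C * (b / (1 - b))" using g by (simp add: sums_iff)
    finally show ?thesis .
  qed
  ultimately show ?thesis unfolding C_def b_def by blast
qed

lemma exs_MacMahon:
  fixes q :: complex
  assumes q: "norm q < 1" "q \<noteq> 0" and x: "norm (x * q) < 1"
  shows "exs (\<lambda>l. x ^ l * q ^ l / (of_nat l * (1 - q ^ l) ^ 2)) (MacMahon x q)" and "MacMahon x q \<noteq> 0"
proof -
  let ?g = "\<lambda>l. x ^ l * q ^ l / (of_nat l * (1 - q ^ l) ^ 2)"
  let ?f = "\<lambda>n. (1 - x * q ^ Suc n) powi (- int (Suc n))"
  define b where "b = norm (x * q)"
  have xq: "norm (x * q ^ Suc n) \<le> b * norm q ^ n" for n
    by (simp add: b_def norm_mult norm_power)
  have xn: "norm (x * q ^ Suc n) < 1" for n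
  proof -
    have "b * norm q ^ n \<le> b * 1" by (rule mult_left_mono) (use q in \<open>auto simp: power_le_one b_def\<close>)
    then show ?thesis using xq[of n] x by (simp add: b_def)
  qed
  have "exs (\<lambda>l. 1 * (x * q ^ Suc n) ^ l / of_nat l) (1 / (1 - x * q ^ Suc n))" for n
    using exs_inv[OF xn] by simp
  from exs_pair_trunc[where sg="\<lambda>_. 1", OF q xn this]
  have "\<forall>N. \<exists>R. exs ?g ((\<Prod>n<N. (1 / (1 - x * q ^ Suc n)) ^ Suc n) * exp R)
    \<and> norm R \<le> (2 * real (Suc N) / (1 - norm q) ^ 2) * (norm (x * q ^ Suc N) / (1 - norm (x * q ^ Suc N)))" by simp
  from choice[OF this] obtain R where RR: "\<forall>N. exs ?g ((\<Prod>n<N. (1 / (1 - x * q ^ Suc n)) ^ Suc n) * exp (R N))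
    \<and> norm (R N) \<le> (2 * real (Suc N) / (1 - norm q) ^ 2) * (norm (x * q ^ Suc N) / (1 - norm (x * q ^ Suc N)))"
    by blast
  note R = conjunct1[OF spec[OF RR]] conjunct2[OF spec[OF RR]]
  define v where "v = (\<Sum>n. expc ?g n)"
  have v: "exs ?g v" "v = (\<Prod>n<N. (1 / (1 - x * q ^ Suc n)) ^ Suc n) * exp (R N)" for N
    using R(1) by (auto simp: v_def exs_def)
  have v0: "v \<noteq> 0"
    using v(2)[of 0] by simp
  have Rlim: "R \<longlonglongrightarrow> 0"
  proof (rule Lim_null_comparison)
    show "\<forall>\<^sub>F N in sequentially. norm (R N) \<le> (2 / (1 - norm q) ^ 2) * (b / (1 - b)) * (real (Suc N) * norm q ^ N)"
    proof (rule always_eventually, rule allI)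
      fix N
      have "b * norm q ^ N \<le> b * 1" by (rule mult_left_mono) (use q in \<open>auto simp: power_le_one b_def\<close>)
      then have le: "norm (x * q ^ Suc N) \<le> b" using xq[of N] by simp
      have "norm (x * q ^ Suc N) / (1 - norm (x * q ^ Suc N)) \<le> b * norm q ^ N / (1 - b)"
        by (rule frac_le) (use le xq[of N] x q in \<open>auto simp: b_def\<close>)
      then have "(2 * real (Suc N) / (1 - norm q) ^ 2) * (norm (x * q ^ Suc N) / (1 - norm (x * q ^ Suc N)))
        \<le> (2 * real (Suc N) / (1 - norm q) ^ 2) * (b * norm q ^ N / (1 - b))"
        by (rule mult_left_mono) auto
      also have "\<dots> = (2 / (1 - norm q) ^ 2) * (b / (1 - b)) * (real (Suc N) * norm q ^ N)"
        by (simp add: mult_ac del: of_nat_Suc)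
      finally show "norm (R N) \<le> (2 / (1 - norm q) ^ 2) * (b / (1 - b)) * (real (Suc N) * norm q ^ N)"
        by (rule order_trans[OF R(2)])
    qed
    have "(\<lambda>N. real N * norm q ^ N) \<longlonglongrightarrow> 0"
      using powser_times_n_limit_0[of "norm q"] q by simp
    then have "(\<lambda>N. real N * norm q ^ N + norm q ^ N) \<longlonglongrightarrow> 0 + 0"
      by (rule tendsto_add) (rule LIMSEQ_power_zero, use q in simp)
    then have "(\<lambda>N. real (Suc N) * norm q ^ N) \<longlonglongrightarrow> 0" by (simp add: algebra_simps)
    from tendsto_mult_left[OF this, of "(2 / (1 - norm q) ^ 2) * (b / (1 - b))"]
    show "(\<lambda>N. (2 / (1 - norm q) ^ 2) * (b / (1 - b)) * (real (Suc N) * norm q ^ N)) \<longlonglongrightarrow> 0" by simp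
  qed
  have fv: "(\<Prod>n<N. ?f n) = v * exp (- R N)" for N
  proof -
    have "(\<Prod>n<N. ?f n) = (\<Prod>n<N. (1 / (1 - x * q ^ Suc n)) ^ Suc n)"
      by (rule prod.cong) (auto simp: power_int_minus power_one_over field_simps simp del: power_Suc of_nat_Suc)
    then show ?thesis using v(2)[of N] by (simp add: exp_minus field_simps)
  qed
  have "(\<lambda>N. v * exp (- R N)) \<longlonglongrightarrow> v * exp (- 0)" by (intro tendsto_intros Rlim)
  then have "(\<lambda>N. \<Prod>n<N. ?f n) \<longlonglongrightarrow> v" unfolding fv by simp
  then have "(\<lambda>N. \<Prod>n<Suc N. ?f n) \<longlonglongrightarrow> v" by (rule LIMSEQ_Suc)
  then have "(\<lambda>N. \<Prod>n\<le>N. ?f (n + 0)) \<longlonglongrightarrow> v" by (simp only: lessThan_Suc_atMost add_0_right)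
  then have "?f has_prod v" using v0 unfolding has_prod_def raw_has_prod_def by blast
  then have "v = MacMahon x q" unfolding MacMahon_def by (rule has_prod_unique)
  then show "exs ?g (MacMahon x q)" "MacMahon x q \<noteq> 0" using v(1) v0 by auto
qed

lemma exs_dual:
  fixes q :: complex
  assumes q: "norm q < 1" "q \<noteq> 0"
  shows "summable (\<lambda>n. norm (expc (\<lambda>l. - ((- x) ^ l) * q ^ l / (of_nat l * (1 - q ^ l) ^ 2)) n))"
proof -
  have "(\<lambda>N. norm x * norm q ^ N) \<longlonglongrightarrow> norm x * 0"
    by (intro tendsto_intros LIMSEQ_power_zero) (use q in simp)
  then have "\<forall>\<^sub>F N in sequentially. norm x * norm q ^ N < 1" by (rule order_tendstoD) simp
  then obtain N where N: "norm x * norm q ^ N < 1" using eventually_happens'[OF sequentially_bot] by blast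
  have "norm (x * q ^ Suc N) \<le> norm x * norm q ^ N"
    unfolding norm_mult norm_power by (rule mult_left_mono[OF power_decreasing]) (use q in auto)
  then have x: "norm (x * q ^ Suc N) < 1" using N by linarith
  let ?sg = "\<lambda>l. - ((-1) ^ l) :: complex"
  have "exs (\<lambda>l. ?sg l * (x * q ^ Suc n) ^ l / of_nat l) (1 + x * q ^ Suc n)" for n
    by (rule exs_cong[OF _ exs_lin]) (simp add: power_minus[of "x * _"] del: power_Suc)
  from exs_pair_trunc[where sg="?sg", OF q x this]
  obtain w where "exs (\<lambda>l. ?sg l * x ^ l * q ^ l / (of_nat l * (1 - q ^ l) ^ 2)) w"
    by (auto simp: norm_power)
  then have "exs (\<lambda>l. - ((- x) ^ l) * q ^ l / (of_nat l * (1 - q ^ l) ^ 2)) w"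
    by (rule exs_cong[rotated]) (simp add: power_minus[of x])
  then show ?thesis by (simp add: exs_def)
qed

section \<open>Absolute convergence of products of infinite matrices\<close>

lemma nn_has_sum:
  fixes f :: "'b \<Rightarrow> real"
  assumes "\<And>x. x \<in> A \<Longrightarrow> 0 \<le> f x" "(f has_sum s) A"
  shows "(\<integral>\<^sup>+x. ennreal (f x) \<partial>count_space A) = ennreal s"
proof -
  have s: "f summable_on A" using assms(2) by (auto simp: summable_on_def)
  then have "(\<lambda>x. norm (f x)) summable_on A"
    by (subst summable_on_cong[of A _ f]) (use assms(1) in auto)
  then have a: "Infinite_Set_Sum.abs_summable_on f A" by (rule abs_summable_equivalent[THEN iffD1])
  show ?thesis
    using nn_integral_conv_infsetsum[OF a assms(1)] infsetsum_infsum[OF a] infsumI[OF assms(2)] by simp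
qed

lemma nn_summable:
  fixes f :: "'b \<Rightarrow> real"
  assumes "\<And>x. x \<in> A \<Longrightarrow> 0 \<le> f x" "(\<integral>\<^sup>+x. ennreal (f x) \<partial>count_space A) < \<infinity>"
  shows "f summable_on A"
proof (rule nonneg_bdd_above_summable_on[OF assms(1)])
  obtain r where r: "(\<integral>\<^sup>+x. ennreal (f x) \<partial>count_space A) = ennreal r" "0 \<le> r"
    using assms(2) by (cases "\<integral>\<^sup>+x. ennreal (f x) \<partial>count_space A") auto
  show "bdd_above (sum f ` {F. F \<subseteq> A \<and> finite F})"
  proof (rule bdd_aboveI2)
    fix F assume "F \<in> {F. F \<subseteq> A \<and> finite F}"
    then have F: "F \<subseteq> A" "finite F" by auto
    have "ennreal (sum f F) = (\<Sum>x\<in>F. ennreal (f x))"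
      by (rule sum_ennreal[symmetric]) (use F assms(1) in auto)
    also have "\<dots> = (\<integral>\<^sup>+x. ennreal (f x) \<partial>count_space F)"
      by (rule nn_integral_count_space_finite[OF F(2), symmetric])
    also have "\<dots> = (\<integral>\<^sup>+x. ennreal (f x) * indicator F x \<partial>count_space A)"
      using F(1) by (subst nn_integral_restrict_space[symmetric]) (auto simp: restrict_count_space Int_absorb1 Int_absorb2)
    also have "\<dots> \<le> (\<integral>\<^sup>+x. ennreal (f x) \<partial>count_space A)"
      by (rule nn_integral_mono) (auto split: split_indicator)
    finally show "sum f F \<le> r" unfolding r(1) by (simp add: r(2))
  qed
qed auto

type_synonym emat = "int set \<Rightarrow> int set \<Rightarrow> ennreal"

definition em :: "emat \<Rightarrow> emat \<Rightarrow> emat"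
  where "em A B U V = (\<integral>\<^sup>+W. A U W * B W V \<partial>count_space UNIV)"

lemma em_assoc: "em (em A B) C = em A (em B C)"
proof (intro ext)
  fix U V
  have "em (em A B) C U V = (\<integral>\<^sup>+X. \<integral>\<^sup>+W. A U W * B W X * C X V \<partial>count_space UNIV \<partial>count_space UNIV)"
    unfolding em_def by (intro nn_integral_cong) (simp add: nn_integral_multc)
  also have "\<dots> = (\<integral>\<^sup>+p. (\<lambda>(X, W). A U W * B W X * C X V) p \<partial>count_space UNIV)"
    by (subst nn_integral_fst_count_space[symmetric]) simp
  also have "\<dots> = (\<integral>\<^sup>+W. \<integral>\<^sup>+X. A U W * B W X * C X V \<partial>count_space UNIV \<partial>count_space UNIV)"
    by (subst nn_integral_snd_count_space[symmetric]) simp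
  also have "\<dots> = em A (em B C) U V"
    unfolding em_def by (intro nn_integral_cong) (simp add: nn_integral_cmult mult.assoc)
  finally show "em (em A B) C U V = em A (em B C) U V" .
qed

definition na :: "complex fop \<Rightarrow> emat"
  where "na A U V = (if U \<in> maya \<and> V \<in> maya then ennreal (norm (A U V)) else 0)"

definition ap :: "complex fop list \<Rightarrow> emat"
  where "ap As = foldr (\<lambda>A. em (na A)) As (na op_id)"

lemma ap_Nil: "ap [] = na op_id" and ap_Cons: "ap (A # As) = em (na A) (ap As)"
  by (simp_all add: ap_def)

lemma ap_maya: "U \<notin> maya \<Longrightarrow> ap As U V = 0"
  by (cases As) (auto simp: ap_def na_def em_def)

lemma em_id: assumes "\<And>U V. U \<notin> maya \<Longrightarrow> A U V = 0" shows "em (na op_id) A = A"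
proof (intro ext)
  fix U V
  have "em (na op_id) A U V = (\<integral>\<^sup>+W. A U V * indicator {U} W \<partial>count_space UNIV)"
    unfolding em_def by (rule nn_integral_cong) (use assms in \<open>auto simp: na_def op_id_def split: split_indicator\<close>)
  also have "\<dots> = A U V" by (simp add: nn_integral_cmult one_ennreal_def[symmetric])
  finally show "em (na op_id) A U V = A U V" .
qed

lemma ap_append: "ap (L @ R) = em (ap L) (ap R)"
proof (induction L)
  case Nil
  show ?case using em_id[of "ap R"] ap_maya by (simp add: ap_Nil)
next
  case (Cons A L)
  then show ?case by (simp add: ap_Cons em_assoc)
qed

lemma em_na:
  assumes "U \<in> maya" "V \<in> maya" "\<And>W. W \<notin> maya \<Longrightarrow> B W V = 0"
  shows "em (na A) B U V = (\<integral>\<^sup>+W. ennreal (norm (A U W)) * B W V \<partial>count_space maya)"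
  unfolding em_def
  by (subst nn_integral_count_space_indicator) (use assms in \<open>auto simp: na_def intro!: nn_integral_cong split: split_indicator\<close>)

lemma op_prod_Cons: "op_prod (A # As) = op_mult A (op_prod As)" and op_prod_Nil: "op_prod [] = op_id"
  by (simp_all add: op_prod_def)

lemma norm_op_prod:
  assumes "U \<in> maya" "V \<in> maya" shows "ennreal (norm (op_prod As U V)) \<le> ap As U V"
  using assms
proof (induction As arbitrary: U)
  case Nil
  then show ?case by (simp add: ap_Nil na_def op_prod_Nil)
next
  case (Cons A As)
  have e: "ap (A # As) U V = (\<integral>\<^sup>+W. ennreal (norm (A U W)) * ap As W V \<partial>count_space maya)"
    unfolding ap_Cons by (rule em_na) (use Cons ap_maya in auto)
  have le: "(\<integral>\<^sup>+W. ennreal (norm (A U W * op_prod As W V)) \<partial>count_space maya) \<le> ap (A # As) U V"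
    unfolding e by (rule nn_integral_mono) (auto simp: norm_mult ennreal_mult intro!: mult_left_mono Cons)
  show ?case
  proof (cases "ap (A # As) U V < \<infinity>")
    case True
    have s: "(\<lambda>W. norm (A U W * op_prod As W V)) summable_on maya"
      by (rule nn_summable) (use le True in auto)
    have "norm (op_prod (A # As) U V) \<le> (\<Sum>\<^sub>\<infinity>W\<in>maya. norm (A U W * op_prod As W V))"
      unfolding op_prod_Cons op_mult_def by (rule norm_infsum_bound) (rule s)
    then have "ennreal (norm (op_prod (A # As) U V)) \<le> ennreal (\<Sum>\<^sub>\<infinity>W\<in>maya. norm (A U W * op_prod As W V))"
      by (rule ennreal_leI)
    also have "\<dots> = (\<integral>\<^sup>+W. ennreal (norm (A U W * op_prod As W V)) \<partial>count_space maya)"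
      by (rule nn_has_sum[symmetric]) (use s has_sum_infsum in auto)
    finally show ?thesis using le by simp
  next
    case False
    then have "ap (A # As) U V = \<infinity>" by (simp add: less_top[symmetric])
    then show ?thesis by simp
  qed
qed

lemma op_prod_append:
  assumes "U \<in> maya" "V \<in> maya" "ap (L @ R) U V < \<infinity>"
  shows "((\<lambda>W. op_prod L U W * op_prod R W V) has_sum op_prod (L @ R) U V) maya"
  using assms
proof (induction L arbitrary: U)
  case Nil
  have "((\<lambda>W. op_prod [] U W * op_prod R W V) has_sum op_prod R U V) {U}"
    using has_sum_finite[of "{U}" "\<lambda>W. op_prod [] U W * op_prod R W V"] Nil by (simp add: op_prod_Nil op_id_def)
  moreover have "((\<lambda>W. op_prod [] U W * op_prod R W V) has_sum op_prod R U V) {U} \<longleftrightarrow>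
      ((\<lambda>W. op_prod [] U W * op_prod R W V) has_sum op_prod R U V) maya"
    by (rule has_sum_cong_neutral) (use Nil in \<open>auto simp: op_prod_Nil op_id_def\<close>)
  ultimately show ?case by simp
next
  case (Cons A L)
  let ?f = "\<lambda>(W, X). A U W * (op_prod L W X * op_prod R X V)"
  let ?B = "ap (L @ R)"
  have e: "ap (A # L @ R) U V = (\<integral>\<^sup>+W. ennreal (norm (A U W)) * ?B W V \<partial>count_space maya)"
    unfolding ap_Cons by (rule em_na) (use Cons ap_maya in auto)
  have LR: "(\<integral>\<^sup>+X. ennreal (norm (op_prod L W X * op_prod R X V)) \<partial>count_space maya) \<le> ?B W V" if W: "W \<in> maya" for W
  proof -
    have "(\<integral>\<^sup>+X. ennreal (norm (op_prod L W X * op_prod R X V)) \<partial>count_space maya)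
      \<le> (\<integral>\<^sup>+X. ap L W X * ap R X V \<partial>count_space maya)"
      by (rule nn_integral_mono)
         (auto simp: norm_mult ennreal_mult intro!: mult_mono norm_op_prod W Cons.prems)
    also have "\<dots> \<le> (\<integral>\<^sup>+X. ap L W X * ap R X V \<partial>count_space UNIV)"
      by (subst nn_integral_count_space_indicator) (auto intro!: nn_integral_mono split: split_indicator)
    finally show ?thesis unfolding ap_append em_def .
  qed
  have fin: "(\<integral>\<^sup>+W. \<integral>\<^sup>+X. ennreal (norm (?f (W, X))) \<partial>count_space maya \<partial>count_space maya) < \<infinity>"
  proof -
    have "(\<integral>\<^sup>+W. \<integral>\<^sup>+X. ennreal (norm (?f (W, X))) \<partial>count_space maya \<partial>count_space maya)
       \<le> (\<integral>\<^sup>+W. ennreal (norm (A U W)) * ?B W V \<partial>count_space maya)"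
    proof (rule nn_integral_mono)
      fix W assume "W \<in> space (count_space maya)"
      then have W: "W \<in> maya" by simp
      have "(\<integral>\<^sup>+X. ennreal (norm (?f (W, X))) \<partial>count_space maya)
        = ennreal (norm (A U W)) * (\<integral>\<^sup>+X. ennreal (norm (op_prod L W X * op_prod R X V)) \<partial>count_space maya)"
        by (subst nn_integral_cmult[symmetric]) (auto simp: norm_mult ennreal_mult)
      also have "\<dots> \<le> ennreal (norm (A U W)) * ?B W V" by (rule mult_left_mono[OF LR[OF W]]) simp
      finally show "(\<integral>\<^sup>+X. ennreal (norm (?f (W, X))) \<partial>count_space maya) \<le> ennreal (norm (A U W)) * ?B W V" .
    qed
    then show ?thesis using Cons.prems(3) e by simp
  qed
  have s: "(\<lambda>p. norm (?f p)) summable_on maya \<times> maya"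
  proof (rule nn_summable)
    have "(\<integral>\<^sup>+p. ennreal (norm (?f p)) \<partial>count_space (maya \<times> maya))
       = (\<integral>\<^sup>+p. ennreal (norm (?f p)) * indicator (maya \<times> maya) p \<partial>count_space UNIV)"
      by (rule nn_integral_count_space_indicator) simp
    also have "\<dots> = (\<integral>\<^sup>+W. \<integral>\<^sup>+X. ennreal (norm (?f (W, X))) * indicator (maya \<times> maya) (W, X) \<partial>count_space UNIV \<partial>count_space UNIV)"
      by (rule nn_integral_fst_count_space[symmetric])
    also have "\<dots> = (\<integral>\<^sup>+W. \<integral>\<^sup>+X. ennreal (norm (?f (W, X))) \<partial>count_space maya \<partial>count_space maya)"
    proof -
      have ind: "(\<integral>\<^sup>+X. h X \<partial>count_space maya) = (\<integral>\<^sup>+X. h X * indicator maya X \<partial>count_space UNIV)" for h :: "int set \<Rightarrow> ennreal"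
        by (rule nn_integral_count_space_indicator) simp
      show ?thesis unfolding ind
        by (intro nn_integral_cong) (simp add: nn_integral_cmult[symmetric] indicator_times mult_ac)
    qed
    finally show "(\<integral>\<^sup>+p. ennreal (norm (?f p)) \<partial>count_space (maya \<times> maya)) < \<infinity>" using fin by simp
  qed simp
  then have sm: "?f summable_on maya \<times> maya" by (rule abs_summable_summable)
  have inner: "(\<Sum>\<^sub>\<infinity>X\<in>maya. A U W * (op_prod L W X * op_prod R X V)) = A U W * op_prod (L @ R) W V" if W: "W \<in> maya" for W
  proof (cases "A U W = 0")
    case False
    have "ennreal (norm (A U W)) * ?B W V \<le> (\<integral>\<^sup>+W. ennreal (norm (A U W)) * ?B W V \<partial>count_space maya)"
      by (rule nn_integral_ge_point) (simp add: W)
    also have "\<dots> < \<infinity>" using Cons.prems(3) e by simp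
    finally have "?B W V < \<infinity>" using False by (auto simp: ennreal_mult_less_top less_top[symmetric] ennreal_mult_eq_top_iff)
    from infsumI[OF Cons.IH[OF W Cons.prems(2) this]] show ?thesis
      by (simp add: infsum_cmult_right')
  qed simp
  have 1: "((\<lambda>X. \<Sum>\<^sub>\<infinity>W\<in>maya. A U W * (op_prod L W X * op_prod R X V)) has_sum op_prod (A # L @ R) U V) maya"
  proof -
    have sm': "(\<lambda>(X, W). A U W * (op_prod L W X * op_prod R X V)) summable_on maya \<times> maya"
    proof -
      have "bij_betw prod.swap (maya \<times> maya) (maya \<times> maya)"
        by (rule bij_betw_byWitness[where f'=prod.swap]) auto
      from summable_on_reindex_bij_betw[OF this, of ?f] sm show ?thesis
        by (simp add: case_prod_beta')
    qed
    have S: "(\<lambda>X. \<Sum>\<^sub>\<infinity>W\<in>maya. A U W * (op_prod L W X * op_prod R X V)) summable_on maya"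
      using summable_on_Sigma_banach[OF sm'] .
    have "(\<Sum>\<^sub>\<infinity>X\<in>maya. \<Sum>\<^sub>\<infinity>W\<in>maya. A U W * (op_prod L W X * op_prod R X V))
       = (\<Sum>\<^sub>\<infinity>W\<in>maya. \<Sum>\<^sub>\<infinity>X\<in>maya. A U W * (op_prod L W X * op_prod R X V))"
      by (rule infsum_swap_banach[symmetric]) (rule sm)
    also have "\<dots> = op_prod (A # L @ R) U V"
      unfolding op_prod_Cons op_mult_def by (rule infsum_cong) (rule inner)
    finally show ?thesis using has_sum_infsum[OF S] by (simp only:)
  qed
  have 2: "(\<Sum>\<^sub>\<infinity>W\<in>maya. A U W * (op_prod L W X * op_prod R X V)) = op_prod (A # L) U X * op_prod R X V" for X
    unfolding op_prod_Cons op_mult_def by (simp add: infsum_cmult_left' mult.assoc[symmetric])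
  show ?case using 1 unfolding 2 by simp
qed

section \<open>Normal form of the alternating products\<close>

text \<open>\<open>NF c d r\<close> is the operator \<open>\<Gamma>\<^sub>-(d) r ^ L\<^sub>0 \<Gamma>\<^sub>+(c)\<close>.\<close>

definition NF :: "(nat \<Rightarrow> complex) \<Rightarrow> (nat \<Rightarrow> complex) \<Rightarrow> complex \<Rightarrow> complex fop"
  where "NF c d r U V = (\<Sum>Z\<in>{Z \<in> maya. en Z \<le> en V}. ent (E d) Z U * r ^ nat (en Z) * ent (E c) Z V)"

lemma NF_alt: "NF c d r U V = (\<Sum>Z\<in>{Z \<in> maya. en Z \<le> en U}. ent (E d) Z U * r ^ nat (en Z) * ent (E c) Z V)"
proof -
  have z: "ent (E d) Z U * r ^ nat (en Z) * ent (E c) Z V = 0" if "\<not> (en Z \<le> en U \<and> en Z \<le> en V)" for Z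
    using that E_lower[of d Z U] E_lower[of c Z V] by auto
  have "NF c d r U V = (\<Sum>Z\<in>{Z \<in> maya. en Z \<le> en V \<and> en Z \<le> en U}. ent (E d) Z U * r ^ nat (en Z) * ent (E c) Z V)"
    unfolding NF_def by (rule sum.mono_neutral_right) (use finite_en z in auto)
  also have "\<dots> = (\<Sum>Z\<in>{Z \<in> maya. en Z \<le> en U}. ent (E d) Z U * r ^ nat (en Z) * ent (E c) Z V)"
    by (rule sum.mono_neutral_left) (use finite_en z in auto)
  finally show ?thesis .
qed

definition scl :: "complex \<Rightarrow> (nat \<Rightarrow> complex) \<Rightarrow> nat \<Rightarrow> complex" where "scl x c l = x ^ l * c l"

lemma ent_E_scl: "ent (E (scl x c)) U V = x ^ nat (en V - en U) * ent (E c) U V"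
  unfolding scl_def[abs_def] by (rule E_scale)

lemma E_scl_left: "ent (E c) U W * p ^ nat (en W) = p ^ nat (en U) * ent (E (scl p c)) U W"
proof (cases "ent (E c) U W = 0")
  case False
  then have "nat (en W) = nat (en U) + nat (en W - en U)"
    using E_lower[of c U W] en_nonneg[of U] by auto
  then show ?thesis by (simp add: ent_E_scl power_add)
qed (simp add: ent_E_scl)

lemma E_plus: "ent (E (\<lambda>l. c l + d l)) U V = (\<Sum>W\<in>{W \<in> maya. en W \<le> en V}. ent (E c) U W * ent (E d) W V)"
  unfolding E_add by (rule ent_mult) (use finite_en E_lower in auto)

lemma has_sum_finite_sum:
  fixes f :: "'x \<Rightarrow> 'y \<Rightarrow> complex"
  assumes "finite S" "\<And>z. z \<in> S \<Longrightarrow> (f z has_sum s z) A"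
  shows "((\<lambda>w. \<Sum>z\<in>S. f z w) has_sum (\<Sum>z\<in>S. s z)) A"
  using assms by (induction S rule: finite_induct) (auto intro!: has_sum_add has_sum_0)

lemma NF_step:
  assumes U: "U \<in> maya" and V: "V \<in> maya"
    and h: "exs (hc (scl p c0) d) H" and h': "exs (hc (scl p' c0') d') H'"
    and dom: "dom (scl p c0) (scl p' c0')" "dom d d'"
  shows "((\<lambda>W. ent (E c0) U W * (p ^ nat (en W) * NF c d r W V)) has_sum
     H * NF (\<lambda>l. scl (p * r) c0 l + c l) (scl p d) (p * r) U V) maya"
proof -
  let ?S = "\<lambda>V. {Z \<in> maya. en Z \<le> en V}"
  have sum: "((\<lambda>W. ent (E (scl p c0)) U W * ent (E d) Z W) has_sum
      (H * (\<Sum>T\<in>?S U. ent (E d) T U * ent (E (scl p c0)) T Z))) maya" if Z: "Z \<in> maya" for Z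
    using Heis(2)[OF U Z _ _ dom] h h' by (simp add: exs_def)
  have "((\<lambda>W. \<Sum>Z\<in>?S V. p ^ nat (en U) * (r ^ nat (en Z) * ent (E c) Z V) * (ent (E (scl p c0)) U W * ent (E d) Z W)) has_sum
     (\<Sum>Z\<in>?S V. p ^ nat (en U) * (r ^ nat (en Z) * ent (E c) Z V) * (H * (\<Sum>T\<in>?S U. ent (E d) T U * ent (E (scl p c0)) T Z)))) maya"
    by (intro has_sum_finite_sum has_sum_cmult_right sum finite_en) auto
  moreover have "(\<Sum>Z\<in>?S V. p ^ nat (en U) * (r ^ nat (en Z) * ent (E c) Z V) * (ent (E (scl p c0)) U W * ent (E d) Z W))
      = ent (E c0) U W * (p ^ nat (en W) * NF c d r W V)" for W
  proof -
    have "ent (E c0) U W * (p ^ nat (en W) * NF c d r W V) = (p ^ nat (en U) * ent (E (scl p c0)) U W) * NF c d r W V"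
      using E_scl_left[of c0 U W p] by (simp add: mult.assoc[symmetric])
    then show ?thesis by (simp add: NF_def sum_distrib_left mult_ac)
  qed
  moreover have "(\<Sum>Z\<in>?S V. p ^ nat (en U) * (r ^ nat (en Z) * ent (E c) Z V) * (H * (\<Sum>T\<in>?S U. ent (E d) T U * ent (E (scl p c0)) T Z)))
     = H * NF (\<lambda>l. scl (p * r) c0 l + c l) (scl p d) (p * r) U V"
  proof -
    have t: "p ^ nat (en U) * (r ^ nat (en Z) * ent (E c) Z V) * (H * (ent (E d) T U * ent (E (scl p c0)) T Z))
       = H * (ent (E (scl p d)) T U * (p * r) ^ nat (en T) * (ent (E (scl (p * r) c0)) T Z * ent (E c) Z V))" for Z T
    proof -
      have 1: "p ^ nat (en U) * ent (E d) T U = p ^ nat (en T) * ent (E (scl p d)) T U"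
        using E_scl_left[of d T U p] by (simp add: mult.commute)
      have 2: "ent (E (scl p c0)) T Z * r ^ nat (en Z) = r ^ nat (en T) * ent (E (scl (p * r) c0)) T Z"
        using E_scl_left[of "scl p c0" T Z r] by (simp add: ent_E_scl power_mult_distrib mult_ac)
      have "p ^ nat (en U) * (r ^ nat (en Z) * ent (E c) Z V) * (H * (ent (E d) T U * ent (E (scl p c0)) T Z))
         = H * (p ^ nat (en U) * ent (E d) T U) * (ent (E (scl p c0)) T Z * r ^ nat (en Z)) * ent (E c) Z V"
        by (simp add: mult_ac)
      then show ?thesis unfolding 1 2 by (simp add: power_mult_distrib mult_ac)
    qed
    have "(\<Sum>Z\<in>?S V. p ^ nat (en U) * (r ^ nat (en Z) * ent (E c) Z V) * (H * (\<Sum>T\<in>?S U. ent (E d) T U * ent (E (scl p c0)) T Z)))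
      = (\<Sum>Z\<in>?S V. \<Sum>T\<in>?S U. H * (ent (E (scl p d)) T U * (p * r) ^ nat (en T) * (ent (E (scl (p * r) c0)) T Z * ent (E c) Z V)))"
      unfolding sum_distrib_left t ..
    also have "\<dots> = (\<Sum>T\<in>?S U. H * (ent (E (scl p d)) T U * (p * r) ^ nat (en T) * (\<Sum>Z\<in>?S V. ent (E (scl (p * r) c0)) T Z * ent (E c) Z V)))"
      unfolding sum_distrib_left by (rule sum.swap)
    also have "\<dots> = H * NF (\<lambda>l. scl (p * r) c0 l + c l) (scl p d) (p * r) U V"
      unfolding NF_alt[of "\<lambda>l. scl (p * r) c0 l + c l"] E_plus sum_distrib_left ..
    finally show ?thesis .
  qed
  ultimately show ?thesis by simp
qed

lemma NF_left:
  assumes U: "U \<in> maya"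
  shows "(\<Sum>W\<in>{W \<in> maya. en W \<le> en U}. ent (E c0) W U * NF c d r W V) = NF c (\<lambda>l. c0 l + d l) r U V"
proof -
  let ?S = "\<lambda>V. {Z \<in> maya. en Z \<le> en V}"
  have e: "(\<lambda>l. c0 l + d l) = (\<lambda>l. d l + c0 l)" by (simp add: add.commute)
  have "(\<Sum>W\<in>?S U. ent (E c0) W U * NF c d r W V)
     = (\<Sum>W\<in>?S U. \<Sum>Z\<in>?S V. ent (E d) Z W * ent (E c0) W U * r ^ nat (en Z) * ent (E c) Z V)"
    by (simp add: NF_def sum_distrib_left mult_ac)
  also have "\<dots> = (\<Sum>Z\<in>?S V. \<Sum>W\<in>?S U. ent (E d) Z W * ent (E c0) W U * r ^ nat (en Z) * ent (E c) Z V)"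
    by (rule sum.swap)
  also have "\<dots> = NF c (\<lambda>l. c0 l + d l) r U V"
    unfolding NF_def e E_plus sum_distrib_right ..
  finally show ?thesis .
qed

definition dg :: "(int set \<Rightarrow> complex) \<Rightarrow> complex fop"
  where "dg \<delta> U V = (if U \<in> maya \<and> U = V then \<delta> V else 0)"

abbreviation pw :: "complex \<Rightarrow> complex fop" where "pw p \<equiv> dg (\<lambda>V. p ^ nat (en V))"

lemma op_mult_dg_left: "U \<in> maya \<Longrightarrow> op_mult (dg \<delta>) B U V = \<delta> U * B U V"
  unfolding op_mult_def by (subst infsum_one[where ?W0.0=U]) (auto simp: dg_def)

lemma op_mult_dg_right: "V \<in> maya \<Longrightarrow> op_mult B (dg \<delta>) U V = B U V * \<delta> V"
  unfolding op_mult_def by (subst infsum_one[where ?W0.0=V]) (auto simp: dg_def)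

lemma op_mult_cong: "(\<And>W. W \<in> maya \<Longrightarrow> B W V = C W V) \<Longrightarrow> op_mult A B U V = op_mult A C U V"
  unfolding op_mult_def by (rule infsum_cong) simp

definition lst :: "(nat \<Rightarrow> complex) \<Rightarrow> complex list \<Rightarrow> (int set \<Rightarrow> complex) \<Rightarrow> complex fop list"
  where "lst c ps \<delta> = [tr (ent (E c)), ent (E c)] @ concat (map (\<lambda>p. [pw p, tr (ent (E c)), ent (E c)]) ps) @ [dg \<delta>]"

lemma lst_Nil: "lst c [] \<delta> = [tr (ent (E c)), ent (E c), dg \<delta>]"
  and lst_Cons: "lst c (p # ps) \<delta> = tr (ent (E c)) # ent (E c) # pw p # lst c ps \<delta>"
  by (simp_all add: lst_def)

fun cl :: "complex list \<Rightarrow> complex list" where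
  "cl [] = [1]"
| "cl (p # ps) = prod_list (p # ps) # cl ps"

fun dl :: "complex list \<Rightarrow> complex list" where
  "dl [] = [1]"
| "dl (p # ps) = 1 # map ((*) p) (dl ps)"

definition sp :: "(nat \<Rightarrow> complex) \<Rightarrow> complex list \<Rightarrow> nat \<Rightarrow> complex"
  where "sp c xs l = (\<Sum>x\<leftarrow>xs. x ^ l) * c l"

lemma sp_Cons: "sp c (x # xs) = (\<lambda>l. scl x c l + sp c xs l)"
  by (rule ext) (simp add: sp_def scl_def algebra_simps)

lemma sp_one: "sp c [1] = c" by (rule ext) (simp add: sp_def)

lemma scl_sp: "scl p (sp c xs) = sp c (map ((*) p) xs)"
  by (rule ext) (simp add: sp_def scl_def power_mult_distrib sum_list_const_mult o_def mult.assoc)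

lemma scl_one: "scl 1 c = c" by (rule ext) (simp add: scl_def)

lemma dom_scl: "dom c d \<Longrightarrow> dom (scl x c) (scl (of_real (norm x)) d)"
  unfolding scl_def[abs_def] by (rule dom_scale)

lemma dom_sp: assumes "dom c d" shows "dom (sp c xs) (sp d (map (\<lambda>x. of_real (norm x)) xs))"
proof (induction xs)
  case Nil
  have "sp c [] = (\<lambda>_. 0)" for c by (rule ext) (simp add: sp_def)
  then show ?case by (simp add: dom_zero)
next
  case (Cons x xs)
  then show ?case by (simp only: sp_Cons list.map) (intro dom_add dom_scl assms)
qed

definition princ :: "(nat \<Rightarrow> complex) \<Rightarrow> complex \<Rightarrow> bool"
  where "princ c q \<longleftrightarrow> (\<forall>l\<ge>1. hc c c l = q ^ l / (of_nat l * (1 - q ^ l) ^ 2))"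

lemma exs_sum_list: "(\<And>x. x \<in> set xs \<Longrightarrow> exs (g x) (v x)) \<Longrightarrow> exs (\<lambda>l. \<Sum>x\<leftarrow>xs. g x l) (\<Prod>x\<leftarrow>xs. v x)"
  by (induction xs) (auto intro: exs_zero exs_add)

lemma hc_sp: "hc (scl x c) (sp d ys) l = (\<Sum>y\<leftarrow>ys. (x * y) ^ l * hc c d l)"
  by (simp add: hc_def scl_def sp_def power_mult_distrib sum_list_const_mult sum_list_mult_const mult_ac)

lemma princ_exs:
  assumes "princ c q" "norm q < 1" "q \<noteq> 0" "\<And>y. y \<in> set ys \<Longrightarrow> norm (x * y * q) < 1"
  shows "exs (hc (scl x c) (sp c ys)) (\<Prod>y\<leftarrow>ys. MacMahon (x * y) q)"
proof (rule exs_cong)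
  show "exs (\<lambda>l. \<Sum>y\<leftarrow>ys. (x * y) ^ l * q ^ l / (of_nat l * (1 - q ^ l) ^ 2)) (\<Prod>y\<leftarrow>ys. MacMahon (x * y) q)"
    by (intro exs_sum_list exs_MacMahon assms)
  show "(\<Sum>y\<leftarrow>ys. (x * y) ^ l * q ^ l / (of_nat l * (1 - q ^ l) ^ 2)) = hc (scl x c) (sp c ys) l" if "1 \<le> l" for l
    using assms(1) that by (simp add: hc_sp princ_def)
qed

fun okps :: "complex \<Rightarrow> complex list \<Rightarrow> bool" where
  "okps q [] \<longleftrightarrow> True"
| "okps q (p # ps) \<longleftrightarrow> (\<forall>y\<in>set (dl ps). norm (p * y * q) < 1) \<and> okps q ps"

text \<open>The scalar produced by moving all \<open>\<Gamma>\<^sub>+\<close> to the right of all \<open>\<Gamma>\<^sub>-\<close>.\<close>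

fun kk :: "complex \<Rightarrow> complex list \<Rightarrow> complex" where
  "kk q [] = 1"
| "kk q (p # ps) = (\<Prod>y\<leftarrow>dl ps. MacMahon (p * y) q) * kk q ps"

abbreviation nrm :: "complex list \<Rightarrow> complex list" where "nrm \<equiv> map (\<lambda>x. of_real (norm x))"

lemma prod_list_nrm: "prod_list (nrm ps) = of_real (norm (prod_list ps))"
  by (induction ps) (auto simp: norm_mult)

lemma cl_nrm: "cl (nrm ps) = nrm (cl ps)"
  by (induction ps) (auto simp: prod_list_nrm norm_mult)

lemma dl_nrm: "dl (nrm ps) = nrm (dl ps)"
  by (induction ps) (auto simp: norm_mult)

lemma cl_Cons_sp: "(\<lambda>l. scl (p * prod_list ps) c l + sp c (cl ps) l) = sp c (cl (p # ps))"
  by (simp add: sp_Cons)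

lemma dl_Cons_sp: "(\<lambda>l. c l + scl p (sp c (dl ps)) l) = sp c (dl (p # ps))"
  by (simp add: sp_Cons scl_sp scl_one)

lemma op_mult_GM:
  assumes "U \<in> maya"
  shows "op_mult (tr (ent (E c))) B U V = (\<Sum>W\<in>{W \<in> maya. en W \<le> en U}. ent (E c) W U * B W V)"
proof -
  have "op_mult (tr (ent (E c))) B U V = (\<Sum>W\<in>{W \<in> maya. en W \<le> en U}. tr (ent (E c)) U W * B W V)"
    by (rule op_mult_finite) (use finite_en E_lower[of c _ U] in \<open>auto simp: tr_def\<close>)
  then show ?thesis by (simp add: tr_def)
qed

lemma op_prod_dg: "V \<in> maya \<Longrightarrow> op_prod [dg \<delta>] U V = dg \<delta> U V"
proof (cases "U \<in> maya")
  case True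
  then show ?thesis
    by (simp only: op_prod_Cons op_prod_Nil op_mult_dg_left) (auto simp: dg_def op_id_def)
qed (simp add: op_prod_Cons op_mult_def dg_def)

lemma lst_Nil_eq:
  assumes U: "U \<in> maya" and V: "V \<in> maya"
  shows "op_prod (lst c [] \<delta>) U V = NF c c 1 U V * \<delta> V"
proof -
  have 1: "op_prod [ent (E c), dg \<delta>] W V = ent (E c) W V * \<delta> V" for W
  proof -
    have "op_prod [ent (E c), dg \<delta>] W V = op_mult (ent (E c)) (op_prod [dg \<delta>]) W V" by (simp only: op_prod_Cons)
    also have "\<dots> = op_mult (ent (E c)) (dg \<delta>) W V" by (rule op_mult_cong) (rule op_prod_dg[OF V])
    finally show ?thesis using op_mult_dg_right[OF V] by simp
  qed
  have "op_prod (lst c [] \<delta>) U V = (\<Sum>W\<in>{W \<in> maya. en W \<le> en U}. ent (E c) W U * (ent (E c) W V * \<delta> V))"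
    unfolding lst_Nil op_prod_Cons[of "tr (ent (E c))"] op_mult_GM[OF U] 1 ..
  then show ?thesis unfolding NF_alt by (simp add: sum_distrib_left sum_distrib_right mult_ac)
qed

lemma lst_eq:
  assumes c: "princ c q" "norm q < 1" "q \<noteq> 0" and cs: "princ cs (of_real (norm q))" "dom c cs"
    and ok: "okps q ps" and U: "U \<in> maya" and V: "V \<in> maya"
  shows "op_prod (lst c ps \<delta>) U V = kk q ps * NF (sp c (cl ps)) (sp c (dl ps)) (prod_list ps) U V * \<delta> V"
  using ok U
proof (induction ps arbitrary: U)
  case Nil
  then show ?case using lst_Nil_eq[OF Nil.prems(2) V] by (simp add: sp_one)
next
  case (Cons p ps)
  let ?H = "\<Prod>y\<leftarrow>dl ps. MacMahon (p * y) q"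
  let ?NF = "NF (sp c (cl ps)) (sp c (dl ps)) (prod_list ps)"
  let ?NF1 = "NF (sp c (cl (p # ps))) (scl p (sp c (dl ps))) (p * prod_list ps)"
  have qs: "norm (complex_of_real (norm q)) < 1" "complex_of_real (norm q) \<noteq> 0" using c by auto
  have okp: "norm (p * y * q) < 1" if "y \<in> set (dl ps)" for y using Cons.prems that by simp
  have h: "exs (hc (scl p c) (sp c (dl ps))) ?H"
    by (rule princ_exs) (use c okp in auto)
  have hs: "exs (hc (scl (of_real (norm p)) cs) (sp cs (nrm (dl ps)))) (\<Prod>y\<leftarrow>nrm (dl ps). MacMahon (of_real (norm p) * y) (of_real (norm q)))"
    by (rule princ_exs[OF cs(1) qs]) (use okp in \<open>auto simp: norm_mult\<close>)
  have step: "op_prod (ent (E c) # pw p # lst c ps \<delta>) W V = ?H * kk q ps * ?NF1 W V * \<delta> V" if W: "W \<in> maya" for W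
  proof -
    have "op_prod (ent (E c) # pw p # lst c ps \<delta>) W V
      = (\<Sum>\<^sub>\<infinity>X\<in>maya. kk q ps * \<delta> V * (ent (E c) W X * (p ^ nat (en X) * ?NF X V)))"
      unfolding op_prod_Cons[of "ent (E c)"] op_mult_def[of "ent (E c)"]
    proof (rule infsum_cong)
      fix X assume X: "X \<in> maya"
      have "op_prod (pw p # lst c ps \<delta>) X V = p ^ nat (en X) * (kk q ps * ?NF X V * \<delta> V)"
        unfolding op_prod_Cons[of "pw p"] op_mult_dg_left[OF X] using Cons.IH[OF _ X] Cons.prems by simp
      then show "ent (E c) W X * op_prod (pw p # lst c ps \<delta>) X V = kk q ps * \<delta> V * (ent (E c) W X * (p ^ nat (en X) * ?NF X V))"
        by simp
    qed
    also have "\<dots> = kk q ps * \<delta> V * (?H * ?NF1 W V)"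
      using NF_step[OF W V h hs dom_scl[OF cs(2)] dom_sp[OF cs(2)], of "sp c (cl ps)" "prod_list ps"]
      unfolding cl_Cons_sp by (intro infsumI has_sum_cmult_right)
    finally show ?thesis by (simp add: mult_ac)
  qed
  have "op_prod (lst c (p # ps) \<delta>) U V = (\<Sum>W\<in>{W \<in> maya. en W \<le> en U}. ent (E c) W U * (?H * kk q ps * ?NF1 W V * \<delta> V))"
    unfolding lst_Cons op_prod_Cons[of "tr (ent (E c))"] op_mult_GM[OF Cons.prems(2)]
    by (rule sum.cong[OF refl], subst step) auto
  also have "\<dots> = ?H * kk q ps * (\<Sum>W\<in>{W \<in> maya. en W \<le> en U}. ent (E c) W U * ?NF1 W V) * \<delta> V"
    by (simp add: sum_distrib_left sum_distrib_right mult_ac)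
  also have "(\<Sum>W\<in>{W \<in> maya. en W \<le> en U}. ent (E c) W U * ?NF1 W V)
      = NF (sp c (cl (p # ps))) (sp c (dl (p # ps))) (p * prod_list ps) U V"
    unfolding NF_left[OF Cons.prems(2)] dl_Cons_sp ..
  finally show ?case by simp
qed

lemma NF_real:
  assumes "dom c c" "dom d d" "0 \<le> r"
  shows "NF c d (of_real r) U V = of_real (Re (NF c d (of_real r) U V))" "0 \<le> Re (NF c d (of_real r) U V)"
proof -
  have "NF c d (of_real r) U V = (\<Sum>Z\<in>{Z \<in> maya. en Z \<le> en V}.
      of_real (Re (ent (E d) Z U) * r ^ nat (en Z) * Re (ent (E c) Z V)))"
    unfolding NF_def of_real_mult of_real_power using dom_real[OF assms(1)] dom_real[OF assms(2)] by simp
  then have *: "NF c d (of_real r) U V = of_real (\<Sum>Z\<in>{Z \<in> maya. en Z \<le> en V}. Re (ent (E d) Z U) * r ^ nat (en Z) * Re (ent (E c) Z V))"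
    by simp
  show "NF c d (of_real r) U V = of_real (Re (NF c d (of_real r) U V))" by (simp add: *)
  show "0 \<le> Re (NF c d (of_real r) U V)"
    unfolding * Re_complex_of_real
    by (intro sum_nonneg mult_nonneg_nonneg dom_nonneg[OF assms(1)] dom_nonneg[OF assms(2)] zero_le_power assms)
qed

definition NS :: "(nat \<Rightarrow> complex) \<Rightarrow> complex list \<Rightarrow> int set \<Rightarrow> int set \<Rightarrow> real"
  where "NS cs ps U V = Re (NF (sp cs (cl (nrm ps))) (sp cs (dl (nrm ps))) (prod_list (nrm ps)) U V)"

lemma NS_eq:
  assumes "dom cs cs"
  shows "NF (sp cs (cl (nrm ps))) (sp cs (dl (nrm ps))) (prod_list (nrm ps)) U V = of_real (NS cs ps U V)"
    and "0 \<le> NS cs ps U V"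
proof -
  have d: "dom (sp cs (nrm xs)) (sp cs (nrm xs))" for xs using dom_self[OF dom_sp[OF assms]] .
  show "NF (sp cs (cl (nrm ps))) (sp cs (dl (nrm ps))) (prod_list (nrm ps)) U V = of_real (NS cs ps U V)"
    and "0 \<le> NS cs ps U V"
    unfolding NS_def cl_nrm dl_nrm prod_list_nrm using NF_real[OF d d] by auto
qed

lemma em_GM_le:
  assumes U: "U \<in> maya" and V: "V \<in> maya" and dom: "dom c cs"
    and B: "\<And>W. W \<in> maya \<Longrightarrow> B W V \<le> ennreal (b W)" and b: "\<And>W. W \<in> maya \<Longrightarrow> 0 \<le> b W" and z: "\<And>W. W \<notin> maya \<Longrightarrow> B W V = 0"
  shows "em (na (tr (ent (E c)))) B U V \<le> ennreal (\<Sum>W\<in>{W \<in> maya. en W \<le> en U}. Re (ent (E cs) W U) * b W)"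
proof -
  have "em (na (tr (ent (E c)))) B U V = (\<integral>\<^sup>+W. ennreal (norm (tr (ent (E c)) U W)) * B W V \<partial>count_space maya)"
    by (rule em_na) (use U V z in auto)
  also have "\<dots> \<le> (\<integral>\<^sup>+W. ennreal (Re (ent (E cs) W U) * b W) \<partial>count_space maya)"
  proof (rule nn_integral_mono)
    fix W assume "W \<in> space (count_space maya)"
    then have W: "W \<in> maya" by simp
    have "ennreal (norm (tr (ent (E c)) U W)) * B W V \<le> ennreal (Re (ent (E cs) W U)) * ennreal (b W)"
      by (rule mult_mono) (use dom_norm[OF dom, of W U] B[OF W] in \<open>auto simp: tr_def intro: ennreal_leI\<close>)
    then show "ennreal (norm (tr (ent (E c)) U W)) * B W V \<le> ennreal (Re (ent (E cs) W U) * b W)"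
      using dom_nonneg[OF dom, of W U] b[OF W] by (simp add: ennreal_mult)
  qed
  also have "\<dots> = (\<Sum>W\<in>{W \<in> maya. en W \<le> en U}. ennreal (Re (ent (E cs) W U) * b W))"
  proof (rule nn_integral_count_space'[OF finite_en])
    fix W assume "W \<in> maya" "W \<notin> {W \<in> maya. en W \<le> en U}"
    then have "ent (E cs) W U = 0" using E_lower[of cs W U] by blast
    then show "ennreal (Re (ent (E cs) W U) * b W) = 0" by simp
  qed auto
  also have "\<dots> = ennreal (\<Sum>W\<in>{W \<in> maya. en W \<le> en U}. Re (ent (E cs) W U) * b W)"
    by (rule sum_ennreal) (use dom_nonneg[OF dom] b in auto)
  finally show ?thesis .
qed

lemma em_GP_le:
  assumes U: "U \<in> maya" and V: "V \<in> maya" and dom: "dom c cs"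
    and B: "\<And>W. W \<in> maya \<Longrightarrow> B W V \<le> ennreal (b W)" and b: "\<And>W. W \<in> maya \<Longrightarrow> 0 \<le> b W" and z: "\<And>W. W \<notin> maya \<Longrightarrow> B W V = 0"
    and s: "((\<lambda>W. Re (ent (E cs) U W) * b W) has_sum s) maya"
  shows "em (na (ent (E c))) B U V \<le> ennreal s"
proof -
  have "em (na (ent (E c))) B U V = (\<integral>\<^sup>+W. ennreal (norm (ent (E c) U W)) * B W V \<partial>count_space maya)"
    by (rule em_na) (use U V z in auto)
  also have "\<dots> \<le> (\<integral>\<^sup>+W. ennreal (Re (ent (E cs) U W) * b W) \<partial>count_space maya)"
  proof (rule nn_integral_mono)
    fix W assume "W \<in> space (count_space maya)"
    then have W: "W \<in> maya" by simp
    have "ennreal (norm (ent (E c) U W)) * B W V \<le> ennreal (Re (ent (E cs) U W)) * ennreal (b W)"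
      by (rule mult_mono) (use dom_norm[OF dom, of U W] B[OF W] in \<open>auto intro: ennreal_leI\<close>)
    then show "ennreal (norm (ent (E c) U W)) * B W V \<le> ennreal (Re (ent (E cs) U W) * b W)"
      using dom_nonneg[OF dom, of U W] b[OF W] by (simp add: ennreal_mult)
  qed
  also have "\<dots> = ennreal s"
    by (rule nn_has_sum[OF _ s]) (use dom_nonneg[OF dom] b in auto)
  finally show ?thesis .
qed

lemma em_dg_le:
  assumes U: "U \<in> maya" and V: "V \<in> maya" and B: "B U V \<le> ennreal b" and b: "0 \<le> b" and z: "\<And>W. W \<notin> maya \<Longrightarrow> B W V = 0"
  shows "em (na (dg \<delta>)) B U V \<le> ennreal (norm (\<delta> U) * b)"
proof -
  have "em (na (dg \<delta>)) B U V = (\<integral>\<^sup>+W. ennreal (norm (dg \<delta> U W)) * B W V \<partial>count_space maya)"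
    by (rule em_na) (use U V z in auto)
  also have "\<dots> = (\<Sum>W\<in>{U}. ennreal (norm (dg \<delta> U W)) * B W V)"
    by (rule nn_integral_count_space') (use U in \<open>auto simp: dg_def\<close>)
  also have "\<dots> \<le> ennreal (norm (\<delta> U)) * ennreal b" using U B by (simp add: dg_def mult_left_mono)
  finally show ?thesis using b by (simp add: ennreal_mult)
qed

lemma lst_bound:
  assumes q: "norm q < 1" "q \<noteq> 0" and cs: "princ cs (of_real (norm q))" "dom c cs"
    and ok: "okps q ps"
  shows "\<exists>K\<ge>0. \<forall>U\<in>maya. \<forall>V\<in>maya. ap (lst c ps \<delta>) U V \<le> ennreal (K * NS cs ps U V * norm (\<delta> V))"
  using ok
proof (induction ps)
  case Nil
  have dcs: "dom cs cs" using dom_self[OF cs(2)] .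
  show ?case
  proof (intro exI[of _ 1] conjI ballI)
    fix U V assume U: "U \<in> maya" and V: "V \<in> maya"
    let ?b0 = "\<lambda>W. norm (\<delta> W) * (if W = V then 1 else 0)"
    have 0: "ap [dg \<delta>] W V \<le> ennreal (?b0 W)" if "W \<in> maya" for W
      unfolding ap_Cons ap_Nil by (rule em_dg_le) (use that V in \<open>auto simp: na_def op_id_def\<close>)
    have 1: "ap [ent (E c), dg \<delta>] W V \<le> ennreal (Re (ent (E cs) W V) * norm (\<delta> V))" if W: "W \<in> maya" for W
      unfolding ap_Cons[of "ent (E c)"]
    proof (rule em_GP_le[where b="?b0" and cs=cs])
      have "((\<lambda>X. Re (ent (E cs) W X) * ?b0 X) has_sum (Re (ent (E cs) W V) * norm (\<delta> V))) {V}"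
        using has_sum_finite[of "{V}" "\<lambda>X. Re (ent (E cs) W X) * ?b0 X"] by simp
      moreover have "((\<lambda>X. Re (ent (E cs) W X) * ?b0 X) has_sum (Re (ent (E cs) W V) * norm (\<delta> V))) {V}
         \<longleftrightarrow> ((\<lambda>X. Re (ent (E cs) W X) * ?b0 X) has_sum (Re (ent (E cs) W V) * norm (\<delta> V))) maya"
        by (rule has_sum_cong_neutral) (use V in auto)
      ultimately show "((\<lambda>X. Re (ent (E cs) W X) * ?b0 X) has_sum (Re (ent (E cs) W V) * norm (\<delta> V))) maya" by simp
    qed (use ap_maya W V cs(2) 0 in auto)
    have "ap (lst c [] \<delta>) U V \<le> ennreal (\<Sum>W\<in>{W \<in> maya. en W \<le> en U}. Re (ent (E cs) W U) * (Re (ent (E cs) W V) * norm (\<delta> V)))"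
      unfolding lst_Nil ap_Cons[of "tr (ent (E c))"]
      by (rule em_GM_le[where b="\<lambda>W. Re (ent (E cs) W V) * norm (\<delta> V)"])
        (use U V cs(2) 1 dom_nonneg[OF cs(2)] ap_maya in auto)
    also have "(\<Sum>W\<in>{W \<in> maya. en W \<le> en U}. Re (ent (E cs) W U) * (Re (ent (E cs) W V) * norm (\<delta> V))) = 1 * NS cs [] U V * norm (\<delta> V)"
    proof -
      have "Im (ent (E cs) X Y) = 0" for X Y using dcs by (simp add: dom_def)
      then show ?thesis by (simp add: NS_def sp_one NF_alt sum_distrib_left sum_distrib_right mult_ac)
    qed
    finally show "ap (lst c [] \<delta>) U V \<le> ennreal (1 * NS cs [] U V * norm (\<delta> V))" .
  qed simp
next
  case (Cons p ps)
  have dcs: "dom cs cs" using dom_self[OF cs(2)] .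
  have okp: "norm (p * y * q) < 1" if "y \<in> set (dl ps)" for y using Cons.prems that by simp
  obtain K where K: "0 \<le> K" "\<And>U V. U \<in> maya \<Longrightarrow> V \<in> maya \<Longrightarrow> ap (lst c ps \<delta>) U V \<le> ennreal (K * NS cs ps U V * norm (\<delta> V))"
    using Cons by auto
  let ?p = "complex_of_real (norm p)" and ?q = "complex_of_real (norm q)"
  let ?d = "sp cs (dl (nrm ps))" and ?r = "prod_list (nrm ps)"
  have qs: "norm ?q < 1" "?q \<noteq> 0" using q by auto
  obtain H where hs: "exs (hc (scl ?p cs) ?d) H"
    using princ_exs[OF cs(1) qs, of "dl (nrm ps)" ?p] okp by (force simp: dl_nrm norm_mult)
  have d1: "dom (scl ?p cs) (scl ?p cs)" using dom_scl[OF dcs, of ?p] by simp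
  have d2: "dom ?d ?d" unfolding dl_nrm using dom_self[OF dom_sp[OF dcs]] .
  let ?NF1 = "NF (sp cs (cl (nrm (p # ps)))) (scl ?p ?d) (prod_list (nrm (p # ps)))"
  have d3: "dom (scl ?p ?d) (scl ?p ?d)" using dom_scl[OF d2, of ?p] by simp
  have d4: "dom (sp cs (cl (nrm xs))) (sp cs (cl (nrm xs)))" for xs unfolding cl_nrm using dom_self[OF dom_sp[OF dcs]] .
  define N1 where "N1 U V = Re (?NF1 U V)" for U V
  have N1: "?NF1 U V = of_real (N1 U V)" "0 \<le> N1 U V" for U V
    using NF_real[OF d4 d3, of "norm (prod_list (p # ps))" "p # ps"] unfolding N1_def prod_list_nrm by auto
  define K' where "K' = K * \<bar>Re H\<bar>"
  have step: "ap (ent (E c) # pw p # lst c ps \<delta>) W V \<le> ennreal (K' * N1 W V * norm (\<delta> V))" if W: "W \<in> maya" and V: "V \<in> maya" for W V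
  proof -
    let ?b = "\<lambda>X. K * norm (\<delta> V) * (norm p ^ nat (en X) * NS cs ps X V)"
    have "((\<lambda>X. ent (E cs) W X * (?p ^ nat (en X) * NF (sp cs (cl (nrm ps))) ?d ?r X V)) has_sum H * ?NF1 W V) maya"
      using NF_step[OF W V hs hs d1 d2, of "sp cs (cl (nrm ps))" ?r] unfolding list.map cl_Cons_sp prod_list.Cons .
    then have "((\<lambda>X. Re (ent (E cs) W X * (?p ^ nat (en X) * NF (sp cs (cl (nrm ps))) ?d ?r X V))) has_sum Re (H * ?NF1 W V)) maya"
      by (rule has_sum_Re)
    moreover have "Re (ent (E cs) W X * (?p ^ nat (en X) * NF (sp cs (cl (nrm ps))) ?d ?r X V)) = Re (ent (E cs) W X) * (norm p ^ nat (en X) * NS cs ps X V)" for X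
      unfolding NS_eq(1)[OF dcs] of_real_power[symmetric] of_real_mult[symmetric] by simp
    ultimately have "((\<lambda>X. Re (ent (E cs) W X) * (norm p ^ nat (en X) * NS cs ps X V)) has_sum Re H * N1 W V) maya"
      unfolding N1(1) by simp
    then have "((\<lambda>X. K * norm (\<delta> V) * (Re (ent (E cs) W X) * (norm p ^ nat (en X) * NS cs ps X V))) has_sum K * norm (\<delta> V) * (Re H * N1 W V)) maya"
      by (rule has_sum_cmult_right)
    then have s: "((\<lambda>X. Re (ent (E cs) W X) * ?b X) has_sum K * norm (\<delta> V) * (Re H * N1 W V)) maya"
      by (simp add: mult_ac)
    have 0: "ap (pw p # lst c ps \<delta>) X V \<le> ennreal (?b X)" if X: "X \<in> maya" for X
    proof -
      have "ap (pw p # lst c ps \<delta>) X V \<le> ennreal (norm (p ^ nat (en X)) * (K * NS cs ps X V * norm (\<delta> V)))"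
        unfolding ap_Cons[of "pw p"] by (rule em_dg_le) (use X V K NS_eq(2)[OF dcs] ap_maya in auto)
      then show ?thesis by (simp add: norm_power mult_ac)
    qed
    have "ap (ent (E c) # pw p # lst c ps \<delta>) W V \<le> ennreal (K * norm (\<delta> V) * (Re H * N1 W V))"
      unfolding ap_Cons[of "ent (E c)"]
      by (rule em_GP_le[where b="?b" and cs=cs]) (use W V cs(2) 0 s K NS_eq(2)[OF dcs] ap_maya in auto)
    also have "\<dots> \<le> ennreal (K' * N1 W V * norm (\<delta> V))"
    proof (rule ennreal_leI)
      have "Re H * N1 W V \<le> \<bar>Re H\<bar> * N1 W V" by (rule mult_right_mono) (use N1 in auto)
      then have "K * norm (\<delta> V) * (Re H * N1 W V) \<le> K * norm (\<delta> V) * (\<bar>Re H\<bar> * N1 W V)"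
        by (rule mult_left_mono) (use K in auto)
      then show "K * norm (\<delta> V) * (Re H * N1 W V) \<le> K' * N1 W V * norm (\<delta> V)" by (simp add: K'_def mult_ac)
    qed
    finally show ?thesis .
  qed
  show ?case
  proof (intro exI[of _ K'] conjI ballI)
    show "0 \<le> K'" using K by (simp add: K'_def)
    fix U V assume U: "U \<in> maya" and V: "V \<in> maya"
    have "ap (lst c (p # ps) \<delta>) U V \<le> ennreal (\<Sum>W\<in>{W \<in> maya. en W \<le> en U}. Re (ent (E cs) W U) * (K' * N1 W V * norm (\<delta> V)))"
      unfolding lst_Cons ap_Cons[of "tr (ent (E c))"]
      by (rule em_GM_le[where b="\<lambda>W. K' * N1 W V * norm (\<delta> V)"])
        (use U V cs(2) step[OF _ V] K N1 ap_maya in \<open>auto simp: K'_def\<close>)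
    also have "(\<Sum>W\<in>{W \<in> maya. en W \<le> en U}. Re (ent (E cs) W U) * (K' * N1 W V * norm (\<delta> V)))
       = K' * (\<Sum>W\<in>{W \<in> maya. en W \<le> en U}. Re (ent (E cs) W U) * N1 W V) * norm (\<delta> V)"
      by (simp add: sum_distrib_left sum_distrib_right mult_ac)
    also have "(\<Sum>W\<in>{W \<in> maya. en W \<le> en U}. Re (ent (E cs) W U) * N1 W V) = NS cs (p # ps) U V"
    proof -
      have "NS cs (p # ps) U V = Re (\<Sum>W\<in>{W \<in> maya. en W \<le> en U}. ent (E cs) W U * ?NF1 W V)"
        unfolding NF_left[OF U] NS_def list.map dl_Cons_sp ..
      then show ?thesis unfolding N1(1) by simp
    qed
    finally show "ap (lst c (p # ps) \<delta>) U V \<le> ennreal (K' * NS cs (p # ps) U V * norm (\<delta> V))" .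
  qed
qed

lemma hc_tw_tw: "hc (tw c) (tw d) l = hc c d l"
  by (cases "even l") (simp_all add: hc_def tw_def)

lemma dual_summable:
  assumes cs: "princ cs q" "norm q < 1" "q \<noteq> 0"
  shows "summable (\<lambda>n. norm (expc (hc (scl Q (sp cs xs)) (sp (tw cs) ys)) n))"
proof -
  have "\<forall>x y. \<exists>v. exs (\<lambda>l. - ((- (Q * x * y)) ^ l) * q ^ l / (of_nat l * (1 - q ^ l) ^ 2)) v"
    using exs_dual[OF cs(2,3)] by (simp add: exs_def)
  then obtain v where v: "\<And>x y. exs (\<lambda>l. - ((- (Q * x * y)) ^ l) * q ^ l / (of_nat l * (1 - q ^ l) ^ 2)) (v x y)"
    by metis
  have "exs (\<lambda>l. \<Sum>x\<leftarrow>xs. \<Sum>y\<leftarrow>ys. - ((- (Q * x * y)) ^ l) * q ^ l / (of_nat l * (1 - q ^ l) ^ 2)) (\<Prod>x\<leftarrow>xs. \<Prod>y\<leftarrow>ys. v x y)"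
    by (intro exs_sum_list v)
  then have "exs (hc (scl Q (sp cs xs)) (sp (tw cs) ys)) (\<Prod>x\<leftarrow>xs. \<Prod>y\<leftarrow>ys. v x y)"
  proof (rule exs_cong[rotated])
    fix l :: nat assume l: "1 \<le> l"
    have t: "- ((- (Q * x * y)) ^ l) * q ^ l / (of_nat l * (1 - q ^ l) ^ 2) = (Q * x * y) ^ l * (- ((-1) ^ l) * hc cs cs l)" for x y
      using cs(1) l by (simp add: princ_def power_minus[of "Q * x * y"])
    have "(\<Sum>x\<leftarrow>xs. \<Sum>y\<leftarrow>ys. - ((- (Q * x * y)) ^ l) * q ^ l / (of_nat l * (1 - q ^ l) ^ 2))
       = (\<Sum>x\<leftarrow>xs. Q ^ l * x ^ l * (\<Sum>y\<leftarrow>ys. y ^ l)) * (- ((-1) ^ l) * hc cs cs l)"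
      unfolding t by (simp add: sum_list_mult_const[symmetric] sum_list_const_mult[symmetric] power_mult_distrib mult_ac)
    also have "\<dots> = hc (scl Q (sp cs xs)) (sp (tw cs) ys) l"
      by (simp add: hc_def scl_def sp_def tw_def sum_list_mult_const sum_list_const_mult mult.assoc)
    finally show "(\<Sum>x\<leftarrow>xs. \<Sum>y\<leftarrow>ys. - ((- (Q * x * y)) ^ l) * q ^ l / (of_nat l * (1 - q ^ l) ^ 2))
      = hc (scl Q (sp cs xs)) (sp (tw cs) ys) l" .
  qed
  then show ?thesis by (simp add: exs_def)
qed

lemma summable_on_finite_sum:
  fixes f :: "'x \<Rightarrow> 'y \<Rightarrow> real"
  assumes "finite S" "\<And>z. z \<in> S \<Longrightarrow> f z summable_on A"
  shows "(\<lambda>w. \<Sum>z\<in>S. f z w) summable_on A"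
  using assms by (induction S rule: finite_induct) (auto intro!: summable_on_add)

lemma ap_finite:
  assumes q: "norm q < 1" "q \<noteq> 0" and cs: "princ cs (of_real (norm q))" "dom c cs"
    and ok: "okps q ps" "okps q ps'" and U: "U \<in> maya" and V: "V \<in> maya"
  shows "ap (lst c ps (\<lambda>_. 1) @ pw Q # lst (tw c) ps' \<delta>) U V < \<infinity>"
proof -
  let ?cs' = "tw cs"
  have dcs: "dom cs cs" using dom_self[OF cs(2)] .
  have dcs': "dom ?cs' ?cs'" by (rule dom_tw[OF dcs])
  have p': "princ ?cs' (of_real (norm q))"
    using cs(1) by (simp add: princ_def hc_tw_tw)
  obtain K where K: "0 \<le> K" "\<And>U V. U \<in> maya \<Longrightarrow> V \<in> maya \<Longrightarrow> ap (lst c ps (\<lambda>_. 1)) U V \<le> ennreal (K * NS cs ps U V)"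
    using lst_bound[OF q cs ok(1), of "\<lambda>_. 1"] by auto
  obtain K' where K': "0 \<le> K'" "\<And>U V. U \<in> maya \<Longrightarrow> V \<in> maya \<Longrightarrow> ap (lst (tw c) ps' \<delta>) U V \<le> ennreal (K' * NS ?cs' ps' U V * norm (\<delta> V))"
    using lst_bound[OF q p' dom_tw[OF cs(2)] ok(2), of \<delta>] by auto
  let ?c = "sp cs (cl (nrm ps))" and ?d = "sp cs (dl (nrm ps))" and ?r = "norm (prod_list ps)"
  let ?c' = "sp ?cs' (cl (nrm ps'))" and ?d' = "sp ?cs' (dl (nrm ps'))" and ?r' = "norm (prod_list ps')"
  let ?Q = "complex_of_real (norm Q)"
  have qs: "norm (complex_of_real (norm q)) < 1" "complex_of_real (norm q) \<noteq> 0" using q by auto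
  have dc: "dom (scl ?Q ?c) (scl ?Q ?c)"
    using dom_scl[OF dom_self[OF dom_sp[OF dcs]], of ?Q "cl ps"] by (simp add: cl_nrm)
  have dc0: "dom ?c ?c" unfolding cl_nrm using dom_self[OF dom_sp[OF dcs]] .
  have dd: "dom ?d ?d" unfolding dl_nrm using dom_self[OF dom_sp[OF dcs]] .
  have dc': "dom ?c' ?c'" unfolding cl_nrm using dom_self[OF dom_sp[OF dcs']] .
  have dd': "dom ?d' ?d'" unfolding dl_nrm using dom_self[OF dom_sp[OF dcs']] .
  have reNF: "Re (ent (E d) Z U * of_real r ^ n * ent (E c) Z' V) = Re (ent (E d) Z U) * r ^ n * Re (ent (E c) Z' V)"
    if "dom c c" "dom d d" for c d Z U n r Z' V
    using dom_real[OF that(1), of Z' V] dom_real[OF that(2), of Z U]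
    by (metis Re_complex_of_real of_real_mult of_real_power)
  have L: "NS cs ps U W = (\<Sum>Z\<in>{Z \<in> maya. en Z \<le> en U}. Re (ent (E ?d) Z U) * ?r ^ nat (en Z) * Re (ent (E ?c) Z W))" for W
    unfolding NS_def NF_alt prod_list_nrm Re_sum reNF[OF dc0 dd] ..
  have R: "NS ?cs' ps' W V = (\<Sum>Z\<in>{Z \<in> maya. en Z \<le> en V}. Re (ent (E ?d') Z W) * ?r' ^ nat (en Z) * Re (ent (E ?c') Z V))" for W
    unfolding NS_def NF_def prod_list_nrm Re_sum reNF[OF dc' dd'] ..
  have scl: "norm Q ^ nat (en W) * Re (ent (E ?c) Z W) = norm Q ^ nat (en Z) * Re (ent (E (scl ?Q ?c)) Z W)" for Z W
  proof -
    have "Re (ent (E ?c) Z W * ?Q ^ nat (en W)) = Re (?Q ^ nat (en Z) * ent (E (scl ?Q ?c)) Z W)"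
      by (simp only: E_scl_left)
    then show ?thesis unfolding of_real_power[symmetric] by (simp add: mult.commute)
  qed
  have base: "(\<lambda>W. Re (ent (E (scl ?Q ?c)) Z W) * Re (ent (E ?d') Z' W)) summable_on maya"
    if "Z \<in> maya" "Z' \<in> maya" for Z Z'
    by (rule Heis_pos[OF that dual_summable[OF cs(1) qs] dc dd'])
  have "(\<lambda>W. \<Sum>Z\<in>{Z \<in> maya. en Z \<le> en U}. \<Sum>Z'\<in>{Z \<in> maya. en Z \<le> en V}.
      (Re (ent (E ?d) Z U) * ?r ^ nat (en Z) * norm Q ^ nat (en Z) * ?r' ^ nat (en Z') * Re (ent (E ?c') Z' V)) *
      (Re (ent (E (scl ?Q ?c)) Z W) * Re (ent (E ?d') Z' W))) summable_on maya"
    by (intro summable_on_finite_sum finite_en summable_on_cmult_right base) auto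
  moreover have "(\<Sum>Z\<in>{Z \<in> maya. en Z \<le> en U}. \<Sum>Z'\<in>{Z \<in> maya. en Z \<le> en V}.
      (Re (ent (E ?d) Z U) * ?r ^ nat (en Z) * norm Q ^ nat (en Z) * ?r' ^ nat (en Z') * Re (ent (E ?c') Z' V)) *
      (Re (ent (E (scl ?Q ?c)) Z W) * Re (ent (E ?d') Z' W)))
      = NS cs ps U W * (norm Q ^ nat (en W) * NS ?cs' ps' W V)" for W
  proof -
    have "NS cs ps U W * (norm Q ^ nat (en W) * NS ?cs' ps' W V)
      = (\<Sum>Z\<in>{Z \<in> maya. en Z \<le> en U}. Re (ent (E ?d) Z U) * ?r ^ nat (en Z) * (norm Q ^ nat (en W) * Re (ent (E ?c) Z W))) * NS ?cs' ps' W V"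
      unfolding L by (simp add: sum_distrib_left sum_distrib_right mult_ac)
    also have "\<dots> = (\<Sum>Z\<in>{Z \<in> maya. en Z \<le> en U}. \<Sum>Z'\<in>{Z \<in> maya. en Z \<le> en V}.
      (Re (ent (E ?d) Z U) * ?r ^ nat (en Z) * norm Q ^ nat (en Z) * ?r' ^ nat (en Z') * Re (ent (E ?c') Z' V)) *
      (Re (ent (E (scl ?Q ?c)) Z W) * Re (ent (E ?d') Z' W)))"
      unfolding scl R sum_product by (intro sum.cong refl) (simp add: mult_ac)
    finally show ?thesis by simp
  qed
  ultimately have f: "(\<lambda>W. NS cs ps U W * (norm Q ^ nat (en W) * NS ?cs' ps' W V)) summable_on maya" by simp
  have s: "((\<lambda>W. K * K' * norm (\<delta> V) * (NS cs ps U W * (norm Q ^ nat (en W) * NS ?cs' ps' W V))) has_sum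
     K * K' * norm (\<delta> V) * infsum (\<lambda>W. NS cs ps U W * (norm Q ^ nat (en W) * NS ?cs' ps' W V)) maya) maya"
    by (rule has_sum_cmult_right) (rule has_sum_infsum[OF f])
  let ?B = "ap (pw Q # lst (tw c) ps' \<delta>)"
  have B: "?B W V \<le> ennreal (norm Q ^ nat (en W) * (K' * NS ?cs' ps' W V * norm (\<delta> V)))" if W: "W \<in> maya" for W
  proof -
    have "?B W V \<le> ennreal (norm (Q ^ nat (en W)) * (K' * NS ?cs' ps' W V * norm (\<delta> V)))"
      unfolding ap_Cons[of "pw Q"]
      by (rule em_dg_le) (use W V K' NS_eq(2)[OF dcs'] ap_maya in auto)
    then show ?thesis by (simp add: norm_power)
  qed
  have "ap (lst c ps (\<lambda>_. 1) @ pw Q # lst (tw c) ps' \<delta>) U V = (\<integral>\<^sup>+W. ap (lst c ps (\<lambda>_. 1)) U W * ?B W V \<partial>count_space UNIV)"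
    unfolding ap_append em_def ..
  also have "\<dots> = (\<integral>\<^sup>+W. ap (lst c ps (\<lambda>_. 1)) U W * ?B W V \<partial>count_space maya)"
    by (rule nn_integral_count_space_eq) (use ap_maya in auto)
  also have "\<dots> \<le> (\<integral>\<^sup>+W. ennreal (K * K' * norm (\<delta> V) * (NS cs ps U W * (norm Q ^ nat (en W) * NS ?cs' ps' W V))) \<partial>count_space maya)"
  proof (rule nn_integral_mono)
    fix W assume "W \<in> space (count_space maya)"
    then have W: "W \<in> maya" by simp
    have "ap (lst c ps (\<lambda>_. 1)) U W * ?B W V \<le> ennreal (K * NS cs ps U W) * ennreal (norm Q ^ nat (en W) * (K' * NS ?cs' ps' W V * norm (\<delta> V)))"
      by (rule mult_mono[OF K(2)[OF U W] B[OF W]]) auto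
    also have "\<dots> = ennreal ((K * NS cs ps U W) * (norm Q ^ nat (en W) * (K' * NS ?cs' ps' W V * norm (\<delta> V))))"
      using K K' NS_eq(2)[OF dcs] NS_eq(2)[OF dcs'] by (intro ennreal_mult[symmetric]) auto
    also have "(K * NS cs ps U W) * (norm Q ^ nat (en W) * (K' * NS ?cs' ps' W V * norm (\<delta> V)))
       = K * K' * norm (\<delta> V) * (NS cs ps U W * (norm Q ^ nat (en W) * NS ?cs' ps' W V))" by (simp add: mult_ac)
    finally show "ap (lst c ps (\<lambda>_. 1)) U W * ?B W V \<le> ennreal (K * K' * norm (\<delta> V) * (NS cs ps U W * (norm Q ^ nat (en W) * NS ?cs' ps' W V)))" .
  qed
  also have "\<dots> = ennreal (K * K' * norm (\<delta> V) * infsum (\<lambda>W. NS cs ps U W * (norm Q ^ nat (en W) * NS ?cs' ps' W V)) maya)"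
    by (rule nn_has_sum[OF _ s]) (use K K' NS_eq(2)[OF dcs] NS_eq(2)[OF dcs'] in auto)
  also have "\<dots> < \<infinity>" by simp
  finally show ?thesis .
qed

section \<open>Diagonal operators and principal specializations\<close>

lemma ent_Dm_0_dg: "ent (Dm \<phi> 0) = dg (wt \<phi>)"
proof (intro ext)
  fix U V
  show "ent (Dm \<phi> 0) U V = dg (wt \<phi>) U V"
  proof (cases "V \<in> maya")
    case True
    then show ?thesis by (auto simp: ent_Dm_0 dg_def)
  next
    case False
    then have "ent (Dm \<phi> 0) U V = 0" using ent_maya by blast
    then show ?thesis using False by (auto simp: dg_def)
  qed
qed

lemma L0_dg: "L0 = dg (\<lambda>V. of_int (en V))"
proof -
  have "L0 = ent (Dm (\<lambda>p. of_int (- p)) 0)"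
  proof (intro ext)
    fix U V
    have "L0 U V = (\<Sum>\<^sub>\<infinity>n. of_int n * ent (nb (- n) 0) U V)"
      unfolding L0_def ent_nb_normal by simp
    also have "\<dots> = (\<Sum>\<^sub>\<infinity>p. of_int (- p) * ent (nb p 0) U V)"
      by (rule infsum_reindex_bij_witness[where i="\<lambda>p. - p" and j="\<lambda>n. - n"]) auto
    finally show "L0 U V = ent (Dm (\<lambda>p. of_int (- p)) 0) U V" by (simp add: ent_Dm_infsum)
  qed
  moreover have "wt (\<lambda>p. of_int (- p) :: complex) = (\<lambda>V. of_int (en V))"
    by (rule ext) (simp add: wt_def en_def)
  ultimately show ?thesis by (simp only: ent_Dm_0_dg)
qed

lemma W0_dg: "W0 = dg w0"
proof -
  have "W0 = ent (Dm (\<lambda>p. of_int (p ^ 2)) 0)"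
  proof (intro ext)
    fix U V
    have "W0 U V = (\<Sum>\<^sub>\<infinity>n. of_int (n ^ 2) * ent (nb (- n) 0) U V)"
      unfolding W0_def ent_nb_normal by simp
    also have "\<dots> = (\<Sum>\<^sub>\<infinity>p. of_int (p ^ 2) * ent (nb p 0) U V)"
      by (rule infsum_reindex_bij_witness[where i="\<lambda>p. - p" and j="\<lambda>n. - n"]) auto
    finally show "W0 U V = ent (Dm (\<lambda>p. of_int (p ^ 2)) 0) U V" by (simp add: ent_Dm_infsum)
  qed
  then show ?thesis by (simp add: ent_Dm_0_dg w0_def)
qed

lemma op_scale_dg: "op_scale c (dg \<phi>) = dg (\<lambda>V. c * \<phi> V)"
  by (intro ext) (auto simp: op_scale_def dg_def)

lemma op_power_dg: "op_power (dg \<phi>) n = dg (\<lambda>V. \<phi> V ^ n)"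
proof (induction n)
  case 0
  show ?case by (intro ext) (simp add: op_id_def dg_def)
next
  case (Suc n)
  show ?case
  proof (intro ext)
    fix U V
    show "op_power (dg \<phi>) (Suc n) U V = dg (\<lambda>V. \<phi> V ^ Suc n) U V"
    proof (cases "U \<in> maya")
      case True
      then show ?thesis by (simp add: Suc op_mult_dg_left) (simp add: dg_def)
    qed (simp add: op_mult_def dg_def)
  qed
qed

lemma op_exp_dg: "op_exp (dg \<phi>) = dg (\<lambda>V. exp (\<phi> V))"
proof (intro ext)
  fix U V
  have "((\<lambda>n. \<phi> V ^ n /\<^sub>R fact n) has_sum exp (\<phi> V)) UNIV"
    by (rule norm_summable_imp_has_sum[OF summable_norm_exp exp_converges])
  then have "(\<Sum>\<^sub>\<infinity>n. \<phi> V ^ n /\<^sub>R fact n) = exp (\<phi> V)" by (rule infsumI)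
  then show "op_exp (dg \<phi>) U V = dg (\<lambda>V. exp (\<phi> V)) U V"
    unfolding op_exp_def op_power_dg by (cases "U \<in> maya \<and> U = V") (auto simp only: dg_def if_True if_False simp_thms scaleR_zero_right infsum_0)
qed

lemma pow_L0_dg: assumes "x \<noteq> 0" shows "pow_L0 x = pw x"
proof -
  have "exp (Ln x * of_int (en V)) = x ^ nat (en V)" for V
  proof -
    have "exp (Ln x * of_int (en V)) = exp (of_nat (nat (en V)) * Ln x)"
      using en_nonneg[of V] by (simp add: mult.commute)
    then show ?thesis using assms by (simp add: exp_of_nat_mult)
  qed
  then show ?thesis by (simp add: pow_L0_def L0_dg op_scale_dg op_exp_dg)
qed

lemma op_prod_append_foldr: "op_prod (xs @ ys) = foldr op_mult xs (op_prod ys)"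
  by (simp add: op_prod_def)

lemma op_prod_dg_one: "op_prod (xs @ dg (\<lambda>_. 1) # dg \<phi> # ys) = op_prod (xs @ dg \<phi> # ys)"
proof -
  have "op_prod (dg (\<lambda>_. 1) # dg \<phi> # ys) = op_prod (dg \<phi> # ys)"
  proof (intro ext)
    fix U V
    show "op_prod (dg (\<lambda>_. 1) # dg \<phi> # ys) U V = op_prod (dg \<phi> # ys) U V"
    proof (cases "U \<in> maya")
      case True
      then show ?thesis by (simp add: op_prod_Cons op_mult_dg_left)
    next
      case False
      then show ?thesis by (simp add: op_prod_Cons op_mult_def dg_def)
    qed
  qed
  then show ?thesis by (simp only: op_prod_append_foldr)
qed

lemma q_rho_eq: "q_rho lq i = exp (lq / 2) * exp lq ^ i"
  by (simp add: q_rho_def exp_of_nat_mult[symmetric] exp_add[symmetric] algebra_simps)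

lemma summable_q_rho: "norm (exp lq) < 1 \<Longrightarrow> summable (\<lambda>i. norm (q_rho lq i))"
  by (simp add: q_rho_eq norm_mult norm_power summable_mult)

lemma norm_exp_power_lt:
  fixes q :: complex assumes "norm q < 1" "1 \<le> l" shows "norm (q ^ l) < 1"
proof -
  have "norm q ^ l \<le> norm q ^ 1" by (rule power_decreasing) (use assms in auto)
  then show ?thesis using assms by (simp add: norm_power)
qed

lemma pp_q_rho:
  assumes "norm (exp lq) < 1" "1 \<le> l"
  shows "pp (q_rho lq) l = exp (lq / 2) ^ l / (of_nat l * (1 - exp lq ^ l))"
proof -
  have n: "norm (exp lq ^ l) < 1" using norm_exp_power_lt[OF assms] .
  have "(\<lambda>i. exp (lq / 2) ^ l * (exp lq ^ l) ^ i) sums (exp (lq / 2) ^ l * (1 / (1 - exp lq ^ l)))"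
    by (intro sums_mult geometric_sums n)
  moreover have "q_rho lq i ^ l = exp (lq / 2) ^ l * (exp lq ^ l) ^ i" for i
    by (simp add: q_rho_eq power_mult_distrib power_mult[symmetric] mult.commute)
  ultimately have "(\<Sum>i. q_rho lq i ^ l) = exp (lq / 2) ^ l * (1 / (1 - exp lq ^ l))" by (simp add: sums_iff)
  then show ?thesis by (simp add: pp_def)
qed

lemma exp_half: "exp (lq / 2) ^ l * exp (lq / 2) ^ l = exp lq ^ l" for lq :: complex
  by (simp add: power_mult_distrib[symmetric] exp_add[symmetric])

lemma princ_q_rho: assumes "norm (exp lq) < 1" shows "princ (pp (q_rho lq)) (exp lq)"
  unfolding princ_def
proof (intro allI impI)
  fix l :: nat assume l: "1 \<le> l"
  have "hc (pp (q_rho lq)) (pp (q_rho lq)) l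
      = of_nat l * (exp (lq / 2) ^ l * exp (lq / 2) ^ l) / ((of_nat l * (1 - exp lq ^ l)) * (of_nat l * (1 - exp lq ^ l)))"
    by (simp add: hc_def pp_q_rho[OF assms l])
  also have "\<dots> = exp lq ^ l / (of_nat l * (1 - exp lq ^ l) ^ 2)"
    unfolding exp_half using l by (simp add: power2_eq_square)
  finally show "hc (pp (q_rho lq)) (pp (q_rho lq)) l = exp lq ^ l / (of_nat l * (1 - exp lq ^ l) ^ 2)" .
qed

lemma exp_Re: "exp (complex_of_real (Re lq)) = of_real (norm (exp lq))"
  by (simp add: exp_of_real)

lemma dom_q_rho: assumes "norm (exp lq) < 1" shows "dom (pp (q_rho lq)) (pp (q_rho (of_real (Re lq))))"
proof -
  have "(\<lambda>i. complex_of_real (norm (q_rho lq i))) = q_rho (of_real (Re lq))"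
    by (rule ext) (simp add: q_rho_def exp_of_real[symmetric])
  then show ?thesis using dom_pp[OF summable_q_rho[OF assms]] by simp
qed

lemma princ_q_rho_norm: assumes "norm (exp lq) < 1" shows "princ (pp (q_rho (of_real (Re lq)))) (of_real (norm (exp lq)))"
  using princ_q_rho[of "of_real (Re lq)"] assms by (simp add: exp_Re)

section \<open>The operator \<open>g'\<close>\<close>

text \<open>The factors of \<open>g'\<close> to the left and to the right of \<open>Q ^ L\<^sub>0\<close>, in normal form.\<close>

definition XL :: "complex \<Rightarrow> complex list \<Rightarrow> nat \<Rightarrow> complex fop"
  where "XL lq ps a U V = exp (lq / (2 * of_nat a) * w0 U) * kk (exp lq) ps *
    NF (sp (pp (q_rho lq)) (cl ps)) (sp (pp (q_rho lq)) (dl ps)) (prod_list ps) U V"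

definition XR :: "complex \<Rightarrow> complex list \<Rightarrow> nat \<Rightarrow> complex fop"
  where "XR lq ps b U V = kk (exp lq) ps *
    NF (sp (pm (q_rho lq)) (cl ps)) (sp (pm (q_rho lq)) (dl ps)) (prod_list ps) U V * exp (- lq / (2 * of_nat b) * w0 V)"

lemma g'_lst:
  assumes "norm (exp lq) < 1" "Q \<noteq> 0" "\<And>i. 1 \<le> i \<Longrightarrow> i < a \<Longrightarrow> P i \<noteq> 0" "\<And>i. 1 \<le> i \<Longrightarrow> i < b \<Longrightarrow> R i \<noteq> 0"
  shows "g' a b lq Q P R = op_prod (dg (\<lambda>U. exp (lq / (2 * of_nat a) * w0 U)) #
     lst (pp (q_rho lq)) (map P [1..<a]) (\<lambda>_. 1) @ pw Q # lst (tw (pp (q_rho lq))) (map R (rev [1..<b])) (\<lambda>V. exp (- lq / (2 * of_nat b) * w0 V)))"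
proof -
  note s = summable_q_rho[OF assms(1)]
  have c1: "map (\<lambda>i. [pow_L0 (P i), Gamma (-1) (q_rho lq), Gamma 1 (q_rho lq)]) [1..<a]
      = map (\<lambda>p. [pw p, tr (ent (E (pp (q_rho lq)))), ent (E (pp (q_rho lq)))]) (map P [1..<a])"
    using assms(3) by (auto simp: pow_L0_dg Gamma_pos[OF s] Gamma_neg[OF s])
  have c2: "map (\<lambda>j. [pow_L0 (R j), Gamma' (-1) (q_rho lq), Gamma' 1 (q_rho lq)]) (rev [1..<b])
      = map (\<lambda>p. [pw p, tr (ent (E (pm (q_rho lq)))), ent (E (pm (q_rho lq)))]) (map R (rev [1..<b]))"
    using assms(4) by (auto simp: pow_L0_dg Gamma'_pos[OF s] Gamma'_neg[OF s])
  have "op_prod (dg (\<lambda>U. exp (lq / (2 * of_nat a) * w0 U)) #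
     lst (pp (q_rho lq)) (map P [1..<a]) (\<lambda>_. 1) @ pw Q # lst (pm (q_rho lq)) (map R (rev [1..<b])) (\<lambda>V. exp (- lq / (2 * of_nat b) * w0 V)))
    = op_prod ((dg (\<lambda>U. exp (lq / (2 * of_nat a) * w0 U)) #
     [tr (ent (E (pp (q_rho lq)))), ent (E (pp (q_rho lq)))] @
     concat (map (\<lambda>p. [pw p, tr (ent (E (pp (q_rho lq)))), ent (E (pp (q_rho lq)))]) (map P [1..<a]))) @
     dg (\<lambda>_. 1) # pw Q # lst (pm (q_rho lq)) (map R (rev [1..<b])) (\<lambda>V. exp (- lq / (2 * of_nat b) * w0 V)))"
    unfolding lst_def[of "pp (q_rho lq)"] by simp
  also have "\<dots> = g' a b lq Q P R"
    unfolding op_prod_dg_one g'_def c1 c2 lst_def[of "pm (q_rho lq)"]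
    by (simp add: Gamma_pos[OF s] Gamma_neg[OF s] Gamma'_pos[OF s] Gamma'_neg[OF s] pow_L0_dg[OF assms(2)]
        W0_dg op_scale_dg op_exp_dg)
  finally show ?thesis by (simp add: pm_def)
qed

lemma g'_has_sum:
  assumes q: "norm (exp lq) < 1" and Q: "Q \<noteq> 0"
    and P: "\<And>i. 1 \<le> i \<Longrightarrow> i < a \<Longrightarrow> P i \<noteq> 0" and R: "\<And>i. 1 \<le> i \<Longrightarrow> i < b \<Longrightarrow> R i \<noteq> 0"
    and ok: "okps (exp lq) (map P [1..<a])" "okps (exp lq) (map R (rev [1..<b]))"
    and U: "U \<in> maya" and V: "V \<in> maya"
  shows "((\<lambda>W. XL lq (map P [1..<a]) a U W * (Q ^ nat (en W) * XR lq (map R (rev [1..<b])) b W V)) has_sum g' a b lq Q P R U V) maya"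
proof -
  let ?c = "pp (q_rho lq)" and ?ps = "map P [1..<a]" and ?ps' = "map R (rev [1..<b])"
  let ?dL = "\<lambda>U. exp (lq / (2 * of_nat a) * w0 U)" and ?dR = "\<lambda>V. exp (- lq / (2 * of_nat b) * w0 V)"
  note pr = princ_q_rho[OF q] and ds = dom_q_rho[OF q] and ps = princ_q_rho_norm[OF q]
  have q0: "exp lq \<noteq> 0" by simp
  have pt: "princ (tw c) r" if "princ c r" for c r using that by (simp add: princ_def hc_tw_tw)
  have fin: "ap (lst ?c ?ps (\<lambda>_. 1) @ pw Q # lst (tw ?c) ?ps' ?dR) U V < \<infinity>"
    by (rule ap_finite[OF q q0 ps ds ok U V])
  then obtain r where r: "ap (lst ?c ?ps (\<lambda>_. 1) @ pw Q # lst (tw ?c) ?ps' ?dR) U V = ennreal r" "0 \<le> r"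
    by (cases "ap (lst ?c ?ps (\<lambda>_. 1) @ pw Q # lst (tw ?c) ?ps' ?dR) U V") auto
  have "ap ((dg ?dL # lst ?c ?ps (\<lambda>_. 1)) @ pw Q # lst (tw ?c) ?ps' ?dR) U V \<le> ennreal (norm (?dL U) * r)"
    unfolding append_Cons ap_Cons[of "dg ?dL"]
    by (rule em_dg_le) (use U V r ap_maya in auto)
  also have "\<dots> < \<infinity>" by simp
  finally have *: "ap ((dg ?dL # lst ?c ?ps (\<lambda>_. 1)) @ pw Q # lst (tw ?c) ?ps' ?dR) U V < \<infinity>" .
  have g: "g' a b lq Q P R = op_prod ((dg ?dL # lst ?c ?ps (\<lambda>_. 1)) @ pw Q # lst (tw ?c) ?ps' ?dR)"
    unfolding append_Cons by (rule g'_lst) (use q Q P R in auto)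
  have "((\<lambda>W. op_prod (dg ?dL # lst ?c ?ps (\<lambda>_. 1)) U W * op_prod (pw Q # lst (tw ?c) ?ps' ?dR) W V) has_sum g' a b lq Q P R U V) maya"
    unfolding g by (rule op_prod_append[OF U V *])
  moreover have "op_prod (dg ?dL # lst ?c ?ps (\<lambda>_. 1)) U W = XL lq ?ps a U W" if "W \<in> maya" for W
    using lst_eq[OF pr q q0 ps ds ok(1) U that, of "\<lambda>_. 1"]
    unfolding op_prod_Cons op_mult_dg_left[OF U] XL_def by simp
  moreover have "op_prod (pw Q # lst (tw ?c) ?ps' ?dR) W V = Q ^ nat (en W) * XR lq ?ps' b W V" if W: "W \<in> maya" for W
    using lst_eq[OF pt[OF pr] q q0 pt[OF ps] dom_tw[OF ds] ok(2) W V, of ?dR]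
    unfolding op_prod_Cons op_mult_dg_left[OF W] XR_def pm_def by simp
  ultimately show ?thesis by (subst (asm) has_sum_cong) auto
qed

section \<open>Index sets\<close>

lemma dl_upt: "i \<le> a \<Longrightarrow> dl (map P [i..<a]) = map (\<lambda>j. \<Prod>k\<in>{i..<j}. P k) [i..<Suc a]"
proof (induction i rule: inc_induct)
  case base
  then show ?case by simp
next
  case (step i)
  have "map (\<lambda>j. \<Prod>k\<in>{i..<j}. P k) [i..<Suc a] = 1 # map (\<lambda>j. \<Prod>k\<in>{i..<j}. P k) [Suc i..<Suc a]"
    using step.hyps by (subst upt_conv_Cons) auto
  also have "map (\<lambda>j. \<Prod>k\<in>{i..<j}. P k) [Suc i..<Suc a] = map (\<lambda>j. P i * (\<Prod>k\<in>{Suc i..<j}. P k)) [Suc i..<Suc a]"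
    by (rule map_cong[OF refl]) (auto simp: prod.atLeast_Suc_lessThan)
  finally show ?case using step by (simp add: upt_conv_Cons[of i a] o_def)
qed

lemma prod_list_upt: "i \<le> a \<Longrightarrow> prod_list (map P [i..<a]) = (\<Prod>k\<in>{i..<a}. P k)" for P :: "nat \<Rightarrow> complex"
  by (simp add: prod.distinct_set_conv_list[symmetric])

lemma cl_upt: "i \<le> a \<Longrightarrow> cl (map P [i..<a]) = map (\<lambda>j. \<Prod>k\<in>{j..<a}. P k) [i..<Suc a]"
proof (induction i rule: inc_induct)
  case base
  then show ?case by simp
next
  case (step i)
  have 1: "[i..<a] = i # [Suc i..<a]" "[i..<Suc a] = i # [Suc i..<Suc a]"
    using step.hyps by (auto simp: upt_conv_Cons)
  have "P i * prod_list (map P [Suc i..<a]) = (\<Prod>k\<in>{i..<a}. P k)"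
    using step.hyps by (simp add: prod_list_upt prod.atLeast_Suc_lessThan)
  then show ?case unfolding 1 using step.IH by simp
qed

lemma prod_list_rev_upt: "prod_list (map R (rev [1..<b])) = (\<Prod>k\<in>{1..<b}. R k)" for R :: "nat \<Rightarrow> complex"
  by (simp add: rev_map[symmetric] prod.distinct_set_conv_list[symmetric])

lemma rev_upt_Suc: "1 \<le> b \<Longrightarrow> rev [1..<Suc b] = b # rev [1..<b]" by simp

lemma dl_rev: "1 \<le> b \<Longrightarrow> dl (map R (rev [1..<b])) = map (\<lambda>j. \<Prod>k\<in>{j..<b}. R k) (rev [1..<Suc b])"
proof (induction b rule: dec_induct)
  case base
  show ?case by simp
next
  case (step b)
  have "map (\<lambda>j. \<Prod>k\<in>{j..<Suc b}. R k) (rev [1..<Suc b]) = map (\<lambda>j. R b * (\<Prod>k\<in>{j..<b}. R k)) (rev [1..<Suc b])"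
    by (rule map_cong[OF refl]) (auto simp: prod.atLeastLessThan_Suc mult.commute)
  then show ?case
    unfolding rev_upt_Suc[OF step.hyps(1)] rev_upt_Suc[of "Suc b", simplified] using step by (simp add: o_def)
qed

lemma cl_rev: "1 \<le> b \<Longrightarrow> cl (map R (rev [1..<b])) = map (\<lambda>j. \<Prod>k\<in>{1..<j}. R k) (rev [1..<Suc b])"
proof (induction b rule: dec_induct)
  case base
  show ?case by simp
next
  case (step b)
  have "R b * prod_list (map R (rev [1..<b])) = (\<Prod>k\<in>{1..<Suc b}. R k)"
    using step.hyps by (simp only: prod_list_rev_upt) (simp add: prod.atLeastLessThan_Suc mult.commute)
  then show ?case
    unfolding rev_upt_Suc[OF step.hyps(1)] rev_upt_Suc[of "Suc b", simplified] using step by simp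
qed

lemma okps_upt:
  assumes "i \<le> a" "\<And>i' j. i \<le> i' \<Longrightarrow> i' \<le> j \<Longrightarrow> j < a \<Longrightarrow> norm ((\<Prod>k=i'..j. P k) * q) < 1"
  shows "okps q (map P [i..<a])"
  using assms
proof (induction i rule: inc_induct)
  case (step i)
  have "norm (P i * y * q) < 1" if y: "y \<in> set (dl (map P [Suc i..<a]))" for y
  proof -
    obtain j where j: "y = (\<Prod>k\<in>{Suc i..<j}. P k)" "Suc i \<le> j" "j \<le> a"
      using y step.hyps by (auto simp: dl_upt simp del: upt_Suc)
    have "{i..j - 1} = insert i {Suc i..<j}" using j by auto
    then have "P i * y = (\<Prod>k=i..j - 1. P k)" unfolding j(1) by (subst \<open>{i..j - 1} = _\<close>) simp
    then show ?thesis using step.prems[of i "j - 1"] j step.hyps by auto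
  qed
  then show ?case using step by (simp add: upt_conv_Cons)
qed simp

lemma okps_rev:
  assumes "1 \<le> b" "\<And>i j. 1 \<le> i \<Longrightarrow> i \<le> j \<Longrightarrow> j < b \<Longrightarrow> norm ((\<Prod>k=i..j. R k) * q) < 1"
  shows "okps q (map R (rev [1..<b]))"
  using assms
proof (induction b rule: dec_induct)
  case (step b)
  have "norm (R b * y * q) < 1" if y: "y \<in> set (dl (map R (rev [1..<b])))" for y
  proof -
    obtain j where j: "y = (\<Prod>k\<in>{j..<b}. R k)" "1 \<le> j" "j \<le> b"
      using y unfolding dl_rev[OF step.hyps(1)] by (auto simp del: upt_Suc)
    have "{j..b} = insert b {j..<b}" using j by auto
    then have "R b * y = (\<Prod>k=j..b. R k)" unfolding j(1) by simp
    then show ?thesis using step.prems[of j b] j by auto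
  qed
  then show ?case using step unfolding rev_upt_Suc[OF step.hyps(1)] by simp
qed simp

lemma kk_upt:
  "i \<le> a \<Longrightarrow> kk q (map P [i..<a]) = (\<Prod>(i', j)\<in>{(i', j). i \<le> i' \<and> i' \<le> j \<and> j < a}. MacMahon (\<Prod>k=i'..j. P k) q)"
proof (induction i rule: inc_induct)
  case base
  have "{(i', j). a \<le> i' \<and> i' \<le> j \<and> j < a} = {}" by auto
  then show ?case by (simp only: prod.empty) simp
next
  case (step i)
  let ?S = "\<lambda>i. {(i', j). i \<le> i' \<and> i' \<le> j \<and> j < a}"
  have fin: "finite (?S i)" for i by (rule finite_subset[of _ "{..<a} \<times> {..<a}"]) auto
  have "(\<Prod>y\<leftarrow>dl (map P [Suc i..<a]). MacMahon (P i * y) q) = (\<Prod>j\<in>{Suc i..<Suc a}. MacMahon (P i * (\<Prod>k\<in>{Suc i..<j}. P k)) q)"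
    using step.hyps by (simp add: dl_upt o_def prod.distinct_set_conv_list[symmetric] del: upt_Suc)
  also have "\<dots> = (\<Prod>(i', j)\<in>Pair i ` {i..<a}. MacMahon (\<Prod>k=i'..j. P k) q)"
  proof (subst prod.reindex)
    show "(\<Prod>j\<in>{Suc i..<Suc a}. MacMahon (P i * (\<Prod>k\<in>{Suc i..<j}. P k)) q)
        = prod ((\<lambda>(i', j). MacMahon (\<Prod>k=i'..j. P k) q) \<circ> Pair i) {i..<a}"
    proof (rule prod.reindex_bij_witness[where i=Suc and j="\<lambda>j. j - 1"])
      fix j assume "j \<in> {Suc i..<Suc a}"
      then have "{i..j - 1} = insert i {Suc i..<j}" by auto
      then show "((\<lambda>(i', j). MacMahon (\<Prod>k=i'..j. P k) q) \<circ> Pair i) (j - 1) = MacMahon (P i * (\<Prod>k\<in>{Suc i..<j}. P k)) q"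
        by (simp only: o_def prod.case) simp
    qed auto
  qed (auto simp: inj_on_def)
  finally have 1: "(\<Prod>y\<leftarrow>dl (map P [Suc i..<a]). MacMahon (P i * y) q) = (\<Prod>(i', j)\<in>Pair i ` {i..<a}. MacMahon (\<Prod>k=i'..j. P k) q)" .
  have "?S i = Pair i ` {i..<a} \<union> ?S (Suc i)" using step.hyps by (auto simp: Suc_le_eq le_less)
  then have "(\<Prod>(i', j)\<in>?S i. MacMahon (\<Prod>k=i'..j. P k) q)
     = (\<Prod>(i', j)\<in>Pair i ` {i..<a}. MacMahon (\<Prod>k=i'..j. P k) q) * (\<Prod>(i', j)\<in>?S (Suc i). MacMahon (\<Prod>k=i'..j. P k) q)"
    by (simp only:) (rule prod.union_disjoint; use fin in auto)
  then show ?case using step.hyps step.IH 1 by (simp add: upt_conv_Cons)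
qed

lemma kk_rev:
  "1 \<le> b \<Longrightarrow> kk q (map R (rev [1..<b])) = (\<Prod>(i, j)\<in>{(i, j). 1 \<le> i \<and> i \<le> j \<and> j < b}. MacMahon (\<Prod>k=i..j. R k) q)"
proof (induction b rule: dec_induct)
  case base
  have "{(i, j). 1 \<le> i \<and> i \<le> j \<and> j < (1::nat)} = {}" by auto
  then show ?case by (simp only: prod.empty) simp
next
  case (step b)
  let ?S = "\<lambda>b. {(i, j). 1 \<le> i \<and> i \<le> j \<and> j < (b::nat)}"
  have fin: "finite (?S b)" for b by (rule finite_subset[of _ "{..<b} \<times> {..<b}"]) auto
  have "(\<Prod>y\<leftarrow>dl (map R (rev [1..<b])). MacMahon (R b * y) q) = (\<Prod>j\<in>{1..<Suc b}. MacMahon (R b * (\<Prod>k\<in>{j..<b}. R k)) q)"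
    unfolding dl_rev[OF step.hyps(1)] map_map o_def by (rule prod_list_rev_upt)
  also have "\<dots> = (\<Prod>j\<in>{1..<Suc b}. MacMahon (\<Prod>k=j..b. R k) q)"
  proof (rule prod.cong[OF refl])
    fix j assume "j \<in> {1..<Suc b}"
    then have "{j..b} = insert b {j..<b}" by auto
    then show "MacMahon (R b * (\<Prod>k\<in>{j..<b}. R k)) q = MacMahon (\<Prod>k=j..b. R k) q" by simp
  qed
  also have "\<dots> = (\<Prod>(i, j)\<in>(\<lambda>i. (i, b)) ` {1..<Suc b}. MacMahon (\<Prod>k=i..j. R k) q)"
    by (subst prod.reindex) (auto simp: inj_on_def)
  finally have 1: "(\<Prod>y\<leftarrow>dl (map R (rev [1..<b])). MacMahon (R b * y) q) = (\<Prod>(i, j)\<in>(\<lambda>i. (i, b)) ` {1..<Suc b}. MacMahon (\<Prod>k=i..j. R k) q)" .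
  have "?S (Suc b) = (\<lambda>i. (i, b)) ` {1..<Suc b} \<union> ?S b" by (auto simp: less_Suc_eq image_iff)
  then have "(\<Prod>(i, j)\<in>?S (Suc b). MacMahon (\<Prod>k=i..j. R k) q)
     = (\<Prod>(i, j)\<in>(\<lambda>i. (i, b)) ` {1..<Suc b}. MacMahon (\<Prod>k=i..j. R k) q) * (\<Prod>(i, j)\<in>?S b. MacMahon (\<Prod>k=i..j. R k) q)"
    by (simp only:) (rule prod.union_disjoint; use fin in auto)
  then show ?case using step 1 unfolding rev_upt_Suc[OF step.hyps(1)] by simp
qed

lemma sum_seq_union:
  assumes "1 \<le> a"
  shows "(\<Sum>m<n * a. seq_union a p x m ^ l) = (\<Sum>i<n. (\<Sum>j\<in>{1..a}. p j ^ l) * x i ^ l)"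
proof -
  have "(\<Sum>m<n * a. seq_union a p x m ^ l) = (\<Sum>i<n. \<Sum>m\<in>{i * a..<i * a + a}. seq_union a p x m ^ l)"
    by (rule sum.nat_group[symmetric])
  also have "\<dots> = (\<Sum>i<n. (\<Sum>j\<in>{1..a}. p j ^ l) * x i ^ l)"
  proof (rule sum.cong[OF refl])
    fix i
    have dm: "m div a = i" "m mod a = m - i * a" if "i * a \<le> m" "m < i * a + a" for m
    proof -
      show "m div a = i" using that by (intro div_nat_eqI) (auto simp: mult.commute)
      then show "m mod a = m - i * a" using minus_div_mult_eq_mod[of m a] by simp
    qed
    have "(\<Sum>m\<in>{i * a..<i * a + a}. seq_union a p x m ^ l) = (\<Sum>j\<in>{1..a}. p j ^ l * x i ^ l)"
      by (rule sum.reindex_bij_witness[where i="\<lambda>j. i * a + (j - 1)" and j="\<lambda>m. m - i * a + 1"])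
         (use assms in \<open>auto simp: seq_union_def power_mult_distrib dm\<close>)
    then show "(\<Sum>m\<in>{i * a..<i * a + a}. seq_union a p x m ^ l) = (\<Sum>j\<in>{1..a}. p j ^ l) * x i ^ l"
      by (simp add: sum_distrib_right)
  qed
  finally show ?thesis .
qed

lemma summable_seq_union:
  assumes a: "1 \<le> a" and x: "summable (\<lambda>i. norm (x i))"
  shows "summable (\<lambda>m. norm (seq_union a p x m))"
proof (rule summableI_nonneg_bounded)
  have "(\<Sum>m<n. norm (seq_union a p x m)) \<le> (\<Sum>j\<in>{1..a}. norm (p j)) * (\<Sum>i. norm (x i))" for n
  proof -
    have e: "norm (seq_union a p x m) = cmod (seq_union a (\<lambda>j. of_real (norm (p j))) (\<lambda>i. of_real (norm (x i))) m ^ 1)" for m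
      by (simp add: seq_union_def norm_mult)
    have "(\<Sum>m<n. norm (seq_union a p x m)) \<le> (\<Sum>m<n * a. norm (seq_union a p x m))"
      by (rule sum_mono2) (use a in auto)
    also have "\<dots> = Re (\<Sum>m<n * a. seq_union a (\<lambda>j. of_real (norm (p j))) (\<lambda>i. of_real (norm (x i))) m ^ 1)"
      by (simp add: seq_union_def norm_mult)
    also have "\<dots> = (\<Sum>i<n. (\<Sum>j\<in>{1..a}. norm (p j)) * norm (x i))"
      unfolding sum_seq_union[OF a] by simp
    also have "\<dots> = (\<Sum>j\<in>{1..a}. norm (p j)) * (\<Sum>i<n. norm (x i))"
      by (rule sum_distrib_left[symmetric])
    also have "\<dots> \<le> (\<Sum>j\<in>{1..a}. norm (p j)) * (\<Sum>i. norm (x i))"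
      by (intro mult_left_mono sum_le_suminf x sum_nonneg) auto
    finally show ?thesis .
  qed
  then show "(\<Sum>m<n. norm (seq_union a p x m)) \<le> (\<Sum>j\<in>{1..a}. norm (p j)) * (\<Sum>i. norm (x i))" for n .
qed auto

lemma summable_norm_power:
  fixes x :: "nat \<Rightarrow> complex"
  assumes "summable (\<lambda>i. norm (x i))" "1 \<le> l"
  shows "summable (\<lambda>i. x i ^ l)"
proof (rule summable_comparison_test_ev[OF _ assms(1)])
  have "(\<lambda>i. norm (x i)) \<longlonglongrightarrow> 0" by (rule summable_LIMSEQ_zero[OF assms(1)])
  then have "\<forall>\<^sub>F i in sequentially. norm (x i) < 1" by (rule order_tendstoD) simp
  then show "\<forall>\<^sub>F i in sequentially. norm (x i ^ l) \<le> norm (x i)"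
  proof (rule eventually_mono)
    fix i assume "norm (x i) < 1"
    then have "norm (x i) ^ l \<le> norm (x i) ^ 1" by (intro power_decreasing assms(2)) auto
    then show "norm (x i ^ l) \<le> norm (x i)" by (simp add: norm_power)
  qed
qed

lemma pp_seq_union:
  assumes a: "1 \<le> a" and x: "summable (\<lambda>i. norm (x i))"
  shows "pp (seq_union a p x) = sp (pp x) (map p [1..<Suc a])"
proof
  fix l
  show "pp (seq_union a p x) l = sp (pp x) (map p [1..<Suc a]) l"
  proof (cases "l = 0")
    case False
    then have l: "1 \<le> l" by simp
    have s: "(\<lambda>m. seq_union a p x m ^ l) sums (\<Sum>m. seq_union a p x m ^ l)"
      by (intro summable_sums summable_norm_power summable_seq_union a x l)
    have "(\<lambda>n. \<Sum>m<n * a. seq_union a p x m ^ l) \<longlonglongrightarrow> (\<Sum>m. seq_union a p x m ^ l)"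
      by (rule filterlim_compose[OF s[unfolded sums_def]])
         (rule filterlim_subseq, use a in \<open>auto simp: strict_mono_def\<close>)
    moreover have "(\<lambda>i. (\<Sum>j\<in>{1..a}. p j ^ l) * x i ^ l) sums ((\<Sum>j\<in>{1..a}. p j ^ l) * (\<Sum>i. x i ^ l))"
      by (intro sums_mult summable_sums summable_norm_power x l)
    then have "(\<lambda>n. \<Sum>m<n * a. seq_union a p x m ^ l) \<longlonglongrightarrow> (\<Sum>j\<in>{1..a}. p j ^ l) * (\<Sum>i. x i ^ l)"
      unfolding sum_seq_union[OF a] sums_def .
    ultimately have e: "(\<Sum>m. seq_union a p x m ^ l) = (\<Sum>j\<in>{1..a}. p j ^ l) * (\<Sum>i. x i ^ l)"
      by (rule LIMSEQ_unique)
    have "(\<Sum>j\<in>{1..a}. p j ^ l) = (\<Sum>y\<leftarrow>map p [1..<Suc a]. y ^ l)"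
      unfolding map_map o_def
      by (subst sum.distinct_set_conv_list[symmetric]) (simp_all only: distinct_upt set_upt atLeastLessThanSuc_atLeastAtMost)
    then show ?thesis by (simp add: pp_def sp_def e del: upt_Suc)
  qed (simp add: pp_def sp_def)
qed

lemma sp_rev: "sp c (map f (rev xs)) = sp c (map f xs)"
  by (rule ext) (simp add: sp_def rev_map[symmetric] sum_list_rev)

lemma tw_sp: "tw (sp c xs) = sp (tw c) xs"
  by (rule ext) (simp add: tw_def sp_def)

section \<open>Intertwining relations\<close>

text \<open>\<open>pf \<alpha>s n\<close> is the coefficient of \<open>w ^ n\<close> in \<open>\<Prod>\<alpha>\<leftarrow>\<alpha>s. 1 - \<alpha> * w\<close>.\<close>

fun pf :: "complex list \<Rightarrow> nat \<Rightarrow> complex" where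
  "pf [] n = (if n = 0 then 1 else 0)"
| "pf (\<alpha> # \<alpha>s) n = pf \<alpha>s n - (if n = 0 then 0 else \<alpha> * pf \<alpha>s (n - 1))"

lemma pf_0: "pf \<alpha>s 0 = 1" by (induction \<alpha>s) auto

lemma pf_high: "length \<alpha>s < n \<Longrightarrow> pf \<alpha>s n = 0" by (induction \<alpha>s arbitrary: n) auto

lemma pf_newton: "of_nat n * pf \<alpha>s n = - (\<Sum>l=1..n. (\<Sum>\<alpha>\<leftarrow>\<alpha>s. \<alpha> ^ l) * pf \<alpha>s (n - l))"
proof (induction \<alpha>s arbitrary: n)
  case (Cons \<beta> \<alpha>s)
  let ?S = "\<lambda>l. \<Sum>\<alpha>\<leftarrow>\<alpha>s. \<alpha> ^ l"
  show ?case
  proof (cases n)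
    case (Suc m)
    have g: "pf (\<beta> # \<alpha>s) (n - l) = pf \<alpha>s (n - l) - (if l = n then 0 else \<beta> * pf \<alpha>s (m - l))" if "l \<in> {1..n}" for l
      using that Suc by auto
    have "(\<Sum>l=1..n. \<beta> ^ l * pf (\<beta> # \<alpha>s) (n - l)) = (\<Sum>l=1..n. \<beta> ^ l * pf \<alpha>s (n - l) - (if l = n then 0 else \<beta> ^ Suc l * pf \<alpha>s (m - l)))"
      by (rule sum.cong[OF refl]) (simp only: g, auto simp: algebra_simps)
    also have "\<dots> = (\<Sum>l=1..n. \<beta> ^ l * pf \<alpha>s (n - l)) - (\<Sum>l=1..m. \<beta> ^ Suc l * pf \<alpha>s (m - l))"
      unfolding sum_subtractf Suc by (auto intro!: arg_cong2[where f="(-)"] sum.cong)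
    also have "(\<Sum>l=1..n. \<beta> ^ l * pf \<alpha>s (n - l)) = \<beta> * pf \<alpha>s m + (\<Sum>l=1..m. \<beta> ^ Suc l * pf \<alpha>s (m - l))"
    proof -
      have "(\<Sum>l=1..n. \<beta> ^ l * pf \<alpha>s (n - l)) = \<beta> ^ 1 * pf \<alpha>s (n - 1) + (\<Sum>l=Suc 1..n. \<beta> ^ l * pf \<alpha>s (n - l))"
        using Suc by (subst sum.atLeast_Suc_atMost) auto
      also have "(\<Sum>l=Suc 1..n. \<beta> ^ l * pf \<alpha>s (n - l)) = (\<Sum>l=1..m. \<beta> ^ Suc l * pf \<alpha>s (m - l))"
        unfolding Suc by (subst sum.shift_bounds_cl_Suc_ivl) simp
      finally show ?thesis using Suc by simp
    qed
    finally have 1: "(\<Sum>l=1..n. \<beta> ^ l * pf (\<beta> # \<alpha>s) (n - l)) = \<beta> * pf \<alpha>s m" by simp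
    have "(\<Sum>l=1..n. ?S l * pf (\<beta> # \<alpha>s) (n - l)) = (\<Sum>l=1..n. ?S l * pf \<alpha>s (n - l) - (if l = n then 0 else \<beta> * (?S l * pf \<alpha>s (m - l))))"
      by (rule sum.cong[OF refl]) (simp only: g, auto simp: algebra_simps)
    also have "\<dots> = (\<Sum>l=1..n. ?S l * pf \<alpha>s (n - l)) - (\<Sum>l=1..m. \<beta> * (?S l * pf \<alpha>s (m - l)))"
      unfolding sum_subtractf Suc by (auto intro!: arg_cong2[where f="(-)"] sum.cong)
    also have "\<dots> = - (of_nat n * pf \<alpha>s n) + \<beta> * (of_nat m * pf \<alpha>s m)"
      unfolding Cons.IH sum_distrib_left[symmetric] by simp
    finally have 2: "(\<Sum>l=1..n. ?S l * pf (\<beta> # \<alpha>s) (n - l)) = - (of_nat n * pf \<alpha>s n) + \<beta> * (of_nat m * pf \<alpha>s m)" .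
    have "(\<Sum>l=1..n. (\<Sum>\<alpha>\<leftarrow>\<beta> # \<alpha>s. \<alpha> ^ l) * pf (\<beta> # \<alpha>s) (n - l))
        = (\<Sum>l=1..n. \<beta> ^ l * pf (\<beta> # \<alpha>s) (n - l)) + (\<Sum>l=1..n. ?S l * pf (\<beta> # \<alpha>s) (n - l))"
      unfolding sum.distrib[symmetric] by (rule sum.cong[OF refl]) (simp add: distrib_right)
    also have "\<dots> = - (of_nat n * pf (\<beta> # \<alpha>s) n)"
      unfolding 1 2 using Suc by (simp add: algebra_simps)
    finally show ?thesis by simp
  qed simp
qed simp

lemma pf_scale: "pf (map ((*) s) \<alpha>s) n = s ^ n * pf \<alpha>s n"
proof (induction \<alpha>s arbitrary: n)
  case (Cons \<alpha> \<alpha>s)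
  then show ?case by (cases n) (simp_all add: algebra_simps)
qed simp

lemma pf_rev:
  assumes "0 \<notin> set \<alpha>s" "n \<le> length \<alpha>s"
  shows "pf \<alpha>s (length \<alpha>s - n) = prod_list (map uminus \<alpha>s) * pf (map inverse \<alpha>s) n"
  using assms
proof (induction \<alpha>s arbitrary: n)
  case (Cons \<alpha> \<alpha>s)
  let ?N = "length \<alpha>s"
  have \<alpha>: "\<alpha> \<noteq> 0" using Cons.prems by auto
  have IH: "n \<le> ?N \<Longrightarrow> pf \<alpha>s (?N - n) = prod_list (map uminus \<alpha>s) * pf (map inverse \<alpha>s) n" for n
    using Cons by auto
  consider "n = 0" | "1 \<le> n" "n \<le> ?N" | "n = Suc ?N" using Cons.prems by fastforce
  then show ?case
  proof cases
    case 1
    then show ?thesis using IH[of 0] by (simp add: pf_high pf_0)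
  next
    case 2
    then have "pf (\<alpha> # \<alpha>s) (length (\<alpha> # \<alpha>s) - n) = pf \<alpha>s (?N - (n - 1)) - \<alpha> * pf \<alpha>s (?N - n)"
      by (simp add: Suc_diff_le)
    also have "\<dots> = prod_list (map uminus \<alpha>s) * pf (map inverse \<alpha>s) (n - 1) - \<alpha> * (prod_list (map uminus \<alpha>s) * pf (map inverse \<alpha>s) n)"
      using 2 by (subst IH, simp, subst IH) auto
    also have "\<dots> = prod_list (map uminus (\<alpha> # \<alpha>s)) * pf (map inverse (\<alpha> # \<alpha>s)) n"
      using 2 \<alpha> by (simp add: field_simps)
    finally show ?thesis .
  next
    case 3
    then show ?thesis using IH[of ?N] \<alpha> by (simp add: pf_high pf_0 mult_ac)
  qed
qed simp

lemma E_At: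
  assumes q: "q \<noteq> 0" "q powi k \<noteq> 1"
    and c: "\<And>l. 1 \<le> l \<Longrightarrow> c l * (1 - q powi (- k * int l)) = - (\<Sum>\<alpha>\<leftarrow>\<alpha>s. \<alpha> ^ l) / of_nat l"
  shows "E c * At q k m = (\<Sum>n\<le>length \<alpha>s. sc (pf \<alpha>s n) (At q k (m + int n))) * E c"
proof (rule E_shift)
  show "Jc (int l) * At q k m - At q k m * Jc (int l) = sc (1 - q powi (- k * int l)) (At q k (m + int l))"
    if "1 \<le> l" for l m by (rule Jc_At) (use that q in auto)
  show "homog m (At q k m)" for m by (rule homog_At)
  show "of_nat n * pf \<alpha>s n = (\<Sum>l=1..n. of_nat l * c l * (1 - q powi (- k * int l)) * pf \<alpha>s (n - l))" for n
    unfolding pf_newton sum_negf[symmetric]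
  proof (rule sum.cong[OF refl])
    fix l assume l: "l \<in> {1..n}"
    have "of_nat l * c l * (1 - q powi (- k * int l)) = of_nat l * (c l * (1 - q powi (- k * int l)))" by simp
    also have "\<dots> = - (\<Sum>\<alpha>\<leftarrow>\<alpha>s. \<alpha> ^ l)" using l by (subst c) auto
    finally show "- ((\<Sum>\<alpha>\<leftarrow>\<alpha>s. \<alpha> ^ l) * pf \<alpha>s (n - l)) = of_nat l * c l * (1 - q powi (- k * int l)) * pf \<alpha>s (n - l)" by simp
  qed
qed (auto simp: pf_0 pf_high)

lemma NF_S:
  assumes "en V \<le> M"
  shows "NF c d r U V = (\<Sum>Z\<in>{Z \<in> maya. en Z \<le> M}. ent (E d) Z U * r ^ nat (en Z) * ent (E c) Z V)"
  unfolding NF_def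
  by (rule sum.mono_neutral_left) (use assms E_lower finite_en in \<open>auto simp: not_le dest!: E_lower[of c]\<close>)

lemma ent_At_0: "en U \<noteq> en V - m \<Longrightarrow> ent (At q k m) U V = 0"
  using homogD[OF homog_At] by blast

lemma NF_shift:
  assumes q: "q \<noteq> 0" "q powi k \<noteq> 1" and r: "r \<noteq> 0" and \<alpha>: "0 \<notin> set \<alpha>s"
    and c: "\<And>l. 1 \<le> l \<Longrightarrow> c l * (1 - q powi (- k * int l)) = - (\<Sum>\<alpha>\<leftarrow>\<alpha>s. \<alpha> ^ l) / of_nat l"
    and d: "\<And>l. 1 \<le> l \<Longrightarrow> d l / r ^ l * (q powi (k * int l) - 1) = - (\<Sum>\<alpha>\<leftarrow>\<alpha>s. inverse \<alpha> ^ l) / of_nat l"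
    and U: "U \<in> maya" and V: "V \<in> maya"
  shows "op_mult (ent (At q k m)) (NF c d r) U V
    = r powi m / prod_list (map uminus \<alpha>s) * op_mult (NF c d r) (ent (At q k (m - int (length \<alpha>s)))) U V"
proof -
  define N where "N = length \<alpha>s"
  define M where "M = max (en U) (en V) + \<bar>m\<bar> + int N"
  define S where "S = {Z \<in> maya. en Z \<le> M}"
  have fin: "finite S" by (simp add: S_def finite_en)
  define x where "x = r / q powi k"
  define \<beta>s where "\<beta>s = map ((*) x) (map inverse \<alpha>s)"
  have len: "length \<beta>s = N" by (simp add: \<beta>s_def N_def)
  have d': "d l * (1 - q powi (- k * int l)) = - (\<Sum>\<beta>\<leftarrow>\<beta>s. \<beta> ^ l) / of_nat l" if "1 \<le> l" for l
  proof -
    have e: "q powi (k * int l) = (q powi k) ^ l" "q powi (- k * int l) = 1 / (q powi k) ^ l"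
      by (simp_all add: power_int_mult power_int_minus field_simps)
    have "(\<Sum>\<beta>\<leftarrow>\<beta>s. \<beta> ^ l) = x ^ l * (\<Sum>\<alpha>\<leftarrow>\<alpha>s. inverse \<alpha> ^ l)"
      by (simp add: \<beta>s_def o_def power_mult_distrib sum_list_const_mult)
    then have "- (\<Sum>\<beta>\<leftarrow>\<beta>s. \<beta> ^ l) / of_nat l = x ^ l * (- (\<Sum>\<alpha>\<leftarrow>\<alpha>s. inverse \<alpha> ^ l) / of_nat l)" by simp
    also have "\<dots> = x ^ l * (d l / r ^ l * (q powi (k * int l) - 1))" using d[OF that] by simp
    also have "\<dots> = d l * (1 - q powi (- k * int l))"
      unfolding e x_def using q r by (simp add: field_simps)
    finally show ?thesis by simp
  qed
  have pf\<beta>: "pf \<beta>s n = x ^ n * (pf \<alpha>s (N - n) / prod_list (map uminus \<alpha>s))" if "n \<le> N" for n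
  proof -
    have "prod_list (map uminus \<alpha>s) \<noteq> 0" using \<alpha> by (auto simp: prod_list_zero_iff)
    then show ?thesis using pf_rev[OF \<alpha>, of n] that unfolding \<beta>s_def pf_scale N_def by simp
  qed
  let ?A = "At q k"
  let ?T = "\<lambda>n. \<Sum>Y\<in>S. ent (E d) Y U * r ^ nat (en Y) * ent (?A (m - int n) * E c) Y V"
  have Ed: "E d * ?A (- m) = (\<Sum>n\<le>N. sc (pf \<beta>s n) (?A (- m + int n))) * E d"
    unfolding len[symmetric] by (rule E_At[OF q d'])
  have Ec: "E c * ?A (m - int N) = (\<Sum>n\<le>N. sc (pf \<alpha>s n) (?A (m - int N + int n))) * E c"
    unfolding N_def by (rule E_At[OF q c])
  have UV: "en U \<le> M" "en V \<le> M" by (auto simp: M_def)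
  have inS: "W \<in> S" if "ent A W X \<noteq> 0" "en W \<le> M" for A W X using that ent_maya by (auto simp: S_def)
  have LE: "W \<in> S" if "ent (E g) W X \<noteq> 0" "en X \<le> M" for g W X using E_lower[OF that(1)] that by (auto simp: S_def)
  have AU: "W \<in> S" if "ent (?A m) U W \<noteq> 0" for W
  proof -
    have "en U = en W - m" using ent_At_0 that by blast
    then have "en W \<le> M" unfolding M_def by linarith
    then show ?thesis using ent_maya[OF that] by (simp add: S_def)
  qed
  have AU': "W \<in> S" if "ent (?A (- m)) W U \<noteq> 0" for W
  proof -
    have "en W = en U - - m" using ent_At_0 that by blast
    then have "en W \<le> M" unfolding M_def by linarith
    then show ?thesis using ent_maya[OF that] by (simp add: S_def)
  qed
  have AV: "W \<in> S" if "ent (?A (m - int N)) W V \<noteq> 0" for W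
  proof -
    have "en W = en V - (m - int N)" using ent_At_0 that by blast
    then have "en W \<le> M" unfolding M_def by linarith
    then show ?thesis using ent_maya[OF that] by (simp add: S_def)
  qed
  have inner: "(\<Sum>Z\<in>S. r ^ nat (en Z) * ent (E c) Z V * ent (?A (- m + int n) * E d) Z U)
      = q powi (k * (int n - m)) * r powi (m - int n) * ?T n" for n
  proof -
    have "(\<Sum>Z\<in>S. r ^ nat (en Z) * ent (E c) Z V * ent (?A (- m + int n) * E d) Z U)
        = (\<Sum>Z\<in>S. \<Sum>Y\<in>S. r ^ nat (en Z) * ent (E c) Z V * (ent (?A (- m + int n)) Z Y * ent (E d) Y U))"
      by (subst ent_mult[OF fin]) (use LE UV in \<open>auto simp: sum_distrib_left\<close>)
    also have "\<dots> = (\<Sum>Y\<in>S. \<Sum>Z\<in>S. r ^ nat (en Z) * ent (E c) Z V * (ent (?A (- m + int n)) Z Y * ent (E d) Y U))"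
      by (rule sum.swap)
    also have "\<dots> = (\<Sum>Y\<in>S. \<Sum>Z\<in>S. q powi (k * (int n - m)) * r powi (m - int n) * (ent (E d) Y U * r ^ nat (en Y) * (ent (?A (m - int n)) Y Z * ent (E c) Z V)))"
    proof (intro sum.cong refl)
      fix Y Z
      have t: "ent (?A (- m + int n)) Z Y = q powi (k * (int n - m)) * ent (?A (m - int n)) Y Z"
        using ent_At_tr[OF q(1), of k "- m + int n" Z Y] by (simp add: algebra_simps)
      have "r ^ nat (en Z) * ent (?A (m - int n)) Y Z = r powi (m - int n) * r ^ nat (en Y) * ent (?A (m - int n)) Y Z"
      proof (cases "ent (?A (m - int n)) Y Z = 0")
        case False
        then have "en Y = en Z - (m - int n)" using ent_At_0 by blast
        then have "r powi (en Z) = r powi (m - int n) * r powi (en Y)"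
          using r by (simp add: power_int_add[symmetric])
        then show ?thesis using en_nonneg[of Y] en_nonneg[of Z] by (simp add: power_int_def split: if_splits)
      qed simp
      then show "r ^ nat (en Z) * ent (E c) Z V * (ent (?A (- m + int n)) Z Y * ent (E d) Y U)
         = q powi (k * (int n - m)) * r powi (m - int n) * (ent (E d) Y U * r ^ nat (en Y) * (ent (?A (m - int n)) Y Z * ent (E c) Z V))"
        unfolding t by (simp add: mult_ac)
    qed
    also have "\<dots> = q powi (k * (int n - m)) * r powi (m - int n) * ?T n"
      by (subst ent_mult[OF fin]) (use LE UV in \<open>auto simp: sum_distrib_left\<close>)
    finally show ?thesis .
  qed
  have "op_mult (ent (?A m)) (NF c d r) U V = (\<Sum>W\<in>S. ent (?A m) U W * NF c d r W V)"
    by (rule op_mult_finite) (use fin AU in \<open>auto simp: S_def\<close>)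
  also have "\<dots> = (\<Sum>W\<in>S. \<Sum>Z\<in>S. q powi (k * m) * (r ^ nat (en Z) * ent (E c) Z V * (ent (E d) Z W * ent (?A (- m)) W U)))"
    unfolding NF_S[OF UV(2)] S_def[symmetric] ent_At_tr[OF q(1), of k m U] sum_distrib_left
    by (intro sum.cong refl) (simp add: mult_ac)
  also have "\<dots> = (\<Sum>Z\<in>S. \<Sum>W\<in>S. q powi (k * m) * (r ^ nat (en Z) * ent (E c) Z V * (ent (E d) Z W * ent (?A (- m)) W U)))"
    by (rule sum.swap)
  also have "\<dots> = q powi (k * m) * (\<Sum>Z\<in>S. r ^ nat (en Z) * ent (E c) Z V * ent (E d * ?A (- m)) Z U)"
    by (subst ent_mult[OF fin]) (use AU' in \<open>auto simp: sum_distrib_left\<close>)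
  also have "\<dots> = q powi (k * m) * (\<Sum>Z\<in>S. \<Sum>n\<le>N. pf \<beta>s n * (r ^ nat (en Z) * ent (E c) Z V * ent (?A (- m + int n) * E d) Z U))"
    unfolding Ed sum_distrib_right ent_sum sum_distrib_left sc_mult_left ent_sc
    by (simp add: mult_ac)
  also have "\<dots> = q powi (k * m) * (\<Sum>n\<le>N. \<Sum>Z\<in>S. pf \<beta>s n * (r ^ nat (en Z) * ent (E c) Z V * ent (?A (- m + int n) * E d) Z U))"
    by (subst sum.swap) simp
  also have "\<dots> = (\<Sum>n\<le>N. q powi (k * m) * pf \<beta>s n * (q powi (k * (int n - m)) * r powi (m - int n)) * ?T n)"
    unfolding sum_distrib_left[symmetric] inner by (simp add: sum_distrib_left mult_ac)
  also have "\<dots> = (\<Sum>n\<le>N. r powi m / prod_list (map uminus \<alpha>s) * (pf \<alpha>s (N - n) * ?T n))"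
  proof (rule sum.cong[OF refl])
    fix n assume n: "n \<in> {..N}"
    have "q powi (k * m) * (q powi (k * (int n - m)) * r powi (m - int n)) * x ^ n = r powi m"
    proof -
      have "q powi (k * m) * q powi (k * (int n - m)) = q powi (k * m + k * (int n - m))"
        by (rule power_int_add[symmetric]) (use q in auto)
      also have "k * m + k * (int n - m) = k * int n" by (simp add: right_diff_distrib)
      finally have "q powi (k * m) * q powi (k * (int n - m)) = (q powi k) ^ n" by (simp add: power_int_mult)
      then show ?thesis using q r by (simp add: x_def power_divide power_int_diff field_simps)
    qed
    then have "q powi (k * m) * pf \<beta>s n * (q powi (k * (int n - m)) * r powi (m - int n)) = r powi m / prod_list (map uminus \<alpha>s) * pf \<alpha>s (N - n)"
      using pf\<beta>[of n] n by (simp add: mult_ac)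
    then show "q powi (k * m) * pf \<beta>s n * (q powi (k * (int n - m)) * r powi (m - int n)) * ?T n
       = r powi m / prod_list (map uminus \<alpha>s) * (pf \<alpha>s (N - n) * ?T n)" by simp
  qed
  also have "\<dots> = r powi m / prod_list (map uminus \<alpha>s) * (\<Sum>n\<le>N. pf \<alpha>s (N - n) * ?T n)"
    by (rule sum_distrib_left[symmetric])
  also have "(\<Sum>n\<le>N. pf \<alpha>s (N - n) * ?T n) = (\<Sum>n\<le>N. pf \<alpha>s n * ?T (N - n))"
    by (rule sum.reindex_bij_witness[where i="\<lambda>n. N - n" and j="\<lambda>n. N - n"]) auto
  also have "\<dots> = (\<Sum>n\<le>N. \<Sum>Y\<in>S. ent (E d) Y U * r ^ nat (en Y) * ent (sc (pf \<alpha>s n) (?A (m - int N + int n)) * E c) Y V)"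
    unfolding sum_distrib_left sc_mult_left ent_sc
    by (intro sum.cong refl) (auto simp: of_nat_diff mult_ac algebra_simps)
  also have "\<dots> = (\<Sum>Y\<in>S. ent (E d) Y U * r ^ nat (en Y) * ent (E c * ?A (m - int N)) Y V)"
    unfolding Ec sum_distrib_right ent_sum sum_distrib_left
    by (rule sum.swap)
  also have "\<dots> = (\<Sum>Y\<in>S. \<Sum>W\<in>S. ent (E d) Y U * r ^ nat (en Y) * ent (E c) Y W * ent (?A (m - int N)) W V)"
    by (subst ent_mult[OF fin]) (use AV in \<open>auto simp: sum_distrib_left mult.assoc\<close>)
  also have "\<dots> = (\<Sum>W\<in>S. \<Sum>Y\<in>S. ent (E d) Y U * r ^ nat (en Y) * ent (E c) Y W * ent (?A (m - int N)) W V)"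
    by (rule sum.swap)
  also have "\<dots> = (\<Sum>W\<in>S. NF c d r U W * ent (?A (m - int N)) W V)"
  proof (rule sum.cong[OF refl])
    fix W assume "W \<in> S"
    then have W: "en W \<le> M" by (simp add: S_def)
    show "(\<Sum>Y\<in>S. ent (E d) Y U * r ^ nat (en Y) * ent (E c) Y W * ent (?A (m - int N)) W V) = NF c d r U W * ent (?A (m - int N)) W V"
      unfolding NF_S[OF W] S_def[symmetric] sum_distrib_right ..
  qed
  also have "\<dots> = op_mult (NF c d r) (ent (?A (m - int N))) U V"
    by (rule op_mult_fin_col[symmetric]) (use fin AV in auto)
  finally show ?thesis by (simp add: N_def)
qed

lemma dl_cl_inverse: "0 \<notin> set ps \<Longrightarrow> map (\<lambda>y. y / prod_list ps) (dl ps) = map inverse (cl ps)"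
  by (induction ps) (auto simp: o_def field_simps)

lemma length_cl: "length (cl ps) = Suc (length ps)" by (induction ps) auto

lemma cl_nonzero: "0 \<notin> set ps \<Longrightarrow> 0 \<notin> set (cl ps)" by (induction ps) (auto simp: prod_list_zero_iff)

definition prds :: "complex list \<Rightarrow> complex list \<Rightarrow> complex list"
  where "prds xs zs = concat (map (\<lambda>x. map ((*) x) zs) xs)"

lemma prds_simps: "prds [] zs = []" "prds (x # xs) zs = map ((*) x) zs @ prds xs zs"
  by (simp_all add: prds_def)

lemma sum_prds: "(\<Sum>\<alpha>\<leftarrow>prds xs zs. \<alpha> ^ l) = (\<Sum>x\<leftarrow>xs. x ^ l) * (\<Sum>z\<leftarrow>zs. z ^ l)"
  by (induction xs) (simp_all add: prds_simps o_def power_mult_distrib sum_list_const_mult distrib_right)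

lemma length_prds: "length (prds xs zs) = length xs * length zs"
  by (induction xs) (simp_all add: prds_simps)

lemma prds_nonzero: "0 \<notin> set xs \<Longrightarrow> 0 \<notin> set zs \<Longrightarrow> 0 \<notin> set (prds xs zs)"
  by (auto simp: prds_def)

lemma inverse_prds: "map inverse (prds xs zs) = prds (map inverse xs) (map inverse zs)"
  by (induction xs) (simp_all add: prds_simps o_def)

lemma prod_list_scale: "prod_list (map (\<lambda>z. x * f z) zs) = x ^ length zs * prod_list (map f zs)" for x :: complex
  by (induction zs) (simp_all add: mult_ac)

lemma prod_prds: "prod_list (map uminus (prds xs zs)) = prod_list xs ^ length zs * prod_list (map uminus zs) ^ length xs"
proof (induction xs)
  case (Cons x xs)
  have "prod_list (map uminus (prds (x # xs) zs)) = prod_list (map (\<lambda>z. x * - z) zs) * prod_list (map uminus (prds xs zs))"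
    by (simp add: prds_simps o_def)
  then show ?case unfolding Cons prod_list_scale by (simp add: power_mult_distrib mult_ac)
qed (simp add: prds_simps)

lemma NF_At:
  assumes q: "q \<noteq> 0" "q powi k \<noteq> 1" and ps: "0 \<notin> set ps" and zs: "0 \<notin> set zs"
    and c: "\<And>l. 1 \<le> l \<Longrightarrow> c l * (1 - q powi (- k * int l)) = - (\<Sum>z\<leftarrow>zs. z ^ l) / of_nat l"
    and d: "\<And>l. 1 \<le> l \<Longrightarrow> c l * (q powi (k * int l) - 1) = - (\<Sum>z\<leftarrow>zs. inverse z ^ l) / of_nat l"
    and U: "U \<in> maya" and V: "V \<in> maya"
  shows "op_mult (ent (At q k m)) (NF (sp c (cl ps)) (sp c (dl ps)) (prod_list ps)) U V
    = prod_list ps powi m / (prod_list (cl ps) ^ length zs * prod_list (map uminus zs) ^ Suc (length ps))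
      * op_mult (NF (sp c (cl ps)) (sp c (dl ps)) (prod_list ps)) (ent (At q k (m - int (Suc (length ps) * length zs)))) U V"
proof -
  have r: "prod_list ps \<noteq> 0" using ps by (simp add: prod_list_zero_iff)
  show ?thesis
    unfolding prod_prds[symmetric] length_cl[symmetric] length_prds[symmetric]
  proof (rule NF_shift[OF q r _ _ _ U V])
    show "0 \<notin> set (prds (cl ps) zs)" by (intro prds_nonzero cl_nonzero ps zs)
    fix l :: nat assume l: "1 \<le> l"
    have "sp c (cl ps) l * (1 - q powi (- k * int l)) = (\<Sum>x\<leftarrow>cl ps. x ^ l) * (c l * (1 - q powi (- k * int l)))"
      by (simp add: sp_def)
    then show "sp c (cl ps) l * (1 - q powi (- k * int l)) = - (\<Sum>\<alpha>\<leftarrow>prds (cl ps) zs. \<alpha> ^ l) / of_nat l"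
      unfolding c[OF l] sum_prds by simp
    have "(\<Sum>y\<leftarrow>ys. y ^ l) / r ^ l = (\<Sum>y\<leftarrow>map (\<lambda>y. y / r) ys. y ^ l)" for ys and r :: complex
      by (induction ys) (simp_all add: power_divide add_divide_distrib)
    from this[of "dl ps" "prod_list ps"]
    have "sp c (dl ps) l / prod_list ps ^ l = (\<Sum>x\<leftarrow>map inverse (cl ps). x ^ l) * c l"
      unfolding dl_cl_inverse[OF ps] by (simp add: sp_def flip: times_divide_eq_left)
    then have "sp c (dl ps) l / prod_list ps ^ l * (q powi (k * int l) - 1)
        = (\<Sum>x\<leftarrow>map inverse (cl ps). x ^ l) * (c l * (q powi (k * int l) - 1))" by simp
    also have "\<dots> = - (\<Sum>\<alpha>\<leftarrow>map inverse (prds (cl ps) zs). \<alpha> ^ l) / of_nat l"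
      unfolding d[OF l] inverse_prds sum_prds by (simp add: o_def)
    finally show "sp c (dl ps) l / prod_list ps ^ l * (q powi (k * int l) - 1) = - (\<Sum>\<alpha>\<leftarrow>prds (cl ps) zs. inverse \<alpha> ^ l) / of_nat l"
      by (simp add: o_def)
  qed
qed

lemma Jc_w0:
  assumes M: "M \<noteq> 0" and W: "W \<in> maya"
  shows "exp (s * w0 U) * ent (Jc M) U W = exp (s * w0 W) * (exp (s * of_int (M ^ 2)) * ent (Dm (\<lambda>p. exp (2 * s * of_int (M * p))) M) U W)"
proof -
  have *: "exp (s * w0 U) * ent (nb p M) U W = exp (s * w0 W) * (exp (s * of_int (M ^ 2)) * (exp (2 * s * of_int (M * p)) * ent (nb p M) U W))" for p
  proof (cases "ent (nb p M) U W = 0")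
    case False
    have nb: "nb p M = cre (p + M) * ann (- p)" using M by (simp add: nb_def)
    have U: "p \<in> W" "p + M \<notin> W" "U = insert (p + M) (W - {p})"
      using False M unfolding nb ent_bil[OF W] by (auto split: if_splits)
    have "w0 U = w0 W - of_int (p ^ 2) + of_int ((p + M) ^ 2)"
      unfolding U(3) w0_def using U(1,2) W
      by (subst wt_insert) (auto simp: wt_remove maya_remove)
    then have "s * w0 U = s * w0 W + (s * of_int (M ^ 2) + 2 * s * of_int (M * p))"
      by (simp add: power2_eq_square algebra_simps)
    then show ?thesis by (simp add: exp_add)
  qed simp
  show ?thesis unfolding Jc_def ent_Dm[OF W] sum_distrib_left mult_1_left
    by (intro sum.cong refl *)
qed

definition Ph :: "complex \<Rightarrow> int \<Rightarrow> int set \<Rightarrow> complex"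
  where "Ph q k V = wt (\<lambda>p. q powi (- k * p)) V + 1 / (1 - q powi (- k))"

lemma At_dg: "ent (At q k 0) = dg (Ph q k)"
proof (intro ext)
  fix U V
  show "ent (At q k 0) U V = dg (Ph q k) U V"
    by (auto simp: At_def ent_plus ent_sc ent_one op_id_def dg_def Ph_def ent_Dm_0_dg)
qed

lemma At_Dm: "m \<noteq> 0 \<Longrightarrow> At q k m = Dm (\<lambda>p. q powi (- k * p)) m"
  by (simp add: At_def sc_0)

lemma exp_powi: "exp (of_int k * z) = exp z powi k" for z :: complex
  by (cases k rule: int_cases2) (simp_all add: power_int_minus exp_of_nat_mult exp_minus)

lemma power_int_ne_1:
  fixes q :: complex
  assumes "q \<noteq> 0" "norm q < 1" "k \<noteq> 0" shows "q powi k \<noteq> 1"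
proof -
  have "norm (q ^ n) < 1" if "1 \<le> n" for n by (rule norm_exp_power_lt[OF assms(2) that])
  then have *: "q ^ n \<noteq> 1" if "1 \<le> n" for n using that by (metis norm_one less_irrefl)
  show ?thesis using assms(3) *[of "nat k"] *[of "nat (- k)"] by (auto simp: power_int_def power_inverse)
qed

lemma geom_down:
  fixes y :: complex assumes "y \<noteq> 0" "1 - y \<noteq> 0"
  shows "(\<Sum>i<k. 1 / y ^ Suc i) = (1 - y ^ k) / y ^ k / (1 - y)"
proof (induction k)
  case (Suc k)
  show ?case unfolding sum.lessThan_Suc Suc.IH using assms by (simp add: field_simps)
qed simp

lemma geom_up:
  fixes y :: complex assumes "1 - y \<noteq> 0" shows "(\<Sum>i<k. y ^ i) = (1 - y ^ k) / (1 - y)"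
  using one_diff_power_eq[of y k] assms by simp

lemma J_XL:
  assumes q: "norm (exp lq) < 1" and ps: "0 \<notin> set ps" and a: "a = Suc (length ps)" and k: "1 \<le> k"
    and U: "U \<in> maya" and V: "V \<in> maya"
  shows "op_mult (J (int (a * k))) (XL lq ps a) U V
    = (-1) ^ (a * k) * prod_list ps ^ (a * k) / prod_list (cl ps) ^ k * (XL lq ps a U V * Ph (exp lq) (int k) V)"
proof -
  define e where "e = exp (lq / 2)"
  have e: "e \<noteq> 0" "exp lq = e ^ 2" by (simp_all add: e_def exp_half[of lq 1, simplified, symmetric] power2_eq_square)
  define zs where "zs = map (\<lambda>i. e / exp lq ^ Suc i) [0..<k]"
  let ?q = "exp lq" and ?c = "pp (q_rho lq)" and ?M = "int (a * k)" and ?s = "lq / (2 * of_nat a)"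
  let ?NF = "NF (sp ?c (cl ps)) (sp ?c (dl ps)) (prod_list ps)"
  have a0: "of_nat a \<noteq> (0 :: complex)" unfolding a by (simp del: of_nat_Suc)
  have "0 < a * k" using a k by simp
  then have M: "?M \<noteq> 0" by linarith
  have zs: "0 \<notin> set zs" "length zs = k" using e by (auto simp: zs_def)
  have k1: "?q powi int k \<noteq> 1" by (rule power_int_ne_1) (use q k in auto)
  have ql: "1 - ?q ^ l \<noteq> 0" if "1 \<le> l" for l using norm_exp_power_lt[OF q that] by auto
  have pw: "?q powi (int k * int l) = (?q ^ l) ^ k" "?q powi (- int k * int l) = 1 / (?q ^ l) ^ k" for l
    by (simp_all add: power_mult[symmetric] mult.commute of_nat_mult[symmetric] power_int_minus_divide del: of_nat_mult of_nat_power)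
  have c1: "?c l * (1 - ?q powi (- int k * int l)) = - (\<Sum>z\<leftarrow>zs. z ^ l) / of_nat l" if l: "1 \<le> l" for l
  proof -
    have "(\<Sum>z\<leftarrow>zs. z ^ l) = (\<Sum>i<k. e ^ l * (1 / (?q ^ l) ^ Suc i))"
      by (simp add: zs_def o_def power_divide interv_sum_list_conv_sum_set_nat atLeast0LessThan power_mult[symmetric] mult.commute power_add[symmetric] del: power_Suc)
    also have "\<dots> = e ^ l * ((1 - (?q ^ l) ^ k) / (?q ^ l) ^ k / (1 - ?q ^ l))"
      unfolding sum_distrib_left[symmetric] by (subst geom_down) (use ql[OF l] in auto)
    finally have S: "(\<Sum>z\<leftarrow>zs. z ^ l) = e ^ l * ((1 - (?q ^ l) ^ k) / (?q ^ l) ^ k / (1 - ?q ^ l))" .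
    show ?thesis unfolding pw pp_q_rho[OF q l] e_def[symmetric] S using ql[OF l] l by (simp add: divide_simps) (simp add: algebra_simps)?
  qed
  have c2: "?c l * (?q powi (int k * int l) - 1) = - (\<Sum>z\<leftarrow>zs. inverse z ^ l) / of_nat l" if l: "1 \<le> l" for l
  proof -
    have "inverse (e / ?q ^ Suc i) ^ l = e ^ l * (?q ^ l) ^ i" for i
    proof -
      have "inverse (e / ?q ^ Suc i) = e * ?q ^ i" using e by (simp add: field_simps power2_eq_square)
      then show ?thesis by (simp add: power_mult_distrib power_mult[symmetric] mult.commute)
    qed
    then have "(\<Sum>z\<leftarrow>zs. inverse z ^ l) = (\<Sum>i<k. e ^ l * (?q ^ l) ^ i)"
      by (simp add: zs_def o_def interv_sum_list_conv_sum_set_nat atLeast0LessThan del: power_Suc)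
    also have "\<dots> = e ^ l * ((1 - (?q ^ l) ^ k) / (1 - ?q ^ l))"
      unfolding sum_distrib_left[symmetric] geom_up[OF ql[OF l]] ..
    finally have S: "(\<Sum>z\<leftarrow>zs. inverse z ^ l) = e ^ l * ((1 - (?q ^ l) ^ k) / (1 - ?q ^ l))" .
    show ?thesis unfolding pw pp_q_rho[OF q l] e_def[symmetric] S using ql[OF l] l by (simp add: divide_simps) (simp add: algebra_simps)?
  qed
  have Pz: "prod_list (map uminus zs) = (-1) ^ k / e ^ (k ^ 2)"
    unfolding zs_def
  proof (induction k)
    case (Suc k)
    have "e ^ (Suc k ^ 2) = e ^ (k ^ 2) * (e * (e ^ 2) ^ k)"
      by (simp only: power_mult[symmetric] power_add[symmetric] power_Suc[symmetric]) (simp add: power2_eq_square algebra_simps mult_2_right)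
    moreover have "- (e / (e ^ 2) ^ Suc k) = -1 / (e * (e ^ 2) ^ k)" using e(1) by (simp add: power2_eq_square)
    ultimately show ?case using Suc unfolding e(2) by simp
  qed simp
  have W: "exp (?s * w0 W) * ent (Jc ?M) U W = exp (?s * w0 U) / e ^ (a * k\<^sup>2) * ent (At ?q k ?M) U W" if W: "W \<in> maya" for W
  proof -
    have "exp (- ?s * w0 U) * ent (Jc ?M) U W = exp (- ?s * w0 W) * (exp (- ?s * of_int (?M ^ 2)) * ent (Dm (\<lambda>p. exp (2 * (- ?s) * of_int (?M * p))) ?M) U W)"
      by (rule Jc_w0[OF M W])
    moreover have "(\<lambda>p. exp (2 * (- ?s) * of_int (?M * p))) = (\<lambda>p. ?q powi (- int k * p))"
    proof
      fix p
      have "2 * (- ?s) * of_int (?M * p) = of_int (- int k * p) * lq" using a0 by (simp add: field_simps)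
      then show "exp (2 * (- ?s) * of_int (?M * p)) = ?q powi (- int k * p)" by (simp only: exp_powi)
    qed
    moreover have "exp (- ?s * of_int (?M ^ 2)) = 1 / e ^ (a * k\<^sup>2)"
    proof -
      have "- ?s * of_int (?M ^ 2) = - (of_nat (a * k\<^sup>2) * (lq / 2))" using a0 by (simp add: field_simps power2_eq_square)
      then show ?thesis unfolding e_def by (simp only: exp_minus exp_of_nat_mult inverse_eq_divide)
    qed
    ultimately have "exp (- ?s * w0 U) * ent (Jc ?M) U W = exp (- ?s * w0 W) * (1 / e ^ (a * k\<^sup>2) * ent (At ?q k ?M) U W)"
      by (simp only: At_Dm[OF M])
    then show ?thesis by (simp add: exp_minus field_simps)
  qed
  have "op_mult (J ?M) (XL lq ps a) U V = (\<Sum>\<^sub>\<infinity>W\<in>maya. exp (?s * w0 U) / e ^ (a * k\<^sup>2) * kk ?q ps * (ent (At ?q k ?M) U W * ?NF W V))"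
    unfolding op_mult_def J_eq
  proof (rule infsum_cong)
    fix W assume Wm: "W \<in> maya"
    have "ent (Jc ?M) U W * XL lq ps a W V = exp (?s * w0 W) * ent (Jc ?M) U W * (kk ?q ps * ?NF W V)" by (simp add: XL_def)
    then show "ent (Jc ?M) U W * XL lq ps a W V = exp (?s * w0 U) / e ^ (a * k\<^sup>2) * kk ?q ps * (ent (At ?q k ?M) U W * ?NF W V)"
      unfolding W[OF Wm] by simp
  qed
  also have "\<dots> = exp (?s * w0 U) / e ^ (a * k\<^sup>2) * kk ?q ps * op_mult (ent (At ?q k ?M)) ?NF U V"
    unfolding op_mult_def by (rule infsum_cmult_right')
  also have "op_mult (ent (At ?q k ?M)) ?NF U V = prod_list ps powi ?M / (prod_list (cl ps) ^ length zs * prod_list (map uminus zs) ^ Suc (length ps))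
      * op_mult ?NF (ent (At ?q k (?M - int (Suc (length ps) * length zs)))) U V"
    by (rule NF_At[OF _ k1 ps zs(1) c1 c2 U V]) auto
  also have "?M - int (Suc (length ps) * length zs) = 0" by (simp add: a zs)
  also have "op_mult ?NF (ent (At ?q k 0)) U V = ?NF U V * Ph ?q k V" unfolding At_dg by (rule op_mult_dg_right[OF V])
  also have "prod_list (cl ps) ^ length zs * prod_list (map uminus zs) ^ Suc (length ps) = prod_list (cl ps) ^ k * ((-1) ^ (a * k) / e ^ (a * k\<^sup>2))"
    unfolding Pz zs a[symmetric] by (simp add: power_divide power_mult[symmetric] mult.commute)
  also have "exp (?s * w0 U) / e ^ (a * k\<^sup>2) * kk ?q ps * (prod_list ps powi ?M / (prod_list (cl ps) ^ k * ((-1) ^ (a * k) / e ^ (a * k\<^sup>2))) * (?NF U V * Ph ?q k V))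
     = (-1) ^ (a * k) * prod_list ps ^ (a * k) / prod_list (cl ps) ^ k * (XL lq ps a U V * Ph (exp lq) (int k) V)"
    unfolding XL_def power_int_of_nat minus_one_power_iff using e(1)
    by (cases "even (a * k)") (simp_all only: if_True if_False, simp_all add: field_simps)
  finally show ?thesis .
qed

lemma XR_J:
  assumes q: "norm (exp lq) < 1" and ps: "0 \<notin> set ps" and b: "b = Suc (length ps)" and k: "1 \<le> k"
    and U: "U \<in> maya" and V: "V \<in> maya"
  shows "op_mult (XR lq ps b) (J (- int (b * k))) U V = prod_list (cl ps) ^ k * (Ph (exp lq) (- int k) U * XR lq ps b U V)"
proof -
  define e where "e = exp (lq / 2)"
  have e: "e \<noteq> 0" "exp lq = e ^ 2" by (simp_all add: e_def exp_half[of lq 1, simplified, symmetric] power2_eq_square)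
  define zs where "zs = map (\<lambda>i. - (e * exp lq ^ i)) [0..<k]"
  let ?q = "exp lq" and ?c = "pm (q_rho lq)" and ?M = "- int (b * k)" and ?s = "- lq / (2 * of_nat b)"
  let ?NF = "NF (sp ?c (cl ps)) (sp ?c (dl ps)) (prod_list ps)"
  have b0: "of_nat b \<noteq> (0 :: complex)" unfolding b by (simp del: of_nat_Suc)
  have "0 < b * k" using b k by simp
  then have M: "?M \<noteq> 0" by linarith
  have zs: "0 \<notin> set zs" "length zs = k" using e by (auto simp: zs_def)
  have k1: "?q powi (- int k) \<noteq> 1" by (rule power_int_ne_1) (use q k in auto)
  have ql: "1 - ?q ^ l \<noteq> 0" if "1 \<le> l" for l using norm_exp_power_lt[OF q that] by auto
  have pw: "?q powi (- (- int k) * int l) = (?q ^ l) ^ k" "?q powi (- int k * int l) = 1 / (?q ^ l) ^ k" for l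
    by (simp_all add: power_mult[symmetric] mult.commute of_nat_mult[symmetric] power_int_minus_divide del: of_nat_mult of_nat_power)
  have pm: "?c l = - ((-1) ^ l) * (e ^ l / (of_nat l * (1 - ?q ^ l)))" if l: "1 \<le> l" for l
    unfolding pm_def tw_def pp_q_rho[OF q l] e_def ..
  have c1: "?c l * (1 - ?q powi (- (- int k) * int l)) = - (\<Sum>z\<leftarrow>zs. z ^ l) / of_nat l" if l: "1 \<le> l" for l
  proof -
    have "(- (e * ?q ^ i)) ^ l = (-1) ^ l * e ^ l * (?q ^ l) ^ i" for i
      by (subst power_minus) (simp add: power_mult_distrib power_mult[symmetric] mult.commute)
    then have "(\<Sum>z\<leftarrow>zs. z ^ l) = (\<Sum>i<k. (-1) ^ l * e ^ l * (?q ^ l) ^ i)"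
      by (simp add: zs_def o_def interv_sum_list_conv_sum_set_nat atLeast0LessThan)
    also have "\<dots> = (-1) ^ l * e ^ l * ((1 - (?q ^ l) ^ k) / (1 - ?q ^ l))"
      unfolding sum_distrib_left[symmetric] geom_up[OF ql[OF l]] ..
    finally have S: "(\<Sum>z\<leftarrow>zs. z ^ l) = (-1) ^ l * e ^ l * ((1 - (?q ^ l) ^ k) / (1 - ?q ^ l))" .
    show ?thesis unfolding pw pm[OF l] S using ql[OF l] l by (simp add: divide_simps) (simp add: algebra_simps)?
  qed
  have c2: "?c l * (?q powi (- int k * int l) - 1) = - (\<Sum>z\<leftarrow>zs. inverse z ^ l) / of_nat l" if l: "1 \<le> l" for l
  proof -
    have "inverse (- (e * ?q ^ i)) ^ l = (-1) ^ l * e ^ l * (1 / (?q ^ l) ^ Suc i)" for i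
    proof -
      have "inverse (- (e * ?q ^ i)) = - (e * (1 / ?q ^ Suc i))" using e by (simp add: field_simps power2_eq_square)
      then show ?thesis by (simp only:) (subst power_minus, simp add: power_mult_distrib power_divide power_mult[symmetric] mult.commute power_add[symmetric] del: power_Suc)
    qed
    then have "(\<Sum>z\<leftarrow>zs. inverse z ^ l) = (\<Sum>i<k. (-1) ^ l * e ^ l * (1 / (?q ^ l) ^ Suc i))"
      by (simp add: zs_def o_def interv_sum_list_conv_sum_set_nat atLeast0LessThan del: power_Suc)
    also have "\<dots> = (-1) ^ l * e ^ l * ((1 - (?q ^ l) ^ k) / (?q ^ l) ^ k / (1 - ?q ^ l))"
      unfolding sum_distrib_left[symmetric] by (subst geom_down) (use ql[OF l] in auto)
    finally have S: "(\<Sum>z\<leftarrow>zs. inverse z ^ l) = (-1) ^ l * e ^ l * ((1 - (?q ^ l) ^ k) / (?q ^ l) ^ k / (1 - ?q ^ l))" .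
    show ?thesis unfolding pw pm[OF l] S using ql[OF l] l by (simp add: divide_simps) (simp add: algebra_simps)?
  qed
  have Pz: "prod_list (map uminus zs) = e ^ (k ^ 2)"
    unfolding zs_def
  proof (induction k)
    case (Suc k)
    have "e ^ (Suc k ^ 2) = e ^ (k ^ 2) * (e * (e ^ 2) ^ k)"
      by (simp only: power_mult[symmetric] power_add[symmetric] power_Suc[symmetric]) (simp add: power2_eq_square algebra_simps mult_2_right)
    then show ?case using Suc unfolding e(2) by simp
  qed simp
  have W: "exp (?s * w0 W) * ent (Jc ?M) W V = exp (?s * w0 V) / e ^ (b * k\<^sup>2) * ent (At ?q (- int k) ?M) W V" for W
  proof -
    have "exp (?s * w0 W) * ent (Jc ?M) W V = exp (?s * w0 V) * (exp (?s * of_int (?M ^ 2)) * ent (Dm (\<lambda>p. exp (2 * ?s * of_int (?M * p))) ?M) W V)"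
      by (rule Jc_w0[OF M V])
    moreover have "(\<lambda>p. exp (2 * ?s * of_int (?M * p))) = (\<lambda>p. ?q powi (- (- int k) * p))"
    proof
      fix p
      have "2 * ?s * of_int (?M * p) = of_int (- (- int k) * p) * lq" using b0 by (simp add: field_simps)
      then show "exp (2 * ?s * of_int (?M * p)) = ?q powi (- (- int k) * p)" by (simp only: exp_powi)
    qed
    moreover have "exp (?s * of_int (?M ^ 2)) = 1 / e ^ (b * k\<^sup>2)"
    proof -
      have "?s * of_int (?M ^ 2) = - (of_nat (b * k\<^sup>2) * (lq / 2))" using b0 by (simp add: field_simps power2_eq_square)
      then show ?thesis unfolding e_def by (simp only: exp_minus exp_of_nat_mult inverse_eq_divide)
    qed
    ultimately show ?thesis by (simp only: At_Dm[OF M]) simp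
  qed
  have "op_mult (XR lq ps b) (J ?M) U V = (\<Sum>\<^sub>\<infinity>W\<in>maya. exp (?s * w0 V) / e ^ (b * k\<^sup>2) * kk ?q ps * (?NF U W * ent (At ?q (- int k) ?M) W V))"
    unfolding op_mult_def J_eq
  proof (rule infsum_cong)
    fix W
    have "XR lq ps b U W * ent (Jc ?M) W V = exp (?s * w0 W) * ent (Jc ?M) W V * (kk ?q ps * ?NF U W)" by (simp add: XR_def)
    then show "XR lq ps b U W * ent (Jc ?M) W V = exp (?s * w0 V) / e ^ (b * k\<^sup>2) * kk ?q ps * (?NF U W * ent (At ?q (- int k) ?M) W V)"
      unfolding W by simp
  qed
  also have "\<dots> = exp (?s * w0 V) / e ^ (b * k\<^sup>2) * kk ?q ps * op_mult ?NF (ent (At ?q (- int k) ?M)) U V"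
    unfolding op_mult_def by (rule infsum_cmult_right')
  also have "op_mult ?NF (ent (At ?q (- int k) ?M)) U V = prod_list (cl ps) ^ k * e ^ (b * k\<^sup>2) * (Ph ?q (- int k) U * ?NF U V)"
  proof -
    have "op_mult (ent (At ?q (- int k) 0)) ?NF U V = prod_list ps powi 0 / (prod_list (cl ps) ^ length zs * prod_list (map uminus zs) ^ Suc (length ps))
      * op_mult ?NF (ent (At ?q (- int k) (0 - int (Suc (length ps) * length zs)))) U V"
      by (rule NF_At[OF _ k1 ps zs(1) c1 c2 U V]) auto
    moreover have "0 - int (Suc (length ps) * length zs) = ?M" by (simp add: b zs)
    moreover have "op_mult (ent (At ?q (- int k) 0)) ?NF U V = Ph ?q (- int k) U * ?NF U V" unfolding At_dg by (rule op_mult_dg_left[OF U])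
    moreover have "prod_list (cl ps) ^ length zs * prod_list (map uminus zs) ^ Suc (length ps) = prod_list (cl ps) ^ k * e ^ (b * k\<^sup>2)"
      unfolding Pz zs b[symmetric] by (simp add: power_mult[symmetric] mult.commute)
    ultimately have "Ph ?q (- int k) U * ?NF U V = prod_list ps powi 0 / (prod_list (cl ps) ^ k * e ^ (b * k\<^sup>2)) * op_mult ?NF (ent (At ?q (- int k) ?M)) U V"
      by (simp only:)
    moreover have "prod_list (cl ps) \<noteq> 0" using cl_nonzero[OF ps] by (simp add: prod_list_zero_iff)
    ultimately show ?thesis using e(1) by (simp add: field_simps)
  qed
  also have "exp (?s * w0 V) / e ^ (b * k\<^sup>2) * kk ?q ps * (prod_list (cl ps) ^ k * e ^ (b * k\<^sup>2) * (Ph ?q (- int k) U * ?NF U V))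
     = prod_list (cl ps) ^ k * (Ph (exp lq) (- int k) U * XR lq ps b U V)"
    unfolding XR_def using e(1) by simp
  finally show ?thesis .
qed

section \<open>Matrices of formal power series\<close>

lemma coeff_zero: "mps_coeff 0 M = 0" by transfer simp
lemma coeff_add: "mps_coeff (f + g) M = mps_coeff f M + mps_coeff g M" by transfer simp
lemma coeff_minus: "mps_coeff (- f) M = - mps_coeff f M" by transfer simp
lemma coeff_diff: "mps_coeff (f - g) M = mps_coeff f M - mps_coeff g M" by transfer simp
lemma coeff_scaleR: "mps_coeff (c *\<^sub>R f) M = c *\<^sub>R mps_coeff f M" by transfer simp
lemma coeff_mult: "mps_coeff (f * g) M = (\<Sum>(A, B)\<in>{(A, B). A + B = M}. mps_coeff f A * mps_coeff g B)"
  by transfer simp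
lemma coeff_const: "mps_coeff (mps_const c) M = (if M = {#} then c else 0)" by transfer simp
lemma coeff_var: "mps_coeff (mps_var v) M = (if M = {#v#} then 1 else 0)" by transfer simp

lemma coeff_sum: "mps_coeff (sum f S) M = (\<Sum>i\<in>S. mps_coeff (f i) M)"
  by (induction S rule: infinite_finite_induct) (simp_all add: coeff_zero coeff_add)

lemma coeff_const_mult: fixes f :: "'v mps" shows "mps_coeff (mps_const c * f) M = c * mps_coeff f M"
proof -
  have "mps_coeff (mps_const c * f) M = (\<Sum>(A, B)\<in>{({#} :: 'v multiset, M)}. mps_coeff (mps_const c) A * mps_coeff f B)"
    unfolding coeff_mult
    by (rule sum.mono_neutral_right) (auto simp: finite_splits coeff_const split: if_splits)
  then show ?thesis by (simp add: coeff_const)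
qed

lemma const_mult: "mps_const (c * d) = mps_const c * mps_const d"
  by (rule mps_eqI) (simp add: coeff_const_mult coeff_const)

lemma coeff_mult_cong:
  assumes "\<And>N. N \<subseteq># M \<Longrightarrow> mps_coeff f N = mps_coeff F N" "\<And>N. N \<subseteq># M \<Longrightarrow> mps_coeff g N = mps_coeff G N"
  shows "mps_coeff (f * g) M = mps_coeff (F * G) M"
  unfolding coeff_mult by (rule sum.cong[OF refl]) (use assms in auto)

lemma coeff_mult_0:
  assumes "\<And>N. N \<subseteq># M \<Longrightarrow> mps_coeff f N = 0" shows "mps_coeff (f * g) M = 0"
  unfolding coeff_mult by (rule sum.neutral) (use assms in auto)

lemma mps_has_sumI:
  assumes "\<And>M. ((\<lambda>i. mps_coeff (f i) M) has_sum mps_coeff S M) A"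
  shows "(f has_sum S) A"
proof -
  have "limitin (product_topology (\<lambda>_. euclidean) UNIV) (\<lambda>F M. \<Sum>i\<in>F. mps_coeff (f i) M) (mps_coeff S) (finite_subsets_at_top A)"
    unfolding limitin_componentwise using assms by (auto simp: has_sum_def)
  then have lim: "((\<lambda>F M. \<Sum>i\<in>F. mps_coeff (f i) M) \<longlongrightarrow> mps_coeff S) (finite_subsets_at_top A)"
    by (simp add: euclidean_product_topology)
  show ?thesis unfolding has_sum_def
  proof (rule topological_tendstoI)
    fix U assume "open U" "S \<in> U"
    then have "\<forall>\<^sub>F F in finite_subsets_at_top A. (\<lambda>M. \<Sum>i\<in>F. mps_coeff (f i) M) \<in> mps_coeff ` U"
      by (intro topological_tendstoD[OF lim]) (auto simp: open_mps_def)
    then show "\<forall>\<^sub>F F in finite_subsets_at_top A. sum f F \<in> U"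
    proof (rule eventually_mono)
      fix F assume "(\<lambda>M. \<Sum>i\<in>F. mps_coeff (f i) M) \<in> mps_coeff ` U"
      then obtain g where g: "g \<in> U" "(\<lambda>M. \<Sum>i\<in>F. mps_coeff (f i) M) = mps_coeff g" by auto
      have "sum f F = g" by (rule mps_eqI) (simp add: coeff_sum fun_cong[OF g(2), symmetric])
      then show "sum f F \<in> U" using g by simp
    qed
  qed
qed

lemma fin_has_sum:
  fixes f :: "'x \<Rightarrow> complex"
  assumes "finite B" "B \<subseteq> A" "\<And>x. x \<in> A \<Longrightarrow> x \<notin> B \<Longrightarrow> f x = 0"
  shows "(f has_sum sum f B) A"
proof -
  have "(f has_sum sum f B) B \<longleftrightarrow> (f has_sum sum f B) A"
    by (rule has_sum_cong_neutral) (use assms in auto)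
  then show ?thesis using has_sum_finite[OF assms(1), of f] by blast
qed

lemma mps_infsum:
  assumes "\<And>M. ((\<lambda>i. mps_coeff (f i) M) has_sum S M) A"
  shows "mps_coeff (infsum f A) M = S M"
proof -
  have "mps_coeff (Abs_mps S) = S" by (simp add: Abs_mps_inverse)
  moreover have "(f has_sum Abs_mps S) A"
    by (rule mps_has_sumI) (use assms in \<open>simp add: Abs_mps_inverse\<close>)
  ultimately show ?thesis by (simp add: infsumI)
qed

definition low :: "nat \<Rightarrow> 'v mps \<Rightarrow> bool"
  where "low n f \<longleftrightarrow> (\<forall>M. size M < n \<longrightarrow> mps_coeff f M = 0)"

lemma low_mult: assumes "low m f" "low n g" shows "low (m + n) (f * g)"
  unfolding low_def
proof (intro allI impI)
  fix M :: "'a multiset" assume M: "size M < m + n"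
  have "mps_coeff f A * mps_coeff g B = 0" if "A + B = M" for A B
  proof -
    have "size A < m \<or> size B < n" using that M by auto
    then show ?thesis using assms by (auto simp: low_def)
  qed
  then show "mps_coeff (f * g) M = 0" unfolding coeff_mult by (intro sum.neutral) auto
qed

lemma low_pow: "low 1 f \<Longrightarrow> low n (f ^ n)"
proof (induction n)
  case (Suc n)
  then show ?case using low_mult[of 1 f n "f ^ n"] by simp
qed (simp add: low_def)

lemma low_scaleR: "low n f \<Longrightarrow> low n (c *\<^sub>R f)" by (simp add: low_def coeff_scaleR)

lemma low_add: "low n f \<Longrightarrow> low n g \<Longrightarrow> low n (f + g)" by (simp add: low_def coeff_add)

lemma low_infsum:
  assumes f: "\<And>n. low n (f n)" and "size M \<le> m"
  shows "mps_coeff (\<Sum>\<^sub>\<infinity>n. f n) M = mps_coeff (\<Sum>n\<le>m. f n) M"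
proof -
  have "mps_coeff (\<Sum>\<^sub>\<infinity>n. f n) M = (\<Sum>n\<le>size M. mps_coeff (f n) M)"
    by (rule mps_infsum, rule fin_has_sum) (use f in \<open>auto simp: low_def\<close>)
  also have "\<dots> = (\<Sum>n\<le>m. mps_coeff (f n) M)"
    by (rule sum.mono_neutral_left) (use assms in \<open>auto simp: low_def\<close>)
  finally show ?thesis by (simp add: coeff_sum)
qed

lemma mps_exp_coeff:
  assumes "low 1 f" "size M \<le> m"
  shows "mps_coeff (mps_exp f) M = mps_coeff (\<Sum>n\<le>m. f ^ n /\<^sub>R fact n) M"
  unfolding mps_exp_def by (intro low_infsum low_scaleR low_pow assms)

lemma mps_exp_add:
  assumes f: "low 1 f" and g: "low 1 g"
  shows "mps_exp (f + g) = mps_exp f * mps_exp g"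
proof (rule mps_eqI)
  fix M :: "'a multiset"
  let ?m = "size M" and ?t = "\<lambda>(i, j). (f ^ i /\<^sub>R fact i) * (g ^ j /\<^sub>R fact j)"
  have "mps_coeff (mps_exp f * mps_exp g) M = mps_coeff ((\<Sum>i\<le>?m. f ^ i /\<^sub>R fact i) * (\<Sum>j\<le>?m. g ^ j /\<^sub>R fact j)) M"
    by (rule coeff_mult_cong; rule mps_exp_coeff) (use f g size_mset_mono in auto)
  also have "\<dots> = (\<Sum>p\<in>{..?m} \<times> {..?m}. mps_coeff (?t p) M)"
    by (simp add: sum_product sum.cartesian_product coeff_sum case_prod_beta)
  also have "\<dots> = (\<Sum>p\<in>{(i, j). i + j \<le> ?m}. mps_coeff (?t p) M)"
  proof (rule sum.mono_neutral_right)
    have "low (i + j) (?t (i, j))" for i j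
      unfolding prod.case by (intro low_mult low_scaleR low_pow f g)
    then show "\<forall>p\<in>{..?m} \<times> {..?m} - {(i, j). i + j \<le> ?m}. mps_coeff (?t p) M = 0"
      by (force simp: low_def)
  qed auto
  also have "\<dots> = mps_coeff (\<Sum>(i, j)\<in>{(i, j). i + j \<le> ?m}. (f ^ i /\<^sub>R fact i) * (g ^ j /\<^sub>R fact j)) M"
    by (simp add: coeff_sum case_prod_beta)
  also have "(\<Sum>(i, j)\<in>{(i, j). i + j \<le> ?m}. (f ^ i /\<^sub>R fact i) * (g ^ j /\<^sub>R fact j))
      = (\<Sum>n\<le>?m. \<Sum>i\<le>n. (f ^ i /\<^sub>R fact i) * (g ^ (n - i) /\<^sub>R fact (n - i)))"
    by (rule sum.triangle_reindex_eq)
  also have "\<dots> = (\<Sum>n\<le>?m. (f + g) ^ n /\<^sub>R fact n)"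
  proof (rule sum.cong[OF refl])
    fix n
    have "(f ^ i /\<^sub>R fact i) * (g ^ (n - i) /\<^sub>R fact (n - i)) = (of_nat (n choose i) * f ^ i * g ^ (n - i)) /\<^sub>R fact n" if "i \<le> n" for i
    proof -
      have "(of_nat (n choose i) * f ^ i * g ^ (n - i)) = real (n choose i) *\<^sub>R (f ^ i * g ^ (n - i))"
        by (simp add: scaleR_conv_of_real)
      then show ?thesis using that by (simp add: binomial_fact field_simps)
    qed
    then show "(\<Sum>i\<le>n. (f ^ i /\<^sub>R fact i) * (g ^ (n - i) /\<^sub>R fact (n - i))) = (f + g) ^ n /\<^sub>R fact n"
      unfolding binomial_ring scaleR_sum_right by (intro sum.cong) auto
  qed
  also have "mps_coeff \<dots> M = mps_coeff (mps_exp (f + g)) M"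
    by (rule mps_exp_coeff[symmetric]) (use f g low_add in auto)
  finally show "mps_coeff (mps_exp (f + g)) M = mps_coeff (mps_exp f * mps_exp g) M" ..
qed

definition rset :: "'v mps fop \<Rightarrow> int set \<Rightarrow> 'v multiset \<Rightarrow> int set set"
  where "rset A U M = {W \<in> maya. \<exists>N. N \<subseteq># M \<and> mps_coeff (A U W) N \<noteq> 0}"

definition rfin :: "'v mps fop \<Rightarrow> bool"
  where "rfin A \<longleftrightarrow> (\<forall>U M. finite {W \<in> maya. mps_coeff (A U W) M \<noteq> 0})"

lemma finite_sub_mset: "finite {N. N \<subseteq># (M :: 'v multiset)}"
proof -
  have "{N. N \<subseteq># M} \<subseteq> fst ` {(A, B). A + B = M}" by (auto simp: subset_mset.le_iff_add image_iff)
  then show ?thesis using finite_splits finite_subset by blast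
qed

lemma finite_rset: assumes "rfin A" shows "finite (rset A U M)"
proof -
  have "rset A U M = (\<Union>N\<in>{N. N \<subseteq># M}. {W \<in> maya. mps_coeff (A U W) N \<noteq> 0})" by (auto simp: rset_def)
  then show ?thesis using assms by (auto simp: rfin_def finite_sub_mset)
qed

lemma rset_maya: "rset A U M \<subseteq> maya" by (auto simp: rset_def)

lemma rset_mono: "N \<subseteq># M \<Longrightarrow> rset A U N \<subseteq> rset A U M"
  by (auto simp: rset_def intro: subset_mset.order_trans)

lemma op_mult_coeff:
  assumes A: "rfin A" and S: "finite S" "S \<subseteq> maya" "rset A U M \<subseteq> S"
  shows "mps_coeff (op_mult A B U V) M = mps_coeff (\<Sum>W\<in>S. A U W * B W V) M"
proof -
  have z: "mps_coeff (A U W * B W V) N = 0" if "W \<in> maya" "W \<notin> rset A U N" for W N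
    by (rule coeff_mult_0) (use that in \<open>auto simp: rset_def\<close>)
  have "mps_coeff (op_mult A B U V) M = (\<Sum>W\<in>rset A U M. mps_coeff (A U W * B W V) M)"
    unfolding op_mult_def
    by (rule mps_infsum, rule fin_has_sum) (use finite_rset[OF A] z in \<open>auto dest: subsetD[OF rset_maya]\<close>)
  also have "\<dots> = (\<Sum>W\<in>S. mps_coeff (A U W * B W V) M)"
    by (rule sum.mono_neutral_left) (use S z in auto)
  finally show ?thesis by (simp add: coeff_sum)
qed

lemma rset_op_mult:
  assumes A: "rfin A"
  shows "rset (op_mult A B) U M \<subseteq> (\<Union>Y\<in>rset A U M. rset B Y M)"
proof
  fix W assume "W \<in> rset (op_mult A B) U M"
  then obtain N where W: "W \<in> maya" and N: "N \<subseteq># M" "mps_coeff (op_mult A B U W) N \<noteq> 0" by (auto simp: rset_def)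
  have "mps_coeff (op_mult A B U W) N = mps_coeff (\<Sum>Y\<in>rset A U M. A U Y * B Y W) N"
    by (rule op_mult_coeff[OF A finite_rset[OF A] rset_maya rset_mono[OF N(1)]])
  then obtain Y where Y: "Y \<in> rset A U M" "mps_coeff (B Y W * A U Y) N \<noteq> 0"
    using N(2) by (auto simp: coeff_sum mult.commute dest!: sum_nonzeroD)
  then obtain N' where "N' \<subseteq># N" "mps_coeff (B Y W) N' \<noteq> 0" using coeff_mult_0 by blast
  then have "W \<in> rset B Y M" using W N(1) by (auto simp: rset_def intro: subset_mset.order_trans)
  then show "W \<in> (\<Union>Y\<in>rset A U M. rset B Y M)" using Y by blast
qed

lemma rfin_op_mult: assumes "rfin A" "rfin B" shows "rfin (op_mult A B)"
  unfolding rfin_def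
proof (intro allI)
  fix U M
  have "finite (rset (op_mult A B) U M)"
    by (rule finite_subset[OF rset_op_mult[OF assms(1)]]) (use assms finite_rset in blast)
  then show "finite {W \<in> maya. mps_coeff (op_mult A B U W) M \<noteq> 0}"
    by (rule finite_subset[rotated]) (auto simp: rset_def)
qed

lemma rfin_id: "rfin op_id"
  unfolding rfin_def
proof (intro allI)
  fix U and M :: "'v multiset"
  have "{W \<in> maya. mps_coeff (op_id U W) M \<noteq> 0} \<subseteq> {U}" by (auto simp: op_id_def coeff_zero split: if_splits)
  then show "finite {W \<in> maya. mps_coeff (op_id U W) M \<noteq> 0}" by (rule finite_subset) simp
qed

lemma rfin_power: "rfin A \<Longrightarrow> rfin (op_power A n)"
  by (induction n) (simp_all add: rfin_id rfin_op_mult)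

lemma op_mult_assoc:
  assumes A: "rfin A" and B: "rfin B"
  shows "op_mult (op_mult A B) X U V = op_mult A (op_mult B X) U V"
proof (rule mps_eqI)
  fix M
  define S1 where "S1 = rset A U M"
  define S2 where "S2 = (\<Union>Y\<in>S1. rset B Y M)"
  have S1: "finite S1" "S1 \<subseteq> maya" "rset A U M \<subseteq> S1" unfolding S1_def using finite_rset[OF A] by (auto dest: subsetD[OF rset_maya])
  have S2: "finite S2" "S2 \<subseteq> maya" unfolding S2_def using finite_rset[OF B] S1(1) by (auto dest: subsetD[OF rset_maya])
  have "mps_coeff (op_mult (op_mult A B) X U V) M = mps_coeff (\<Sum>W\<in>S2. op_mult A B U W * X W V) M"
    by (rule op_mult_coeff[OF rfin_op_mult[OF A B] S2]) (use rset_op_mult[OF A] in \<open>simp add: S2_def S1_def\<close>)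
  also have "\<dots> = mps_coeff (\<Sum>W\<in>S2. (\<Sum>Y\<in>S1. A U Y * B Y W) * X W V) M"
    unfolding coeff_sum
  proof (intro sum.cong refl coeff_mult_cong)
    fix W N assume "N \<subseteq># M"
    then show "mps_coeff (op_mult A B U W) N = mps_coeff (\<Sum>Y\<in>S1. A U Y * B Y W) N"
      by (intro op_mult_coeff[OF A S1(1,2)]) (simp add: S1_def rset_mono)
  qed
  also have "(\<Sum>W\<in>S2. (\<Sum>Y\<in>S1. A U Y * B Y W) * X W V) = (\<Sum>Y\<in>S1. A U Y * (\<Sum>W\<in>S2. B Y W * X W V))"
    unfolding sum_distrib_right sum_distrib_left mult.assoc by (rule sum.swap)
  also have "mps_coeff \<dots> M = mps_coeff (\<Sum>Y\<in>S1. A U Y * op_mult B X Y V) M"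
    unfolding coeff_sum
  proof (intro sum.cong refl coeff_mult_cong)
    fix Y N assume "Y \<in> S1" "N \<subseteq># M"
    then have "rset B Y N \<subseteq> S2" using rset_mono[of N M B Y] by (auto simp: S2_def)
    then show "mps_coeff (\<Sum>W\<in>S2. B Y W * X W V) N = mps_coeff (op_mult B X Y V) N"
      by (rule op_mult_coeff[OF B S2, symmetric])
  qed
  also have "\<dots> = mps_coeff (op_mult A (op_mult B X) U V) M" by (rule op_mult_coeff[OF A S1, symmetric])
  finally show "mps_coeff (op_mult (op_mult A B) X U V) M = mps_coeff (op_mult A (op_mult B X) U V) M" .
qed

lemma op_mult_scale_right:
  assumes A: "rfin A" shows "op_mult A (\<lambda>W V. X W V * c V) U V = op_mult A X U V * c V"
proof (rule mps_eqI)
  fix M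
  note S = finite_rset[OF A, of U M] rset_maya[of A U M]
  have "mps_coeff (op_mult A (\<lambda>W V. X W V * c V) U V) M = mps_coeff ((\<Sum>W\<in>rset A U M. A U W * X W V) * c V) M"
    unfolding op_mult_coeff[OF A S subset_refl] sum_distrib_right mult.assoc ..
  also have "\<dots> = mps_coeff (op_mult A X U V * c V) M"
    by (rule coeff_mult_cong) (use S in \<open>auto intro!: op_mult_coeff[OF A, symmetric] intro: rset_mono[THEN subsetD]\<close>)
  finally show "mps_coeff (op_mult A (\<lambda>W V. X W V * c V) U V) M = mps_coeff (op_mult A X U V * c V) M" .
qed

lemma op_mult_id_left: "U \<in> maya \<Longrightarrow> op_mult op_id X U V = X U V"
  unfolding op_mult_def by (subst infsum_one[of maya U]) (auto simp: op_id_def)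

lemma op_mult_id_right: "V \<in> maya \<Longrightarrow> op_mult X op_id U V = X U V"
  unfolding op_mult_def by (subst infsum_one[of maya V]) (auto simp: op_id_def)

lemma low_power:
  assumes A: "rfin A" and l: "\<And>U V. low 1 (A U V)"
  shows "low n (op_power A n U V)"
proof (induction n arbitrary: U)
  case (Suc n)
  show ?case unfolding low_def
  proof (intro allI impI)
    fix M :: "'a multiset" assume M: "size M < Suc n"
    have "low (1 + n) (A U W * op_power A n W V)" for W by (rule low_mult[OF l Suc])
    moreover have "mps_coeff (op_mult A (op_power A n) U V) M = mps_coeff (\<Sum>W\<in>rset A U M. A U W * op_power A n W V) M"
      by (rule op_mult_coeff[OF A finite_rset[OF A] rset_maya subset_refl])
    ultimately show "mps_coeff (op_power A (Suc n) U V) M = 0"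
      using M by (simp add: coeff_sum low_def)
  qed
qed (simp add: low_def)

lemma op_exp_coeff:
  assumes "rfin A" "\<And>U V. low 1 (A U V)" "size M \<le> m"
  shows "mps_coeff (op_exp A U V) M = mps_coeff (\<Sum>n\<le>m. op_power A n U V /\<^sub>R fact n) M"
  unfolding op_exp_def by (intro low_infsum low_scaleR low_power assms)

lemma rset_op_exp:
  assumes A: "rfin A" and l: "\<And>U V. low 1 (A U V)"
  shows "rset (op_exp A) U M \<subseteq> (\<Union>n\<in>{..size M}. rset (op_power A n) U M)"
proof
  fix W assume "W \<in> rset (op_exp A) U M"
  then obtain N where W: "W \<in> maya" and N: "N \<subseteq># M" "mps_coeff (op_exp A U W) N \<noteq> 0" by (auto simp: rset_def)
  have "mps_coeff (op_exp A U W) N = mps_coeff (\<Sum>n\<le>size M. op_power A n U W /\<^sub>R fact n) N"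
    by (rule op_exp_coeff[OF A l size_mset_mono[OF N(1)]])
  then obtain n where "n \<le> size M" "mps_coeff (op_power A n U W) N \<noteq> 0"
    using N(2) by (auto simp: coeff_sum coeff_scaleR dest!: sum_nonzeroD)
  then show "W \<in> (\<Union>n\<in>{..size M}. rset (op_power A n) U M)" using W N(1) by (auto simp: rset_def)
qed

lemma rfin_op_exp:
  assumes A: "rfin A" and l: "\<And>U V. low 1 (A U V)" shows "rfin (op_exp A)"
  unfolding rfin_def
proof (intro allI)
  fix U M
  have "finite (rset (op_exp A) U M)"
    by (rule finite_subset[OF rset_op_exp[OF A l]]) (use finite_rset[OF rfin_power[OF A]] in blast)
  then show "finite {W \<in> maya. mps_coeff (op_exp A U W) M \<noteq> 0}"
    by (rule finite_subset[rotated]) (auto simp: rset_def)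
qed

lemma op_power_intertwine:
  assumes A: "rfin A" and AX: "\<And>U. U \<in> maya \<Longrightarrow> op_mult A X U V = X U V * D" and U: "U \<in> maya"
  shows "op_mult (op_power A n) X U V = X U V * D ^ n"
  using U
proof (induction n arbitrary: U)
  case 0
  then show ?case by (simp add: op_mult_id_left)
next
  case (Suc n)
  have "op_mult (op_power A (Suc n)) X U V = op_mult A (op_mult (op_power A n) X) U V"
    using op_mult_assoc[OF A rfin_power[OF A]] by simp
  also have "\<dots> = op_mult A (\<lambda>W V. X W V * D ^ n) U V"
    unfolding op_mult_def by (rule infsum_cong) (simp add: Suc.IH[unfolded op_mult_def])
  also have "\<dots> = X U V * D * D ^ n" using op_mult_scale_right[OF A, of X "\<lambda>_. D ^ n"] AX[OF Suc.prems] by simp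
  finally show ?case by (simp add: mult.assoc)
qed

lemma op_exp_intertwine:
  fixes A X :: "'v mps fop"
  assumes A: "rfin A" and l: "\<And>U V. low 1 (A U V)" and D: "low 1 D"
    and AX: "\<And>U. U \<in> maya \<Longrightarrow> op_mult A X U V = X U V * D" and U: "U \<in> maya"
  shows "op_mult (op_exp A) X U V = X U V * mps_exp D"
proof (rule mps_eqI)
  fix M :: "'v multiset"
  let ?m = "size M"
  define S where "S = (\<Union>n\<in>{..?m}. rset (op_power A n) U M)"
  have S: "finite S" "S \<subseteq> maya" using finite_rset[OF rfin_power[OF A]] by (auto simp: S_def dest: subsetD[OF rset_maya])
  have "mps_coeff (op_mult (op_exp A) X U V) M = mps_coeff (\<Sum>W\<in>S. op_exp A U W * X W V) M"
    by (rule op_mult_coeff[OF rfin_op_exp[OF A l] S]) (use rset_op_exp[OF A l] in \<open>simp add: S_def\<close>)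
  also have "\<dots> = mps_coeff (\<Sum>W\<in>S. (\<Sum>n\<le>?m. op_power A n U W /\<^sub>R fact n) * X W V) M"
    unfolding coeff_sum[of _ S]
    by (intro sum.cong refl coeff_mult_cong op_exp_coeff[OF A l] size_mset_mono)
  also have "(\<Sum>W\<in>S. (\<Sum>n\<le>?m. op_power A n U W /\<^sub>R fact n) * X W V)
      = (\<Sum>n\<le>?m. (\<Sum>W\<in>S. op_power A n U W * X W V) /\<^sub>R fact n)"
    unfolding sum_distrib_right scaleR_sum_right by (subst sum.swap) simp
  also have "mps_coeff \<dots> M = (\<Sum>n\<le>?m. mps_coeff (op_mult (op_power A n) X U V) M /\<^sub>R fact n)"
    unfolding coeff_sum[of _ "{..?m}"] coeff_scaleR
  proof (intro sum.cong refl arg_cong2[where f = scaleR])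
    fix n assume "n \<in> {..?m}"
    then show "mps_coeff (\<Sum>W\<in>S. op_power A n U W * X W V) M = mps_coeff (op_mult (op_power A n) X U V) M"
      by (intro op_mult_coeff[OF rfin_power[OF A] S, symmetric]) (auto simp: S_def)
  qed
  also have "\<dots> = mps_coeff (X U V * (\<Sum>n\<le>?m. D ^ n /\<^sub>R fact n)) M"
    using op_power_intertwine[OF A AX U] by (simp add: sum_distrib_left coeff_sum coeff_scaleR)
  also have "\<dots> = mps_coeff (X U V * mps_exp D) M"
    by (rule coeff_mult_cong[OF refl], rule mps_exp_coeff[symmetric]) (use D size_mset_mono in auto)
  finally show "mps_coeff (op_mult (op_exp A) X U V) M = mps_coeff (X U V * mps_exp D) M" .
qed

lemma op_exp_tr_mps:
  assumes A: "rfin A" and m: "\<And>U V. A U V \<noteq> 0 \<Longrightarrow> U \<in> maya \<and> V \<in> maya"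
  shows "op_exp (tr A) = tr (op_exp A)"
proof -
  have comm: "op_mult (op_power A n) A = op_mult A (op_power A n)" for n
  proof (induction n)
    case 0
    show ?case
    proof (intro ext)
      fix U V
      consider "U \<in> maya" "V \<in> maya" | "U \<notin> maya" | "V \<notin> maya" by blast
      then show "op_mult (op_power A 0) A U V = op_mult A (op_power A 0) U V"
      proof cases
        case 2
        then have "A U W = 0" for W using m by blast
        then show ?thesis using 2 by (simp add: op_mult_def op_id_def)
      next
        case 3
        then have "A W V = 0" for W using m by blast
        moreover have "op_id W V = (0 :: 'a mps)" for W using 3 by (auto simp: op_id_def)
        ultimately show ?thesis by (simp add: op_mult_def)
      qed (simp add: op_mult_id_left op_mult_id_right)
    qed
  next
    case (Suc n)
    have "op_mult (op_mult A (op_power A n)) A = op_mult A (op_mult (op_power A n) A)"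
      by (intro ext op_mult_assoc A rfin_power)
    then show ?case by (simp add: Suc.IH)
  qed
  have "op_power (tr A) n = tr (op_power A n)" for n
    by (induction n) (simp_all add: tr_op_id op_mult_tr comm)
  then show ?thesis by (intro ext) (simp add: op_exp_def tr_def)
qed

text \<open>The linear form \<open>\<Sum>k\<ge>1. x k * v k\<close>; for injective \<open>v\<close> the sum below has at most one term.\<close>

definition lin :: "(nat \<Rightarrow> 'v) \<Rightarrow> (nat \<Rightarrow> complex) \<Rightarrow> 'v mps"
  where "lin v x = Abs_mps (\<lambda>M. \<Sum>\<^sub>\<infinity>k\<in>{k. 1 \<le> k \<and> M = {#v k#}}. x k)"

lemma lin_coeff_var: "inj v \<Longrightarrow> 1 \<le> k \<Longrightarrow> mps_coeff (lin v x) {#v k#} = x k"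
proof -
  assume "inj v" "1 \<le> k"
  then have "{j. 1 \<le> j \<and> {#v k#} = {#v j#}} = {k}" by (auto simp: inj_def)
  then show ?thesis by (simp add: lin_def Abs_mps_inverse)
qed

lemma lin_coeff_0: "(\<And>k. 1 \<le> k \<Longrightarrow> M \<noteq> {#v k#}) \<Longrightarrow> mps_coeff (lin v x) M = 0"
proof -
  assume "\<And>k. 1 \<le> k \<Longrightarrow> M \<noteq> {#v k#}"
  then have "{k. 1 \<le> k \<and> M = {#v k#}} = {}" by auto
  then show ?thesis by (simp only: lin_def Abs_mps_inverse UNIV_I infsum_empty)
qed

lemma low_lin: "low 1 (lin v x)"
  unfolding low_def by (auto intro!: lin_coeff_0)

lemma lin_eqI:
  assumes v: "inj v" and "\<And>k. 1 \<le> k \<Longrightarrow> mps_coeff f {#v k#} = x k"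
    and "\<And>M. (\<And>k. 1 \<le> k \<Longrightarrow> M \<noteq> {#v k#}) \<Longrightarrow> mps_coeff f M = 0"
  shows "f = lin v x"
proof (rule mps_eqI)
  fix M
  show "mps_coeff f M = mps_coeff (lin v x) M"
  proof (cases "\<exists>k\<ge>1. M = {#v k#}")
    case True
    then show ?thesis using assms(2) lin_coeff_var[OF v] by auto
  next
    case False
    then have "\<And>k. 1 \<le> k \<Longrightarrow> M \<noteq> {#v k#}" by blast
    then show ?thesis using assms(3)[of M] lin_coeff_0[of M v x] by simp
  qed
qed

lemma has_sum_lin:
  assumes v: "inj v" and f: "\<And>k. 1 \<le> k \<Longrightarrow> f (g k) = mps_const (x k) * mps_var (v k)"
    and z: "\<And>n. n \<in> A \<Longrightarrow> n \<notin> g ` {1..} \<Longrightarrow> f n = 0" and g: "inj_on g {1..}" "g ` {1..} \<subseteq> A"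
  shows "((\<lambda>n. mps_coeff (f n) M) has_sum mps_coeff (lin v x) M) A"
proof (cases "\<exists>k\<ge>1. M = {#v k#}")
    case True
    then obtain k where k: "1 \<le> k" "M = {#v k#}" by auto
    have "((\<lambda>n. mps_coeff (f n) M) has_sum (\<Sum>n\<in>{g k}. mps_coeff (f n) M)) A"
    proof (rule fin_has_sum)
      fix n assume n: "n \<in> A" "n \<notin> {g k}"
      show "mps_coeff (f n) M = 0"
      proof (cases "n \<in> g ` {1..}")
        case True
        then obtain j where "1 \<le> j" "n = g j" "j \<noteq> k" using n by auto
        then show ?thesis using v by (auto simp: f coeff_const_mult coeff_var k inj_def)
      qed (use z n coeff_zero in auto)
    qed (use g k in auto)
    then show ?thesis using k f[OF k(1)] lin_coeff_var[OF v k(1), of x] by (simp add: coeff_const_mult coeff_var)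
  next
    case False
    have "mps_coeff (f n) M = 0" if n: "n \<in> A" for n
    proof (cases "n \<in> g ` {1..}")
      case True
      then show ?thesis using False by (auto simp: f coeff_const_mult coeff_var)
    qed (use z n coeff_zero in auto)
    moreover have "mps_coeff (lin v x) M = 0" by (rule lin_coeff_0) (use False in auto)
    ultimately show ?thesis by (simp add: has_sum_0)
  qed

lemma infsum_lin:
  assumes "inj v" "\<And>k. 1 \<le> k \<Longrightarrow> f (g k) = mps_const (x k) * mps_var (v k)"
    and "\<And>n. n \<in> A \<Longrightarrow> n \<notin> g ` {1..} \<Longrightarrow> f n = 0" "inj_on g {1..}" "g ` {1..} \<subseteq> A"
  shows "infsum f A = lin v x"
  by (rule infsumI, rule mps_has_sumI, rule has_sum_lin[where g = g]) (use assms in auto)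

lemma lin_add: "inj v \<Longrightarrow> lin v x + lin v y = lin v (\<lambda>k. x k + y k)"
  by (rule lin_eqI) (simp_all add: coeff_add lin_coeff_var lin_coeff_0)

lemma lin_cong: "inj v \<Longrightarrow> (\<And>k. 1 \<le> k \<Longrightarrow> x k = y k) \<Longrightarrow> lin v x = lin v y"
  by (rule lin_eqI) (simp_all add: lin_coeff_var lin_coeff_0)

section \<open>The partition function as a matrix element\<close>

lemma spread_sum:
  assumes v: "inj v" and a: "1 \<le> a"
  shows "(\<Sum>\<^sub>\<infinity>n\<in>{1..}. spread a (\<lambda>k. mps_const (\<tau> k) * mps_var (v k)) n * mps_const (y n)) = lin v (\<lambda>k. \<tau> k * y (a * k))"
proof (rule infsum_lin[OF v, where g = "\<lambda>k. a * k"])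
  show "spread a (\<lambda>k. mps_const (\<tau> k) * mps_var (v k)) (a * k) * mps_const (y (a * k)) = mps_const (\<tau> k * y (a * k)) * mps_var (v k)"
    if "1 \<le> k" for k using a by (simp add: spread_def const_mult mult_ac)
  show "spread a (\<lambda>k. mps_const (\<tau> k) * mps_var (v k)) n * mps_const (y n) = 0" if n: "n \<in> {1..}" "n \<notin> (\<lambda>k. a * k) ` {1..}" for n
  proof -
    have "\<not> a dvd n"
    proof
      assume "a dvd n"
      then obtain m where m: "n = a * m" by auto
      then have "1 \<le> m" using n(1) by (cases m) auto
      then show False using n(2) m by auto
    qed
    then show ?thesis by (simp add: spread_def)
  qed
  show "(\<lambda>k. a * k) ` {1..} \<subseteq> {1..}" using a by (auto simp: Suc_le_eq)
qed (use a in \<open>auto simp: inj_on_def\<close>)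

lemma var_sum:
  assumes "inj v" shows "(\<Sum>\<^sub>\<infinity>k\<in>{1..}. mps_var (v k) * mps_const (x k)) = lin v x"
  by (rule infsum_lin[OF assms, where g = "\<lambda>k. k"]) (auto simp: mult.commute)

definition LJ :: "(nat \<Rightarrow> 'v) \<Rightarrow> (nat \<Rightarrow> complex) \<Rightarrow> nat \<Rightarrow> 'v mps fop"
  where "LJ v \<tau> a U V = lin v (\<lambda>k. \<tau> k * J (int (a * k)) U V)"

lemma finite_J: "finite {W \<in> maya. J k U W \<noteq> 0}"
proof (rule finite_subset[OF _ finite_en])
  have "en W \<le> en U + k" if "J k U W \<noteq> 0" for W
    using that ent_Jc_0[of W U k] by (cases "en W - en U = k") (auto simp: J_eq)
  then show "{W \<in> maya. J k U W \<noteq> 0} \<subseteq> {W \<in> maya. en W \<le> en U + k}" by auto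
qed

lemma rfin_LJ: assumes v: "inj v" shows "rfin (LJ v \<tau> a)"
  unfolding rfin_def
proof (intro allI)
  fix U M
  show "finite {W \<in> maya. mps_coeff (LJ v \<tau> a U W) M \<noteq> 0}"
  proof (cases "\<exists>k\<ge>1. M = {#v k#}")
    case True
    then obtain k where k: "1 \<le> k" "M = {#v k#}" by auto
    have "{W \<in> maya. mps_coeff (LJ v \<tau> a U W) M \<noteq> 0} \<subseteq> {W \<in> maya. J (int (a * k)) U W \<noteq> 0}"
      unfolding k(2) LJ_def lin_coeff_var[OF v k(1)] by auto
    then show ?thesis using finite_J finite_subset by blast
  next
    case False
    then have "mps_coeff (LJ v \<tau> a U W) M = 0" for W unfolding LJ_def by (intro lin_coeff_0) auto
    then show ?thesis by simp
  qed
qed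

lemma low_LJ: "low 1 (LJ v \<tau> a U V)" unfolding LJ_def by (rule low_lin)

lemma LJ_maya:
  assumes v: "inj v" and "LJ v \<tau> a U V \<noteq> 0" shows "U \<in> maya \<and> V \<in> maya"
proof (rule ccontr)
  assume "\<not> (U \<in> maya \<and> V \<in> maya)"
  then have J: "J k U V = 0" for k unfolding J_eq using ent_maya by blast
  have "0 = lin v (\<lambda>k. \<tau> k * J (int (a * k)) U V)" by (rule lin_eqI[OF v]) (simp_all add: coeff_zero J)
  then show False using assms(2) by (simp add: LJ_def)
qed

lemma LJ_intertwine:
  fixes X :: "complex fop" and v :: "nat \<Rightarrow> 'v"
  assumes v: "inj v" and y: "\<And>k. 1 \<le> k \<Longrightarrow> \<tau> k * op_mult (J (int (a * k))) X U V = X U V * y k"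
  shows "op_mult (LJ v \<tau> a) (\<lambda>U V. mps_const (X U V)) U V = mps_const (X U V) * lin v y"
proof (rule mps_eqI)
  fix M :: "'v multiset"
  show "mps_coeff (op_mult (LJ v \<tau> a) (\<lambda>U V. mps_const (X U V)) U V) M = mps_coeff (mps_const (X U V) * lin v y) M"
  proof (cases "\<exists>k\<ge>1. M = {#v k#}")
    case True
    then obtain k where k: "1 \<le> k" "M = {#v k#}" by auto
    define S where "S = rset (LJ v \<tau> a) U M \<union> {W \<in> maya. J (int (a * k)) U W \<noteq> 0}"
    have S: "finite S" "S \<subseteq> maya" unfolding S_def
      using finite_rset[OF rfin_LJ[OF v]] finite_J by (auto dest: subsetD[OF rset_maya])
    have "mps_coeff (op_mult (LJ v \<tau> a) (\<lambda>U V. mps_const (X U V)) U V) M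
        = mps_coeff (\<Sum>W\<in>S. LJ v \<tau> a U W * mps_const (X W V)) M"
      by (rule op_mult_coeff[OF rfin_LJ[OF v] S]) (simp add: S_def)
    also have "\<dots> = (\<Sum>W\<in>S. \<tau> k * (J (int (a * k)) U W * X W V))"
      unfolding coeff_sum mult.commute[of _ "mps_const _"] coeff_const_mult
      by (simp add: k(2) LJ_def lin_coeff_var[OF v k(1)] mult_ac)
    also have "\<dots> = \<tau> k * op_mult (J (int (a * k))) X U V"
      unfolding sum_distrib_left[symmetric]
      by (subst op_mult_finite[OF S]) (auto simp: S_def)
    also have "\<dots> = mps_coeff (mps_const (X U V) * lin v y) M"
      unfolding y[OF k(1)] by (simp add: k(2) coeff_const_mult lin_coeff_var[OF v k(1)])
    finally show ?thesis .
  next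
    case False
    then have z: "mps_coeff (lin v x) M = 0" for x by (intro lin_coeff_0) auto
    have "mps_coeff (op_mult (LJ v \<tau> a) (\<lambda>U V. mps_const (X U V)) U V) M
        = mps_coeff (\<Sum>W\<in>rset (LJ v \<tau> a) U M. LJ v \<tau> a U W * mps_const (X W V)) M"
      by (rule op_mult_coeff[OF rfin_LJ[OF v] finite_rset[OF rfin_LJ[OF v]] rset_maya subset_refl])
    also have "\<dots> = 0"
      unfolding coeff_sum mult.commute[of _ "mps_const _"] coeff_const_mult by (simp add: LJ_def z)
    finally show ?thesis by (simp add: coeff_const_mult z)
  qed
qed

lemma op_exp_LJ:
  fixes X :: "complex fop" and v :: "nat \<Rightarrow> 'v"
  assumes v: "inj v" and U: "U \<in> maya"
    and y: "\<And>U k. U \<in> maya \<Longrightarrow> 1 \<le> k \<Longrightarrow> \<tau> k * op_mult (J (int (a * k))) X U V = X U V * y k"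
  shows "op_mult (op_exp (LJ v \<tau> a)) (\<lambda>U V. mps_const (X U V)) U V = mps_const (X U V) * mps_exp (lin v y)"
  by (rule op_exp_intertwine[OF rfin_LJ[OF v] low_LJ low_lin _ U]) (rule LJ_intertwine[OF v y])

lemma tau_has_sum:
  fixes A B :: "'v mps fop" and L R g :: "complex fop"
  assumes A: "rfin A" and B: "rfin B" and Vm: "V \<in> maya"
    and g: "\<And>U W. U \<in> maya \<Longrightarrow> W \<in> maya \<Longrightarrow> ((\<lambda>Y. L U Y * R Y W) has_sum g U W) maya"
  shows "((\<lambda>Y. mps_coeff (op_mult A (\<lambda>U Y. mps_const (L U Y)) V Y * op_mult B (\<lambda>W Y. mps_const (R Y W)) V Y) M)
     has_sum mps_coeff (op_prod [A, \<lambda>U W. mps_const (g U W), tr B] V V) M) maya"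
proof -
  define S1 where "S1 = rset A V M"
  define S2 where "S2 = rset B V M"
  have S1: "finite S1" "S1 \<subseteq> maya" and S2: "finite S2" "S2 \<subseteq> maya"
    unfolding S1_def S2_def using finite_rset A B rset_maya by blast+
  define c where "c U W = mps_coeff (A V U * B V W) M" for U W
  let ?G = "\<lambda>U W. mps_const (g U W)"
  have "((\<lambda>Y. \<Sum>U\<in>S1. \<Sum>W\<in>S2. c U W * (L U Y * R Y W)) has_sum (\<Sum>U\<in>S1. \<Sum>W\<in>S2. c U W * g U W)) maya"
    by (intro has_sum_finite_sum S1(1) S2(1) has_sum_cmult_right g) (use S1 S2 in auto)
  moreover have "(\<Sum>U\<in>S1. \<Sum>W\<in>S2. c U W * (L U Y * R Y W))
      = mps_coeff (op_mult A (\<lambda>U Y. mps_const (L U Y)) V Y * op_mult B (\<lambda>W Y. mps_const (R Y W)) V Y) M" for Y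
  proof -
    have "mps_coeff (op_mult A (\<lambda>U Y. mps_const (L U Y)) V Y * op_mult B (\<lambda>W Y. mps_const (R Y W)) V Y) M
        = mps_coeff ((\<Sum>U\<in>S1. A V U * mps_const (L U Y)) * (\<Sum>W\<in>S2. B V W * mps_const (R Y W))) M"
      by (rule coeff_mult_cong; rule op_mult_coeff)
         (use A B S1 S2 in \<open>auto simp: S1_def S2_def intro: rset_mono[THEN subsetD]\<close>)
    also have "(\<Sum>U\<in>S1. A V U * mps_const (L U Y)) * (\<Sum>W\<in>S2. B V W * mps_const (R Y W))
        = (\<Sum>U\<in>S1. \<Sum>W\<in>S2. mps_const (L U Y * R Y W) * (A V U * B V W))"
      by (simp add: sum_product const_mult mult_ac)
    finally show ?thesis unfolding coeff_sum coeff_const_mult c_def by (simp only: mult_ac)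
  qed
  moreover have "mps_coeff (op_prod [A, ?G, tr B] V V) M = (\<Sum>U\<in>S1. \<Sum>W\<in>S2. c U W * g U W)"
  proof -
    have GB: "op_mult ?G (op_mult (tr B) op_id) U V = op_mult B (tr ?G) V U" for U
    proof -
      have "op_mult (tr B) op_id W V = B V W" for W using op_mult_id_right[OF Vm, of "tr B" W] by (simp add: tr_def)
      then show ?thesis unfolding op_mult_def by (simp add: tr_def mult.commute)
    qed
    have "mps_coeff (op_prod [A, ?G, tr B] V V) M = mps_coeff (\<Sum>U\<in>S1. A V U * op_mult B (tr ?G) V U) M"
      unfolding op_prod_Cons op_prod_Nil GB[symmetric] by (rule op_mult_coeff[OF A S1]) (simp add: S1_def)
    also have "\<dots> = mps_coeff (\<Sum>U\<in>S1. A V U * (\<Sum>W\<in>S2. B V W * mps_const (g U W))) M"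
      unfolding coeff_sum[of _ S1]
    proof (intro sum.cong refl coeff_mult_cong)
      fix U N assume "N \<subseteq># M"
      then have "mps_coeff (op_mult B (tr ?G) V U) N = mps_coeff (\<Sum>W\<in>S2. B V W * tr ?G W U) N"
        by (intro op_mult_coeff[OF B S2]) (simp add: S2_def rset_mono)
      then show "mps_coeff (op_mult B (tr ?G) V U) N = mps_coeff (\<Sum>W\<in>S2. B V W * mps_const (g U W)) N"
        by (simp add: tr_def)
    qed
    also have "(\<Sum>U\<in>S1. A V U * (\<Sum>W\<in>S2. B V W * mps_const (g U W)))
        = (\<Sum>U\<in>S1. \<Sum>W\<in>S2. mps_const (g U W) * (A V U * B V W))"
      by (simp add: sum_distrib_left mult_ac)
    finally show ?thesis unfolding coeff_sum coeff_const_mult c_def by (simp only: mult_ac)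
  qed
  ultimately show ?thesis by (simp only:)
qed

lemma op_exp_minus_LJ:
  assumes v: "inj v" and b: "1 \<le> b"
  shows "op_exp (\<lambda>U V. - (\<Sum>\<^sub>\<infinity>k\<in>{1..}. - spread b (\<lambda>k. mps_const (\<tau> k) * mps_var (v k)) k * mps_const (J (- int k) U V)))
    = tr (op_exp (LJ v \<tau> b))"
proof -
  have "(\<lambda>U V. - (\<Sum>\<^sub>\<infinity>k\<in>{1..}. - spread b (\<lambda>k. mps_const (\<tau> k) * mps_var (v k)) k * mps_const (J (- int k) U V))) = tr (LJ v \<tau> b)"
  proof (intro ext)
    fix U V
    have J: "J (- int n) U V = J (int n) V U" for n by (simp add: J_neg_tr tr_def)
    have "(- (\<Sum>\<^sub>\<infinity>k\<in>{1..}. - spread b (\<lambda>k. mps_const (\<tau> k) * mps_var (v k)) k * mps_const (J (- int k) U V)))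
        = - lin v (\<lambda>k. - \<tau> k * J (int (b * k)) V U)"
    proof -
      have "- spread b (\<lambda>k. mps_const (\<tau> k) * mps_var (v k)) n * mps_const (J (- int n) U V)
        = spread b (\<lambda>k. mps_const (- \<tau> k) * mps_var (v k)) n * mps_const (J (int n) V U)" for n
        unfolding J spread_def by (auto intro!: mps_eqI simp: mult.assoc coeff_minus coeff_const_mult mult.commute[of _ "mps_const (J _ _ _)"])
      then show ?thesis using spread_sum[OF v b, of "\<lambda>k. - \<tau> k" "\<lambda>n. J (int n) V U"] by simp
    qed
    also have "\<dots> = lin v (\<lambda>k. \<tau> k * J (int (b * k)) V U)"
      by (rule lin_eqI[OF v]) (simp_all add: coeff_minus lin_coeff_var[OF v] lin_coeff_0)
    finally show "(- (\<Sum>\<^sub>\<infinity>k\<in>{1..}. - spread b (\<lambda>k. mps_const (\<tau> k) * mps_var (v k)) k * mps_const (J (- int k) U V))) = tr (LJ v \<tau> b) U V"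
      by (simp add: tr_def LJ_def)
  qed
  then show ?thesis using op_exp_tr_mps[OF rfin_LJ[OF v] LJ_maya[OF v]] by simp
qed

section \<open>Energies and weights\<close>

lemma en_ground: "en (ground s) = s * (s + 1) div 2"
  unfolding en_def
proof (rule wt_ground)
  fix s :: int
  have "s * (s + 1) = (s - 1) * (s - 1 + 1) + s * 2" by (simp add: algebra_simps)
  then show "s * (s + 1) div 2 = (s - 1) * (s - 1 + 1) div 2 + - (- s)" by simp
qed simp

lemma w0_ground: "w0 (ground s) = of_int (s * (s + 1) * (2 * s + 1)) / 6"
  unfolding w0_def by (rule wt_ground) (simp_all add: power2_eq_square field_simps)

lemma Phi_wt:
  assumes q: "q \<noteq> 0" "q powi k \<noteq> 1" and \<mu>: "\<mu> \<in> partitions"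
  shows "Phi q k \<mu> s = wt (\<lambda>p. q powi (- k * p)) (mayaP s \<mu>)"
proof -
  obtain n where n: "\<And>i. n \<le> i \<Longrightarrow> \<mu> i = 0" using partitions_bound[OF \<mu>] by blast
  let ?h = "\<lambda>i. q powi (k * (int (\<mu> (i - 1)) + s - int i + 1)) - q powi (k * (s - int i + 1))"
  have "(\<Sum>\<^sub>\<infinity>i\<in>{1..}. ?h i) = sum ?h {1..n}"
  proof (rule infsumI, rule fin_has_sum)
    show "?h i = 0" if "i \<in> {1..}" "i \<notin> {1..n}" for i
    proof -
      have "\<mu> (i - 1) = 0" by (rule n) (use that in auto)
      then show ?thesis by simp
    qed
  qed auto
  also have "\<dots> = (\<Sum>i<n. q powi (- k * (int i - s - int (\<mu> i))) - q powi (- k * (int i - s)))"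
    by (rule sum.reindex_bij_witness[where i=Suc and j="\<lambda>i. i - 1"]) (auto simp: algebra_simps of_nat_diff)
  moreover have "wt (\<lambda>p. q powi (- k * p)) (ground s) = (1 - q powi (k * s)) / (1 - q powi k) * q powi k"
  proof (rule wt_ground)
    fix s :: int
    have "q powi (k * (s - 1)) * q powi k = q powi (k * s)"
      using q by (simp add: power_int_add[symmetric] algebra_simps)
    then have "(1 - q powi (k * (s - 1))) * q powi k + (1 - q powi k) * q powi (k * s) = (1 - q powi (k * s)) * q powi k"
      by (simp add: algebra_simps)
    then show "(1 - q powi (k * s)) / (1 - q powi k) * q powi k = (1 - q powi (k * (s - 1))) / (1 - q powi k) * q powi k + q powi (- k * - s)"
      using q by (simp add: field_simps)
  qed simp
  ultimately show ?thesis
    unfolding Phi_def by (subst wt_mayaP[OF \<mu> n]) simp_all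
qed

lemma prod_cl_upt:
  assumes "1 \<le> a" shows "prod_list (cl (map P [1..<a])) = (\<Prod>k\<in>{1..<a}. P k ^ k)"
proof -
  have "prod_list (cl (map P [1..<a])) = (\<Prod>j\<in>{1..<Suc a}. \<Prod>k\<in>{j..<a}. P k)"
    unfolding cl_upt[OF assms] by (rule prod_list_upt) simp
  also have "\<dots> = (\<Prod>k\<in>{1..<a}. P k ^ k)"
    using assms
  proof (induction a rule: dec_induct)
    case (step a)
    have "(\<Prod>j\<in>{1..<Suc (Suc a)}. \<Prod>k\<in>{j..<Suc a}. P k) = (\<Prod>j\<in>{1..<Suc a}. (\<Prod>k\<in>{j..<a}. P k) * P a)"
      by (auto simp: prod.atLeastLessThan_Suc intro!: prod.cong)
    also have "\<dots> = (\<Prod>k\<in>{1..<Suc a}. P k ^ k)"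
      unfolding prod.distrib step.IH using step.hyps by (simp add: prod.atLeastLessThan_Suc)
    finally show ?case .
  qed simp
  finally show ?thesis .
qed

lemma prod_cl_rev:
  assumes "1 \<le> b" shows "prod_list (cl (map R (rev [1..<b]))) = (\<Prod>k\<in>{1..<b}. R k ^ (b - k))"
proof -
  have "prod_list (cl (map R (rev [1..<b]))) = (\<Prod>j\<in>{1..<Suc b}. \<Prod>k\<in>{1..<j}. R k)"
    unfolding cl_rev[OF assms] by (rule prod_list_rev_upt)
  also have "\<dots> = (\<Prod>k\<in>{1..<b}. R k ^ (b - k))"
    using assms
  proof (induction b rule: dec_induct)
    case (step b)
    have "(\<Prod>j\<in>{1..<Suc (Suc b)}. \<Prod>k\<in>{1..<j}. R k) = (\<Prod>k\<in>{1..<b}. R k ^ (b - k)) * (\<Prod>k\<in>{1..<Suc b}. R k)"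
      using step.hyps by (simp only: prod.atLeastLessThan_Suc[of 1 "Suc b"] step.IH)
    also have "\<dots> = (\<Prod>k\<in>{1..<b}. R k ^ (b - k) * R k) * R b"
      using step.hyps by (simp add: prod.atLeastLessThan_Suc prod.distrib)
    also have "(\<Prod>k\<in>{1..<b}. R k ^ (b - k) * R k) = (\<Prod>k\<in>{1..<b}. R k ^ (Suc b - k))"
      by (rule prod.cong[OF refl]) (auto simp: Suc_diff_le)
    finally show ?case using step.hyps by (simp add: prod.atLeastLessThan_Suc)
  qed simp
  finally show ?thesis .
qed

lemma NF_ground_left: "NF c d r (ground s) V = r ^ nat (en (ground s)) * ent (E c) (ground s) V"
proof -
  have "NF c d r (ground s) V = (\<Sum>Z\<in>{ground s}. ent (E d) Z (ground s) * r ^ nat (en Z) * ent (E c) Z V)"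
    unfolding NF_alt by (rule sum.mono_neutral_right) (auto simp: finite_en ground_maya E_ground op_id_def)
  then show ?thesis by (simp add: E_ground op_id_def ground_maya)
qed

lemma NF_ground_right: "NF c d r U (ground s) = ent (E d) (ground s) U * r ^ nat (en (ground s))"
proof -
  have "NF c d r U (ground s) = (\<Sum>Z\<in>{ground s}. ent (E d) Z U * r ^ nat (en Z) * ent (E c) Z (ground s))"
    unfolding NF_def by (rule sum.mono_neutral_right) (auto simp: finite_en ground_maya E_ground op_id_def)
  then show ?thesis by (simp add: E_ground op_id_def ground_maya)
qed

lemma XL_schur:
  assumes q: "norm (exp lq) < 1" and a: "1 \<le> a" and \<mu>: "\<mu> \<in> partitions"
  shows "XL lq (map P [1..<a]) a (ground s) (mayaP s \<mu>) = exp (lq / (2 * of_nat a) * w0 (ground s)) * kk (exp lq) (map P [1..<a])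
    * ((\<Prod>i\<in>{1..<a}. P i) ^ nat (en (ground s)) * schur \<mu> (seq_union a (normalized a P) (q_rho lq)))"
proof -
  have "sp (pp (q_rho lq)) (cl (map P [1..<a])) = pp (seq_union a (normalized a P) (q_rho lq))"
    unfolding pp_seq_union[OF a summable_q_rho[OF q]] cl_upt[OF a] normalized_def ..
  then show ?thesis
    unfolding XL_def NF_ground_left prod_list_upt[OF a]
    by (simp only: schur_E[OF \<mu> summable_seq_union[OF a summable_q_rho[OF q]], of _ s])
qed

lemma XR_schur:
  assumes q: "norm (exp lq) < 1" and b: "1 \<le> b" and \<mu>: "\<mu> \<in> partitions"
  shows "XR lq (map R (rev [1..<b])) b (mayaP s \<mu>) (ground s) = kk (exp lq) (map R (rev [1..<b]))
    * (schur (conjugate \<mu>) (seq_union b (normalized b R) (q_rho lq)) * (\<Prod>i\<in>{1..<b}. R i) ^ nat (en (ground s)))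
    * exp (- lq / (2 * of_nat b) * w0 (ground s))"
proof -
  have "sp (pm (q_rho lq)) (dl (map R (rev [1..<b]))) = pm (seq_union b (normalized b R) (q_rho lq))"
    unfolding pm_def pp_seq_union[OF b summable_q_rho[OF q]] dl_rev[OF b] normalized_def tw_sp sp_rev ..
  then show ?thesis
    unfolding XR_def NF_ground_right prod_list_rev_upt
    by (simp only: schur_conjugate_E[OF \<mu> summable_seq_union[OF b summable_q_rho[OF q]], of _ s])
qed

lemma NF_charge: "NF c d r U V \<noteq> 0 \<Longrightarrow> charge U = charge V"
  unfolding NF_def by (drule sum_nonzeroD) (auto dest!: charge_E)

lemma XL_charge: "XL lq ps a (ground s) Y \<noteq> 0 \<Longrightarrow> charge Y = s"
  using NF_charge[of _ _ _ "ground s" Y] charge_mayaP[of "\<lambda>_. 0" s]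
  by (force simp: XL_def mayaP_0 zero_partition)

lemma bij_mayaP: "bij_betw (mayaP s) partitions {V \<in> maya. charge V = s}"
  unfolding bij_betw_def
proof
  show "inj_on (mayaP s) partitions" using mayaP_inj by (auto simp: inj_on_def)
  show "mayaP s ` partitions = {V \<in> maya. charge V = s}"
  proof (intro set_eqI iffI)
    fix V assume "V \<in> {V \<in> maya. charge V = s}"
    then show "V \<in> mayaP s ` partitions" using maya_charge_mayaP by blast
  qed (auto simp: mayaP_maya charge_mayaP)
qed

lemma cancel: "x * y = z \<Longrightarrow> x \<noteq> 0 \<Longrightarrow> y \<noteq> 0 \<Longrightarrow> inverse x * (z / y) = 1" for x y z :: complex
  by auto

lemma XL_intertwine:
  assumes q: "norm (exp lq) < 1" and a: "1 \<le> a" and P: "\<And>i. 1 \<le> i \<Longrightarrow> i < a \<Longrightarrow> P i \<noteq> 0" and k: "1 \<le> k"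
    and U: "U \<in> maya" and V: "V \<in> maya"
  shows "(-1) ^ (a * k) * (\<Prod>i\<in>{1..<a}. P i powi (- (int (a - i) * int k))) * op_mult (J (int (a * k))) (XL lq (map P [1..<a]) a) U V
    = XL lq (map P [1..<a]) a U V * Ph (exp lq) (int k) V"
proof -
  let ?ps = "map P [1..<a]" and ?s = "(-1 :: complex) ^ (a * k)"
  have ps: "0 \<notin> set ?ps" using P by auto
  have len: "a = Suc (length ?ps)" using a by simp
  have "(\<Prod>i\<in>{1..<a}. P i powi (- (int (a - i) * int k))) * (prod_list ?ps ^ (a * k) / prod_list (cl ?ps) ^ k)
      = (\<Prod>i\<in>{1..<a}. P i powi (- (int (a - i) * int k)) * (P i ^ (a * k) / (P i ^ i) ^ k))"
    by (simp only: prod_list_upt[OF a] prod_cl_upt[OF a] prod.distrib prod_dividef prod_power_distrib)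
  also have "\<dots> = 1"
  proof (rule prod.neutral, rule ballI)
    fix i assume i: "i \<in> {1..<a}"
    have "P i powi (int (a - i) * int k) * (P i ^ i) ^ k = P i ^ ((a - i) * k + i * k)"
      by (simp add: power_mult[symmetric] power_add of_nat_mult[symmetric] del: of_nat_mult)
    also have "(a - i) * k + i * k = a * k" using i by (simp add: distrib_right[symmetric])
    finally have "P i powi (int (a - i) * int k) * (P i ^ i) ^ k = P i ^ (a * k)" .
    then show "P i powi (- (int (a - i) * int k)) * (P i ^ (a * k) / (P i ^ i) ^ k) = 1"
      unfolding power_int_minus by (rule cancel) (use P[of i] i in auto)
  qed
  finally have 1: "(\<Prod>i\<in>{1..<a}. P i powi (- (int (a - i) * int k))) * (prod_list ?ps ^ (a * k) / prod_list (cl ?ps) ^ k) = 1" .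
  have 2: "?s * ?s = 1" by (simp add: power_mult_distrib[symmetric])
  have "?s * (\<Prod>i\<in>{1..<a}. P i powi (- (int (a - i) * int k))) * op_mult (J (int (a * k))) (XL lq ?ps a) U V
      = (?s * ?s) * ((\<Prod>i\<in>{1..<a}. P i powi (- (int (a - i) * int k))) * (prod_list ?ps ^ (a * k) / prod_list (cl ?ps) ^ k))
        * (XL lq ?ps a U V * Ph (exp lq) (int k) V)"
    unfolding J_XL[OF q ps len k U V] by simp
  then show ?thesis unfolding 1 2 by simp
qed

lemma XR_intertwine:
  assumes q: "norm (exp lq) < 1" and b: "1 \<le> b" and R: "\<And>i. 1 \<le> i \<Longrightarrow> i < b \<Longrightarrow> R i \<noteq> 0" and k: "1 \<le> k"
    and U: "U \<in> maya" and V: "V \<in> maya"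
  shows "(\<Prod>i\<in>{1..<b}. R i powi (- (int (b - i) * int k))) * op_mult (XR lq (map R (rev [1..<b])) b) (J (- int (b * k))) U V
    = XR lq (map R (rev [1..<b])) b U V * Ph (exp lq) (- int k) U"
proof -
  let ?ps = "map R (rev [1..<b])"
  have ps: "0 \<notin> set ?ps" using R by auto
  have len: "b = Suc (length ?ps)" using b by simp
  have "(\<Prod>i\<in>{1..<b}. R i powi (- (int (b - i) * int k))) * prod_list (cl ?ps) ^ k
      = (\<Prod>i\<in>{1..<b}. R i powi (- (int (b - i) * int k)) * (R i ^ (b - i)) ^ k)"
    by (simp only: prod_cl_rev[OF b] prod.distrib prod_power_distrib)
  also have "\<dots> = 1"
  proof (rule prod.neutral, rule ballI)
    fix i assume i: "i \<in> {1..<b}"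
    have "R i powi (int (b - i) * int k) = (R i ^ (b - i)) ^ k"
      by (simp add: power_mult[symmetric] of_nat_mult[symmetric] del: of_nat_mult)
    then show "R i powi (- (int (b - i) * int k)) * (R i ^ (b - i)) ^ k = 1"
      unfolding power_int_minus using R[of i] i by (metis left_inverse power_not_zero atLeastLessThan_iff)
  qed
  finally have 1: "(\<Prod>i\<in>{1..<b}. R i powi (- (int (b - i) * int k))) * prod_list (cl ?ps) ^ k = 1" .
  have "(\<Prod>i\<in>{1..<b}. R i powi (- (int (b - i) * int k))) * op_mult (XR lq ?ps b) (J (- int (b * k))) U V
      = (\<Prod>i\<in>{1..<b}. R i powi (- (int (b - i) * int k))) * prod_list (cl ?ps) ^ k * (XR lq ?ps b U V * Ph (exp lq) (- int k) U)"
    unfolding XR_J[OF q ps len k U V] by simp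
  then show ?thesis unfolding 1 by simp
qed

lemma XR_intertwine_tr:
  fixes z :: "int set \<Rightarrow> complex"
  assumes q: "norm (exp lq) < 1" and b: "1 \<le> b" and R: "\<And>i. 1 \<le> i \<Longrightarrow> i < b \<Longrightarrow> R i \<noteq> 0" and k: "1 \<le> k"
    and W: "W \<in> maya" and Y: "Y \<in> maya"
  defines "X \<equiv> \<lambda>W Y. z Y * XR lq (map R (rev [1..<b])) b Y W"
  shows "(\<Prod>i\<in>{1..<b}. R i powi (- (int (b - i) * int k))) * op_mult (J (int (b * k))) X W Y = X W Y * Ph (exp lq) (- int k) Y"
proof -
  have "op_mult (J (int (b * k))) X W Y = (\<Sum>\<^sub>\<infinity>U\<in>maya. z Y * (XR lq (map R (rev [1..<b])) b Y U * J (- int (b * k)) U W))"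
    unfolding op_mult_def J_neg_tr by (simp add: X_def tr_def mult_ac)
  also have "\<dots> = z Y * op_mult (XR lq (map R (rev [1..<b])) b) (J (- int (b * k))) Y W"
    unfolding op_mult_def by (rule infsum_cmult_right')
  finally have J: "op_mult (J (int (b * k))) X W Y = z Y * op_mult (XR lq (map R (rev [1..<b])) b) (J (- int (b * k))) Y W" .
  have "(\<Prod>i\<in>{1..<b}. R i powi (- (int (b - i) * int k))) * op_mult (XR lq (map R (rev [1..<b])) b) (J (- int (b * k))) Y W
      = XR lq (map R (rev [1..<b])) b Y W * Ph (exp lq) (- int k) Y"
    by (rule XR_intertwine) (use assms in auto)
  then show ?thesis unfolding J mult.left_commute[of _ "z Y"] by (simp only: X_def mult.assoc)
qed

lemma exp_w0_cancel:
  assumes "1 \<le> a" "1 \<le> b"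
  shows "exp (- of_int (s * (s + 1) * (2 * s + 1)) * (1 / (12 * of_nat a) - 1 / (12 * of_nat b)) * lq)
    * (exp (lq / (2 * of_nat a) * w0 (ground s)) * exp (- lq / (2 * of_nat b) * w0 (ground s))) = 1"
proof -
  have "- of_int (s * (s + 1) * (2 * s + 1)) * (1 / (12 * of_nat a) - 1 / (12 * of_nat b)) * lq
    + (lq / (2 * of_nat a) * w0 (ground s) + - lq / (2 * of_nat b) * w0 (ground s)) = 0"
    unfolding w0_ground using assms by (simp add: field_simps del: of_int_mult of_int_add)
  then show ?thesis by (simp only: exp_add[symmetric] exp_zero)
qed

lemma powi_nat_cancel: "x \<noteq> 0 \<Longrightarrow> 0 \<le> n \<Longrightarrow> x powi (- n) * x ^ nat n = 1" for x :: complex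
  by (simp add: power_int_def power_inverse)

lemma inverse_MacMahon:
  assumes "norm q < 1" "q \<noteq> 0" "\<And>i j. 1 \<le> i \<Longrightarrow> i \<le> j \<Longrightarrow> j < a \<Longrightarrow> norm ((\<Prod>k=i..j. P k) * q) < 1"
  shows "(\<Prod>(i, j)\<in>{(i, j). 1 \<le> i \<and> i \<le> j \<and> j < a}. inverse (MacMahon (\<Prod>k=i..j. P k) q))
    * (\<Prod>(i, j)\<in>{(i, j). 1 \<le> i \<and> i \<le> j \<and> j < (a :: nat)}. MacMahon (\<Prod>k=i..j. P k) q) = 1"
  unfolding prod.distrib[symmetric]
  by (rule prod.neutral) (use exs_MacMahon(2)[OF assms(1,2) assms(3)] in auto)

theorem theorem2:
  fixes a b :: nat and s :: int and q lq Q :: complex and P R :: "nat \<Rightarrow> complex"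
  assumes "a \<ge> 1" and "b \<ge> 1"
    and "exp lq = q" and "norm q < 1" and "Q \<noteq> 0"
    and "\<And>i. 1 \<le> i \<Longrightarrow> i < a \<Longrightarrow> P i \<noteq> 0"
    and "\<And>j. 1 \<le> j \<Longrightarrow> j < b \<Longrightarrow> R j \<noteq> 0"
    and "\<And>i j. 1 \<le> i \<Longrightarrow> i \<le> j \<Longrightarrow> j < a \<Longrightarrow> norm ((\<Prod>k=i..j. P k) * q) < 1"
    and "\<And>i j. 1 \<le> i \<Longrightarrow> i \<le> j \<Longrightarrow> j < b \<Longrightarrow> norm ((\<Prod>k=i..j. R k) * q) < 1"
  shows "Z' a b lq Q (normalized a P) (normalized b R) s tvar tbvar =
    mps_const (((\<Prod>i\<in>{1..<a}. P i) * (\<Prod>j\<in>{1..<b}. R j)) powi (- (s * (s + 1) div 2)))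
    * f' a b lq P R s tvar tbvar
    * tau' a b lq Q P R s (spread a (T_scaled a P tvar)) (\<lambda>n. - spread b (Tbar_scaled b R tbvar) n)"
proof -
  note a = assms(1) and b = assms(2) and q_eq = assms(3) and Q = assms(5) and P = assms(6) and R = assms(7)
  have q: "norm (exp lq) < 1" using assms(3,4) by simp
  have q0: "exp lq \<noteq> 0" by simp
  have okP: "\<And>i j. 1 \<le> i \<Longrightarrow> i \<le> j \<Longrightarrow> j < a \<Longrightarrow> norm ((\<Prod>k=i..j. P k) * exp lq) < 1"
    and okR: "\<And>i j. 1 \<le> i \<Longrightarrow> i \<le> j \<Longrightarrow> j < b \<Longrightarrow> norm ((\<Prod>k=i..j. R k) * exp lq) < 1"
    using assms(8,9) q_eq by auto
  have ok: "okps (exp lq) (map P [1..<a])" "okps (exp lq) (map R (rev [1..<b]))"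
    using okps_upt[OF a, of P "exp lq"] okps_rev[OF b, of R "exp lq"] okP okR by blast+
  have vl: "inj (Inl :: nat \<Rightarrow> nat + nat)" and vr: "inj (Inr :: nat \<Rightarrow> nat + nat)" by simp_all
  let ?V = "ground s"
  define L where "L = XL lq (map P [1..<a]) a"
  define X where "X = (\<lambda>Y W. Q ^ nat (en Y) * XR lq (map R (rev [1..<b])) b Y W)"
  define \<tau> where "\<tau> k = (-1) ^ (a * k) * (\<Prod>i\<in>{1..<a}. P i powi (- (int (a - i) * int k)))" for k
  define \<sigma> where "\<sigma> k = (\<Prod>j\<in>{1..<b}. R j powi (- (int (b - j) * int k)))" for k
  define D :: "int set \<Rightarrow> (nat + nat) mps" where "D Y = lin Inl (\<lambda>k. Ph (exp lq) (int k) Y)" for Y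
  define D' :: "int set \<Rightarrow> (nat + nat) mps" where "D' Y = lin Inr (\<lambda>k. Ph (exp lq) (- int k) Y)" for Y
  let ?A = "op_exp (LJ Inl \<tau> a) :: (nat + nat) mps fop" and ?B = "op_exp (LJ Inr \<sigma> b) :: (nat + nat) mps fop"
  define tau where "tau = tau' a b lq Q P R s (spread a (T_scaled a P tvar)) (\<lambda>n. - spread b (Tbar_scaled b R tbvar) n)"
  have T: "T_scaled a P tvar = (\<lambda>k. mps_const (\<tau> k) * mps_var (Inl k))" "Tbar_scaled b R tbvar = (\<lambda>k. mps_const (\<sigma> k) * mps_var (Inr k))"
    by (auto simp: T_scaled_def Tbar_scaled_def \<tau>_def \<sigma>_def tvar_def tbvar_def)
  have tau: "tau = op_prod [?A, \<lambda>U V. mps_const (g' a b lq Q P R U V), tr ?B] ?V ?V"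
  proof -
    have "(\<lambda>U V. \<Sum>\<^sub>\<infinity>k\<in>{1..}. spread a (T_scaled a P tvar) k * mps_const (J (int k) U V)) = LJ Inl \<tau> a"
      unfolding T by (intro ext) (simp only: LJ_def spread_sum[OF vl a, of \<tau> "\<lambda>n. J (int n) _ _"])
    moreover have "op_exp (\<lambda>U V. - (\<Sum>\<^sub>\<infinity>k\<in>{1..}. - spread b (Tbar_scaled b R tbvar) k * mps_const (J (- int k) U V))) = tr ?B"
      unfolding T by (rule op_exp_minus_LJ[OF vr b])
    ultimately show ?thesis unfolding tau_def tau'_def by (simp only:)
  qed
  have Lexp: "op_mult ?A (\<lambda>U Y. mps_const (L U Y)) ?V Y = mps_const (L ?V Y) * mps_exp (D Y)" if Y: "Y \<in> maya" for Y
    unfolding D_def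
  proof (rule op_exp_LJ[OF vl ground_maya])
    show "\<tau> k * op_mult (J (int (a * k))) L U Y = L U Y * Ph (exp lq) (int k) Y" if "U \<in> maya" "1 \<le> k" for U k
      unfolding \<tau>_def L_def by (rule XL_intertwine[OF q a P]) (use that Y in auto)
  qed
  have Rexp: "op_mult ?B (\<lambda>W Y. mps_const (X Y W)) ?V Y = mps_const (X Y ?V) * mps_exp (D' Y)" if Y: "Y \<in> maya" for Y
    unfolding D'_def
  proof (rule op_exp_LJ[OF vr ground_maya, where X = "\<lambda>W Y. X Y W"])
    show "\<sigma> k * op_mult (J (int (b * k))) (\<lambda>W Y. X Y W) U Y = X Y U * Ph (exp lq) (- int k) Y" if "U \<in> maya" "1 \<le> k" for U k
      unfolding \<sigma>_def X_def by (rule XR_intertwine_tr[OF q b R, where z = "\<lambda>Y. Q ^ nat (en Y)"]) (use that Y in auto)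
  qed
  have tau_sum: "((\<lambda>Y. mps_coeff (mps_const (L ?V Y * X Y ?V) * (mps_exp (D Y) * mps_exp (D' Y))) M) has_sum mps_coeff tau M) maya" for M
  proof -
    have "((\<lambda>Y. mps_coeff (op_mult ?A (\<lambda>U Y. mps_const (L U Y)) ?V Y * op_mult ?B (\<lambda>W Y. mps_const (X Y W)) ?V Y) M) has_sum mps_coeff tau M) maya"
      unfolding tau
    proof (rule tau_has_sum[OF rfin_op_exp[OF rfin_LJ[OF vl] low_LJ] rfin_op_exp[OF rfin_LJ[OF vr] low_LJ] ground_maya])
      show "((\<lambda>Y. L U Y * X Y W) has_sum g' a b lq Q P R U W) maya" if "U \<in> maya" "W \<in> maya" for U W
        unfolding L_def X_def by (rule g'_has_sum[OF q Q _ _ ok that]) (use P R in auto)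
    qed
    then show ?thesis
      by (subst (asm) has_sum_cong) (auto simp: Lexp Rexp const_mult mult_ac)
  qed
  define c0 where "c0 = ((\<Prod>i\<in>{1..<a}. P i) * (\<Prod>j\<in>{1..<b}. R j)) powi (- (s * (s + 1) div 2))"
  define c1 where "c1 = exp (- of_int (s * (s + 1) * (2 * s + 1)) * (1 / (12 * of_nat a) - 1 / (12 * of_nat b)) * lq)
        * (\<Prod>(i, j) \<in> {(i, j). 1 \<le> i \<and> i \<le> j \<and> j < a}. inverse (MacMahon (\<Prod>k=i..j. P k) (exp lq)))
        * (\<Prod>(i, j) \<in> {(i, j). 1 \<le> i \<and> i \<le> j \<and> j < b}. inverse (MacMahon (\<Prod>k=i..j. R k) (exp lq)))"
  define F :: "(nat + nat) mps" where "F = lin Inl (\<lambda>k. exp lq ^ k / (1 - exp lq ^ k)) + lin Inr (\<lambda>k. - (1 / (1 - exp lq ^ k)))"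
  have F: "(\<Sum>\<^sub>\<infinity>k\<in>{1..}. (tvar k * mps_const (exp lq ^ k) - tbvar k) * mps_const (1 / (1 - exp lq ^ k))) = F"
  proof (rule infsumI, rule mps_has_sumI)
    fix M
    have s1: "((\<lambda>k. mps_coeff (mps_var (v k) * mps_const (x k)) M) has_sum mps_coeff (lin v x) M) {1..}" if v: "inj v" for v :: "nat \<Rightarrow> nat + nat" and x
      by (rule has_sum_lin[OF v, where g = "\<lambda>k. k"]) (auto simp: mult.commute)
    have "((\<lambda>k. mps_coeff (mps_var (Inl k) * mps_const (exp lq ^ k / (1 - exp lq ^ k))) M + mps_coeff (mps_var (Inr k) * mps_const (- (1 / (1 - exp lq ^ k)))) M)
       has_sum mps_coeff F M) {1..}"
      unfolding F_def coeff_add by (intro has_sum_add s1 vl vr)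
    moreover have "mps_coeff (mps_var (Inl k) * mps_const (exp lq ^ k / (1 - exp lq ^ k))) M + mps_coeff (mps_var (Inr k) * mps_const (- (1 / (1 - exp lq ^ k)))) M
       = mps_coeff ((tvar k * mps_const (exp lq ^ k) - tbvar k) * mps_const (1 / (1 - exp lq ^ k))) M" for k
      by (simp add: tvar_def tbvar_def mult.commute[of _ "mps_const _"] coeff_const_mult coeff_diff diff_divide_distrib)
    ultimately show "((\<lambda>k. mps_coeff ((tvar k * mps_const (exp lq ^ k) - tbvar k) * mps_const (1 / (1 - exp lq ^ k))) M) has_sum mps_coeff F M) {1..}"
      by (simp only:)
  qed
  have f': "f' a b lq P R s tvar tbvar = mps_exp F * mps_const c1" by (simp only: f'_def F c1_def)
  define G where "G = mps_const c0 * f' a b lq P R s tvar tbvar"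
  have G_sum: "((\<lambda>Y. mps_coeff (G * (mps_const (L ?V Y * X Y ?V) * (mps_exp (D Y) * mps_exp (D' Y)))) M) has_sum mps_coeff (G * tau) M) maya" for M
    unfolding coeff_mult[of G] case_prod_beta
    by (intro has_sum_finite_sum has_sum_cmult_right tau_sum) (use finite_splits[of M, unfolded case_prod_unfold] in simp)
  let ?term = "\<lambda>\<mu>. mps_const (schur \<mu> (seq_union a (normalized a P) (q_rho lq)) * schur (conjugate \<mu>) (seq_union b (normalized b R) (q_rho lq))
      * Q powi (int (psize \<mu>) + s * (s + 1) div 2))
    * mps_exp ((\<Sum>\<^sub>\<infinity>k\<in>{1..}. tvar k * mps_const (Phi (exp lq) (int k) \<mu> s)) + (\<Sum>\<^sub>\<infinity>k\<in>{1..}. tbvar k * mps_const (Phi (exp lq) (- int k) \<mu> s)))"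
  have e: "en ?V = s * (s + 1) div 2" by (rule en_ground)
  have summand: "G * (mps_const (L ?V (mayaP s \<mu>) * X (mayaP s \<mu>) ?V) * (mps_exp (D (mayaP s \<mu>)) * mps_exp (D' (mayaP s \<mu>)))) = ?term \<mu>"
    if \<mu>: "\<mu> \<in> partitions" for \<mu>
  proof -
    let ?Y = "mayaP s \<mu>" and ?n = "nat (en ?V)"
    let ?PP = "\<Prod>i\<in>{1..<a}. P i" and ?RR = "\<Prod>j\<in>{1..<b}. R j"
    let ?MP = "\<Prod>(i, j)\<in>{(i, j). 1 \<le> i \<and> i \<le> j \<and> j < a}. MacMahon (\<Prod>k=i..j. P k) (exp lq)"
    let ?MR = "\<Prod>(i, j)\<in>{(i, j). 1 \<le> i \<and> i \<le> j \<and> j < b}. MacMahon (\<Prod>k=i..j. R k) (exp lq)"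
    let ?iP = "\<Prod>(i, j)\<in>{(i, j). 1 \<le> i \<and> i \<le> j \<and> j < a}. inverse (MacMahon (\<Prod>k=i..j. P k) (exp lq))"
    let ?iR = "\<Prod>(i, j)\<in>{(i, j). 1 \<le> i \<and> i \<le> j \<and> j < b}. inverse (MacMahon (\<Prod>k=i..j. R k) (exp lq))"
    let ?w = "exp (- of_int (s * (s + 1) * (2 * s + 1)) * (1 / (12 * of_nat a) - 1 / (12 * of_nat b)) * lq)"
    let ?wa = "exp (lq / (2 * of_nat a) * w0 ?V)" and ?wb = "exp (- lq / (2 * of_nat b) * w0 ?V)"
    let ?S = "schur \<mu> (seq_union a (normalized a P) (q_rho lq))" and ?S' = "schur (conjugate \<mu>) (seq_union b (normalized b R) (q_rho lq))"
    have PR: "?PP * ?RR \<noteq> 0" using P R by auto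
    have c0': "c0 * (?PP ^ ?n * ?RR ^ ?n) = 1"
      using powi_nat_cancel[OF PR en_nonneg[of ?V]] unfolding c0_def e by (simp add: power_mult_distrib)
    have QY: "Q ^ nat (en ?Y) = Q powi (int (psize \<mu>) + s * (s + 1) div 2)"
      unfolding psize_cells[OF \<mu>] using en_nonneg[of ?Y] by (simp add: en_mayaP[OF \<mu>] e power_int_def add.commute)
    have iP: "?iP * ?MP = 1" and iR: "?iR * ?MR = 1"
      by (rule inverse_MacMahon; use q q0 okP okR in blast)+
    have "c0 * c1 * (L ?V ?Y * X ?Y ?V) = (c0 * (?PP ^ ?n * ?RR ^ ?n)) * (?w * (?wa * ?wb)) * (?iP * ?MP) * (?iR * ?MR) * (?S * ?S' * Q ^ nat (en ?Y))"
      unfolding c1_def L_def X_def XL_schur[OF q a \<mu>] XR_schur[OF q b \<mu>] kk_upt[OF a] kk_rev[OF b] by (simp only: mult_ac)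
    also have "\<dots> = ?S * ?S' * Q powi (int (psize \<mu>) + s * (s + 1) div 2)"
      unfolding c0' exp_w0_cancel[OF a b] iP iR QY by simp
    finally have cc: "c0 * c1 * (L ?V ?Y * X ?Y ?V) = ?S * ?S' * Q powi (int (psize \<mu>) + s * (s + 1) div 2)" .
    have Phl: "exp lq ^ k / (1 - exp lq ^ k) + Ph (exp lq) (int k) ?Y = Phi (exp lq) (int k) \<mu> s"
      and Phr: "- (1 / (1 - exp lq ^ k)) + Ph (exp lq) (- int k) ?Y = Phi (exp lq) (- int k) \<mu> s" if k: "1 \<le> k" for k
    proof -
      have n1: "exp lq powi int k \<noteq> 1" "exp lq powi (- int k) \<noteq> 1" by (rule power_int_ne_1; use q k in simp)+
      then have n2: "1 - exp lq ^ k \<noteq> 0" by simp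
      have "1 / (1 - exp lq powi (- int k)) = - (exp lq ^ k / (1 - exp lq ^ k))"
        using n2 by (simp add: power_int_minus field_simps)
      then show "exp lq ^ k / (1 - exp lq ^ k) + Ph (exp lq) (int k) ?Y = Phi (exp lq) (int k) \<mu> s"
        unfolding Phi_wt[OF q0 n1(1) \<mu>] Ph_def by simp
      show "- (1 / (1 - exp lq ^ k)) + Ph (exp lq) (- int k) ?Y = Phi (exp lq) (- int k) \<mu> s"
        unfolding Phi_wt[OF q0 n1(2) \<mu>] Ph_def by simp
    qed
    have "F + (D ?Y + D' ?Y) = (lin Inl (\<lambda>k. exp lq ^ k / (1 - exp lq ^ k)) + D ?Y) + (lin Inr (\<lambda>k. - (1 / (1 - exp lq ^ k))) + D' ?Y)"
      by (simp add: F_def)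
    also have "\<dots> = lin Inl (\<lambda>k. Phi (exp lq) (int k) \<mu> s) + lin Inr (\<lambda>k. Phi (exp lq) (- int k) \<mu> s)"
      unfolding D_def D'_def lin_add[OF vl] lin_add[OF vr]
      by (intro arg_cong2[where f = "(+)"] lin_cong vl vr Phl Phr)
    finally have FD: "F + (D ?Y + D' ?Y) = (\<Sum>\<^sub>\<infinity>k\<in>{1..}. tvar k * mps_const (Phi (exp lq) (int k) \<mu> s)) + (\<Sum>\<^sub>\<infinity>k\<in>{1..}. tbvar k * mps_const (Phi (exp lq) (- int k) \<mu> s))"
      by (simp only: tvar_def tbvar_def var_sum[OF vl] var_sum[OF vr])
    have "mps_exp (F + (D ?Y + D' ?Y)) = mps_exp F * (mps_exp (D ?Y) * mps_exp (D' ?Y))"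
    proof -
      have "low 1 F" "low 1 (D ?Y)" "low 1 (D' ?Y)" unfolding F_def D_def D'_def by (intro low_add low_lin)+
      then show ?thesis by (simp only: mps_exp_add low_add)
    qed
    moreover have "G * (mps_const (L ?V ?Y * X ?Y ?V) * (mps_exp (D ?Y) * mps_exp (D' ?Y)))
        = mps_const (c0 * c1 * (L ?V ?Y * X ?Y ?V)) * (mps_exp F * (mps_exp (D ?Y) * mps_exp (D' ?Y)))"
      unfolding G_def f' by (simp only: const_mult mult_ac)
    ultimately show ?thesis unfolding cc FD by simp
  qed
  have "(?term has_sum (G * tau)) partitions"
  proof (rule mps_has_sumI)
    fix M
    let ?h = "\<lambda>Y. mps_coeff (G * (mps_const (L ?V Y * X Y ?V) * (mps_exp (D Y) * mps_exp (D' Y)))) M"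
    have z: "?h Y = 0" if "Y \<in> maya - {V \<in> maya. charge V = s}" for Y
    proof -
      have "L ?V Y = 0" unfolding L_def using XL_charge that by blast
      moreover have "mps_const 0 = (0 :: (nat + nat) mps)" by (rule mps_eqI) (simp add: coeff_const coeff_zero)
      ultimately show ?thesis by (simp add: coeff_zero)
    qed
    have "(?h has_sum mps_coeff (G * tau) M) maya \<longleftrightarrow> (?h has_sum mps_coeff (G * tau) M) {V \<in> maya. charge V = s}"
      by (rule has_sum_cong_neutral) (use z in auto)
    then have "(?h has_sum mps_coeff (G * tau) M) {V \<in> maya. charge V = s}" using G_sum by blast
    then have "((\<lambda>\<mu>. ?h (mayaP s \<mu>)) has_sum mps_coeff (G * tau) M) partitions"
      by (subst has_sum_reindex_bij_betw[OF bij_mayaP])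
    then show "((\<lambda>\<mu>. mps_coeff (?term \<mu>) M) has_sum mps_coeff (G * tau) M) partitions"
      by (subst (asm) has_sum_cong) (simp_all only: summand)
  qed
  then have "Z' a b lq Q (normalized a P) (normalized b R) s tvar tbvar = G * tau"
    unfolding Z'_def by (rule infsumI)
  then show ?thesis unfolding G_def tau_def c0_def by simp
qed

end
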